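(* Fix $\alpha>\frac12$. For every $c>-1$ there exists a ground state (minimizer) $\chi\in H^{\frac\alpha2}_{\rm per,odd}$ of the constrained minimization problem $$q_{c,\rm odd}:=\inf_{u\in H^{\frac\alpha2}_{\rm per,odd}}\left\{\mathcal{B}_c(u):\ \int_{-\pi}^{\pi}u^4\,dx=1\right\},\qquad \mathcal{B}_c(u):=\frac12\int_{-\pi}^{\pi}\left[(D^{\frac\alpha2}u)^2+cu^2\right]dx.$$ If $\alpha\le 2$, the ground state has a single-lobe profile, which is even with respect to the points $x=\pm\pi/2$.
   Context: $\mathbb{T}=[-\pi,\pi]$ periodic; for $u=\sum_n u_ne^{inx}$, $D^{s}u=\sum_n|n|^{s}u_ne^{inx}$. $H^{s}_{\rm per,odd}$ denotes the odd functions in the periodic Sobolev space $H^s_{\rm per}(\mathbb{T})$. A periodic function has a single-lobe profile if it admits only one isolated maximum and one isolated minimum on $\mathbb{T}$. *)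

theory Defs
  imports "HOL-Analysis.Analysis"
begin

text \<open>Functions on the torus T = [-pi,pi] are represented as 2pi-periodic
  functions real => real.\<close>

definition per2pi :: "(real \<Rightarrow> real) \<Rightarrow> bool" where
  "per2pi u \<longleftrightarrow> (\<forall>x. u (x + 2 * pi) = u x)"

definition odd_fun :: "(real \<Rightarrow> real) \<Rightarrow> bool" where
  "odd_fun u \<longleftrightarrow> (\<forall>x. u (- x) = - u x)"

definition fcoeff :: "(real \<Rightarrow> real) \<Rightarrow> int \<Rightarrow> complex" where
  "fcoeff u n = complex_of_real (1 / (2 * pi)) *
     (LINT x : {-pi..pi} | lebesgue. complex_of_real (u x) * cis (- (of_int n * x)))"

definition Hper :: "real \<Rightarrow> (real \<Rightarrow> real) set" where
  "Hper s = {u. per2pi u \<and> u \<in> borel_measurable lebesgue \<and>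
     set_integrable lebesgue {-pi..pi} (\<lambda>x. (u x)^2) \<and>
     (\<lambda>n::int. (1 + (of_int n)^2) powr s * (cmod (fcoeff u n))^2) summable_on UNIV}"

definition Hper_odd :: "real \<Rightarrow> (real \<Rightarrow> real) set" where
  "Hper_odd s = {u \<in> Hper s. odd_fun u}"

text \<open>int_{-pi}^{pi} (D^s u)^2 dx, written via Parseval:
  2pi sum_n |n|^{2s} |u_n|^2 (D^s u = sum_n |n|^s u_n e^{inx}).\<close>
definition Dsq_integral :: "real \<Rightarrow> (real \<Rightarrow> real) \<Rightarrow> real" where
  "Dsq_integral s u = 2 * pi * (\<Sum>\<^sub>\<infinity>n::int. (\<bar>of_int n\<bar> powr s)^2 * (cmod (fcoeff u n))^2)"

definition Bc :: "real \<Rightarrow> real \<Rightarrow> (real \<Rightarrow> real) \<Rightarrow> real" where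
  "Bc \<alpha> c u = (1/2) * (Dsq_integral (\<alpha>/2) u + c * (LINT x : {-pi..pi} | lebesgue. (u x)^2))"

definition admissible_odd :: "real \<Rightarrow> (real \<Rightarrow> real) set" where
  "admissible_odd \<alpha> = {u \<in> Hper_odd (\<alpha>/2). (LINT x : {-pi..pi} | lebesgue. (u x)^4) = 1}"

definition q_odd :: "real \<Rightarrow> real \<Rightarrow> real" where
  "q_odd \<alpha> c = (INF u \<in> admissible_odd \<alpha>. Bc \<alpha> c u)"

definition ground_state_odd :: "real \<Rightarrow> real \<Rightarrow> (real \<Rightarrow> real) \<Rightarrow> bool" where
  "ground_state_odd \<alpha> c g \<longleftrightarrow> g \<in> admissible_odd \<alpha> \<and> (\<forall>u \<in> admissible_odd \<alpha>. Bc \<alpha> c g \<le> Bc \<alpha> c u)"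

definition loc_max :: "(real \<Rightarrow> real) \<Rightarrow> real \<Rightarrow> bool" where
  "loc_max f x \<longleftrightarrow> (\<exists>e>0. \<forall>y. \<bar>y - x\<bar> < e \<longrightarrow> f y \<le> f x)"
definition loc_min :: "(real \<Rightarrow> real) \<Rightarrow> real \<Rightarrow> bool" where
  "loc_min f x \<longleftrightarrow> (\<exists>e>0. \<forall>y. \<bar>y - x\<bar> < e \<longrightarrow> f x \<le> f y)"
definition iso_max :: "(real \<Rightarrow> real) \<Rightarrow> real \<Rightarrow> bool" where
  "iso_max f x \<longleftrightarrow> (\<exists>e>0. \<forall>y. 0 < \<bar>y - x\<bar> \<and> \<bar>y - x\<bar> < e \<longrightarrow> f y < f x)"
definition iso_min :: "(real \<Rightarrow> real) \<Rightarrow> real \<Rightarrow> bool" where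
  "iso_min f x \<longleftrightarrow> (\<exists>e>0. \<forall>y. 0 < \<bar>y - x\<bar> \<and> \<bar>y - x\<bar> < e \<longrightarrow> f x < f y)"

definition single_lobe :: "(real \<Rightarrow> real) \<Rightarrow> bool" where
  "single_lobe f \<longleftrightarrow> (\<exists>a b. {x \<in> {-pi<..pi}. loc_max f x} = {a} \<and> iso_max f a \<and>
                              {x \<in> {-pi<..pi}. loc_min f x} = {b} \<and> iso_min f b)"

definition even_about :: "(real \<Rightarrow> real) \<Rightarrow> real \<Rightarrow> bool" where
  "even_about f p \<longleftrightarrow> (\<forall>x. f (p + x) = f (p - x))"

end

theory Submission
  imports Defs "HOL-Library.Diagonal_Subsequence"
begin

text \<open>
  The functional is minimised over the larger class of functions \<open>u\<close> equimeasurable with \<open>- u\<close>.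
  In contrast to the odd functions, this class is invariant under translations and under
  polarization, which replaces \<open>u y\<close> and \<open>u (- y)\<close> by their maximum and minimum according to the
  sign of \<open>sin y\<close>. For \<open>\<alpha> \<le> 2\<close> polarization does not increase \<open>B_c\<close>: by the binomial series for
  \<open>(1 - z) powr (\<alpha> / 2)\<close>, the symbol \<open>n powr \<alpha>\<close> is a limit of \<open>m powr (\<alpha> / 2) * (1 - q n)\<close>, where \<open>q\<close>
  is a nonnegative combination of powers of the coefficients of \<open>(1 + cos t)\<^sup>m\<close>, and such sine
  multipliers preserve the functions of the sign of \<open>sin\<close>. Existence follows from the compact embedding
  into \<open>L\<^sup>4\<close>. A minimizer that in addition maximizes \<open>\<integral> u sin\<close> is fixed by all polarizations towards
  \<open>pi / 2\<close>; hence it is a nondecreasing function of \<open>sin x\<close>, and, being equimeasurable with its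
  negative, it is odd. Monotonicity lets the Euler-Lagrange equation be bootstrapped into an absolutely
  convergent sine series, and positivity of the powers of the resolvent makes the monotonicity
  strict.
\<close>

section \<open>Square-integrable functions\<close>

text \<open>The parameter ranges have three sources. Bounding the L^4 norm by the energy means
  bounding a self-convolution of the coefficients, which uses convergence of the sum of (1 +
  k^2)^(-\<alpha>), so \<alpha> > 1/2. On mean-zero functions every frequency has modulus at least
  1, so the energy is coercive for c > -1. The nonconstant Taylor coefficients of (1 -
  z)^(\<alpha>/2) all have the same sign when \<alpha>/2 \<le> 1. The maximization of the integral
  of u sin replaces an analysis of equality in the polarization inequality: this linear functional
  strictly grows under every polarization towards pi/2 that changes the function, while the energy
  merely does not increase. Odd functions are balanced, so a balanced minimizer that turns out to be
  odd solves the original problem. Single-lobe profiles concern pointwise local extrema, but a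
  minimizer is a class modulo null sets and for \<alpha> \<le> 1 the energy space contains
  discontinuous functions. Monotonicity is therefore stated for smooth means that depend on the
  Fourier coefficients alone, until the Euler-Lagrange equation supplies continuity; strictness also
  comes from that equation.\<close>

definition sq_int :: "'a measure \<Rightarrow> ('a \<Rightarrow> real) \<Rightarrow> bool" where
  "sq_int M u \<longleftrightarrow> u \<in> borel_measurable M \<and> integrable M (\<lambda>x. (u x)\<^sup>2)"

lemma sq_int_measurable [measurable_dest]: "sq_int M u \<Longrightarrow> u \<in> borel_measurable M"
  by (simp add: sq_int_def)

lemma sq_int_mult:
  assumes "sq_int M u" "sq_int M v"
  shows "integrable M (\<lambda>x. u x * v x)"
proof (rule Bochner_Integration.integrable_bound)
  show "integrable M (\<lambda>x. (u x)\<^sup>2 + (v x)\<^sup>2)"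
    using assms by (simp add: sq_int_def)
  show "(\<lambda>x. u x * v x) \<in> borel_measurable M"
    using assms by measurable
  have "\<bar>a * b\<bar> \<le> a\<^sup>2 + b\<^sup>2" for a b :: real
    using sum_squares_bound[of a b] sum_squares_bound[of a "-b"] zero_le_power2[of a] zero_le_power2[of b]
    unfolding power2_minus by arith
  then show "AE x in M. norm (u x * v x) \<le> norm ((u x)\<^sup>2 + (v x)\<^sup>2)"
    by auto
qed

lemma sq_int_cmult: "sq_int M u \<Longrightarrow> sq_int M (\<lambda>x. c * u x)"
  by (auto simp: sq_int_def power_mult_distrib)

lemma sq_int_add:
  assumes "sq_int M u" "sq_int M v"
  shows "sq_int M (\<lambda>x. u x + v x)"
  using assms sq_int_mult[OF assms] unfolding sq_int_def power2_sum
  by (auto simp: mult.assoc)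

lemma sq_int_diff:
  assumes "sq_int M u" "sq_int M v"
  shows "sq_int M (\<lambda>x. u x - v x)"
  using sq_int_add[OF assms(1) sq_int_cmult[OF assms(2), of "-1"]] by simp

lemma sq_int_bounded:
  assumes "finite_measure M" "f \<in> borel_measurable M" "\<And>x. x \<in> space M \<Longrightarrow> \<bar>f x\<bar> \<le> B"
  shows "sq_int M f"
  unfolding sq_int_def
proof (intro conjI finite_measure.integrable_const_bound[OF assms(1), of _ "B\<^sup>2"])
  show "AE x in M. norm ((f x)\<^sup>2) \<le> B\<^sup>2"
    using power_mono[OF assms(3) abs_ge_zero, of _ 2] by (intro AE_I2) auto
qed (use assms in auto)

lemma sq_int_integrable:
  assumes "finite_measure M" "sq_int M u" shows "integrable M u"
  using sq_int_mult[OF assms(2) sq_int_bounded[OF assms(1), of "\<lambda>_. 1" 1]] by simp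

lemma nonneg_quadratic_discriminant:
  fixes a b c :: real
  assumes "\<And>t. 0 \<le> a - 2 * t * b + t\<^sup>2 * c" and "c \<ge> 0"
  shows "b\<^sup>2 \<le> a * c"
proof (cases "c = 0")
  case True
  \<comment> \<open>For \<open>c = 0\<close> the quadratic is affine in \<open>t\<close>; if
    \<open>b\<close> were nonzero, this \<open>t\<close> would give it the value -1.\<close>
  then have "b = 0"
    using assms(1)[of "(a + 1) / (2 * b)"] by (cases "b = 0") (auto simp: field_simps)
  then show ?thesis using True by simp
next
  case False
  then show ?thesis using assms(1)[of "b / c"] assms(2)
    by (simp add: field_simps power2_eq_square)
qed

lemma Cauchy_Schwarz_integral:
  assumes u: "sq_int M u" and v: "sq_int M v"
  shows "(\<integral>x. u x * v x \<partial>M)\<^sup>2 \<le> (\<integral>x. (u x)\<^sup>2 \<partial>M) * (\<integral>x. (v x)\<^sup>2 \<partial>M)"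
proof (rule nonneg_quadratic_discriminant)
  fix t :: real
  have "0 \<le> (\<integral>x. (u x - t * v x)\<^sup>2 \<partial>M)" by simp
  also have "\<dots> = (\<integral>x. (u x)\<^sup>2 - 2 * t * (u x * v x) + t\<^sup>2 * (v x)\<^sup>2 \<partial>M)"
    by (intro Bochner_Integration.integral_cong) (auto simp: power2_eq_square algebra_simps)
  also have "\<dots> = (\<integral>x. (u x)\<^sup>2 \<partial>M) - 2 * t * (\<integral>x. u x * v x \<partial>M) + t\<^sup>2 * (\<integral>x. (v x)\<^sup>2 \<partial>M)"
    using u v sq_int_mult[OF u v] by (simp add: sq_int_def)
  finally show "0 \<le> \<dots>" .
qed simp

text \<open>Fatou's lemma with integrability of the limit as a conclusion. This is how limits are
  shown to lie in L^2 and L^4.\<close>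

lemma Fatou_integral:
  fixes f :: "nat \<Rightarrow> 'a \<Rightarrow> real"
  assumes int: "\<And>n. integrable M (f n)" and nn: "\<And>n x. x \<in> space M \<Longrightarrow> 0 \<le> f n x"
    and lim: "AE x in M. (\<lambda>n. f n x) \<longlonglongrightarrow> g x" and g: "g \<in> borel_measurable M"
    and le: "\<And>n. (\<integral>x. f n x \<partial>M) \<le> C"
  shows "integrable M g" "(\<integral>x. g x \<partial>M) \<le> C"
proof -
  have gnn: "AE x in M. 0 \<le> g x"
    using lim AE_space by eventually_elim (rule LIMSEQ_le_const, auto intro: nn)
  have C: "0 \<le> C" using le[of 0] Bochner_Integration.integral_nonneg[of M "f 0"] nn by fastforce
  have "(\<integral>\<^sup>+x. ennreal (g x) \<partial>M) = (\<integral>\<^sup>+x. liminf (\<lambda>n. ennreal (f n x)) \<partial>M)"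
  proof (rule nn_integral_cong_AE, use lim in eventually_elim)
    fix x assume "(\<lambda>n. f n x) \<longlonglongrightarrow> g x"
    then have "(\<lambda>n. ennreal (f n x)) \<longlonglongrightarrow> ennreal (g x)" by (rule tendsto_ennrealI)
    from lim_imp_Liminf[OF _ this] show "ennreal (g x) = liminf (\<lambda>n. ennreal (f n x))" by simp
  qed
  also have "\<dots> \<le> liminf (\<lambda>n. \<integral>\<^sup>+x. ennreal (f n x) \<partial>M)"
    by (rule nn_integral_liminf) (use int in auto)
  also have "\<dots> \<le> ennreal C"
  proof (rule order_trans[OF Liminf_mono[of _ "\<lambda>_. ennreal C"]])
    show "\<forall>\<^sub>F n in sequentially. (\<integral>\<^sup>+x. ennreal (f n x) \<partial>M) \<le> ennreal C"
      by (intro always_eventually allI, subst nn_integral_eq_integral[OF int])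
        (use nn le in \<open>auto intro!: AE_I2 ennreal_leI\<close>)
  qed (simp add: Liminf_const)
  finally have *: "(\<integral>\<^sup>+x. ennreal (g x) \<partial>M) \<le> ennreal C" .
  show "integrable M g"
    by (rule integrableI_nonneg[OF g gnn]) (use * in \<open>auto simp: top_unique less_top[symmetric]\<close>)
  then show "(\<integral>x. g x \<partial>M) \<le> C"
    using * gnn C by (simp add: nn_integral_eq_integral)
qed

text \<open>By Cauchy-Schwarz against the constant 1, the L^1 norms of the increments are at most a
  constant times 2^(-k). The sum of the absolute increments then has finite integral, so it is
  finite almost everywhere and the sequence telescopes to a limit. The rate 1/4 is chosen so that
  its square root is still geometric.\<close>

lemma sq_int_fast_Cauchy_AE_convergent:
  assumes fin: "finite_measure M" and u: "\<And>k. sq_int M (u k)"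
    and le: "\<And>k. (\<integral>x. (u (Suc k) x - u k x)\<^sup>2 \<partial>M) \<le> (1/4)^k"
  shows "AE x in M. convergent (\<lambda>k. u k x)"
proof -
  interpret finite_measure M by fact
  define d where "d k x = \<bar>u (Suc k) x - u k x\<bar>" for k x
  have [measurable]: "u k \<in> borel_measurable M" for k using u by measurable
  have d: "sq_int M (d k)" for k
    using sq_int_diff[OF u u, of "Suc k" k] unfolding sq_int_def d_def by simp
  have dint: "integrable M (d k)" for k by (rule sq_int_integrable[OF fin d])
  have one: "sq_int M (\<lambda>_. 1)" by (rule sq_int_bounded[OF fin]) auto
  define K where "K = sqrt (measure M (space M))"
  have dk: "(\<integral>x. d k x \<partial>M) \<le> (1/2)^k * K" for k
  proof (rule power2_le_imp_le)
    have "(\<integral>x. d k x \<partial>M)\<^sup>2 \<le> (\<integral>x. (d k x)\<^sup>2 \<partial>M) * measure M (space M)"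
      using Cauchy_Schwarz_integral[OF d one, of k] by simp
    also have "\<dots> \<le> (1/4)^k * measure M (space M)"
      using le[of k] by (intro mult_right_mono) (auto simp: d_def)
    also have "\<dots> = ((1/2)^k * K)\<^sup>2"
    proof -
      have "((1/2::real)^k)\<^sup>2 = (1/4)^k" by (simp add: power2_eq_square power_mult_distrib[symmetric])
      then show ?thesis by (simp add: K_def power_mult_distrib)
    qed
    finally show "(\<integral>x. d k x \<partial>M)\<^sup>2 \<le> ((1/2)^k * K)\<^sup>2" .
  qed (simp add: K_def)
  have "(\<integral>\<^sup>+x. (\<Sum>k. ennreal (d k x)) \<partial>M) = (\<Sum>k. \<integral>\<^sup>+x. ennreal (d k x) \<partial>M)"
    by (rule nn_integral_suminf) (use dint in auto)
  also have "\<dots> \<le> (\<Sum>k. ennreal ((1/2)^k * K))"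
    by (intro suminf_le summableI, subst nn_integral_eq_integral[OF dint])
      (auto intro!: ennreal_leI dk simp: d_def)
  also have "\<dots> < \<infinity>"
  proof -
    have "summable (\<lambda>k. (1/2::real)^k * K)" by (intro summable_mult2 summable_geometric) simp
    then show ?thesis by (subst suminf_ennreal2) (auto simp: K_def)
  qed
  finally have "AE x in M. (\<Sum>k. ennreal (d k x)) \<noteq> \<infinity>"
    by (intro nn_integral_noteq_infinite) (use dint in auto)
  then show ?thesis
  proof eventually_elim
    fix x assume "(\<Sum>k. ennreal (d k x)) \<noteq> \<infinity>"
    then have "summable (\<lambda>k. d k x)" by (intro summable_suminf_not_top) (auto simp: d_def)
    then have "summable (\<lambda>k. u (Suc k) x - u k x)"
      unfolding d_def by (rule summable_rabs_cancel)
    then have "convergent (\<lambda>n. \<Sum>k<n. u (Suc k) x - u k x)" by (simp add: summable_iff_convergent)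
    then have "convergent (\<lambda>n. u n x - u 0 x)" unfolding sum_lessThan_telescope[of "\<lambda>k. u k x"] .
    from convergent_add[OF this convergent_const[of "u 0 x"]] show "convergent (\<lambda>k. u k x)" by simp
  qed
qed

section \<open>The circle\<close>

abbreviation circ :: "real measure" where "circ \<equiv> lebesgue_on {-pi..pi}"

lemma finite_measure_circ: "finite_measure circ"
  by (rule finite_measure_lebesgue_on) simp

interpretation circ: finite_measure circ by (rule finite_measure_circ)

lemma measure_circ: "measure circ {-pi..pi} = 2 * pi"
  by (simp add: measure_restrict_space)

lemma integrable_circ_continuous:
  fixes f :: "real \<Rightarrow> 'a::euclidean_space"
  shows "continuous_on {-pi..pi} f \<Longrightarrow> integrable circ f"
  by (rule continuous_imp_integrable_real)

lemma measurable_circ_continuous: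
  fixes f :: "real \<Rightarrow> 'a::euclidean_space"
  shows "continuous_on UNIV f \<Longrightarrow> f \<in> borel_measurable circ"
  by (rule borel_measurable_integrable[OF integrable_circ_continuous]) (rule continuous_on_subset, auto)

lemma integral_circ_HK:
  fixes f :: "real \<Rightarrow> 'a::euclidean_space"
  shows "integrable circ f \<Longrightarrow> integral\<^sup>L circ f = integral {-pi..pi} f"
  by (metis has_integral_integral_lebesgue_on integral_unique lmeasurable_interval(1) fmeasurableD box_real(2))

lemma measurable_circ_lebesgue: "f \<in> borel_measurable lebesgue \<Longrightarrow> f \<in> borel_measurable circ"
  by (rule measurable_restrict_space1)

lemma integral_circ_reflect:
  fixes f :: "real \<Rightarrow> 'a::euclidean_space"
  shows "(\<integral>x. f (- x) \<partial>circ) = (\<integral>x. f x \<partial>circ)"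
  using integral_reflect_real[of pi "-pi" f] by simp

lemma integrable_circ_reflect:
  fixes f :: "real \<Rightarrow> 'a::euclidean_space"
  shows "integrable circ (\<lambda>x. f (- x)) \<longleftrightarrow> integrable circ f"
  using integrable_reflect_real[of pi "-pi" f] by simp

lemma set_lebesgue_integral_circ:
  fixes f :: "real \<Rightarrow> 'a::{banach, second_countable_topology}"
  shows "(LINT x : {-pi..pi} | lebesgue. f x) = integral\<^sup>L circ f"
    "set_integrable lebesgue {-pi..pi} f \<longleftrightarrow> integrable circ f"
  by (simp_all add: set_lebesgue_integral_def set_integrable_def integral_restrict_space integrable_restrict_space)

text \<open>Cut (-pi, pi] at -pi + p: the right piece is translated by \<open>p\<close>, the left
  one by \<open>p - 2*pi\<close>, and together they fill the interval again. The endpoint -pi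
  belongs to neither half-open piece and is restored by the null term \<open>pt\<close>.\<close>

lemma circ_shift_aux:
  fixes f :: "real \<Rightarrow> 'a::euclidean_space"
  assumes per: "\<And>x. f (x + 2 * pi) = f x" and f: "integrable circ f" and p: "0 \<le> p" "p \<le> 2 * pi"
  shows "integrable circ (\<lambda>x. f (x + p)) \<and> (\<integral>x. f (x + p) \<partial>circ) = (\<integral>x. f x \<partial>circ)"
proof -
  have F: "integrable lebesgue (\<lambda>x. indicator {-pi..pi} x *\<^sub>R f x)"
    using f by (simp add: integrable_restrict_space)
  have sub: "integrable lebesgue (\<lambda>x. indicator S x *\<^sub>R f x)" if S: "S \<subseteq> {-pi..pi}" "S \<in> sets lebesgue" for S
  proof -
    have "integrable lebesgue (\<lambda>x. indicator S x *\<^sub>R (indicator {-pi..pi} x *\<^sub>R f x))"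
      by (rule integrable_mult_indicator[OF S(2) F])
    moreover have "(\<lambda>x. indicator S x *\<^sub>R (indicator {-pi..pi} x *\<^sub>R f x)) = (\<lambda>x. indicator S x *\<^sub>R f x)"
    proof
      fix x show "indicator S x *\<^sub>R (indicator {-pi..pi} x *\<^sub>R f x) = indicator S x *\<^sub>R f x"
        using S(1) by (cases "x \<in> S") auto
    qed
    ultimately show ?thesis by (simp only:)
  qed
  let ?A = "{-pi+p<..pi}" and ?B = "{-pi<..-pi+p}"
  have A: "integrable lebesgue (\<lambda>x. indicator ?A x *\<^sub>R f x)" and B: "integrable lebesgue (\<lambda>x. indicator ?B x *\<^sub>R f x)"
    using p by (auto intro!: sub)
  have pt: "has_bochner_integral lebesgue (\<lambda>x. indicator {-pi} x *\<^sub>R c) 0" for c :: 'a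
    using has_bochner_integral_indicator[of "{-pi}" lebesgue c] by simp
  have shift: "has_bochner_integral lebesgue (\<lambda>x. indicator S (x + q) *\<^sub>R f (x + q)) (LINT x|lebesgue. indicator S x *\<^sub>R f x)"
    if "integrable lebesgue (\<lambda>x. indicator S x *\<^sub>R f x)" for S q
    using has_bochner_integral_lebesgue_real_affine_iff[of 1 "\<lambda>x. indicator S x *\<^sub>R f x" _ q]
      has_bochner_integral_integrable[OF that] by (simp add: add.commute)
  note A' = shift[OF A, of p] and B' = shift[OF B, of "p - 2*pi"]
  have "f (x + (p - 2*pi)) = f (x + p)" for x
    using per[of "x + (p - 2*pi)"] by simp
  then have eq: "(\<lambda>x. indicator ?A (x + p) *\<^sub>R f (x + p) + indicator ?B (x + (p - 2*pi)) *\<^sub>R f (x + (p - 2*pi))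
        + indicator {-pi} x *\<^sub>R f (-pi + p)) = (\<lambda>x. indicator {-pi..pi} x *\<^sub>R f (x + p))"
    using p by (intro ext) (simp add: indicator_def)
  have eq2: "(\<lambda>x. indicator ?A x *\<^sub>R f x + indicator ?B x *\<^sub>R f x + indicator {-pi} x *\<^sub>R f (-pi)) = (\<lambda>x. indicator {-pi..pi} x *\<^sub>R f x)"
    using p by (intro ext) (simp add: indicator_def)
  note has_bochner_integral_add[OF has_bochner_integral_add[OF A' B'] pt, of "f (-pi + p)", unfolded eq]
    and has_bochner_integral_add[OF has_bochner_integral_add[OF A[THEN has_bochner_integral_integrable]
      B[THEN has_bochner_integral_integrable]] pt, of "f (-pi)", unfolded eq2]
  then show ?thesis
    by (simp add: integrable_restrict_space integral_restrict_space has_bochner_integral_iff)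
qed

lemma periodic_int_multiple:
  assumes "\<And>x. f (x + 2 * pi) = f x"
  shows "f (x + 2 * pi * of_int k) = f x"
proof -
  have nat: "f (x + 2 * pi * of_nat n) = f x" for x n
  proof (induction n)
    case (Suc n)
    have "x + 2 * pi * of_nat (Suc n) = (x + 2 * pi * of_nat n) + 2 * pi" by (simp add: algebra_simps)
    then show ?case using Suc assms by metis
  qed simp
  show ?thesis
  proof (cases "k \<ge> 0")
    case True then show ?thesis using nat[of x "nat k"] by simp
  next
    case False then show ?thesis using nat[of "x + 2 * pi * of_int k" "nat (-k)"] by simp
  qed
qed

lemma
  fixes f :: "real \<Rightarrow> 'a::euclidean_space"
  assumes per: "\<And>x. f (x + 2 * pi) = f x" and f: "integrable circ f"
  shows integrable_circ_shift: "integrable circ (\<lambda>x. f (x + p))"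
    and integral_circ_shift: "(\<integral>x. f (x + p) \<partial>circ) = (\<integral>x. f x \<partial>circ)"
proof -
  define k where "k = \<lfloor>p / (2 * pi)\<rfloor>"
  define r where "r = p - 2 * pi * of_int k"
  have "of_int k \<le> p / (2 * pi)" "p / (2 * pi) < of_int k + 1"
    using floor_correct[of "p / (2 * pi)"] by (auto simp: k_def)
  then have "0 \<le> r" "r \<le> 2 * pi"
    by (auto simp: r_def field_simps)
  moreover have "f (x + p) = f (x + r)" for x
    using periodic_int_multiple[of f "x + r" k, OF per] by (simp add: r_def)
  ultimately show "integrable circ (\<lambda>x. f (x + p))" "(\<integral>x. f (x + p) \<partial>circ) = (\<integral>x. f x \<partial>circ)"
    using circ_shift_aux[OF per f] by auto
qed

lemma measurable_lebesgue_affine: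
  fixes f :: "real \<Rightarrow> 'a::euclidean_space"
  assumes "f \<in> borel_measurable lebesgue" "c \<noteq> 0"
  shows "(\<lambda>x. f (t + c * x)) \<in> borel_measurable lebesgue"
proof -
  have "(\<lambda>x. t + c * x) \<in> lebesgue \<rightarrow>\<^sub>M lebesgue"
    using lebesgue_affine_measurable[where c= "\<lambda>x::real. c"] \<open>c \<noteq> 0\<close> by simp
  from measurable_compose[OF this assms(1)] show ?thesis .
qed

section \<open>Fourier coefficients\<close>

lemma fcoeff_circ: "fcoeff u n = 1 / (2 * pi) * (\<integral>x. of_real (u x) * cis (- (of_int n * x)) \<partial>circ)"
  by (simp add: fcoeff_def set_lebesgue_integral_circ)

lemma continuous_on_circ_trig [continuous_intros]:
  fixes a :: real
  shows "continuous_on S (\<lambda>x. cis (a * x))" "continuous_on S (\<lambda>x. cis (- (a * x)))"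
  by (auto simp: cis_conv_exp intro!: continuous_intros)

lemma measurable_circ_trig [measurable]:
  fixes a :: real
  shows "(\<lambda>x. cis (a * x)) \<in> borel_measurable circ" "(\<lambda>x. cis (- (a * x))) \<in> borel_measurable circ"
    "(\<lambda>x. cos (a * x)) \<in> borel_measurable circ" "(\<lambda>x. sin (a * x)) \<in> borel_measurable circ"
    "(\<lambda>x. cos x) \<in> borel_measurable circ" "(\<lambda>x. sin x) \<in> borel_measurable circ"
  by (intro measurable_circ_continuous continuous_intros)+

lemma integrable_mult_bounded:
  fixes f g :: "'a \<Rightarrow> 'b::{real_normed_algebra, second_countable_topology, banach}"
  assumes "integrable M f" "g \<in> borel_measurable M" "\<And>x. norm (g x) \<le> B"
  shows "integrable M (\<lambda>x. f x * g x)"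
proof (rule Bochner_Integration.integrable_bound)
  show "integrable M (\<lambda>x. B * norm (f x))" using assms by auto
  have "0 \<le> B" using assms(3)[of undefined] norm_ge_zero order_trans by blast
  then show "AE x in M. norm (f x * g x) \<le> norm (B * norm (f x))"
    using assms(3) by (intro AE_I2) (simp add: order_trans[OF norm_mult_ineq] mult.commute[of B] mult_left_mono abs_mult)
  show "(\<lambda>x. f x * g x) \<in> borel_measurable M"
    using assms by measurable
qed

text \<open>Unnormalised, so that products with sines and cosines and the reflection rules carry no
  factors; the factor \<open>1 / (2 * pi)\<close> of \<open>fcoeff\<close> reappears in
  \<open>fcoeff_Cc_Sc\<close>.\<close>

definition Cc :: "(real \<Rightarrow> real) \<Rightarrow> real \<Rightarrow> real" where
  "Cc u a = (\<integral>x. u x * cos (a * x) \<partial>circ)"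

definition Sc :: "(real \<Rightarrow> real) \<Rightarrow> real \<Rightarrow> real" where
  "Sc u a = (\<integral>x. u x * sin (a * x) \<partial>circ)"

lemma integrable_mult_cos: "integrable circ u \<Longrightarrow> integrable circ (\<lambda>x. u x * cos (a * x))" for u :: "real \<Rightarrow> real"
  by (rule integrable_mult_bounded[of _ _ _ 1]) auto

lemma integrable_mult_sin: "integrable circ u \<Longrightarrow> integrable circ (\<lambda>x. u x * sin (a * x))" for u :: "real \<Rightarrow> real"
  by (rule integrable_mult_bounded[of _ _ _ 1]) auto

lemma fcoeff_Cc_Sc:
  assumes "integrable circ u"
  shows "fcoeff u n = Complex (Cc u (of_int n) / (2 * pi)) (- Sc u (of_int n) / (2 * pi))"
proof -
  have int: "integrable circ (\<lambda>x. of_real (u x) * cis (- (of_int n * x)))"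
    by (rule integrable_mult_bounded[of _ _ _ 1]) (use assms in auto)
  have "Re (fcoeff u n) = Cc u (of_int n) / (2 * pi)"
    using integral_bounded_linear[OF bounded_linear_Re int] by (simp add: fcoeff_circ Cc_def)
  moreover have "Im (fcoeff u n) = - Sc u (of_int n) / (2 * pi)"
    using integral_bounded_linear[OF bounded_linear_Im int] by (simp add: fcoeff_circ Sc_def)
  ultimately show ?thesis by (simp add: complex_eq_iff)
qed

lemma cmod_fcoeff:
  assumes "integrable circ u"
  shows "(cmod (fcoeff u n))\<^sup>2 = ((Cc u (of_int n))\<^sup>2 + (Sc u (of_int n))\<^sup>2) / (4 * pi\<^sup>2)"
  unfolding fcoeff_Cc_Sc[OF assms] cmod_def by (simp add: power_divide power_mult_distrib add_divide_distrib)

lemma fcoeff_add: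
  assumes "integrable circ u" "integrable circ v"
  shows "fcoeff (\<lambda>x. u x + v x) n = fcoeff u n + fcoeff v n"
  using assms integrable_mult_cos[of _ "of_int n"] integrable_mult_sin[of _ "of_int n"]
  by (simp add: fcoeff_Cc_Sc complex_eq_iff Cc_def Sc_def distrib_right add_divide_distrib diff_divide_distrib)

lemma fcoeff_cmult:
  assumes "integrable circ u"
  shows "fcoeff (\<lambda>x. c * u x) n = of_real c * fcoeff u n"
  using assms integrable_mult_cos[of _ "of_int n"] integrable_mult_sin[of _ "of_int n"]
  by (simp add: fcoeff_Cc_Sc complex_eq_iff Cc_def Sc_def mult.assoc)

lemma fcoeff_diff:
  assumes "integrable circ u" "integrable circ v"
  shows "fcoeff (\<lambda>x. u x - v x) n = fcoeff u n - fcoeff v n"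
  using fcoeff_add[OF assms(1), of "\<lambda>x. -1 * v x"] fcoeff_cmult[OF assms(2), of "-1"] assms by simp

lemma fcoeff_minus: "integrable circ u \<Longrightarrow> fcoeff u (- n) = cnj (fcoeff u n)"
  by (simp add: fcoeff_Cc_Sc complex_eq_iff Cc_def Sc_def)

lemma fcoeff_cong_AE:
  assumes "integrable circ u" "integrable circ v" "AE x in circ. u x = v x"
  shows "fcoeff u n = fcoeff v n"
proof -
  have "Cc u a = Cc v a" "Sc u a = Sc v a" for a
    unfolding Cc_def Sc_def using assms
    by (auto intro!: integral_cong_AE borel_measurable_times elim: AE_mp)
  then show ?thesis using assms by (simp add: fcoeff_Cc_Sc)
qed

section \<open>Uniqueness of Fourier coefficients\<close>

text \<open>The class of integrable functions with vanishing coefficients is closed under multiplication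
  by polynomials in \<open>cos x\<close> and \<open>sin x\<close>, hence, by Stone-Weierstrass, annihilates continuous functions
  and indicators of compact sets.\<close>

definition trig_null :: "(real \<Rightarrow> real) \<Rightarrow> bool" where
  "trig_null w \<longleftrightarrow> integrable circ w \<and> (\<forall>n::int. Cc w (of_int n) = 0 \<and> Sc w (of_int n) = 0)"

lemma trig_null_linear:
  assumes "trig_null v" "trig_null w"
  shows "trig_null (\<lambda>x. a * v x + b * w x)"
proof -
  have "integrable circ v" "integrable circ w" using assms by (auto simp: trig_null_def)
  then have "Cc (\<lambda>x. a * v x + b * w x) t = a * Cc v t + b * Cc w t"
    "Sc (\<lambda>x. a * v x + b * w x) t = a * Sc v t + b * Sc w t" for t
    using integrable_mult_cos[of _ t] integrable_mult_sin[of _ t]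
    by (simp_all add: Cc_def Sc_def distrib_right mult.assoc)
  with assms show ?thesis by (simp add: trig_null_def)
qed

text \<open>The product-to-sum formulas express the new coefficients by old ones at the neighbouring
  frequencies \<open>n + 1\<close> and \<open>n - 1\<close>.\<close>

lemma trig_null_mult_cos:
  assumes "trig_null w"
  shows "trig_null (\<lambda>x. w x * cos x)"
proof -
  have w: "integrable circ w" and c: "\<And>n::int. Cc w (of_int n) = 0" and s: "\<And>n::int. Sc w (of_int n) = 0"
    using assms by (auto simp: trig_null_def)
  have "Cc (\<lambda>x. w x * cos x) (of_int n) = 0" for n
  proof -
    have "Cc (\<lambda>x. w x * cos x) (of_int n) = (\<integral>x. w x * cos (of_int (n+1) * x) / 2 + w x * cos (of_int (n-1) * x) / 2 \<partial>circ)"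
      unfolding Cc_def by (rule Bochner_Integration.integral_cong) (auto simp: cos_add cos_diff distrib_right left_diff_distrib field_simps)
    also have "\<dots> = (Cc w (of_int (n+1)) + Cc w (of_int (n-1))) / 2"
      using integrable_mult_cos[OF w, of "of_int (n+1)"] integrable_mult_cos[OF w, of "of_int (n-1)"]
      by (simp add: Cc_def del: of_int_add of_int_diff)
    finally show ?thesis by (simp add: c del: of_int_add of_int_diff)
  qed
  moreover have "Sc (\<lambda>x. w x * cos x) (of_int n) = 0" for n
  proof -
    have "Sc (\<lambda>x. w x * cos x) (of_int n) = (\<integral>x. w x * sin (of_int (n+1) * x) / 2 + w x * sin (of_int (n-1) * x) / 2 \<partial>circ)"
      unfolding Sc_def by (rule Bochner_Integration.integral_cong) (auto simp: sin_add sin_diff distrib_right left_diff_distrib field_simps)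
    also have "\<dots> = (Sc w (of_int (n+1)) + Sc w (of_int (n-1))) / 2"
      using integrable_mult_sin[OF w, of "of_int (n+1)"] integrable_mult_sin[OF w, of "of_int (n-1)"]
      by (simp add: Sc_def del: of_int_add of_int_diff)
    finally show ?thesis by (simp add: s del: of_int_add of_int_diff)
  qed
  ultimately show ?thesis using integrable_mult_cos[OF w, of 1] by (simp add: trig_null_def)
qed

lemma trig_null_mult_sin:
  assumes "trig_null w"
  shows "trig_null (\<lambda>x. w x * sin x)"
proof -
  have w: "integrable circ w" and c: "\<And>n::int. Cc w (of_int n) = 0" and s: "\<And>n::int. Sc w (of_int n) = 0"
    using assms by (auto simp: trig_null_def)
  have "Cc (\<lambda>x. w x * sin x) (of_int n) = 0" for n
  proof -
    have "Cc (\<lambda>x. w x * sin x) (of_int n) = (\<integral>x. w x * sin (of_int (n+1) * x) / 2 - w x * sin (of_int (n-1) * x) / 2 \<partial>circ)"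
      unfolding Cc_def by (rule Bochner_Integration.integral_cong) (auto simp: sin_add sin_diff distrib_right left_diff_distrib field_simps)
    also have "\<dots> = (Sc w (of_int (n+1)) - Sc w (of_int (n-1))) / 2"
      using integrable_mult_sin[OF w, of "of_int (n+1)"] integrable_mult_sin[OF w, of "of_int (n-1)"]
      by (simp add: Sc_def del: of_int_add of_int_diff)
    finally show ?thesis by (simp add: s del: of_int_add of_int_diff)
  qed
  moreover have "Sc (\<lambda>x. w x * sin x) (of_int n) = 0" for n
  proof -
    have "Sc (\<lambda>x. w x * sin x) (of_int n) = (\<integral>x. w x * cos (of_int (n-1) * x) / 2 - w x * cos (of_int (n+1) * x) / 2 \<partial>circ)"
      unfolding Sc_def by (rule Bochner_Integration.integral_cong) (auto simp: cos_add cos_diff distrib_right left_diff_distrib field_simps)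
    also have "\<dots> = (Cc w (of_int (n-1)) - Cc w (of_int (n+1))) / 2"
      using integrable_mult_cos[OF w, of "of_int (n+1)"] integrable_mult_cos[OF w, of "of_int (n-1)"]
      by (simp add: Cc_def del: of_int_add of_int_diff)
    finally show ?thesis by (simp add: c del: of_int_add of_int_diff)
  qed
  ultimately show ?thesis using integrable_mult_sin[OF w, of 1] by (simp add: trig_null_def)
qed

text \<open>Polynomials live on the complex plane and are evaluated at \<open>cis x\<close>, so that
  Stone-Weierstrass on the compact unit circle takes care of the identification of -pi with pi. A
  real-linear form is determined by its values at 1 and \<open>\<i>\<close>, which reduces the
  linear case to \<open>cos\<close> and \<open>sin\<close>.\<close>

lemma trig_null_mult_polynomial:
  assumes "real_polynomial_function p" "trig_null w"
  shows "trig_null (\<lambda>x. w x * p (cis x))"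
  using assms
proof (induction arbitrary: w)
  case (linear f)
  have "f (cis x) = cos x * f 1 + sin x * f \<i>" for x
  proof -
    have "cis x = cos x *\<^sub>R 1 + sin x *\<^sub>R \<i>" by (simp add: complex_eq_iff)
    then show ?thesis using linear.hyps by (simp only: bounded_linear.linear linear_add linear_scale) simp
  qed
  then have "w x * f (cis x) = f 1 * (w x * cos x) + f \<i> * (w x * sin x)" for x
    by (simp add: algebra_simps)
  then show ?case
    using trig_null_linear[OF trig_null_mult_cos[OF linear.prems] trig_null_mult_sin[OF linear.prems]] by simp
next
  case (const c)
  then show ?case using trig_null_linear[OF const const, of c 0] by (simp add: mult.commute)
next
  case (add f g)
  then show ?case using trig_null_linear[OF add.IH(1) add.IH(2), of w w 1 1] by (simp add: distrib_left)
next
  case (mult f g)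
  then show ?case using mult.IH(2)[OF mult.IH(1)] by (simp add: mult.assoc)
qed

lemma trig_null_integral_continuous:
  fixes f :: "complex \<Rightarrow> real"
  assumes w: "trig_null w" and f: "continuous_on UNIV f"
  shows "(\<integral>x. w x * f (cis x) \<partial>circ) = 0"
proof -
  have wi: "integrable circ w" using w by (simp add: trig_null_def)
  have fc: "continuous_on (sphere 0 1) f" by (rule continuous_on_subset[OF f]) simp
  have cm: "(\<lambda>x. f (cis x)) \<in> borel_measurable circ"
    using continuous_on_circ_trig(1)[of UNIV 1]
    by (intro measurable_circ_continuous continuous_on_compose2[OF f]) auto
  have "bounded (f ` sphere 0 1)" by (rule compact_imp_bounded[OF compact_continuous_image[OF fc compact_sphere]])
  then obtain B where "\<forall>y \<in> f ` sphere 0 1. norm y \<le> B"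
    unfolding bounded_iff by blast
  then have B: "norm (f (cis x)) \<le> B" for x by simp
  have int: "integrable circ (\<lambda>x. w x * f (cis x))"
    by (rule integrable_mult_bounded[OF wi cm B])
  have "\<bar>\<integral>x. w x * f (cis x) \<partial>circ\<bar> \<le> e * (\<integral>x. \<bar>w x\<bar> \<partial>circ)" if "e > 0" for e
  proof -
    obtain p where p: "real_polynomial_function p" "\<And>z. z \<in> sphere 0 1 \<Longrightarrow> \<bar>f z - p z\<bar> < e"
      using Stone_Weierstrass_real_polynomial_function[OF compact_sphere fc \<open>e > 0\<close>] by blast
    have "trig_null (\<lambda>x. w x * p (cis x))" using trig_null_mult_polynomial[OF p(1) w] .
    then have pi: "integrable circ (\<lambda>x. w x * p (cis x))" and "Cc (\<lambda>x. w x * p (cis x)) (of_int 0) = 0"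
      unfolding trig_null_def by blast+
    then have p0: "(\<integral>x. w x * p (cis x) \<partial>circ) = 0" by (simp add: Cc_def)
    have "(\<integral>x. w x * f (cis x) \<partial>circ) = (\<integral>x. w x * f (cis x) - w x * p (cis x) \<partial>circ)"
      using int pi p0 by simp
    also have "\<bar>\<dots>\<bar> \<le> (\<integral>x. \<bar>w x * f (cis x) - w x * p (cis x)\<bar> \<partial>circ)"
      by (rule integral_abs_bound)
    also have "\<dots> \<le> (\<integral>x. e * \<bar>w x\<bar> \<partial>circ)"
    proof (rule integral_mono)
      fix x
      have "\<bar>w x * f (cis x) - w x * p (cis x)\<bar> = \<bar>w x\<bar> * \<bar>f (cis x) - p (cis x)\<bar>"
        by (simp only: abs_mult[symmetric] right_diff_distrib)
      also have "\<dots> \<le> \<bar>w x\<bar> * e" using p(2)[of "cis x"] by (intro mult_left_mono) auto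
      finally show "\<bar>w x * f (cis x) - w x * p (cis x)\<bar> \<le> e * \<bar>w x\<bar>" by (simp add: mult.commute)
    qed (use int pi wi in auto)
    finally show ?thesis by simp
  qed
  note bound = this
  \<comment> \<open>The added 1 keeps the divisor positive when \<open>w\<close> vanishes almost
    everywhere.\<close>
  define K where "K = (\<integral>x. \<bar>w x\<bar> \<partial>circ) + 1"
  have K: "K > 0" by (simp add: K_def add_nonneg_pos)
  have "\<bar>\<integral>x. w x * f (cis x) \<partial>circ\<bar> \<le> 0 + d" if "d > 0" for d
  proof -
    have "\<bar>\<integral>x. w x * f (cis x) \<partial>circ\<bar> \<le> d / K * (K - 1)"
      using bound[of "d / K"] K that by (simp add: K_def)
    also have "\<dots> \<le> 0 + d" using K that by (simp add: field_simps)
    finally show ?thesis .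
  qed
  then have "\<bar>\<integral>x. w x * f (cis x) \<partial>circ\<bar> \<le> 0" by (rule field_le_epsilon)
  then show ?thesis by simp
qed

lemma trig_null_integral_compact:
  assumes w: "trig_null w" and C: "compact C" "C \<subseteq> {-pi<..<pi}"
  shows "(\<integral>x. w x * indicator C x \<partial>circ) = 0"
proof (cases "C = {}")
  case False
  define D where "D = cis ` C"
  have D: "closed D" "D \<noteq> {}"
    using False C(1) by (auto simp: D_def cis_conv_exp intro!: compact_imp_closed compact_continuous_image continuous_intros)
  have in_D: "cis x \<in> D \<longleftrightarrow> x \<in> C" if x: "x \<in> {-pi..pi}" for x
  proof
    assume "cis x \<in> D"
    then obtain y where y: "y \<in> C" "cis x = cis y" by (auto simp: D_def)
    then have yb: "-pi < y" "y < pi" using C(2) by auto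
    show "x \<in> C"
    proof (cases "x = -pi")
      case True
      then have "sgn (cis y) = cis pi" using y by (simp add: complex_eq_iff sgn_eq)
      then have "Arg (cis y) = pi" by (rule cis_Arg_unique) auto
      moreover have "Arg (cis y) = y" by (rule cis_Arg_unique) (use yb in \<open>auto simp: sgn_eq\<close>)
      ultimately show ?thesis using yb by simp
    next
      case False
      have "Arg (cis y) = y" by (rule cis_Arg_unique) (use yb in \<open>auto simp: sgn_eq\<close>)
      moreover have "Arg (cis x) = x" by (rule cis_Arg_unique) (use False x in \<open>auto simp: sgn_eq\<close>)
      ultimately show ?thesis using y by simp
    qed
  qed (auto simp: D_def)
  define f where "f k z = max 0 (1 - real k * infdist z D)" for k z
  have fc: "continuous_on UNIV (f k)" for k
    unfolding f_def by (intro continuous_intros)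
  have wi: "integrable circ w" using w by (simp add: trig_null_def)
  have cm: "(\<lambda>x. f k (cis x)) \<in> borel_measurable circ" for k
    using continuous_on_circ_trig(1)[of UNIV 1]
    by (intro measurable_circ_continuous continuous_on_compose2[OF fc]) auto
  have f01: "0 \<le> f k z" "f k z \<le> 1" for k z by (auto simp: f_def infdist_nonneg)
  have "(\<lambda>k. \<integral>x. w x * f k (cis x) \<partial>circ) \<longlonglongrightarrow> (\<integral>x. w x * indicator C x \<partial>circ)"
  proof (rule integral_dominated_convergence)
    have [measurable]: "C \<inter> {-pi..pi} \<in> sets circ"
      using C(1) by (auto simp: sets_restrict_space_iff compact_imp_closed intro!: lmeasurable_compact fmeasurableD)
    have "(\<lambda>x. w x * indicator (C \<inter> {-pi..pi}) x) \<in> borel_measurable circ"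
      using wi by measurable
    then show "(\<lambda>x. w x * indicator C x) \<in> borel_measurable circ"
      by (rule measurable_cong[THEN iffD1, rotated]) (auto simp: indicator_def)
    show "(\<lambda>x. w x * f k (cis x)) \<in> borel_measurable circ" for k using wi cm by measurable
    show "integrable circ (\<lambda>x. \<bar>w x\<bar>)" using wi by simp
    show "AE x in circ. norm (w x * f k (cis x)) \<le> \<bar>w x\<bar>" for k
      using f01 by (intro AE_I2) (auto simp: abs_mult intro!: mult_left_le)
    show "AE x in circ. (\<lambda>k. w x * f k (cis x)) \<longlonglongrightarrow> w x * indicator C x"
    proof (rule AE_I2)
      fix x assume "x \<in> space circ"
      then have x: "x \<in> {-pi..pi}" by simp
      have "(\<lambda>k. f k (cis x)) \<longlonglongrightarrow> indicator C x"
      proof (cases "x \<in> C")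
        case True
        then have "infdist (cis x) D = 0" using in_D[OF x] by simp
        then show ?thesis using True by (simp add: f_def)
      next
        case False
        then have "infdist (cis x) D > 0"
          using in_D[OF x] D in_closed_iff_infdist_zero[of D "cis x"] infdist_nonneg[of "cis x" D] by linarith
        then have "\<forall>\<^sub>F k in sequentially. 1 / infdist (cis x) D < real k"
          by (metis eventually_at_top_dense filterlim_at_top_dense filterlim_real_sequentially)
        then have "\<forall>\<^sub>F k in sequentially. f k (cis x) = 0"
          by eventually_elim (use \<open>infdist (cis x) D > 0\<close> in \<open>simp add: f_def field_simps\<close>)
        then show ?thesis using False by (simp add: tendsto_eventually)
      qed
      then show "(\<lambda>k. w x * f k (cis x)) \<longlonglongrightarrow> w x * indicator C x" by (intro tendsto_intros)
    qed
  qed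
  then show ?thesis using trig_null_integral_continuous[OF w fc] LIMSEQ_const_iff[of "0::real"] by simp
qed simp

text \<open>Inner regularity exhausts the set where \<open>w > 0\<close> by closed subsets up to
  small measure. The integral of \<open>w\<close> over each of them is zero although
  \<open>w\<close> is positive there, so each is a null set.\<close>

lemma trig_null_nonpos_AE:
  assumes w: "trig_null w"
  shows "AE x in circ. w x \<le> 0"
proof -
  define S where "S = {x \<in> {-pi<..<pi}. w x > 0}"
  have wi: "integrable circ w" using w by (simp add: trig_null_def)
  then have [measurable]: "w \<in> borel_measurable circ" by simp
  have "{x \<in> space circ. w x > 0} \<in> sets circ" by measurable
  then have "{x \<in> {-pi..pi}. w x > 0} \<in> sets lebesgue" by (simp add: sets_restrict_space_iff)
  moreover have "S = {x \<in> {-pi..pi}. w x > 0} \<inter> {-pi<..<pi}" by (auto simp: S_def)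
  ultimately have S: "S \<in> sets lebesgue" using sets.Int[of _ lebesgue "{-pi<..<pi}"] by simp
  have small: "emeasure lebesgue S \<le> ennreal e" if "e > 0" for e
  proof -
    obtain T where T: "closed T" "T \<subseteq> S" "S - T \<in> lmeasurable" "emeasure lebesgue (S - T) < ennreal e"
      using sets_lebesgue_inner_closed[OF S \<open>e > 0\<close>] by blast
    have sub: "T \<subseteq> {-pi<..<pi}" using T(2) by (auto simp: S_def)
    then have cT: "compact T" using T(1)
      bounded_subset[OF bounded_closed_interval[of "-pi" pi], of T] by (force simp: compact_eq_bounded_closed)
    have "(\<integral>x. w x * indicator T x \<partial>circ) = 0" by (rule trig_null_integral_compact[OF w cT sub])
    moreover have Tm: "T \<in> sets circ" using T(1) sub by (auto simp: sets_restrict_space_iff)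
    moreover have "integrable circ (\<lambda>x. w x * indicator T x)"
      using integrable_real_mult_indicator[OF Tm wi] .
    moreover have "0 \<le> w x * indicator T x" for x using T(2) by (auto simp: S_def indicator_def)
    ultimately have "AE x in circ. w x * indicator T x = 0"
      by (subst (asm) integral_nonneg_eq_0_iff_AE) auto
    then have "AE x in circ. x \<notin> T"
      by eventually_elim (use T(2) in \<open>auto simp: S_def indicator_def split: if_splits\<close>)
    then have "emeasure circ T = 0" using AE_iff_null_sets[OF Tm] by auto
    then have "emeasure lebesgue T = 0"
      using sub Tm by (subst (asm) emeasure_restrict_space) auto
    moreover have "emeasure lebesgue S \<le> emeasure lebesgue T + emeasure lebesgue (S - T)"
    proof -
      have "S = T \<union> (S - T)" using T(2) by auto
      then show ?thesis using emeasure_subadditive[of T lebesgue "S - T"] T(1) S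
          sets.Diff[of S lebesgue T] by (auto simp: sup_absorb2 emeasure_completion simp del: Un_Diff_cancel)
    qed
    ultimately show ?thesis using T(4) by simp
  qed
  have "emeasure lebesgue S = 0"
  proof -
    have "emeasure lebesgue S \<le> 0 + ennreal e" if "e > 0" for e using small[OF that] by simp
    then have "emeasure lebesgue S \<le> 0" by (rule ennreal_le_epsilon)
    then show ?thesis by simp
  qed
  then have "S \<in> null_sets lebesgue" using S by auto
  then have "S \<union> {-pi, pi} \<in> null_sets lebesgue"
    unfolding negligible_iff_null_sets[symmetric] by (auto intro!: negligible_Un negligible_finite)
  moreover have "{x \<in> space circ. \<not> w x \<le> 0} \<subseteq> S \<union> {-pi, pi}" by (auto simp: S_def)
  ultimately show ?thesis
    by (subst AE_restrict_space_iff) (auto intro!: AE_I'[of "S \<union> {-pi, pi}"])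
qed

theorem fourier_uniqueness:
  assumes "integrable circ u" "\<And>n. fcoeff u n = 0"
  shows "AE x in circ. u x = 0"
proof -
  have "Cc u (of_int n) = 0" "Sc u (of_int n) = 0" for n
    using assms(2)[of n] by (auto simp: fcoeff_Cc_Sc[OF assms(1)] complex_eq_iff)
  then have n: "trig_null u" using assms(1) by (simp add: trig_null_def)
  have "AE x in circ. u x \<le> 0" "AE x in circ. - u x \<le> 0"
    using trig_null_nonpos_AE[OF n] trig_null_nonpos_AE[OF trig_null_linear[OF n n, of "-1" 0]] by auto
  then show ?thesis by eventually_elim auto
qed

section \<open>Completeness and Parseval's identity\<close>

text \<open>A limit that inherits pointwise symmetries of the sequence, such as periodicity and oddness.\<close>

definition plim :: "(nat \<Rightarrow> 'a \<Rightarrow> real) \<Rightarrow> 'a \<Rightarrow> real" where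
  "plim f x = (if convergent (\<lambda>k. f k x) then lim (\<lambda>k. f k x) else 0)"

lemma plim_eq: "(\<lambda>k. f k x) \<longlonglongrightarrow> l \<Longrightarrow> plim f x = l"
  by (auto simp: plim_def convergent_def limI)

lemma plim_tendsto: "convergent (\<lambda>k. f k x) \<Longrightarrow> (\<lambda>k. f k x) \<longlonglongrightarrow> plim f x"
  by (simp add: plim_def convergent_LIMSEQ_iff)

lemma plim_measurable [measurable]:
  assumes [measurable]: "\<And>k. f k \<in> borel_measurable M"
  shows "plim f \<in> borel_measurable M"
proof -
  have [measurable]: "Measurable.pred M (\<lambda>x. convergent (\<lambda>k. f k x))"
    unfolding Cauchy_convergent_iff[symmetric] pred_def using sets_Collect_Cauchy[of f M] by simp
  show ?thesis unfolding plim_def[abs_def] by measurable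
qed

text \<open>For fixed \<open>n\<close>, Fatou along the subsequence turns a Cauchy bound into a
  bound on the distance to the limit. The even exponent is a parameter so that the almost everywhere
  limit obtained from L^2 convergence also serves in L^4.\<close>

lemma plim_Fatou:
  fixes u :: "nat \<Rightarrow> 'a \<Rightarrow> real"
  assumes AE: "AE x in M. convergent (\<lambda>k. u (r k) x)" and r: "strict_mono r" and p: "even p"
    and meas: "\<And>n. u n \<in> borel_measurable M"
    and int: "\<And>m n. integrable M (\<lambda>x. (u m x - u n x) ^ p)"
    and N: "\<And>m n. m \<ge> N \<Longrightarrow> n \<ge> N \<Longrightarrow> (\<integral>x. (u m x - u n x) ^ p \<partial>M) \<le> e" and n: "n \<ge> N"
  shows "integrable M (\<lambda>x. (u n x - plim (\<lambda>k. u (r k)) x) ^ p)"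
    "(\<integral>x. (u n x - plim (\<lambda>k. u (r k)) x) ^ p \<partial>M) \<le> e"
proof -
  have rk: "r (k + N) \<ge> N" for k using seq_suble[OF r, of "k + N"] by linarith
  have lim: "AE x in M. (\<lambda>k. (u n x - u (r (k + N)) x) ^ p) \<longlonglongrightarrow> (u n x - plim (\<lambda>k. u (r k)) x) ^ p"
    using AE
  proof eventually_elim
    fix x assume "convergent (\<lambda>k. u (r k) x)"
    from plim_tendsto[of "\<lambda>k. u (r k)", OF this] have "(\<lambda>k. u (r (k + N)) x) \<longlonglongrightarrow> plim (\<lambda>k. u (r k)) x"
      by (rule LIMSEQ_ignore_initial_segment)
    then show "(\<lambda>k. (u n x - u (r (k + N)) x) ^ p) \<longlonglongrightarrow> (u n x - plim (\<lambda>k. u (r k)) x) ^ p"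
      by (intro tendsto_intros)
  qed
  have m: "(\<lambda>x. (u n x - plim (\<lambda>k. u (r k)) x) ^ p) \<in> borel_measurable M"
    using meas by measurable
  note F = Fatou_integral[OF int _ lim m, of e]
  have nn: "0 \<le> (u n x - u (r (k + N)) x) ^ p" for x k
    using p by (rule zero_le_even_power)
  show "integrable M (\<lambda>x. (u n x - plim (\<lambda>k. u (r k)) x) ^ p)"
    by (rule F(1)[OF nn N[OF n rk]])
  show "(\<integral>x. (u n x - plim (\<lambda>k. u (r k)) x) ^ p \<partial>M) \<le> e"
    by (rule F(2)[OF nn N[OF n rk]])
qed

lemma sq_int_Cauchy_AE_subseq:
  fixes u :: "nat \<Rightarrow> 'a \<Rightarrow> real"
  assumes fin: "finite_measure M" and u: "\<And>k. sq_int M (u k)"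
    and C: "\<And>e. e > 0 \<Longrightarrow> \<exists>N. \<forall>m\<ge>N. \<forall>n\<ge>N. (\<integral>x. (u m x - u n x)\<^sup>2 \<partial>M) < e"
  obtains r where "strict_mono r" "AE x in M. convergent (\<lambda>k. u (r k) x)"
proof -
  have "\<exists>r. \<forall>k. (\<forall>m\<ge>r k. \<forall>n\<ge>r k. (\<integral>x. (u m x - u n x)\<^sup>2 \<partial>M) < (1/4)^k) \<and> r k < r (Suc k)"
  proof (rule dependent_nat_choice)
    show "\<exists>N. \<forall>m\<ge>N. \<forall>n\<ge>N. (\<integral>x. (u m x - u n x)\<^sup>2 \<partial>M) < (1/4)^0" using C[of 1] by simp
    fix N k
    obtain N' where "\<forall>m\<ge>N'. \<forall>n\<ge>N'. (\<integral>x. (u m x - u n x)\<^sup>2 \<partial>M) < (1/4)^Suc k"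
      using C[of "(1/4)^Suc k"] by auto
    then show "\<exists>y. (\<forall>m\<ge>y. \<forall>n\<ge>y. (\<integral>x. (u m x - u n x)\<^sup>2 \<partial>M) < (1/4)^Suc k) \<and> N < y"
      by (intro exI[of _ "max N' (Suc N)"]) auto
  qed
  then obtain r where r: "\<And>k m n. m \<ge> r k \<Longrightarrow> n \<ge> r k \<Longrightarrow> (\<integral>x. (u m x - u n x)\<^sup>2 \<partial>M) < (1/4)^k"
    "\<And>k. r k < r (Suc k)" by blast
  have mono: "strict_mono r" using r(2) by (rule strict_monoI_Suc)
  have "AE x in M. convergent (\<lambda>k. u (r k) x)"
    by (rule sq_int_fast_Cauchy_AE_convergent[OF fin u])
      (use r(1)[OF less_imp_le[OF r(2)] order_refl] in \<open>auto intro: less_imp_le\<close>)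
  with mono show thesis by (rule that)
qed

lemma sq_int_complete:
  fixes u :: "nat \<Rightarrow> 'a \<Rightarrow> real"
  assumes fin: "finite_measure M" and u: "\<And>k. sq_int M (u k)"
    and C: "\<And>e. e > 0 \<Longrightarrow> \<exists>N. \<forall>m\<ge>N. \<forall>n\<ge>N. (\<integral>x. (u m x - u n x)\<^sup>2 \<partial>M) < e"
  obtains r where "strict_mono r" "AE x in M. convergent (\<lambda>k. u (r k) x)"
    "sq_int M (plim (\<lambda>k. u (r k)))" "(\<lambda>n. \<integral>x. (u n x - plim (\<lambda>k. u (r k)) x)\<^sup>2 \<partial>M) \<longlonglongrightarrow> 0"
proof -
  obtain r where r: "strict_mono r" "AE x in M. convergent (\<lambda>k. u (r k) x)"
    by (rule sq_int_Cauchy_AE_subseq[where u = u, OF fin u]) (use C in blast)+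
  let ?v = "plim (\<lambda>k. u (r k))"
  have meas: "\<And>n. u n \<in> borel_measurable M" using u by measurable
  have int: "integrable M (\<lambda>x. (u m x - u n x) ^ 2)" for m n
    using sq_int_diff[OF u u, of m n] by (simp add: sq_int_def)
  have F: "\<exists>N. \<forall>n\<ge>N. integrable M (\<lambda>x. (u n x - ?v x)\<^sup>2) \<and> (\<integral>x. (u n x - ?v x)\<^sup>2 \<partial>M) \<le> e" if e: "e > 0" for e
  proof -
    obtain N where "\<forall>m\<ge>N. \<forall>n\<ge>N. (\<integral>x. (u m x - u n x)\<^sup>2 \<partial>M) < e" using C[OF e] by blast
    then have N: "\<And>m n. m \<ge> N \<Longrightarrow> n \<ge> N \<Longrightarrow> (\<integral>x. (u m x - u n x)\<^sup>2 \<partial>M) \<le> e" by (simp add: less_imp_le)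
    show ?thesis
      using plim_Fatou[OF r(2,1) _ meas int N] by (intro exI[of _ N]) auto
  qed
  obtain N where N: "integrable M (\<lambda>x. (u N x - ?v x)\<^sup>2)" using F[of 1] by auto
  have "(\<lambda>x. u N x - ?v x) \<in> borel_measurable M" using meas by measurable
  with N have "sq_int M (\<lambda>x. u N x - ?v x)" by (simp add: sq_int_def)
  from sq_int_diff[OF u[of N] this] have v: "sq_int M ?v" by simp
  have "(\<lambda>n. \<integral>x. (u n x - ?v x)\<^sup>2 \<partial>M) \<longlonglongrightarrow> 0"
  proof (rule LIMSEQ_I)
    fix e :: real assume "e > 0"
    then obtain N where "\<forall>n\<ge>N. (\<integral>x. (u n x - ?v x)\<^sup>2 \<partial>M) \<le> e / 2" using F[of "e/2"] by auto
    with \<open>e > 0\<close> show "\<exists>N. \<forall>n\<ge>N. norm ((\<integral>x. (u n x - ?v x)\<^sup>2 \<partial>M) - 0) < e"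
      by (intro exI[of _ N]) force
  qed
  with r v show thesis by (rule that)
qed

section \<open>Trigonometric polynomials and Fourier partial sums\<close>

lemma integral_circ_cis:
  "(\<integral>x. cis (of_int k * x) \<partial>circ) = (if k = 0 then 2 * pi else 0)"
proof (cases "k = 0")
  case True
  then show ?thesis by (simp add: measure_circ scaleR_conv_of_real)
next
  case False
  have int: "integrable circ (\<lambda>x. cis (of_int k * x))"
    by (intro integrable_circ_continuous continuous_intros)
  have per: "cis (of_int k * (x + 2 * pi)) = cis (of_int k * x)" for x
  proof -
    have "cis (of_int k * (x + 2 * pi)) = cis (of_int k * x) * cis (2 * pi * of_int k)"
      by (simp add: cis_mult algebra_simps)
    then show ?thesis by (simp add: cis_multiple_2pi)
  qed
  \<comment> \<open>Translating by \<open>pi / k\<close> changes the sign of the integrand but not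
    the integral.\<close>
  have "(\<integral>x. cis (of_int k * x) \<partial>circ) = (\<integral>x. cis (of_int k * (x + pi / of_int k)) \<partial>circ)"
    by (rule integral_circ_shift[OF per int, symmetric])
  also have "\<dots> = (\<integral>x. - cis (of_int k * x) \<partial>circ)"
    using False by (simp add: distrib_left cis_mult[symmetric])
  finally show ?thesis using False by simp
qed

definition trigp :: "(int \<Rightarrow> complex) \<Rightarrow> int set \<Rightarrow> real \<Rightarrow> complex" where
  "trigp a F x = (\<Sum>k\<in>F. a k * cis (of_int k * x))"

lemma continuous_on_trigp [continuous_intros]: "continuous_on S (trigp a F)"
  unfolding trigp_def[abs_def] by (intro continuous_intros)

lemma integral_trigp_mult_cis:
  fixes a :: "int \<Rightarrow> complex"
  assumes "finite F"
  shows "(\<integral>x. trigp a F x * cis (- (of_int n * x)) \<partial>circ) = (if n \<in> F then 2 * pi * a n else 0)"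
proof -
  have int: "integrable circ (\<lambda>x. a k * cis (of_int (k - n) * x))" for k
    by (intro integrable_circ_continuous continuous_intros)
  have "(\<integral>x. trigp a F x * cis (- (of_int n * x)) \<partial>circ) = (\<integral>x. (\<Sum>k\<in>F. a k * cis (of_int (k - n) * x)) \<partial>circ)"
    by (rule Bochner_Integration.integral_cong)
      (auto simp: trigp_def sum_distrib_right mult.assoc cis_mult left_diff_distrib)
  also have "\<dots> = (\<Sum>k\<in>F. if k = n then of_real (2 * pi) * a k else 0)"
    by (subst Bochner_Integration.integral_sum[OF int]) (auto intro!: sum.cong simp: integral_circ_cis simp del: of_int_diff)
  also have "\<dots> = (if n \<in> F then of_real (2 * pi) * a n else 0)"
    using assms by (simp add: if_distrib[of "\<lambda>c. _ * of_real c"] if_distrib[of "\<lambda>c. _ * c"] if_distrib[of of_real] cong: if_cong)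
  finally show ?thesis .
qed

lemma integral_cmod_trigp:
  assumes "finite F"
  shows "(\<integral>x. (cmod (trigp a F x))\<^sup>2 \<partial>circ) = 2 * pi * (\<Sum>k\<in>F. (cmod (a k))\<^sup>2)"
proof -
  have int: "integrable circ (\<lambda>x. cnj (a k) * (trigp a F x * cis (- (of_int k * x))))" for k
    by (intro integrable_circ_continuous continuous_intros)
  have "complex_of_real (\<integral>x. (cmod (trigp a F x))\<^sup>2 \<partial>circ) = (\<integral>x. trigp a F x * cnj (trigp a F x) \<partial>circ)"
    unfolding complex_norm_square[symmetric] integral_complex_of_real[symmetric] by simp
  also have "\<dots> = (\<integral>x. (\<Sum>k\<in>F. cnj (a k) * (trigp a F x * cis (- (of_int k * x)))) \<partial>circ)"
    by (rule Bochner_Integration.integral_cong)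
      (auto simp: trigp_def[of a F] cnj_sum cis_cnj sum_distrib_left intro!: sum.cong)
  also have "\<dots> = (\<Sum>k\<in>F. cnj (a k) * (2 * pi * a k))"
    by (subst Bochner_Integration.integral_sum[OF int])
      (auto intro!: sum.cong simp: integral_trigp_mult_cis[OF assms])
  also have "\<dots> = complex_of_real (2 * pi * (\<Sum>k\<in>F. (cmod (a k))\<^sup>2))"
    unfolding of_real_mult of_real_sum sum_distrib_left
    by (intro sum.cong) (auto simp: complex_norm_square simp del: of_real_power)
  finally show ?thesis by (simp only: of_real_eq_iff)
qed

text \<open>Symmetric partial sums; the coefficient sequence \<open>a\<close> is Hermitian, so that the sum is real.\<close>

definition psum :: "(int \<Rightarrow> complex) \<Rightarrow> nat \<Rightarrow> real \<Rightarrow> real" where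
  "psum a N x = Re (trigp a {- int N..int N} x)"

definition herm :: "(int \<Rightarrow> complex) \<Rightarrow> bool" where
  "herm a \<longleftrightarrow> (\<forall>k. a (- k) = cnj (a k))"

lemma herm_fcoeff: "integrable circ u \<Longrightarrow> herm (fcoeff u)"
  by (simp add: herm_def fcoeff_minus)

lemma of_real_psum:
  assumes "herm a"
  shows "complex_of_real (psum a N x) = trigp a {- int N..int N} x"
proof -
  have "cnj (trigp a {- int N..int N} x) = trigp a {- int N..int N} x"
    unfolding trigp_def cnj_sum
    by (rule sum.reindex_bij_witness[of _ uminus uminus]) (use assms in \<open>auto simp: herm_def cis_cnj\<close>)
  then show ?thesis by (simp add: psum_def complex_eq_iff)
qed

lemma continuous_on_psum: "continuous_on S (psum a N)"
  unfolding psum_def[abs_def] by (intro continuous_intros)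

lemma psum_measurable [measurable]: "psum a N \<in> borel_measurable circ"
  by (intro measurable_circ_continuous continuous_on_psum)

lemma sq_int_continuous: "continuous_on UNIV f \<Longrightarrow> sq_int circ f"
  unfolding sq_int_def
  by (auto intro!: measurable_circ_continuous integrable_circ_continuous continuous_intros intro: continuous_on_subset)

lemma sq_int_psum: "sq_int circ (psum a N)"
  by (intro sq_int_continuous continuous_on_psum)

lemma fcoeff_psum:
  assumes "herm a"
  shows "fcoeff (psum a N) n = (if \<bar>n\<bar> \<le> int N then a n else 0)"
  using integral_trigp_mult_cis[of "{- int N..int N}" a n] by (auto simp: fcoeff_circ of_real_psum[OF assms])

lemma integral_psum_sq:
  assumes "herm a"
  shows "(\<integral>x. (psum a N x)\<^sup>2 \<partial>circ) = 2 * pi * (\<Sum>k\<in>{- int N..int N}. (cmod (a k))\<^sup>2)"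
proof -
  have "(psum a N x)\<^sup>2 = (cmod (trigp a {- int N..int N} x))\<^sup>2" for x
    by (simp add: of_real_psum[OF assms, symmetric])
  then show ?thesis by (simp add: integral_cmod_trigp)
qed

lemma integral_mult_psum:
  assumes u: "integrable circ u" and a: "herm a"
  shows "(\<integral>x. u x * psum a N x \<partial>circ) = 2 * pi * (\<Sum>k\<in>{- int N..int N}. Re (cnj (fcoeff u k) * a k))"
proof -
  have int: "integrable circ (\<lambda>x. of_real (u x) * cis (of_int k * x))" for k
    by (rule integrable_mult_bounded[of _ _ _ 1]) (use u in auto)
  have c: "(\<integral>x. of_real (u x) * cis (of_int k * x) \<partial>circ) = 2 * pi * cnj (fcoeff u k)" for k
    using fcoeff_circ[of u "-k"] by (simp add: fcoeff_minus[OF u])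
  have "complex_of_real (\<integral>x. u x * psum a N x \<partial>circ) = (\<integral>x. complex_of_real (u x * psum a N x) \<partial>circ)"
    unfolding integral_complex_of_real ..
  also have "\<dots> = (\<integral>x. (\<Sum>k\<in>{- int N..int N}. a k * (of_real (u x) * cis (of_int k * x))) \<partial>circ)"
    by (rule Bochner_Integration.integral_cong)
      (auto simp: of_real_psum[OF a] trigp_def sum_distrib_left intro!: sum.cong)
  also have "\<dots> = (\<Sum>k\<in>{- int N..int N}. a k * (2 * pi * cnj (fcoeff u k)))"
    by (subst Bochner_Integration.integral_sum) (use int in \<open>auto simp: c\<close>)
  finally have "(\<integral>x. u x * psum a N x \<partial>circ) = Re (\<Sum>k\<in>{- int N..int N}. a k * (2 * pi * cnj (fcoeff u k)))"
    by (metis Re_complex_of_real)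
  also have "\<dots> = 2 * pi * (\<Sum>k\<in>{- int N..int N}. Re (cnj (fcoeff u k) * a k))"
    unfolding sum_distrib_left Re_sum by (intro sum.cong) (auto simp: algebra_simps)
  finally show ?thesis .
qed

lemma Bessel_equality:
  assumes "sq_int circ u"
  shows "(\<integral>x. (u x - psum (fcoeff u) N x)\<^sup>2 \<partial>circ) = (\<integral>x. (u x)\<^sup>2 \<partial>circ) - 2 * pi * (\<Sum>k\<in>{- int N..int N}. (cmod (fcoeff u k))\<^sup>2)"
proof -
  have u: "integrable circ u" by (rule sq_int_integrable[OF finite_measure_circ assms])
  note h = herm_fcoeff[OF u]
  have re: "Re (cnj z * z) = (cmod z)\<^sup>2" for z by (simp add: cmod_power2) (simp add: power2_eq_square)
  have "(\<integral>x. (u x - psum (fcoeff u) N x)\<^sup>2 \<partial>circ)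
      = (\<integral>x. (u x)\<^sup>2 - 2 * (u x * psum (fcoeff u) N x) + (psum (fcoeff u) N x)\<^sup>2 \<partial>circ)"
    by (intro Bochner_Integration.integral_cong) (auto simp: power2_eq_square algebra_simps)
  also have "\<dots> = (\<integral>x. (u x)\<^sup>2 \<partial>circ) - 2 * (\<integral>x. u x * psum (fcoeff u) N x \<partial>circ) + (\<integral>x. (psum (fcoeff u) N x)\<^sup>2 \<partial>circ)"
    using assms sq_int_mult[OF assms sq_int_psum] sq_int_psum by (simp add: sq_int_def)
  finally show ?thesis unfolding integral_mult_psum[OF u h] integral_psum_sq[OF h] re by simp
qed

text \<open>Links the unordered sums over all integers, in which the functional is defined, with
  symmetric partial sums, along which limits are taken.\<close>

lemma int_interval_sums_limit:
  fixes f :: "int \<Rightarrow> real"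
  assumes "f summable_on UNIV"
  shows "(\<lambda>N. \<Sum>k\<in>{- int N..int N}. f k) \<longlonglongrightarrow> infsum f UNIV"
proof -
  have "filterlim (\<lambda>N. {- int N..int N}) (finite_subsets_at_top UNIV) sequentially"
    unfolding filterlim_finite_subsets_at_top
  proof (intro allI impI)
    fix X :: "int set" assume X: "finite X \<and> X \<subseteq> UNIV"
    define M where "M = (\<Sum>k\<in>X. nat \<bar>k\<bar>)"
    have M: "\<bar>k\<bar> \<le> int M" if "k \<in> X" for k
    proof -
      have "nat \<bar>k\<bar> \<le> M" unfolding M_def using that X by (intro member_le_sum) auto
      then show ?thesis by simp
    qed
    show "\<forall>\<^sub>F N in sequentially. finite {- int N..int N} \<and> X \<subseteq> {- int N..int N} \<and> {- int N..int N} \<subseteq> UNIV"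
      using eventually_ge_at_top[of M] by eventually_elim (use M in force)
  qed
  from filterlim_compose[OF has_sum_infsum[OF assms, unfolded has_sum_def] this] show ?thesis .
qed

text \<open>Every finite set of integers lies in a symmetric interval. This is the form in which
  lower semicontinuity enters: finite symmetric sums pass to limits term by term, and a bound on all
  of them bounds the infinite sum.\<close>

lemma int_summable_bounded:
  fixes f :: "int \<Rightarrow> real"
  assumes nn: "\<And>k. 0 \<le> f k" and b: "\<And>N. (\<Sum>k\<in>{- int N..int N}. f k) \<le> C"
  shows "f summable_on UNIV" "infsum f UNIV \<le> C"
proof -
  have le: "sum f X \<le> C" if "finite X" for X
  proof -
    define N where "N = (\<Sum>k\<in>X. nat \<bar>k\<bar>)"
    have "X \<subseteq> {- int N..int N}"
    proof
      fix k assume "k \<in> X"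
      then have "nat \<bar>k\<bar> \<le> N" unfolding N_def using that by (intro member_le_sum) auto
      then show "k \<in> {- int N..int N}" by auto
    qed
    then have "sum f X \<le> (\<Sum>k\<in>{- int N..int N}. f k)" by (intro sum_mono2) (use nn in auto)
    also have "\<dots> \<le> C" by (rule b)
    finally show ?thesis .
  qed
  show "f summable_on UNIV"
    by (rule nonneg_bdd_above_summable_on) (use nn le in \<open>auto intro!: bdd_aboveI\<close>)
  then show "infsum f UNIV \<le> C" by (rule infsum_le_finite_sums) (use le in auto)
qed



lemma Cauchy_Schwarz_integral_abs:
  assumes "sq_int M u" "sq_int M v"
  shows "\<bar>\<integral>x. u x * v x \<partial>M\<bar> \<le> sqrt (\<integral>x. (u x)\<^sup>2 \<partial>M) * sqrt (\<integral>x. (v x)\<^sup>2 \<partial>M)"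
  using real_sqrt_le_mono[OF Cauchy_Schwarz_integral[OF assms]] by (simp add: real_sqrt_mult)

lemma integral_mult_L2_limit:
  assumes un: "\<And>n. sq_int M (u n)" and v: "sq_int M v" and f: "sq_int M f"
    and lim: "(\<lambda>n. \<integral>x. (u n x - v x)\<^sup>2 \<partial>M) \<longlonglongrightarrow> 0"
  shows "(\<lambda>n. \<integral>x. u n x * f x \<partial>M) \<longlonglongrightarrow> (\<integral>x. v x * f x \<partial>M)"
proof -
  have "(\<integral>x. u n x * f x \<partial>M) - (\<integral>x. v x * f x \<partial>M) = (\<integral>x. (u n x - v x) * f x \<partial>M)" for n
    using sq_int_mult[OF un f, of n] sq_int_mult[OF v f] by (simp add: left_diff_distrib)
  then have le: "norm ((\<integral>x. u n x * f x \<partial>M) - (\<integral>x. v x * f x \<partial>M)) \<le> sqrt (\<integral>x. (u n x - v x)\<^sup>2 \<partial>M) * sqrt (\<integral>x. (f x)\<^sup>2 \<partial>M)" for n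
    using Cauchy_Schwarz_integral_abs[OF sq_int_diff[OF un v] f] by simp
  have "(\<lambda>n. sqrt (\<integral>x. (u n x - v x)\<^sup>2 \<partial>M) * sqrt (\<integral>x. (f x)\<^sup>2 \<partial>M)) \<longlonglongrightarrow> sqrt 0 * sqrt (\<integral>x. (f x)\<^sup>2 \<partial>M)"
    by (intro tendsto_intros lim)
  then have "(\<lambda>n. (\<integral>x. u n x * f x \<partial>M) - (\<integral>x. v x * f x \<partial>M)) \<longlonglongrightarrow> 0"
    by (intro Lim_null_comparison[OF always_eventually[OF allI[OF le]]]) simp
  then show ?thesis by (simp add: LIM_zero_iff)
qed

lemma fcoeff_L2_limit:
  assumes un: "\<And>n. sq_int circ (u n)" and v: "sq_int circ v"
    and lim: "(\<lambda>n. \<integral>x. (u n x - v x)\<^sup>2 \<partial>circ) \<longlonglongrightarrow> 0"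
  shows "(\<lambda>n. fcoeff (u n) k) \<longlonglongrightarrow> fcoeff v k"
proof -
  have c: "sq_int circ (\<lambda>x. cos (of_int k * x))" "sq_int circ (\<lambda>x. sin (of_int k * x))"
    by (intro sq_int_continuous continuous_intros)+
  note i = sq_int_integrable[OF finite_measure_circ]
  have "(\<lambda>n. Cc (u n) (of_int k)) \<longlonglongrightarrow> Cc v (of_int k)" "(\<lambda>n. Sc (u n) (of_int k)) \<longlonglongrightarrow> Sc v (of_int k)"
    unfolding Cc_def Sc_def by (intro integral_mult_L2_limit un v c lim)+
  then show ?thesis
    by (simp add: fcoeff_Cc_Sc[OF i[OF un]] fcoeff_Cc_Sc[OF i[OF v]] tendsto_complex_iff tendsto_divide tendsto_minus)
qed

text \<open>Deleting the low modes makes the difference a partial sum itself, so that the norm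
  formula for partial sums applies to it.\<close>

lemma psum_minus_psum:
  assumes "M \<le> N"
  shows "psum a N x - psum a M x = psum (\<lambda>k. if \<bar>k\<bar> \<le> int M then 0 else a k) N x"
proof -
  have "trigp a {- int N..int N} x = trigp a ({- int N..int N} - {- int M..int M}) x + trigp a {- int M..int M} x"
    unfolding trigp_def by (rule sum.subset_diff) (use assms in auto)
  moreover have "trigp (\<lambda>k. if \<bar>k\<bar> \<le> int M then 0 else a k) {- int N..int N} x = trigp a ({- int N..int N} - {- int M..int M}) x"
    unfolding trigp_def by (rule sum.mono_neutral_cong_right) auto
  ultimately show ?thesis by (simp add: psum_def)
qed

lemma integral_psum_diff_sq:
  assumes a: "herm a" and MN: "M \<le> N"
  shows "(\<integral>x. (psum a N x - psum a M x)\<^sup>2 \<partial>circ)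
    = 2 * pi * ((\<Sum>k\<in>{- int N..int N}. (cmod (a k))\<^sup>2) - (\<Sum>k\<in>{- int M..int M}. (cmod (a k))\<^sup>2))"
proof -
  define b where "b k = (if \<bar>k\<bar> \<le> int M then 0 else a k)" for k
  have b: "herm b" using a by (simp add: herm_def b_def)
  have "(\<Sum>k\<in>{- int N..int N}. (cmod (a k))\<^sup>2) = (\<Sum>k\<in>{- int N..int N} - {- int M..int M}. (cmod (a k))\<^sup>2) + (\<Sum>k\<in>{- int M..int M}. (cmod (a k))\<^sup>2)"
    by (rule sum.subset_diff) (use MN in auto)
  moreover have "(\<Sum>k\<in>{- int N..int N}. (cmod (b k))\<^sup>2) = (\<Sum>k\<in>{- int N..int N} - {- int M..int M}. (cmod (a k))\<^sup>2)"
    by (rule sum.mono_neutral_cong_right) (auto simp: b_def)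
  ultimately have "(\<Sum>k\<in>{- int N..int N}. (cmod (a k))\<^sup>2) - (\<Sum>k\<in>{- int M..int M}. (cmod (a k))\<^sup>2) = (\<Sum>k\<in>{- int N..int N}. (cmod (b k))\<^sup>2)"
    by simp
  then show ?thesis
    unfolding psum_minus_psum[OF MN] b_def[symmetric] by (simp add: integral_psum_sq[OF b])
qed

text \<open>The squared L^2 distance of two partial sums is \<open>2 * pi\<close> times the
  difference of the corresponding sums of squares, so completeness of L^2 provides the
  limit.\<close>

lemma Riesz_Fischer:
  assumes a: "herm a" and sm: "(\<lambda>k. (cmod (a k))\<^sup>2) summable_on UNIV"
  obtains v where "sq_int circ v" "\<And>k. fcoeff v k = a k" "(\<lambda>N. \<integral>x. (psum a N x - v x)\<^sup>2 \<partial>circ) \<longlonglongrightarrow> 0"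
proof -
  define S where "S N = (\<Sum>k\<in>{- int N..int N}. (cmod (a k))\<^sup>2)" for N
  have "convergent S" using int_interval_sums_limit[OF sm] by (auto simp: S_def[abs_def] convergent_def)
  then have CS: "Cauchy S" by (rule convergent_Cauchy)
  have D: "(\<integral>x. (psum a m x - psum a n x)\<^sup>2 \<partial>circ) = 2 * pi * \<bar>S m - S n\<bar>" for m n
  proof (cases "n \<le> m")
    case True
    have "S n \<le> S m" unfolding S_def by (intro sum_mono2) (use True in auto)
    then show ?thesis using integral_psum_diff_sq[OF a True] by (simp add: S_def)
  next
    case False
    then have le: "m \<le> n" by simp
    have "S m \<le> S n" unfolding S_def by (intro sum_mono2) (use le in auto)
    moreover have "(psum a m x - psum a n x)\<^sup>2 = (psum a n x - psum a m x)\<^sup>2" for x by (rule power2_commute)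
    ultimately show ?thesis using integral_psum_diff_sq[OF a le] by (simp add: S_def)
  qed
  have C: "\<exists>N. \<forall>m\<ge>N. \<forall>n\<ge>N. (\<integral>x. (psum a m x - psum a n x)\<^sup>2 \<partial>circ) < e" if "e > 0" for e
  proof -
    have "e / (2 * pi) > 0" using that by simp
    then obtain N where "\<forall>m\<ge>N. \<forall>n\<ge>N. dist (S m) (S n) < e / (2 * pi)"
      using CS unfolding Cauchy_def by blast
    then have "\<forall>m\<ge>N. \<forall>n\<ge>N. 2 * pi * \<bar>S m - S n\<bar> < e"
      using pi_gt_zero by (auto simp: dist_real_def field_simps)
    then show ?thesis unfolding D by blast
  qed
  obtain r where r: "sq_int circ (plim (\<lambda>k. psum a (r k)))"
    "(\<lambda>n. \<integral>x. (psum a n x - plim (\<lambda>k. psum a (r k)) x)\<^sup>2 \<partial>circ) \<longlonglongrightarrow> 0"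
    by (rule sq_int_complete[where u = "psum a", OF finite_measure_circ sq_int_psum]) (use C in blast)+
  have "fcoeff (plim (\<lambda>k. psum a (r k))) k = a k" for k
  proof -
    have "\<forall>\<^sub>F N in sequentially. fcoeff (psum a N) k = a k"
      using eventually_ge_at_top[of "nat \<bar>k\<bar>"] by eventually_elim (auto simp: fcoeff_psum[OF a])
    then have "(\<lambda>N. fcoeff (psum a N) k) \<longlonglongrightarrow> a k" by (rule tendsto_eventually)
    with fcoeff_L2_limit[where u = "psum a", OF sq_int_psum r] show ?thesis by (rule LIMSEQ_unique)
  qed
  with r show thesis by (intro that) auto
qed

text \<open>Riesz-Fischer yields a function with the coefficients of \<open>u\<close> that is the
  L^2 limit of the partial sums; uniqueness identifies it with \<open>u\<close>. Hence the defect in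
  Bessel's equality tends to zero.\<close>

lemma
  assumes u: "sq_int circ u"
  shows Parseval_summable: "(\<lambda>k. (cmod (fcoeff u k))\<^sup>2) summable_on UNIV"
    and psum_fcoeff_tendsto: "(\<lambda>N. \<integral>x. (psum (fcoeff u) N x - u x)\<^sup>2 \<partial>circ) \<longlonglongrightarrow> 0"
    and Parseval: "(\<integral>x. (u x)\<^sup>2 \<partial>circ) = 2 * pi * (\<Sum>\<^sub>\<infinity>k. (cmod (fcoeff u k))\<^sup>2)"
proof -
  note i = sq_int_integrable[OF finite_measure_circ]
  have h: "herm (fcoeff u)" by (rule herm_fcoeff[OF i[OF u]])
  have "2 * pi * (\<Sum>k\<in>{- int N..int N}. (cmod (fcoeff u k))\<^sup>2) \<le> (\<integral>x. (u x)\<^sup>2 \<partial>circ)" for N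
  proof -
    have "0 \<le> (\<integral>x. (u x - psum (fcoeff u) N x)\<^sup>2 \<partial>circ)" by simp
    then show ?thesis unfolding Bessel_equality[OF u] by simp
  qed
  then have "(\<Sum>k\<in>{- int N..int N}. (cmod (fcoeff u k))\<^sup>2) \<le> (\<integral>x. (u x)\<^sup>2 \<partial>circ) / (2 * pi)" for N
    by (simp add: field_simps)
  then show sm: "(\<lambda>k. (cmod (fcoeff u k))\<^sup>2) summable_on UNIV"
    by (intro int_summable_bounded(1)) auto
  obtain v where v: "sq_int circ v" "\<And>k. fcoeff v k = fcoeff u k"
    "(\<lambda>N. \<integral>x. (psum (fcoeff u) N x - v x)\<^sup>2 \<partial>circ) \<longlonglongrightarrow> 0"
    using Riesz_Fischer[OF h sm] by blast
  have AE: "AE x in circ. u x - v x = 0"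
    by (rule fourier_uniqueness) (use v(2) in \<open>auto simp: fcoeff_diff i u v(1)\<close>)
  have "(\<integral>x. (psum (fcoeff u) N x - v x)\<^sup>2 \<partial>circ) = (\<integral>x. (psum (fcoeff u) N x - u x)\<^sup>2 \<partial>circ)" for N
  proof (rule integral_cong_AE)
    show "AE x in circ. (psum (fcoeff u) N x - v x)\<^sup>2 = (psum (fcoeff u) N x - u x)\<^sup>2"
      using AE by eventually_elim auto
  qed (use u v(1) in measurable)
  with v(3) show L: "(\<lambda>N. \<integral>x. (psum (fcoeff u) N x - u x)\<^sup>2 \<partial>circ) \<longlonglongrightarrow> 0" by simp
  have "(\<lambda>N. (\<integral>x. (u x)\<^sup>2 \<partial>circ) - 2 * pi * (\<Sum>k\<in>{- int N..int N}. (cmod (fcoeff u k))\<^sup>2)) \<longlonglongrightarrow> 0"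
    using L by (simp add: Bessel_equality[OF u, symmetric] power2_commute)
  moreover have "(\<lambda>N. (\<integral>x. (u x)\<^sup>2 \<partial>circ) - 2 * pi * (\<Sum>k\<in>{- int N..int N}. (cmod (fcoeff u k))\<^sup>2))
      \<longlonglongrightarrow> (\<integral>x. (u x)\<^sup>2 \<partial>circ) - 2 * pi * (\<Sum>\<^sub>\<infinity>k. (cmod (fcoeff u k))\<^sup>2)"
    by (intro tendsto_intros int_interval_sums_limit sm)
  ultimately show "(\<integral>x. (u x)\<^sup>2 \<partial>circ) = 2 * pi * (\<Sum>\<^sub>\<infinity>k. (cmod (fcoeff u k))\<^sup>2)"
    using LIMSEQ_unique by fastforce
qed

section \<open>Embedding into \<open>L\<^sup>4\<close> and compactness\<close>

text \<open>The Japanese bracket with the exponent counted on its square; the weight in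
  \<open>Hper s\<close> is \<open>jb s\<close>.\<close>

definition jb :: "real \<Rightarrow> int \<Rightarrow> real" where "jb t k = (1 + (of_int k)\<^sup>2) powr t"

lemma jb_pos: "jb t k > 0"
proof -
  have "1 + (real_of_int k)\<^sup>2 > 0" by (simp add: add_pos_nonneg)
  then show ?thesis by (simp add: jb_def)
qed

lemma jb_minus: "jb (- t) k = inverse (jb t k)"
  by (simp add: jb_def powr_minus)

lemma jb_add: "jb (s + t) k = jb s k * jb t k"
  by (simp add: jb_def powr_add)

lemma jb_ge_1: "t \<ge> 0 \<Longrightarrow> jb t k \<ge> 1"
  unfolding jb_def by (intro ge_one_powr_ge_zero) auto

lemma sum_int_interval:
  fixes f :: "int \<Rightarrow> 'a::comm_monoid_add"
  shows "(\<Sum>k\<in>{- int N..int N}. f k) = f 0 + (\<Sum>n\<in>{1..N}. f (int n) + f (- int n))"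
proof (induction N)
  case (Suc N)
  have "{- int (Suc N)..int (Suc N)} = insert (int (Suc N)) (insert (- int (Suc N)) {- int N..int N})" by auto
  then have "(\<Sum>k\<in>{- int (Suc N)..int (Suc N)}. f k) = f (int (Suc N)) + (f (- int (Suc N)) + (\<Sum>k\<in>{- int N..int N}. f k))"
    by (simp del: of_nat_Suc)
  then show ?case unfolding Suc by (simp add: ac_simps)
qed simp

lemma jb_summable:
  assumes "t > 1/2"
  shows "jb (- t) summable_on UNIV"
proof (rule int_summable_bounded(1))
  have s: "summable (\<lambda>n. real n powr (- 2 * t))" using assms by (simp add: summable_real_powr_iff)
  show "(\<Sum>k\<in>{- int N..int N}. jb (- t) k) \<le> 1 + 2 * (\<Sum>n. real n powr (- 2 * t))" for N
  proof -
    have "jb (- t) (int n) + jb (- t) (- int n) \<le> 2 * real n powr (- 2 * t)" if "n \<in> {1..N}" for n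
    proof -
      have "(1 + (real n)\<^sup>2) powr (- t) \<le> ((real n)\<^sup>2) powr (- t)"
        by (rule powr_mono2') (use that assms in auto)
      also have "\<dots> = real n powr (- 2 * t)"
      proof -
        have "(real n)\<^sup>2 = real n powr 2" using that by simp
        then show ?thesis by (simp only: powr_powr) simp
      qed
      finally show ?thesis by (simp add: jb_def)
    qed
    then have "(\<Sum>n\<in>{1..N}. jb (- t) (int n) + jb (- t) (- int n)) \<le> (\<Sum>n\<in>{1..N}. 2 * real n powr (- 2 * t))"
      by (rule sum_mono)
    also have "\<dots> = 2 * (\<Sum>n\<in>{1..N}. real n powr (- 2 * t))" by (simp add: sum_distrib_left)
    also have "(\<Sum>n\<in>{1..N}. real n powr (- 2 * t)) \<le> (\<Sum>n. real n powr (- 2 * t))"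
      by (rule sum_le_suminf[OF s]) auto
    finally show ?thesis unfolding sum_int_interval by (simp add: jb_def)
  qed
qed (simp add: jb_def)

definition jbsum :: "real \<Rightarrow> real" where "jbsum t = infsum (jb (- t)) UNIV"

lemma jb_sum_le:
  assumes "t > 1/2" "finite F" shows "(\<Sum>k\<in>F. jb (- t) k) \<le> jbsum t"
  unfolding jbsum_def by (rule finite_sum_le_infsum[OF jb_summable[OF assms(1)]])
    (use assms in \<open>auto simp: jb_def\<close>)

lemma jbsum_nonneg: "jbsum t \<ge> 0"
  unfolding jbsum_def by (rule infsum_nonneg) (simp add: jb_def)

text \<open>The squared modulus is again a trigonometric polynomial, with the autocorrelation of
  \<open>a\<close> as coefficients and the differences of elements of \<open>F\<close> as
  frequencies. An L^4 norm thereby becomes an L^2 norm.\<close>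

lemma trigp_mult_cnj:
  assumes F: "finite F"
  shows "complex_of_real ((cmod (trigp a F x))\<^sup>2)
    = trigp (\<lambda>n. \<Sum>k\<in>F. a k * (if k - n \<in> F then cnj (a (k - n)) else 0)) ((\<lambda>(k, l). k - l) ` (F \<times> F)) x"
    (is "_ = trigp ?c ?G x")
proof -
  have fG: "finite ?G" using F by simp
  have in1: "(\<Sum>n\<in>?G. (if k - n \<in> F then cnj (a (k - n)) else 0) * cis (of_int n * x)) = (\<Sum>l\<in>F. cnj (a l) * cis (of_int (k - l) * x))"
    if "k \<in> F" for k
  proof -
    have "(\<Sum>l\<in>F. cnj (a l) * cis (of_int (k - l) * x)) = (\<Sum>n\<in>(\<lambda>l. k - l) ` F. cnj (a (k - n)) * cis (of_int n * x))"
      by (subst sum.reindex) (auto simp: inj_on_def)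
    also have "\<dots> = (\<Sum>n\<in>?G. (if k - n \<in> F then cnj (a (k - n)) else 0) * cis (of_int n * x))"
    proof (rule sum.mono_neutral_cong_left[OF fG])
      show "(\<lambda>l. k - l) ` F \<subseteq> ?G" using that by auto
      show "\<forall>i\<in>?G - (\<lambda>l. k - l) ` F. (if k - i \<in> F then cnj (a (k - i)) else 0) * cis (of_int i * x) = 0"
        by (auto simp: image_iff) (metis diff_diff_eq2 add_diff_cancel_left')
    qed auto
    finally show ?thesis ..
  qed
  have "trigp ?c ?G x = (\<Sum>n\<in>?G. \<Sum>k\<in>F. a k * ((if k - n \<in> F then cnj (a (k - n)) else 0) * cis (of_int n * x)))"
    unfolding trigp_def sum_distrib_right mult.assoc ..
  also have "\<dots> = (\<Sum>k\<in>F. \<Sum>n\<in>?G. a k * ((if k - n \<in> F then cnj (a (k - n)) else 0) * cis (of_int n * x)))"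
    by (rule sum.swap)
  also have "\<dots> = (\<Sum>k\<in>F. a k * (\<Sum>l\<in>F. cnj (a l) * cis (of_int (k - l) * x)))"
    by (intro sum.cong refl) (simp only: sum_distrib_left[symmetric] in1)
  also have "\<dots> = (\<Sum>k\<in>F. \<Sum>l\<in>F. (a k * cis (of_int k * x)) * cnj (a l * cis (of_int l * x)))"
    unfolding sum_distrib_left by (intro sum.cong refl) (simp add: cis_cnj cis_mult left_diff_distrib mult_ac right_diff_distrib)
  also have "\<dots> = trigp a F x * cnj (trigp a F x)"
    unfolding trigp_def cnj_sum sum_product ..
  also have "\<dots> = complex_of_real ((cmod (trigp a F x))\<^sup>2)"
    using complex_norm_square[of "trigp a F x"] by simp
  finally show ?thesis ..
qed

text \<open>By the weighted Cauchy-Schwarz inequality, the coefficients \<open>c n\<close> of \<open>|u|\<^sup>2\<close> satisfy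
  \<open>|c n|\<^sup>2 \<le> (\<Sum> w k w (k-n) |a k|\<^sup>2 |a (k-n)|\<^sup>2) (\<Sum> 1 / (w k w (k-n)))\<close>, and the last sum is bounded
  independently of \<open>n\<close> precisely when \<open>\<Sum> w\<^sup>-\<^sup>2\<close> converges.\<close>

lemma integral_trigp_fourth:
  assumes F: "finite F" and t: "t > 1/2"
  shows "(\<integral>x. (cmod (trigp a F x)) ^ 4 \<partial>circ) \<le> 2 * pi * jbsum t * (\<Sum>k\<in>F. jb (t/2) k * (cmod (a k))\<^sup>2)\<^sup>2"
proof -
  let ?b = "\<lambda>l. if l \<in> F then a l else 0"
  let ?c = "\<lambda>n. \<Sum>k\<in>F. a k * (if k - n \<in> F then cnj (a (k - n)) else 0)"
  define G where "G = (\<lambda>(k, l). k - l) ` (F \<times> F)"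
  let ?w = "jb (t/2)"
  define h where "h l = ?w l * (cmod (?b l))\<^sup>2" for l
  have fG: "finite G" using F by (simp add: G_def)
  have h0: "h l \<ge> 0" for l by (simp add: h_def less_imp_le[OF jb_pos])
  have eq: "(cmod (trigp a F x)) ^ 4 = (cmod (trigp ?c G x))\<^sup>2" for x
    unfolding G_def trigp_mult_cnj[OF F, symmetric] norm_of_real by simp
  have c: "(cmod (?c n))\<^sup>2 \<le> jbsum t * (\<Sum>k\<in>F. h k * h (k - n))" for n
  proof -
    define A where "A k = sqrt (h k * h (k - n))" for k
    define B where "B k = 1 / sqrt (?w k * ?w (k - n))" for k
    have "cmod (?c n) \<le> (\<Sum>k\<in>F. A k * B k)"
    proof (rule sum_norm_le)
      fix k assume "k \<in> F"
      have "A k * B k = cmod (a k) * cmod (?b (k - n))"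
        using \<open>k \<in> F\<close> jb_pos[of "t/2" k] jb_pos[of "t/2" "k - n"]
        by (simp add: A_def B_def h_def real_sqrt_mult)
      then show "cmod (a k * (if k - n \<in> F then cnj (a (k - n)) else 0)) \<le> A k * B k"
        by (simp add: norm_mult)
    qed
    then have "(cmod (?c n))\<^sup>2 \<le> (\<Sum>k\<in>F. A k * B k)\<^sup>2" by (intro power_mono) auto
    also have "\<dots> \<le> (\<Sum>k\<in>F. (A k)\<^sup>2) * (\<Sum>k\<in>F. (B k)\<^sup>2)" by (rule Cauchy_Schwarz_ineq_sum)
    also have "(\<Sum>k\<in>F. (A k)\<^sup>2) = (\<Sum>k\<in>F. h k * h (k - n))" using h0 by (simp add: A_def)
    also have "(\<Sum>k\<in>F. (B k)\<^sup>2) \<le> jbsum t"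
    proof -
      \<comment> \<open>The arithmetic-geometric mean inequality separates the two weights; each
        resulting sum is a sum of \<open>jb (- t)\<close> over a finite set, whatever the shift
        \<open>n\<close>.\<close>
      have "(B k)\<^sup>2 \<le> jb (- t) k / 2 + jb (- t) (k - n) / 2" for k
      proof -
        define p where "p = inverse (?w k)"
        define q where "q = inverse (?w (k - n))"
        have "jb (- t) k = p\<^sup>2" "jb (- t) (k - n) = q\<^sup>2"
          using jb_add[of "t/2" "t/2"] by (simp_all add: jb_minus p_def q_def power2_eq_square)
        moreover have "(B k)\<^sup>2 = p * q"
          using jb_pos[of "t/2"] by (simp add: B_def p_def q_def power_divide field_simps less_imp_le)
        ultimately show ?thesis using sum_squares_bound[of p q] by simp
      qed
      then have "(\<Sum>k\<in>F. (B k)\<^sup>2) \<le> (\<Sum>k\<in>F. jb (- t) k / 2 + jb (- t) (k - n) / 2)" by (rule sum_mono)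
      also have "\<dots> = (\<Sum>k\<in>F. jb (- t) k) / 2 + (\<Sum>k\<in>(\<lambda>k. k - n) ` F. jb (- t) k) / 2"
        by (subst sum.reindex) (auto simp: sum.distrib sum_divide_distrib inj_on_def)
      also have "\<dots> \<le> jbsum t" using jb_sum_le[OF t F] jb_sum_le[OF t finite_imageI[OF F]] by (smt (verit) field_sum_of_halves)
      finally show ?thesis .
    qed
    finally show ?thesis using h0 by (simp add: mult_left_mono sum_nonneg mult.commute[of "jbsum t"])
  qed
  \<comment> \<open>For fixed \<open>k\<close> the map from \<open>n\<close> to \<open>k - n\<close>
    is injective, so each term \<open>h l\<close> occurs at most once.\<close>
  have hs: "(\<Sum>n\<in>G. h (k - n)) \<le> (\<Sum>l\<in>F. h l)" for k
  proof -
    have "(\<Sum>n\<in>G. h (k - n)) = (\<Sum>l\<in>(\<lambda>n. k - n) ` G. h l)" by (subst sum.reindex) (auto simp: inj_on_def)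
    also have "\<dots> = (\<Sum>l\<in>((\<lambda>n. k - n) ` G) \<inter> F. h l)"
      by (rule sum.mono_neutral_right) (use fG in \<open>auto simp: h_def\<close>)
    also have "\<dots> \<le> (\<Sum>l\<in>F. h l)" by (rule sum_mono2) (use F h0 in auto)
    finally show ?thesis .
  qed
  have "(\<integral>x. (cmod (trigp a F x)) ^ 4 \<partial>circ) = 2 * pi * (\<Sum>n\<in>G. (cmod (?c n))\<^sup>2)"
    unfolding eq by (rule integral_cmod_trigp[OF fG])
  also have "(\<Sum>n\<in>G. (cmod (?c n))\<^sup>2) \<le> (\<Sum>n\<in>G. jbsum t * (\<Sum>k\<in>F. h k * h (k - n)))"
    by (rule sum_mono) (rule c)
  also have "\<dots> = jbsum t * (\<Sum>k\<in>F. h k * (\<Sum>n\<in>G. h (k - n)))"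
    unfolding sum_distrib_left[symmetric] by (subst sum.swap) (simp only: sum_distrib_left)
  also have "\<dots> \<le> jbsum t * (\<Sum>k\<in>F. h k * (\<Sum>l\<in>F. h l))"
    by (intro mult_left_mono sum_mono hs h0 jbsum_nonneg)
  also have "(\<Sum>k\<in>F. h k * (\<Sum>l\<in>F. h l)) = (\<Sum>k\<in>F. jb (t/2) k * (cmod (a k))\<^sup>2)\<^sup>2"
    by (simp add: sum_distrib_right[symmetric] power2_eq_square h_def)
  finally show ?thesis by (simp add: mult.assoc)
qed

lemma L2_limit_AE_subseq:
  assumes fin: "finite_measure M" and u: "\<And>n. sq_int M (u n)" and v: "sq_int M v"
    and lim: "(\<lambda>n. \<integral>x. (u n x - v x)\<^sup>2 \<partial>M) \<longlonglongrightarrow> 0"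
  obtains r where "strict_mono r" "AE x in M. (\<lambda>n. u (r n) x) \<longlonglongrightarrow> v x"
proof -
  interpret finite_measure M by fact
  have d: "sq_int M (\<lambda>x. u n x - v x)" for n by (rule sq_int_diff[OF u v])
  have d': "sq_int M (\<lambda>x. \<bar>u n x - v x\<bar>)" for n using d[of n] borel_measurable_abs[of "\<lambda>x. u n x - v x" M] unfolding sq_int_def by simp
  have one: "sq_int M (\<lambda>_. 1)" by (rule sq_int_bounded[OF fin]) auto
  have "norm (\<integral>x. \<bar>u n x - v x\<bar> \<partial>M) \<le> sqrt (\<integral>x. (u n x - v x)\<^sup>2 \<partial>M) * sqrt (measure M (space M))" for n
    using Cauchy_Schwarz_integral_abs[OF d' one, of n] by simp
  note le = this
  have "(\<lambda>n. sqrt (\<integral>x. (u n x - v x)\<^sup>2 \<partial>M) * sqrt (measure M (space M))) \<longlonglongrightarrow> sqrt 0 * sqrt (measure M (space M))"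
    by (intro tendsto_intros lim)
  then have "(\<lambda>n. \<integral>x. \<bar>u n x - v x\<bar> \<partial>M) \<longlonglongrightarrow> 0"
    by (intro Lim_null_comparison[OF always_eventually[OF allI[OF le]]]) simp
  then have "(\<lambda>n. \<integral>x. norm (u n x - v x) \<partial>M) \<longlonglongrightarrow> 0" by simp
  from tendsto_L1_AE_subseq[OF sq_int_integrable[OF fin d] this]
  obtain r where "strict_mono r" "AE x in M. (\<lambda>n. u (r n) x - v x) \<longlonglongrightarrow> 0" by blast
  then show thesis by (intro that[of r]) (auto simp: LIM_zero_iff)
qed

text \<open>The index is the order of the operator, so this is the Sobolev space of order
  \<open>t / 2\<close>, stated on one period only; periodicity and measurability on the line are
  added in \<open>H0\<close>.\<close>

definition Hs :: "real \<Rightarrow> (real \<Rightarrow> real) \<Rightarrow> bool" where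
  "Hs t u \<longleftrightarrow> sq_int circ u \<and> (\<lambda>k. jb (t/2) k * (cmod (fcoeff u k))\<^sup>2) summable_on UNIV"

definition en :: "real \<Rightarrow> (real \<Rightarrow> real) \<Rightarrow> real" where
  "en t u = (\<Sum>\<^sub>\<infinity>k. jb (t/2) k * (cmod (fcoeff u k))\<^sup>2)"

lemma Hs_sq_int: "Hs t u \<Longrightarrow> sq_int circ u" by (simp add: Hs_def)

lemma Hs_integrable: "Hs t u \<Longrightarrow> integrable circ u"
  by (rule sq_int_integrable[OF finite_measure_circ Hs_sq_int])

lemma en_term_nonneg: "0 \<le> jb t k * (cmod z)\<^sup>2"
  by (simp add: less_imp_le[OF jb_pos])

lemma en_sum_le:
  assumes "Hs t u" "finite F"
  shows "(\<Sum>k\<in>F. jb (t/2) k * (cmod (fcoeff u k))\<^sup>2) \<le> en t u"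
  unfolding en_def by (rule finite_sum_le_infsum) (use assms en_term_nonneg in \<open>auto simp: Hs_def\<close>)

lemma en_nonneg: "0 \<le> en t u"
  unfolding en_def by (intro infsum_nonneg en_term_nonneg)

text \<open>The bound for trigonometric polynomials is uniform over the partial sums of
  \<open>u\<close>, and Fatou carries it over along a subsequence converging almost
  everywhere.\<close>

theorem Sobolev_L4:
  assumes u: "Hs t u" and t: "t > 1/2"
  shows "integrable circ (\<lambda>x. u x ^ 4)" "(\<integral>x. u x ^ 4 \<partial>circ) \<le> 2 * pi * jbsum t * (en t u)\<^sup>2"
proof -
  let ?p = "psum (fcoeff u)"
  have s: "sq_int circ u" using u by (rule Hs_sq_int)
  have h: "herm (fcoeff u)" by (rule herm_fcoeff[OF Hs_integrable[OF u]])
  obtain r where r: "strict_mono r" "AE x in circ. (\<lambda>n. ?p (r n) x) \<longlonglongrightarrow> u x"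
    using L2_limit_AE_subseq[where u = ?p, OF finite_measure_circ sq_int_psum s psum_fcoeff_tendsto[OF s]] by blast
  have int: "integrable circ (\<lambda>x. ?p (r n) x ^ 4)" for n
    by (intro integrable_circ_continuous continuous_intros continuous_on_psum)
  have lim: "AE x in circ. (\<lambda>n. ?p (r n) x ^ 4) \<longlonglongrightarrow> u x ^ 4"
    using r(2) by eventually_elim (intro tendsto_intros)
  have "(\<integral>x. ?p N x ^ 4 \<partial>circ) \<le> 2 * pi * jbsum t * (en t u)\<^sup>2" for N
  proof -
    let ?F = "{- int N..int N}"
    have "(?p N x) ^ 4 = (cmod (trigp (fcoeff u) ?F x)) ^ 4" for x
      unfolding of_real_psum[OF h, symmetric] by simp
    then have "(\<integral>x. ?p N x ^ 4 \<partial>circ) \<le> 2 * pi * jbsum t * (\<Sum>k\<in>?F. jb (t/2) k * (cmod (fcoeff u k))\<^sup>2)\<^sup>2"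
      using integral_trigp_fourth[of ?F t "fcoeff u"] t by simp
    also have "\<dots> \<le> 2 * pi * jbsum t * (en t u)\<^sup>2"
      using en_sum_le[OF u, of ?F] by (intro mult_left_mono power_mono sum_nonneg en_term_nonneg) (auto simp: jbsum_nonneg)
    finally show ?thesis .
  qed
  note le = this
  have m: "(\<lambda>x. u x ^ 4) \<in> borel_measurable circ" using s by measurable
  show "integrable circ (\<lambda>x. u x ^ 4)" "(\<integral>x. u x ^ 4 \<partial>circ) \<le> 2 * pi * jbsum t * (en t u)\<^sup>2"
    by (rule Fatou_integral[OF int _ lim m le], simp)+
qed

lemma Hs_diff:
  assumes u: "Hs t u" and v: "Hs t v"
  shows "Hs t (\<lambda>x. u x - v x)" "en t (\<lambda>x. u x - v x) \<le> 2 * (en t u + en t v)"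
proof -
  have f: "fcoeff (\<lambda>x. u x - v x) k = fcoeff u k - fcoeff v k" for k
    by (rule fcoeff_diff[OF Hs_integrable[OF u] Hs_integrable[OF v]])
  have "jb (t/2) k * (cmod (fcoeff u k - fcoeff v k))\<^sup>2 \<le> 2 * (jb (t/2) k * (cmod (fcoeff u k))\<^sup>2) + 2 * (jb (t/2) k * (cmod (fcoeff v k))\<^sup>2)" for k
  proof -
    have "(cmod (fcoeff u k - fcoeff v k))\<^sup>2 \<le> (cmod (fcoeff u k) + cmod (fcoeff v k))\<^sup>2"
      by (intro power_mono norm_triangle_ineq4) auto
    also have "\<dots> \<le> 2 * (cmod (fcoeff u k))\<^sup>2 + 2 * (cmod (fcoeff v k))\<^sup>2"
      using sum_squares_bound[of "cmod (fcoeff u k)" "cmod (fcoeff v k)"] by (simp add: power2_sum)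
    finally have "jb (t/2) k * (cmod (fcoeff u k - fcoeff v k))\<^sup>2 \<le> jb (t/2) k * (2 * (cmod (fcoeff u k))\<^sup>2 + 2 * (cmod (fcoeff v k))\<^sup>2)"
      by (rule mult_left_mono) (rule less_imp_le[OF jb_pos])
    then show ?thesis by (simp add: distrib_left mult.left_commute[of _ 2])
  qed
  note le = this
  have b: "(\<Sum>k\<in>{- int N..int N}. jb (t/2) k * (cmod (fcoeff (\<lambda>x. u x - v x) k))\<^sup>2) \<le> 2 * (en t u + en t v)" for N
  proof -
    let ?F = "{- int N..int N}"
    have "(\<Sum>k\<in>?F. jb (t/2) k * (cmod (fcoeff (\<lambda>x. u x - v x) k))\<^sup>2)
      \<le> (\<Sum>k\<in>?F. 2 * (jb (t/2) k * (cmod (fcoeff u k))\<^sup>2) + 2 * (jb (t/2) k * (cmod (fcoeff v k))\<^sup>2))"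
      unfolding f by (rule sum_mono) (rule le)
    also have "\<dots> = 2 * (\<Sum>k\<in>?F. jb (t/2) k * (cmod (fcoeff u k))\<^sup>2) + 2 * (\<Sum>k\<in>?F. jb (t/2) k * (cmod (fcoeff v k))\<^sup>2)"
      by (simp only: sum.distrib sum_distrib_left)
    also have "\<dots> \<le> 2 * (en t u + en t v)"
      using en_sum_le[OF u, of ?F] en_sum_le[OF v, of ?F] by simp
    finally show ?thesis .
  qed
  note S = int_summable_bounded[where f = "\<lambda>k. jb (t/2) k * (cmod (fcoeff (\<lambda>x. u x - v x) k))\<^sup>2", OF en_term_nonneg b]
  show "Hs t (\<lambda>x. u x - v x)"
    using sq_int_diff[OF Hs_sq_int[OF u] Hs_sq_int[OF v]] S(1) by (simp add: Hs_def)
  show "en t (\<lambda>x. u x - v x) \<le> 2 * (en t u + en t v)" unfolding en_def[of t "\<lambda>x. u x - v x"] by (rule S(2))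
qed

text \<open>The second claim splits the energy at frequency \<open>N\<close>: low modes are kept,
  and on high modes the weaker weight gains a factor that tends to zero with \<open>N\<close> when
  \<open>s < t\<close>. This is the quantitative form of compactness.\<close>

lemma Hs_mono:
  assumes u: "Hs t u" and st: "s \<le> t"
  shows "Hs s u"
    "en s u \<le> (\<Sum>k\<in>{- int N..int N}. jb (s/2) k * (cmod (fcoeff u k))\<^sup>2) + (1 + (real N)\<^sup>2) powr (- (t - s) / 2) * en t u"
proof -
  let ?d = "(1 + (real N)\<^sup>2) powr (- (t - s) / 2)"
  have le: "jb (s/2) k * (cmod z)\<^sup>2 \<le> (if \<bar>k\<bar> \<le> int N then jb (s/2) k * (cmod z)\<^sup>2 else 0) + ?d * (jb (t/2) k * (cmod z)\<^sup>2)" for k z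
  proof (cases "\<bar>k\<bar> \<le> int N")
    case False
    then have "real N \<le> \<bar>of_int k\<bar>" by linarith
    then have "(real N)\<^sup>2 \<le> \<bar>of_int k\<bar>\<^sup>2" by (rule power_mono) simp
    then have "(1 + (of_int k)\<^sup>2) powr (- (t - s) / 2) \<le> ?d"
      using st by (intro powr_mono2') (auto intro: add_pos_nonneg)
    then have "jb (- (t - s) / 2) k * jb (t/2) k \<le> ?d * jb (t/2) k"
      unfolding jb_def[of "- (t - s) / 2"] by (rule mult_right_mono) (rule less_imp_le[OF jb_pos])
    moreover have "- (t - s) / 2 + t / 2 = s / 2" by (simp add: field_simps)
    then have "jb (- (t - s) / 2) k * jb (t/2) k = jb (s/2) k"
      by (simp only: jb_add[symmetric])
    ultimately have "jb (s/2) k \<le> ?d * jb (t/2) k" by (simp only:)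
    from mult_right_mono[OF this, of "(cmod z)\<^sup>2"] False show ?thesis by (simp add: mult.assoc)
  qed (use jb_pos[of "t/2" k] in simp)
  have b: "(\<Sum>k\<in>{- int K..int K}. jb (s/2) k * (cmod (fcoeff u k))\<^sup>2)
      \<le> (\<Sum>k\<in>{- int N..int N}. jb (s/2) k * (cmod (fcoeff u k))\<^sup>2) + ?d * en t u" for K
  proof -
    have "(\<Sum>k\<in>{- int K..int K}. jb (s/2) k * (cmod (fcoeff u k))\<^sup>2)
      \<le> (\<Sum>k\<in>{- int K..int K}. (if \<bar>k\<bar> \<le> int N then jb (s/2) k * (cmod (fcoeff u k))\<^sup>2 else 0) + ?d * (jb (t/2) k * (cmod (fcoeff u k))\<^sup>2))"
      by (rule sum_mono) (rule le)
    also have "\<dots> = (\<Sum>k\<in>{- int K..int K}. if \<bar>k\<bar> \<le> int N then jb (s/2) k * (cmod (fcoeff u k))\<^sup>2 else 0)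
        + ?d * (\<Sum>k\<in>{- int K..int K}. jb (t/2) k * (cmod (fcoeff u k))\<^sup>2)"
      by (simp only: sum.distrib sum_distrib_left)
    also have "(\<Sum>k\<in>{- int K..int K}. if \<bar>k\<bar> \<le> int N then jb (s/2) k * (cmod (fcoeff u k))\<^sup>2 else 0)
      = (\<Sum>k\<in>{- int K..int K} \<inter> {- int N..int N}. jb (s/2) k * (cmod (fcoeff u k))\<^sup>2)"
      by (rule sum.mono_neutral_cong_right) auto
    also have "\<dots> \<le> (\<Sum>k\<in>{- int N..int N}. jb (s/2) k * (cmod (fcoeff u k))\<^sup>2)"
      by (rule sum_mono2) (auto simp: en_term_nonneg)
    also have "?d * (\<Sum>k\<in>{- int K..int K}. jb (t/2) k * (cmod (fcoeff u k))\<^sup>2) \<le> ?d * en t u"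
      by (intro mult_left_mono en_sum_le[OF u]) auto
    finally show ?thesis by simp
  qed
  note S = int_summable_bounded[where f = "\<lambda>k. jb (s/2) k * (cmod (fcoeff u k))\<^sup>2", OF en_term_nonneg b]
  show "Hs s u" using Hs_sq_int[OF u] S(1) by (simp add: Hs_def)
  show "en s u \<le> (\<Sum>k\<in>{- int N..int N}. jb (s/2) k * (cmod (fcoeff u k))\<^sup>2) + ?d * en t u"
    unfolding en_def[of s u] by (rule S(2))
qed

lemma integral_sq_le_en:
  assumes u: "Hs t u" and t: "t \<ge> 0"
  shows "(\<integral>x. (u x)\<^sup>2 \<partial>circ) \<le> 2 * pi * en t u"
proof -
  have "(\<Sum>\<^sub>\<infinity>k. (cmod (fcoeff u k))\<^sup>2) \<le> en t u"
    unfolding en_def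
  proof (rule infsum_mono)
    show "(\<lambda>k. (cmod (fcoeff u k))\<^sup>2) summable_on UNIV" by (rule Parseval_summable[OF Hs_sq_int[OF u]])
    show "(\<lambda>k. jb (t/2) k * (cmod (fcoeff u k))\<^sup>2) summable_on UNIV" using u by (simp add: Hs_def)
    show "(cmod (fcoeff u k))\<^sup>2 \<le> jb (t/2) k * (cmod (fcoeff u k))\<^sup>2" for k
      using mult_right_mono[OF jb_ge_1[of "t/2" k], of "(cmod (fcoeff u k))\<^sup>2"] t by simp
  qed
  then show ?thesis by (simp add: Parseval[OF Hs_sq_int[OF u]])
qed

section \<open>Compactness of the embedding\<close>

lemma bounded_sequences_diagonal:
  fixes a :: "nat \<Rightarrow> int \<Rightarrow> complex"
  assumes B: "\<And>k n. cmod (a k n) \<le> B"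
  obtains r where "strict_mono r" "\<And>n. convergent (\<lambda>k. a (r k) n)"
proof -
  interpret subseqs "\<lambda>n s. convergent (\<lambda>k. a (s k) (from_nat n))"
  proof
    fix n s assume "strict_mono (s :: nat \<Rightarrow> nat)"
    have "bounded (range (\<lambda>k. a (s k) (from_nat n)))" using B by (auto simp: bounded_iff)
    from bounded_imp_convergent_subsequence[OF this]
    show "\<exists>r'. strict_mono r' \<and> convergent (\<lambda>k. a ((s \<circ> r') k) (from_nat n))"
      by (auto simp: convergent_def o_def)
  qed
  have "convergent (\<lambda>k. a (diagseq k) n)" for n
  proof -
    have "convergent (\<lambda>k. a ((diagseq \<circ> (+) (Suc (to_nat n))) k) (from_nat (to_nat n)))"
    proof (rule diagseq_holds)
      fix r s :: "nat \<Rightarrow> nat" and m assume "strict_mono r" "convergent (\<lambda>k. a (s k) (from_nat m))"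
      from convergent_subseq_convergent[OF this(2,1)]
      show "convergent (\<lambda>k. a ((s \<circ> r) k) (from_nat m))" by (simp add: o_def)
    qed
    then have "convergent (\<lambda>k. a (diagseq (k + Suc (to_nat n))) n)" by (simp add: o_def add.commute)
    then show ?thesis using convergent_ignore_initial_segment[of "\<lambda>k. a (diagseq k) n" "Suc (to_nat n)"] by (simp only:)
  qed
  with subseq_diagseq show thesis by (rule that)
qed

text \<open>High modes are uniformly small by \<open>Hs_mono\<close>, finitely many low modes
  converge. The constant \<open>4 * B\<close> bounds the energy of a difference, by
  \<open>Hs_diff\<close>.\<close>

lemma en_Cauchy:
  assumes st: "s < t" and u: "\<And>k. Hs t (u k)" and B: "\<And>k. en t (u k) \<le> B"
    and conv: "\<And>n. convergent (\<lambda>k. fcoeff (u k) n)" and e: "e > 0"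
  shows "\<exists>N. \<forall>m\<ge>N. \<forall>n\<ge>N. en s (\<lambda>x. u m x - u n x) < e"
proof -
  have "(\<lambda>N. (1 + (real N)\<^sup>2) powr (- (t - s) / 2)) \<longlonglongrightarrow> 0"
  proof (rule tendsto_neg_powr)
    show "- (t - s) / 2 < 0" using st by simp
    show "filterlim (\<lambda>N. 1 + (real N)\<^sup>2) at_top sequentially"
    proof (rule filterlim_at_top_mono[OF filterlim_real_sequentially], rule always_eventually, rule allI)
      fix N show "real N \<le> 1 + (real N)\<^sup>2" using sum_squares_bound[of 1 "real N"] by simp
    qed
  qed
  then have "(\<lambda>N. (1 + (real N)\<^sup>2) powr (- (t - s) / 2) * (4 * B)) \<longlonglongrightarrow> 0 * (4 * B)"
    by (intro tendsto_intros)
  then have "\<forall>\<^sub>F N in sequentially. (1 + (real N)\<^sup>2) powr (- (t - s) / 2) * (4 * B) < e / 2"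
    using e by (intro order_tendstoD(2)) auto
  then obtain N where N: "(1 + (real N)\<^sup>2) powr (- (t - s) / 2) * (4 * B) < e / 2"
    by (auto simp: eventually_sequentially)
  define A where "A n = lim (\<lambda>k. fcoeff (u k) n)" for n
  have A: "(\<lambda>k. fcoeff (u k) n) \<longlonglongrightarrow> A n" for n
    using conv[of n] by (simp add: A_def convergent_LIMSEQ_iff)
  define D where "D m = (\<Sum>k\<in>{- int N..int N}. jb (s/2) k * (2 * (cmod (fcoeff (u m) k - A k))\<^sup>2))" for m
  have "D \<longlonglongrightarrow> (\<Sum>k\<in>{- int N..int N}. jb (s/2) k * (2 * (cmod (A k - A k))\<^sup>2))"
    unfolding D_def[abs_def] by (intro tendsto_intros A)
  then have "D \<longlonglongrightarrow> 0" by simp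
  then have "\<forall>\<^sub>F m in sequentially. D m < e / 4" using e by (intro order_tendstoD(2)) auto
  then obtain M where M: "\<And>m. m \<ge> M \<Longrightarrow> D m < e / 4" by (auto simp: eventually_sequentially)
  have "en s (\<lambda>x. u m x - u n x) < e" if mn: "m \<ge> M" "n \<ge> M" for m n
  proof -
    note d = Hs_diff[OF u u, of m n]
    have f: "fcoeff (\<lambda>x. u m x - u n x) k = fcoeff (u m) k - fcoeff (u n) k" for k
      by (rule fcoeff_diff[OF Hs_integrable[OF u] Hs_integrable[OF u]])
    have "(\<Sum>k\<in>{- int N..int N}. jb (s/2) k * (cmod (fcoeff (\<lambda>x. u m x - u n x) k))\<^sup>2) \<le> 
      (\<Sum>k\<in>{- int N..int N}. jb (s/2) k * (2 * (cmod (fcoeff (u m) k - A k))\<^sup>2) + jb (s/2) k * (2 * (cmod (fcoeff (u n) k - A k))\<^sup>2))"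
    proof (rule sum_mono)
      fix k
      let ?a = "fcoeff (u m) k - A k" and ?b = "fcoeff (u n) k - A k"
      have "cmod (?a - ?b) \<le> cmod ?a + cmod ?b" by (rule norm_triangle_ineq4)
      then have "(cmod (fcoeff (u m) k - fcoeff (u n) k))\<^sup>2 \<le> (cmod ?a + cmod ?b)\<^sup>2"
        by (intro power_mono) auto
      also have "\<dots> \<le> 2 * (cmod ?a)\<^sup>2 + 2 * (cmod ?b)\<^sup>2"
        using sum_squares_bound[of "cmod ?a" "cmod ?b"] by (simp add: power2_sum)
      finally have "jb (s/2) k * (cmod (fcoeff (u m) k - fcoeff (u n) k))\<^sup>2 \<le> jb (s/2) k * (2 * (cmod ?a)\<^sup>2 + 2 * (cmod ?b)\<^sup>2)"
        by (rule mult_left_mono) (rule less_imp_le[OF jb_pos])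
      then show "jb (s/2) k * (cmod (fcoeff (\<lambda>x. u m x - u n x) k))\<^sup>2
        \<le> jb (s/2) k * (2 * (cmod ?a)\<^sup>2) + jb (s/2) k * (2 * (cmod ?b)\<^sup>2)"
        unfolding f by (simp only: distrib_left)
    qed
    also have "\<dots> = D m + D n" by (simp only: sum.distrib D_def)
    finally have 1: "(\<Sum>k\<in>{- int N..int N}. jb (s/2) k * (cmod (fcoeff (\<lambda>x. u m x - u n x) k))\<^sup>2) \<le> D m + D n" .
    have "en t (\<lambda>x. u m x - u n x) \<le> 4 * B" using d(2) B[of m] B[of n] by simp
    then have "(1 + (real N)\<^sup>2) powr (- (t - s) / 2) * en t (\<lambda>x. u m x - u n x) \<le> (1 + (real N)\<^sup>2) powr (- (t - s) / 2) * (4 * B)"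
      by (rule mult_left_mono) simp
    then show ?thesis using Hs_mono(2)[OF d(1) less_imp_le[OF st], of N] 1 N M[OF mn(1)] M[OF mn(2)] by linarith
  qed
  then show ?thesis by blast
qed

theorem Rellich_L4:
  fixes u :: "nat \<Rightarrow> real \<Rightarrow> real"
  assumes t: "t > 1/2" and u: "\<And>k. Hs t (u k)" and B: "\<And>k. en t (u k) \<le> B"
  obtains r where "strict_mono r" "Hs t (plim (\<lambda>k. u (r k)))"
    "(\<lambda>k. \<integral>x. (u (r k) x - plim (\<lambda>k. u (r k)) x)\<^sup>2 \<partial>circ) \<longlonglongrightarrow> 0"
    "(\<lambda>k. \<integral>x. (u (r k) x - plim (\<lambda>k. u (r k)) x) ^ 4 \<partial>circ) \<longlonglongrightarrow> 0"
    "\<And>k. integrable circ (\<lambda>x. (u (r k) x - plim (\<lambda>k. u (r k)) x) ^ 4)"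
proof -
  have "cmod (fcoeff (u k) n) \<le> sqrt B" for k n
  proof (rule real_le_rsqrt)
    have "(cmod (fcoeff (u k) n))\<^sup>2 \<le> jb (t/2) n * (cmod (fcoeff (u k) n))\<^sup>2"
      using mult_right_mono[OF jb_ge_1[of "t/2" n], of "(cmod (fcoeff (u k) n))\<^sup>2"] t by simp
    also have "\<dots> \<le> B" using en_sum_le[OF u, of "{n}" k] B[of k] by simp
    finally show "(cmod (fcoeff (u k) n))\<^sup>2 \<le> B" .
  qed
  from bounded_sequences_diagonal[where a = "\<lambda>k. fcoeff (u k)", OF this]
  obtain r1 where r1: "strict_mono r1" "\<And>n. convergent (\<lambda>k. fcoeff (u (r1 k)) n)" by blast
  define w where "w k = u (r1 k)" for k
  \<comment> \<open>An order strictly between: below \<open>t\<close>, so that a subsequence is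
    Cauchy in the energy of order \<open>s\<close>, and above 1/2, so that this energy still
    controls the L^4 norm.\<close>
  define s where "s = (t + 1/2) / 2"
  have s: "s > 1/2" "s < t" using t by (auto simp: s_def)
  have w: "Hs t (w k)" for k by (simp add: w_def u)
  have ws: "Hs s (\<lambda>x. w m x - w n x)" for m n by (rule Hs_mono(1)[OF Hs_diff(1)[OF w w] less_imp_le[OF s(2)]])
  have C: "\<exists>N. \<forall>m\<ge>N. \<forall>n\<ge>N. en s (\<lambda>x. w m x - w n x) < e" if "e > 0" for e
    by (rule en_Cauchy[where t = t and u = w and B = B, OF s(2) w _ _ that]) (use B r1 in \<open>auto simp: w_def\<close>)
  have C2: "\<exists>N. \<forall>m\<ge>N. \<forall>n\<ge>N. (\<integral>x. (w m x - w n x)\<^sup>2 \<partial>circ) < e" if e: "e > 0" for e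
  proof -
    have "e / (2 * pi) > 0" using e by simp
    then obtain N where N: "\<forall>m\<ge>N. \<forall>n\<ge>N. en s (\<lambda>x. w m x - w n x) < e / (2 * pi)"
      using C by blast
    have "(\<integral>x. (w m x - w n x)\<^sup>2 \<partial>circ) < e" if "m \<ge> N" "n \<ge> N" for m n
    proof -
      have "(\<integral>x. (w m x - w n x)\<^sup>2 \<partial>circ) \<le> 2 * pi * en s (\<lambda>x. w m x - w n x)"
        using s by (intro integral_sq_le_en[OF ws]) auto
      also have "\<dots> < 2 * pi * (e / (2 * pi))" using N that by (intro mult_strict_left_mono) auto
      finally show ?thesis by simp
    qed
    then show ?thesis by blast
  qed
  have C4: "\<exists>N. \<forall>m\<ge>N. \<forall>n\<ge>N. (\<integral>x. (w m x - w n x) ^ 4 \<partial>circ) \<le> e" if e: "e > 0" for e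
  proof -
    \<comment> \<open>Solves \<open>2 * pi * (jbsum s + 1) * d^2 = e\<close>; the added 1 keeps the
      divisor positive.\<close>
    define d where "d = sqrt (e / (2 * pi * (jbsum s + 1)))"
    have J: "jbsum s + 1 > 0" using jbsum_nonneg[of s] by simp
    then have d: "d > 0" using e by (simp add: d_def)
    obtain N where N: "\<forall>m\<ge>N. \<forall>n\<ge>N. en s (\<lambda>x. w m x - w n x) < d"
      using C[OF d] by blast
    have "(\<integral>x. (w m x - w n x) ^ 4 \<partial>circ) \<le> e" if "m \<ge> N" "n \<ge> N" for m n
    proof -
      have "(\<integral>x. (w m x - w n x) ^ 4 \<partial>circ) \<le> 2 * pi * jbsum s * (en s (\<lambda>x. w m x - w n x))\<^sup>2"
        by (rule Sobolev_L4(2)[OF ws s(1)])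
      also have "\<dots> \<le> 2 * pi * (jbsum s + 1) * d\<^sup>2"
        using N that by (intro mult_mono power_mono en_nonneg) (auto simp: jbsum_nonneg less_imp_le)
      also have "\<dots> = e" using J e pi_gt_zero by (simp add: d_def less_imp_le)
      finally show ?thesis .
    qed
    then show ?thesis by blast
  qed
  obtain r2 where r2: "strict_mono r2" "AE x in circ. convergent (\<lambda>k. w (r2 k) x)"
    "sq_int circ (plim (\<lambda>k. w (r2 k)))" "(\<lambda>n. \<integral>x. (w n x - plim (\<lambda>k. w (r2 k)) x)\<^sup>2 \<partial>circ) \<longlonglongrightarrow> 0"
    by (rule sq_int_complete[where u = w, OF finite_measure_circ Hs_sq_int[OF w]]) (use C2 in blast)+
  let ?v = "plim (\<lambda>k. w (r2 k))"
  have meas: "w n \<in> borel_measurable circ" for n using Hs_sq_int[OF w] by measurable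
  have int4: "integrable circ (\<lambda>x. (w m x - w n x) ^ 4)" for m n by (rule Sobolev_L4(1)[OF ws s(1)])
  have F: "\<exists>N. \<forall>n\<ge>N. integrable circ (\<lambda>x. (w n x - ?v x) ^ 4) \<and> (\<integral>x. (w n x - ?v x) ^ 4 \<partial>circ) \<le> e" if e: "e > 0" for e
  proof -
    obtain N where "\<forall>m\<ge>N. \<forall>n\<ge>N. (\<integral>x. (w m x - w n x) ^ 4 \<partial>circ) \<le> e" using C4[OF e] by blast
    then have N: "\<And>m n. m \<ge> N \<Longrightarrow> n \<ge> N \<Longrightarrow> (\<integral>x. (w m x - w n x) ^ 4 \<partial>circ) \<le> e" by simp
    show ?thesis
      using plim_Fatou[OF r2(2,1) _ meas int4 N] by (intro exI[of _ N]) auto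
  qed
  \<comment> \<open>The energy of order \<open>t\<close> is only bounded along the sequence, so
    membership of the limit follows from convergence of each coefficient and the bound on finite
    sums.\<close>
  have v: "Hs t ?v"
  proof -
    have f: "(\<lambda>n. fcoeff (w n) k) \<longlonglongrightarrow> fcoeff ?v k" for k
      by (rule fcoeff_L2_limit[OF Hs_sq_int[OF w] r2(3,4)])
    have "(\<Sum>k\<in>{- int K..int K}. jb (t/2) k * (cmod (fcoeff ?v k))\<^sup>2) \<le> B" for K
    proof (rule LIMSEQ_le_const2)
      show "(\<lambda>n. \<Sum>k\<in>{- int K..int K}. jb (t/2) k * (cmod (fcoeff (w n) k))\<^sup>2) \<longlonglongrightarrow> (\<Sum>k\<in>{- int K..int K}. jb (t/2) k * (cmod (fcoeff ?v k))\<^sup>2)"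
        by (intro tendsto_intros f)
      have "(\<Sum>k\<in>{- int K..int K}. jb (t/2) k * (cmod (fcoeff (w n) k))\<^sup>2) \<le> B" for n
        using en_sum_le[OF w, of "{- int K..int K}" n] B[of "r1 n"] by (simp add: w_def)
      then show "\<exists>N. \<forall>n\<ge>N. (\<Sum>k\<in>{- int K..int K}. jb (t/2) k * (cmod (fcoeff (w n) k))\<^sup>2) \<le> B" by blast
    qed
    from int_summable_bounded(1)[where f = "\<lambda>k. jb (t/2) k * (cmod (fcoeff ?v k))\<^sup>2", OF en_term_nonneg this]
    show ?thesis using r2(3) by (simp add: Hs_def)
  qed
  have int4v: "integrable circ (\<lambda>x. (w n x - ?v x) ^ 4)" for n
    by (rule Sobolev_L4(1)[OF Hs_diff(1)[OF w v] t])
  have L4: "(\<lambda>n. \<integral>x. (w n x - ?v x) ^ 4 \<partial>circ) \<longlonglongrightarrow> 0"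
  proof (rule LIMSEQ_I)
    fix e :: real assume e: "e > 0"
    then obtain N where "\<forall>n\<ge>N. (\<integral>x. (w n x - ?v x) ^ 4 \<partial>circ) \<le> e / 2" using F[of "e/2"] by auto
    moreover have "0 \<le> (\<integral>x. (w n x - ?v x) ^ 4 \<partial>circ)" for n by simp
    ultimately show "\<exists>N. \<forall>n\<ge>N. norm ((\<integral>x. (w n x - ?v x) ^ 4 \<partial>circ) - 0) < e"
      using e by (intro exI[of _ N]) force
  qed
  show thesis
  proof (rule that[of "\<lambda>k. r1 (r2 k)"])
    show "strict_mono (\<lambda>k. r1 (r2 k))" using strict_mono_o[OF r1(1) r2(1)] by (simp add: o_def)
    show "Hs t (plim (\<lambda>k. u (r1 (r2 k))))" using v by (simp add: w_def)
    show "(\<lambda>k. \<integral>x. (u (r1 (r2 k)) x - plim (\<lambda>k. u (r1 (r2 k))) x)\<^sup>2 \<partial>circ) \<longlonglongrightarrow> 0"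
      using LIMSEQ_subseq_LIMSEQ[OF r2(4,1)] by (simp add: w_def o_def)
    show "(\<lambda>k. \<integral>x. (u (r1 (r2 k)) x - plim (\<lambda>k. u (r1 (r2 k))) x) ^ 4 \<partial>circ) \<longlonglongrightarrow> 0"
      using LIMSEQ_subseq_LIMSEQ[OF L4 r2(1)] by (simp add: w_def o_def)
    show "integrable circ (\<lambda>x. (u (r1 (r2 k)) x - plim (\<lambda>k. u (r1 (r2 k))) x) ^ 4)" for k
      using int4v[of "r2 k"] by (simp add: w_def)
  qed
qed

text \<open>Cauchy-Schwarz is used on u^4 - v^4 = (u^2 - v^2)(u^2 + v^2), and again on (u^2 - v^2)^2
  = (u - v)^2 (u + v)^2, where the L^4 distance appears. The constant \<open>8 * C + 8 * V\<close>
  bounds the integral of (2 u^2 + 2 v^2)^2.\<close>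

lemma L4_norm_limit:
  fixes u :: "nat \<Rightarrow> 'a \<Rightarrow> real" and v :: "'a \<Rightarrow> real"
  assumes u: "\<And>n. u n \<in> borel_measurable M" "\<And>n. integrable M (\<lambda>x. u n x ^ 4)" "\<And>n. (\<integral>x. u n x ^ 4 \<partial>M) \<le> C"
    and v: "v \<in> borel_measurable M" "integrable M (\<lambda>x. v x ^ 4)"
    and d: "\<And>n. integrable M (\<lambda>x. (u n x - v x) ^ 4)" "(\<lambda>n. \<integral>x. (u n x - v x) ^ 4 \<partial>M) \<longlonglongrightarrow> 0"
  shows "(\<lambda>n. \<integral>x. u n x ^ 4 \<partial>M) \<longlonglongrightarrow> (\<integral>x. v x ^ 4 \<partial>M)"
proof -
  have p4: "((a::real)\<^sup>2)\<^sup>2 = a ^ 4" for a by simp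
  have su: "sq_int M (\<lambda>x. (u n x)\<^sup>2)" for n using u by (simp add: sq_int_def p4 borel_measurable_power)
  have sv: "sq_int M (\<lambda>x. (v x)\<^sup>2)" using v by (simp add: sq_int_def p4 borel_measurable_power)
  have sd: "sq_int M (\<lambda>x. (u n x - v x)\<^sup>2)" for n
    using u v d by (simp add: sq_int_def p4 borel_measurable_power)
  have s2: "sq_int M (\<lambda>x. 2 * (u n x)\<^sup>2 + 2 * (v x)\<^sup>2)" for n
    by (intro sq_int_add sq_int_cmult su sv)
  define V where "V = (\<integral>x. v x ^ 4 \<partial>M)"
  have K: "(\<integral>x. (2 * (u n x)\<^sup>2 + 2 * (v x)\<^sup>2)\<^sup>2 \<partial>M) \<le> 8 * C + 8 * V" for n
  proof -
    have "(2 * a + 2 * b)\<^sup>2 \<le> 8 * a\<^sup>2 + 8 * b\<^sup>2" for a b :: real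
      using sum_squares_bound[of a b] by (simp add: power2_sum power_mult_distrib)
    then have "(2 * (u n x)\<^sup>2 + 2 * (v x)\<^sup>2)\<^sup>2 \<le> 8 * u n x ^ 4 + 8 * v x ^ 4" for x
      unfolding p4[symmetric] .
    then have "(\<integral>x. (2 * (u n x)\<^sup>2 + 2 * (v x)\<^sup>2)\<^sup>2 \<partial>M) \<le> (\<integral>x. 8 * u n x ^ 4 + 8 * v x ^ 4 \<partial>M)"
      using s2[of n] u v by (intro integral_mono) (auto simp: sq_int_def)
    also have "\<dots> = 8 * (\<integral>x. u n x ^ 4 \<partial>M) + 8 * V" using u v by (simp add: V_def)
    finally show ?thesis using u(3)[of n] by simp
  qed
  define D where "D n = (\<integral>x. (u n x - v x) ^ 4 \<partial>M)" for n
  have D2: "(\<integral>x. ((u n x)\<^sup>2 - (v x)\<^sup>2)\<^sup>2 \<partial>M) \<le> sqrt (D n) * sqrt (8 * C + 8 * V)" for n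
  proof -
    have "(\<integral>x. ((u n x)\<^sup>2 - (v x)\<^sup>2)\<^sup>2 \<partial>M) \<le> (\<integral>x. (u n x - v x)\<^sup>2 * (2 * (u n x)\<^sup>2 + 2 * (v x)\<^sup>2) \<partial>M)"
    proof (rule integral_mono)
      show "integrable M (\<lambda>x. ((u n x)\<^sup>2 - (v x)\<^sup>2)\<^sup>2)" using sq_int_diff[OF su sv, of n] by (simp add: sq_int_def)
      show "integrable M (\<lambda>x. (u n x - v x)\<^sup>2 * (2 * (u n x)\<^sup>2 + 2 * (v x)\<^sup>2))" by (rule sq_int_mult[OF sd s2])
      fix x
      have "((u n x)\<^sup>2 - (v x)\<^sup>2)\<^sup>2 = (u n x - v x)\<^sup>2 * (u n x + v x)\<^sup>2"
        by (simp add: power_mult_distrib[symmetric] power2_eq_square algebra_simps)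
      also have "(u n x + v x)\<^sup>2 \<le> 2 * (u n x)\<^sup>2 + 2 * (v x)\<^sup>2"
        using sum_squares_bound[of "u n x" "v x"] by (simp add: power2_sum)
      finally show "((u n x)\<^sup>2 - (v x)\<^sup>2)\<^sup>2 \<le> (u n x - v x)\<^sup>2 * (2 * (u n x)\<^sup>2 + 2 * (v x)\<^sup>2)"
        by (simp add: mult_left_mono)
    qed
    also have "\<dots> \<le> sqrt (\<integral>x. ((u n x - v x)\<^sup>2)\<^sup>2 \<partial>M) * sqrt (\<integral>x. (2 * (u n x)\<^sup>2 + 2 * (v x)\<^sup>2)\<^sup>2 \<partial>M)"
      using Cauchy_Schwarz_integral_abs[OF sd s2, of n] by simp
    also have "\<dots> \<le> sqrt (D n) * sqrt (8 * C + 8 * V)"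
      unfolding p4 D_def using K[of n] by (intro mult_left_mono real_sqrt_le_mono) auto
    finally show ?thesis .
  qed
  have D0: "0 \<le> sqrt (D n) * sqrt (8 * C + 8 * V)" for n
    by (rule order_trans[OF _ D2]) simp
  have "norm ((\<integral>x. u n x ^ 4 \<partial>M) - V) \<le> sqrt (sqrt (D n) * sqrt (8 * C + 8 * V)) * sqrt (8 * C + 8 * V)" for n
  proof -
    have "(\<integral>x. u n x ^ 4 \<partial>M) - V = (\<integral>x. u n x ^ 4 - v x ^ 4 \<partial>M)" using u v by (simp add: V_def)
    also have "\<dots> = (\<integral>x. ((u n x)\<^sup>2 - (v x)\<^sup>2) * ((u n x)\<^sup>2 + (v x)\<^sup>2) \<partial>M)"
      by (intro Bochner_Integration.integral_cong) (auto simp: algebra_simps power2_eq_square power4_eq_xxxx)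
    finally have "norm ((\<integral>x. u n x ^ 4 \<partial>M) - V) \<le> sqrt (\<integral>x. ((u n x)\<^sup>2 - (v x)\<^sup>2)\<^sup>2 \<partial>M) * sqrt (\<integral>x. ((u n x)\<^sup>2 + (v x)\<^sup>2)\<^sup>2 \<partial>M)"
      using Cauchy_Schwarz_integral_abs[OF sq_int_diff[OF su sv] sq_int_add[OF su sv], of n n] by simp
    also have "\<dots> \<le> sqrt (sqrt (D n) * sqrt (8 * C + 8 * V)) * sqrt (8 * C + 8 * V)"
    proof (intro mult_mono real_sqrt_le_mono D2)
      have "(\<integral>x. ((u n x)\<^sup>2 + (v x)\<^sup>2)\<^sup>2 \<partial>M) \<le> (\<integral>x. (2 * (u n x)\<^sup>2 + 2 * (v x)\<^sup>2)\<^sup>2 \<partial>M)"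
        using s2[of n] sq_int_add[OF su sv, of n] by (intro integral_mono power_mono) (auto simp: sq_int_def)
      then show "(\<integral>x. ((u n x)\<^sup>2 + (v x)\<^sup>2)\<^sup>2 \<partial>M) \<le> 8 * C + 8 * V" using K[of n] by simp
    qed (use D0 in auto)
    finally show ?thesis .
  qed
  note le = this
  have "(\<lambda>n. sqrt (sqrt (D n) * sqrt (8 * C + 8 * V)) * sqrt (8 * C + 8 * V)) \<longlonglongrightarrow> sqrt (sqrt 0 * sqrt (8 * C + 8 * V)) * sqrt (8 * C + 8 * V)"
    unfolding D_def by (intro tendsto_intros d)
  then have "(\<lambda>n. (\<integral>x. u n x ^ 4 \<partial>M) - V) \<longlonglongrightarrow> 0"
    by (intro Lim_null_comparison[OF always_eventually[OF allI[OF le]]]) simp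
  then show ?thesis by (simp add: V_def LIM_zero_iff)
qed

section \<open>The variational problem\<close>

text \<open>The homogeneous counterpart of \<open>en\<close>; as \<open>0 powr t = 0\<close>, the
  zero mode does not contribute.\<close>

definition dq :: "real \<Rightarrow> (real \<Rightarrow> real) \<Rightarrow> real" where
  "dq t u = (\<Sum>\<^sub>\<infinity>k. \<bar>real_of_int k\<bar> powr t * (cmod (fcoeff u k))\<^sup>2)"

lemma dq_term_nonneg: "0 \<le> \<bar>real_of_int k\<bar> powr t * (cmod z)\<^sup>2" by simp

lemma dq_term_le: 
  assumes "t \<ge> 0" shows "\<bar>real_of_int k\<bar> powr t * (cmod z)\<^sup>2 \<le> jb (t/2) k * (cmod z)\<^sup>2"
proof (intro mult_right_mono)
  show "\<bar>real_of_int k\<bar> powr t \<le> jb (t/2) k"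
  proof (cases "k = 0")
    case False
    then have "\<bar>real_of_int k\<bar> powr t = ((of_int k)\<^sup>2) powr (t/2)"
    proof -
      have "(real_of_int k)\<^sup>2 = \<bar>real_of_int k\<bar> powr 2" using False by simp
      then show ?thesis by (simp only: powr_powr) simp
    qed
    also have "\<dots> \<le> jb (t/2) k" unfolding jb_def using assms by (intro powr_mono2) auto
    finally show ?thesis .
  qed (simp add: jb_def)
qed simp

lemma dq_summable:
  assumes "Hs t u" "t \<ge> 0"
  shows "(\<lambda>k. \<bar>real_of_int k\<bar> powr t * (cmod (fcoeff u k))\<^sup>2) summable_on UNIV"
  by (rule summable_on_comparison_test[of "\<lambda>k. jb (t/2) k * (cmod (fcoeff u k))\<^sup>2"])
    (use assms dq_term_le in \<open>auto simp: Hs_def\<close>)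

lemma dq_sum_le:
  assumes "Hs t u" "t \<ge> 0" "finite F"
  shows "(\<Sum>k\<in>F. \<bar>real_of_int k\<bar> powr t * (cmod (fcoeff u k))\<^sup>2) \<le> dq t u"
  unfolding dq_def by (rule finite_sum_le_infsum[OF dq_summable]) (use assms in auto)

lemma dq_nonneg: "0 \<le> dq t u"
  unfolding dq_def by (intro infsum_nonneg dq_term_nonneg)

lemma Dsq_integral_dq: "Dsq_integral (t/2) u = 2 * pi * dq t u"
proof -
  have "(\<bar>real_of_int k\<bar> powr (t/2))\<^sup>2 = \<bar>real_of_int k\<bar> powr t" for k
    by (simp add: power2_eq_square powr_add[symmetric])
  then show ?thesis by (simp add: Dsq_integral_def dq_def)
qed

lemma Bc_eq: "Bc t c u = pi * dq t u + c / 2 * (\<integral>x. (u x)\<^sup>2 \<partial>circ)"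
  by (simp add: Bc_def Dsq_integral_dq set_lebesgue_integral_circ algebra_simps)

lemma fcoeff_0: "fcoeff u 0 = of_real ((\<integral>x. u x \<partial>circ) / (2 * pi))"
  by (simp add: fcoeff_circ)

text \<open>A Poincare inequality: with vanishing mean only frequencies of modulus at least 1 occur.
  Its constant is the source of the threshold -1 for \<open>c\<close>.\<close>

lemma integral_sq_le_dq:
  assumes u: "Hs t u" and t: "t \<ge> 0" and z: "(\<integral>x. u x \<partial>circ) = 0"
  shows "(\<integral>x. (u x)\<^sup>2 \<partial>circ) \<le> 2 * pi * dq t u"
proof -
  have "(\<Sum>\<^sub>\<infinity>k. (cmod (fcoeff u k))\<^sup>2) \<le> dq t u"
    unfolding dq_def
  proof (rule infsum_mono[OF Parseval_summable[OF Hs_sq_int[OF u]] dq_summable[OF u t]])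
    fix k :: int
    show "(cmod (fcoeff u k))\<^sup>2 \<le> \<bar>real_of_int k\<bar> powr t * (cmod (fcoeff u k))\<^sup>2"
    proof (cases "k = 0")
      case False
      then have "1 \<le> \<bar>real_of_int k\<bar>" by linarith
      then have "1 \<le> \<bar>real_of_int k\<bar> powr t" using t by (rule ge_one_powr_ge_zero)
      from mult_right_mono[OF this, of "(cmod (fcoeff u k))\<^sup>2"] show ?thesis by simp
    qed (simp add: fcoeff_0 z)
  qed
  then show ?thesis by (simp add: Parseval[OF Hs_sq_int[OF u]])
qed

lemma en_le_dq:
  assumes u: "Hs t u" and t: "t \<ge> 0" and z: "(\<integral>x. u x \<partial>circ) = 0"
  shows "en t u \<le> 2 powr (t/2) * dq t u"
proof -
  have "en t u \<le> (\<Sum>\<^sub>\<infinity>k. 2 powr (t/2) * (\<bar>real_of_int k\<bar> powr t * (cmod (fcoeff u k))\<^sup>2))"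
    unfolding en_def
  proof (rule infsum_mono)
    show "(\<lambda>k. jb (t/2) k * (cmod (fcoeff u k))\<^sup>2) summable_on UNIV" using u by (simp add: Hs_def)
    show "(\<lambda>k. 2 powr (t/2) * (\<bar>real_of_int k\<bar> powr t * (cmod (fcoeff u k))\<^sup>2)) summable_on UNIV"
      by (intro summable_on_cmult_right dq_summable u t)
    fix k :: int
    show "jb (t/2) k * (cmod (fcoeff u k))\<^sup>2 \<le> 2 powr (t/2) * (\<bar>real_of_int k\<bar> powr t * (cmod (fcoeff u k))\<^sup>2)"
    proof (cases "k = 0")
      case False
      then have "1 \<le> \<bar>real_of_int k\<bar>" by linarith
      then have "1\<^sup>2 \<le> \<bar>real_of_int k\<bar>\<^sup>2" by (rule power_mono) simp
      then have "jb (t/2) k \<le> (2 * (of_int k)\<^sup>2) powr (t/2)"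
        unfolding jb_def using t by (intro powr_mono2) auto
      also have "\<dots> = 2 powr (t/2) * \<bar>real_of_int k\<bar> powr t"
      proof -
        have "(real_of_int k)\<^sup>2 = \<bar>real_of_int k\<bar> powr 2" using False by simp
        then show ?thesis by (simp add: powr_mult powr_powr del: powr_numeral)
      qed
      finally show ?thesis by (simp add: mult.assoc[symmetric] mult_right_mono)
    qed (simp add: fcoeff_0 z)
  qed
  also have "\<dots> = 2 powr (t/2) * dq t u" unfolding dq_def by (rule infsum_cmult_right')
  finally show ?thesis .
qed

text \<open>For negative \<open>c\<close> the Poincare inequality absorbs the L^2 term and leaves
  the fraction \<open>1 + c\<close> of the leading term.\<close>

lemma Bc_coercive:
  assumes u: "Hs t u" and t: "t \<ge> 0" and z: "(\<integral>x. u x \<partial>circ) = 0" and c: "c > -1"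
  shows "pi * min 1 (1 + c) * dq t u \<le> Bc t c u"
proof (cases "c \<ge> 0")
  case True
  then have "0 \<le> c / 2 * (\<integral>x. (u x)\<^sup>2 \<partial>circ)" by simp
  then show ?thesis using True by (simp add: Bc_eq)
next
  case False
  then have "(- c) / 2 * (\<integral>x. (u x)\<^sup>2 \<partial>circ) \<le> (- c) / 2 * (2 * pi * dq t u)"
    by (intro mult_left_mono integral_sq_le_dq[OF u t z]) auto
  then show ?thesis using False by (simp add: Bc_eq algebra_simps)
qed

text \<open>Vanishing mean is the part of oddness that survives translation and polarization, and it
  is what coercivity uses.\<close>

definition H0 :: "real \<Rightarrow> (real \<Rightarrow> real) set" where
  "H0 t = {u. per2pi u \<and> u \<in> borel_measurable lebesgue \<and> Hs t u \<and> (\<integral>x. u x \<partial>circ) = 0}"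

definition A0 :: "real \<Rightarrow> (real \<Rightarrow> real) set" where
  "A0 t = {u \<in> H0 t. (\<integral>x. u x ^ 4 \<partial>circ) = 1}"

lemma Hper_iff: "u \<in> Hper (t/2) \<longleftrightarrow> per2pi u \<and> u \<in> borel_measurable lebesgue \<and> Hs t u"
  by (auto simp: Hper_def Hs_def sq_int_def jb_def set_lebesgue_integral_circ measurable_circ_lebesgue)

lemma integral_odd_fun:
  assumes "odd_fun u" shows "(\<integral>x. u x \<partial>circ) = 0"
proof -
  have "(\<integral>x. u x \<partial>circ) = (\<integral>x. u (- x) \<partial>circ)" by (rule integral_circ_reflect[symmetric])
  also have "\<dots> = - (\<integral>x. u x \<partial>circ)" using assms by (simp add: odd_fun_def)
  finally show ?thesis by simp
qed

lemma admissible_odd_iff: "u \<in> admissible_odd t \<longleftrightarrow> u \<in> A0 t \<and> odd_fun u"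
  by (auto simp: admissible_odd_def Hper_odd_def Hper_iff A0_def H0_def set_lebesgue_integral_circ integral_odd_fun)

lemma integral_sq_L2_limit:
  assumes un: "\<And>n. sq_int M (u n)" and v: "sq_int M v"
    and lim: "(\<lambda>n. \<integral>x. (u n x - v x)\<^sup>2 \<partial>M) \<longlonglongrightarrow> 0"
  shows "(\<lambda>n. \<integral>x. (u n x)\<^sup>2 \<partial>M) \<longlonglongrightarrow> (\<integral>x. (v x)\<^sup>2 \<partial>M)"
proof -
  have "(\<integral>x. (u n x)\<^sup>2 \<partial>M) = (\<integral>x. (u n x - v x)\<^sup>2 \<partial>M) + 2 * (\<integral>x. u n x * v x \<partial>M) - (\<integral>x. v x * v x \<partial>M)" for n
  proof -
    have "(\<integral>x. (u n x)\<^sup>2 \<partial>M) = (\<integral>x. (u n x - v x)\<^sup>2 + 2 * (u n x * v x) - v x * v x \<partial>M)"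
      by (intro Bochner_Integration.integral_cong) (auto simp: power2_eq_square algebra_simps)
    also have "\<dots> = (\<integral>x. (u n x - v x)\<^sup>2 \<partial>M) + 2 * (\<integral>x. u n x * v x \<partial>M) - (\<integral>x. v x * v x \<partial>M)"
      using sq_int_diff[OF un v, of n] sq_int_mult[OF un v, of n] sq_int_mult[OF v v] by (simp add: sq_int_def)
    finally show ?thesis .
  qed
  moreover have "(\<lambda>n. (\<integral>x. (u n x - v x)\<^sup>2 \<partial>M) + 2 * (\<integral>x. u n x * v x \<partial>M) - (\<integral>x. v x * v x \<partial>M))
      \<longlonglongrightarrow> 0 + 2 * (\<integral>x. v x * v x \<partial>M) - (\<integral>x. v x * v x \<partial>M)"
    by (intro tendsto_intros lim integral_mult_L2_limit un v)
  ultimately show ?thesis by (simp add: power2_eq_square)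
qed

text \<open>The constraint passes to the limit by strong L^4 convergence, the L^2 term by strong
  convergence, and the leading term is lower semicontinuous. The limit is given as
  \<open>plim\<close>, so that pointwise symmetries can be checked on it.\<close>

theorem A0_compact:
  assumes t: "t > 1/2" and c: "c > -1" and u: "\<And>k. u k \<in> A0 t" and m: "(\<lambda>k. Bc t c (u k)) \<longlonglongrightarrow> m"
  obtains r where "strict_mono r" "plim (\<lambda>k. u (r k)) \<in> A0 t"
    "(\<lambda>k. \<integral>x. (u (r k) x - plim (\<lambda>k. u (r k)) x)\<^sup>2 \<partial>circ) \<longlonglongrightarrow> 0"
    "Bc t c (plim (\<lambda>k. u (r k))) \<le> m"
proof -
  have t0: "t \<ge> 0" using t by simp
  have uH: "Hs t (u k)" and uz: "(\<integral>x. u k x \<partial>circ) = 0" and up: "per2pi (u k)" and um: "u k \<in> borel_measurable lebesgue"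
    and u4: "(\<integral>x. u k x ^ 4 \<partial>circ) = 1" for k
    using u[of k] by (auto simp: A0_def H0_def)
  define q where "q = pi * min 1 (1 + c)"
  have q: "q > 0" using c by (simp add: q_def)
  obtain K where K: "\<And>k. Bc t c (u k) \<le> K"
    using convergent_imp_Bseq[OF convergentI[OF m]] by (auto simp: Bseq_def) (metis abs_le_D1)
  have "en t (u k) \<le> 2 powr (t/2) * (K / q)" for k
  proof -
    have "q * dq t (u k) \<le> K" using Bc_coercive[OF uH t0 uz c, of k] K[of k] by (simp add: q_def)
    then have "dq t (u k) \<le> K / q" using q by (simp add: field_simps)
    then have "2 powr (t/2) * dq t (u k) \<le> 2 powr (t/2) * (K / q)" by (rule mult_left_mono) simp
    then show ?thesis using en_le_dq[OF uH t0 uz, of k] by simp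
  qed
  from Rellich_L4[where u = u, OF t uH this]
  obtain r where r: "strict_mono r" "Hs t (plim (\<lambda>k. u (r k)))"
    "(\<lambda>k. \<integral>x. (u (r k) x - plim (\<lambda>k. u (r k)) x)\<^sup>2 \<partial>circ) \<longlonglongrightarrow> 0"
    "(\<lambda>k. \<integral>x. (u (r k) x - plim (\<lambda>k. u (r k)) x) ^ 4 \<partial>circ) \<longlonglongrightarrow> 0"
    "\<And>k. integrable circ (\<lambda>x. (u (r k) x - plim (\<lambda>k. u (r k)) x) ^ 4)" by blast
  let ?v = "plim (\<lambda>k. u (r k))"
  note s = Hs_sq_int[OF uH]
  note vs = Hs_sq_int[OF r(2)]
  have f: "(\<lambda>n. fcoeff (u (r n)) k) \<longlonglongrightarrow> fcoeff ?v k" for k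
    by (rule fcoeff_L2_limit[OF s vs r(3)])
  have "(\<lambda>n. fcoeff (u (r n)) 0) \<longlonglongrightarrow> fcoeff ?v 0" by (rule f)
  then have "fcoeff ?v 0 = 0" by (simp add: fcoeff_0 uz LIMSEQ_const_iff)
  then have vz: "(\<integral>x. ?v x \<partial>circ) = 0" by (simp add: fcoeff_0)
  have "(\<lambda>n. \<integral>x. u (r n) x ^ 4 \<partial>circ) \<longlonglongrightarrow> (\<integral>x. ?v x ^ 4 \<partial>circ)"
    using s vs by (intro L4_norm_limit[where C = 1, OF _ Sobolev_L4(1)[OF uH t] _ _ Sobolev_L4(1)[OF r(2) t] r(5,4)])
      (auto simp: u4 sq_int_def)
  then have v4: "(\<integral>x. ?v x ^ 4 \<partial>circ) = 1" by (simp add: u4 LIMSEQ_const_iff)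
  have vp: "per2pi ?v" using up by (simp add: per2pi_def plim_def)
  have vm: "?v \<in> borel_measurable lebesgue" by (rule plim_measurable) (rule um)
  have vA: "?v \<in> A0 t" using vz v4 vp vm r(2) by (simp add: A0_def H0_def)
  have mr: "(\<lambda>n. Bc t c (u (r n))) \<longlonglongrightarrow> m" using LIMSEQ_subseq_LIMSEQ[OF m r(1)] by (simp add: o_def)
  \<comment> \<open>The limit of \<open>dq\<close> along the subsequence, read off from the limits
    of \<open>Bc\<close> and of the L^2 norm.\<close>
  define L where "L = (m - c / 2 * (\<integral>x. (?v x)\<^sup>2 \<partial>circ)) / pi"
  have L: "(\<lambda>n. dq t (u (r n))) \<longlonglongrightarrow> L"
  proof -
    have "(\<lambda>n. (Bc t c (u (r n)) - c / 2 * (\<integral>x. (u (r n) x)\<^sup>2 \<partial>circ)) / pi) \<longlonglongrightarrow> L"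
      unfolding L_def by (intro tendsto_intros mr integral_sq_L2_limit s vs r(3)) auto
    then show ?thesis by (simp add: Bc_eq)
  qed
  have "(\<Sum>k\<in>{- int N..int N}. \<bar>real_of_int k\<bar> powr t * (cmod (fcoeff ?v k))\<^sup>2) \<le> L" for N
  proof (rule LIMSEQ_le[OF _ L])
    show "(\<lambda>n. \<Sum>k\<in>{- int N..int N}. \<bar>real_of_int k\<bar> powr t * (cmod (fcoeff (u (r n)) k))\<^sup>2)
        \<longlonglongrightarrow> (\<Sum>k\<in>{- int N..int N}. \<bar>real_of_int k\<bar> powr t * (cmod (fcoeff ?v k))\<^sup>2)"
      by (intro tendsto_intros f)
    show "\<exists>M. \<forall>n\<ge>M. (\<Sum>k\<in>{- int N..int N}. \<bar>real_of_int k\<bar> powr t * (cmod (fcoeff (u (r n)) k))\<^sup>2) \<le> dq t (u (r n))"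
      using dq_sum_le[OF uH t0] by auto
  qed
  from int_summable_bounded(2)[where f = "\<lambda>k. \<bar>real_of_int k\<bar> powr t * (cmod (fcoeff ?v k))\<^sup>2", OF dq_term_nonneg this]
  have "dq t ?v \<le> L" by (simp add: dq_def)
  then have "Bc t c ?v \<le> m" by (simp add: Bc_eq L_def field_simps)
  with r(1) vA r(3) show thesis by (rule that)
qed

text \<open>The set \<open>X\<close> is a parameter because the direct method is run twice: over all
  odd functions, for every \<alpha> > 1/2, and over the balanced ones.\<close>

theorem exists_minimizer:
  assumes t: "t > 1/2" and c: "c > -1" and X: "X \<subseteq> A0 t" "X \<noteq> {}"
    and closed: "\<And>u. (\<And>k. u k \<in> X) \<Longrightarrow> plim u \<in> A0 t \<Longrightarrow> (\<lambda>k. \<integral>x. (u k x - plim u x)\<^sup>2 \<partial>circ) \<longlonglongrightarrow> 0 \<Longrightarrow> plim u \<in> X"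
  shows "\<exists>v\<in>X. \<forall>u\<in>X. Bc t c v \<le> Bc t c u"
proof -
  define m where "m = Inf (Bc t c ` X)"
  have nn: "0 \<le> Bc t c u" if "u \<in> X" for u
  proof -
    have "u \<in> H0 t" using X that by (auto simp: A0_def)
    then have "pi * min 1 (1 + c) * dq t u \<le> Bc t c u" using t by (intro Bc_coercive c) (auto simp: H0_def)
    moreover have "0 \<le> pi * min 1 (1 + c) * dq t u" using c dq_nonneg[of t u] by simp
    ultimately show ?thesis by simp
  qed
  have bdd: "bdd_below (Bc t c ` X)" using nn by (auto intro!: bdd_belowI)
  have "\<exists>u\<in>X. Bc t c u < m + 1 / real (Suc k)" for k
  proof -
    have "Inf (Bc t c ` X) < m + 1 / real (Suc k)" by (simp add: m_def)
    then show ?thesis using cInf_less_iff[of "Bc t c ` X"] bdd X(2) by auto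
  qed
  then obtain u where u: "\<And>k. u k \<in> X" "\<And>k. Bc t c (u k) < m + 1 / real (Suc k)" by metis
  have mle: "m \<le> Bc t c w" if "w \<in> X" for w unfolding m_def using bdd that by (intro cInf_lower) auto
  have "(\<lambda>k. Bc t c (u k)) \<longlonglongrightarrow> m"
  proof (rule real_tendsto_sandwich)
    show "\<forall>\<^sub>F k in sequentially. m \<le> Bc t c (u k)" using mle u(1) by simp
    show "\<forall>\<^sub>F k in sequentially. Bc t c (u k) \<le> m + 1 / real (Suc k)"
      by (intro always_eventually allI less_imp_le u(2))
    show "(\<lambda>k. m + 1 / real (Suc k)) \<longlonglongrightarrow> m"
      using tendsto_add[OF tendsto_const LIMSEQ_inverse_real_of_nat, of m] by (simp add: inverse_eq_divide)
  qed simp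
  from A0_compact[OF t c _ this] obtain r where r: "strict_mono r" "plim (\<lambda>k. u (r k)) \<in> A0 t"
    "(\<lambda>k. \<integral>x. (u (r k) x - plim (\<lambda>k. u (r k)) x)\<^sup>2 \<partial>circ) \<longlonglongrightarrow> 0"
    "Bc t c (plim (\<lambda>k. u (r k))) \<le> m"
    using u X by blast
  have "plim (\<lambda>k. u (r k)) \<in> X" by (rule closed[OF _ r(2,3)]) (rule u)
  then show ?thesis using r(4) mle by (meson order_trans)
qed

section \<open>Sign-preserving sine multipliers\<close>

definition mk :: "(nat \<Rightarrow> real) \<Rightarrow> nat \<Rightarrow> real \<Rightarrow> real \<Rightarrow> real" where
  "mk r m x y = (\<Sum>n\<in>{1..m}. r n * (sin (real n * x) * sin (real n * y)))"

text \<open>Multipliers whose kernel, acting on odd functions, maps functions that are nonnegative on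
  \<open>(0, pi)\<close> to such functions. The product with \<open>sin x * sin y\<close> encodes the sign on the whole torus.\<close>

definition cone :: "nat \<Rightarrow> (nat \<Rightarrow> real) \<Rightarrow> bool" where
  "cone m r \<longleftrightarrow> (\<forall>x y. 0 \<le> mk r m x y * (sin x * sin y))"

lemma coneD: "cone m r \<Longrightarrow> 0 \<le> mk r m x y * (sin x * sin y)"
  by (simp add: cone_def)

lemma sin_nat_zero: "sin y = 0 \<Longrightarrow> sin (real n * y) = 0"
  by (induction n) (simp_all add: distrib_right sin_add)

lemma mk_zero: "sin y = 0 \<Longrightarrow> mk r m x y = 0" "sin x = 0 \<Longrightarrow> mk r m x y = 0"
  by (simp_all add: mk_def sin_nat_zero)

lemma cone_zero: "cone m (\<lambda>_. 0)"
  by (simp add: cone_def mk_def)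

lemma cone_add:
  assumes "cone m r" "cone m s" shows "cone m (\<lambda>n. r n + s n)"
proof -
  have "mk (\<lambda>n. r n + s n) m x y = mk r m x y + mk s m x y" for x y
    by (simp add: mk_def distrib_right sum.distrib)
  then show ?thesis using assms by (simp add: cone_def distrib_right)
qed

lemma cone_scale:
  assumes "cone m r" "c \<ge> 0" shows "cone m (\<lambda>n. c * r n)"
proof -
  have "mk (\<lambda>n. c * r n) m x y = c * mk r m x y" for x y
    by (simp add: mk_def sum_distrib_left mult.assoc)
  then show ?thesis using assms by (simp add: cone_def mult.assoc)
qed

lemma cone_sum: "(\<And>i. i \<in> I \<Longrightarrow> cone m (r i)) \<Longrightarrow> cone m (\<lambda>n. \<Sum>i\<in>I. r i n)"
proof (induction I rule: infinite_finite_induct)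
  case (insert i I)
  then show ?case using cone_add[of m "r i" "\<lambda>n. \<Sum>i\<in>I. r i n"] by simp
qed (auto simp: cone_zero)

lemma cone_limit:
  assumes "\<And>i. i \<ge> b \<Longrightarrow> cone m (R i)" "\<And>n. n \<in> {1..m} \<Longrightarrow> (\<lambda>i. R i n) \<longlonglongrightarrow> r n"
  shows "cone m r"
  unfolding cone_def
proof (intro allI)
  fix x y
  have "(\<lambda>i. mk (R i) m x y * (sin x * sin y)) \<longlonglongrightarrow> mk r m x y * (sin x * sin y)"
    unfolding mk_def by (intro tendsto_intros assms(2))
  then show "0 \<le> mk r m x y * (sin x * sin y)"
    by (rule LIMSEQ_le_const) (use assms(1) in \<open>auto simp: cone_def\<close>)
qed

lemma cone_sums:
  assumes "\<And>j. cone m (R j)" "\<And>n. n \<in> {1..m} \<Longrightarrow> (\<lambda>j. R j n) sums r n"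
  shows "cone m r"
  by (rule cone_limit[where b = 0 and R = "\<lambda>N n. \<Sum>j<N. R j n"])
    (use assms in \<open>auto simp: sums_def intro: cone_sum\<close>)

lemma integral_circ_sin_sin:
  assumes "k \<ge> 1" "l \<ge> 1"
  shows "(\<integral>y. sin (real k * y) * sin (real l * y) \<partial>circ) = (if k = l then pi else 0)"
proof -
  have c: "(\<integral>y. cos (of_int j * y) \<partial>circ) = (if j = 0 then 2 * pi else 0)" for j
  proof -
    have "integrable circ (\<lambda>y. cis (of_int j * y))" by (intro integrable_circ_continuous continuous_intros)
    from integral_bounded_linear[OF bounded_linear_Re this] show ?thesis
      by (simp add: integral_circ_cis)
  qed
  have i: "integrable circ (\<lambda>y. cos (of_int j * y) / 2)" for j
    by (intro integrable_circ_continuous continuous_intros) auto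
  have "(\<integral>y. sin (real k * y) * sin (real l * y) \<partial>circ)
    = (\<integral>y. cos (of_int (int k - int l) * y) / 2 - cos (of_int (int k + int l) * y) / 2 \<partial>circ)"
    by (intro Bochner_Integration.integral_cong) (auto simp: sin_times_sin left_diff_distrib distrib_right diff_divide_distrib)
  also have "\<dots> = (\<integral>y. cos (of_int (int k - int l) * y) / 2 \<partial>circ) - (\<integral>y. cos (of_int (int k + int l) * y) / 2 \<partial>circ)"
    by (rule Bochner_Integration.integral_diff[OF i i])
  also have "\<dots> = (if k = l then pi else 0)" using assms by (simp add: c del: of_int_add of_int_diff)
  finally show ?thesis .
qed

lemma integral_mk_mk:
  "(\<integral>y. mk r m x y * mk s m y z \<partial>circ) = pi * mk (\<lambda>n. r n * s n) m x z"
proof -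
  have i: "integrable circ (\<lambda>y. r n * sin (real n * x) * (s l * sin (real l * z)) * (sin (real n * y) * sin (real l * y)))" for n l
    by (intro integrable_circ_continuous continuous_intros)
  have "(\<integral>y. mk r m x y * mk s m y z \<partial>circ)
    = (\<integral>y. (\<Sum>n\<in>{1..m}. \<Sum>l\<in>{1..m}. r n * sin (real n * x) * (s l * sin (real l * z)) * (sin (real n * y) * sin (real l * y))) \<partial>circ)"
    unfolding mk_def sum_product by (intro Bochner_Integration.integral_cong sum.cong refl) (simp add: mult_ac)
  also have "\<dots> = (\<Sum>n\<in>{1..m}. \<Sum>l\<in>{1..m}. r n * sin (real n * x) * (s l * sin (real l * z)) * (\<integral>y. sin (real n * y) * sin (real l * y) \<partial>circ))"
    by (subst Bochner_Integration.integral_sum, intro Bochner_Integration.integrable_sum i, subst Bochner_Integration.integral_sum, rule i) simp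
  also have "\<dots> = (\<Sum>n\<in>{1..m}. \<Sum>l\<in>{1..m}. if n = l then pi * (r n * s n * (sin (real n * x) * sin (real n * z))) else 0)"
    by (intro sum.cong refl) (auto simp: integral_circ_sin_sin)
  also have "\<dots> = pi * mk (\<lambda>n. r n * s n) m x z"
    by (simp add: mk_def sum_distrib_left)
  finally show ?thesis .
qed

text \<open>Multiplying symbols composes kernels. In the product of the two sign conditions the
  intermediate variable enters through \<open>(sin y)^2\<close>, which can be divided out; where
  \<open>sin y = 0\<close> both kernels vanish.\<close>

lemma cone_mult:
  assumes r: "cone m r" and s: "cone m s" shows "cone m (\<lambda>n. r n * s n)"
  unfolding cone_def
proof (intro allI)
  fix x z
  have nn: "0 \<le> mk r m x y * mk s m y z * (sin x * sin z)" for y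
  proof (cases "sin y = 0")
    case False
    have "0 \<le> (mk r m x y * (sin x * sin y)) * (mk s m y z * (sin y * sin z))"
      by (intro mult_nonneg_nonneg coneD r s)
    also have "\<dots> = (mk r m x y * mk s m y z * (sin x * sin z)) * (sin y)\<^sup>2"
      by (simp add: power2_eq_square mult_ac)
    finally show ?thesis using False by (simp add: zero_le_mult_iff)
  qed (simp add: mk_zero)
  have "0 \<le> (\<integral>y. mk r m x y * mk s m y z * (sin x * sin z) \<partial>circ)"
    by (rule Bochner_Integration.integral_nonneg) (rule nn)
  also have "\<dots> = pi * mk (\<lambda>n. r n * s n) m x z * (sin x * sin z)"
    by (simp add: integral_mk_mk)
  finally show "0 \<le> mk (\<lambda>n. r n * s n) m x z * (sin x * sin z)"
    using pi_gt_zero by (simp add: mult.assoc zero_le_mult_iff)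
qed

lemma cone_power:
  assumes "cone m r" shows "cone m (\<lambda>n. r n ^ Suc j)"
proof (induction j)
  case (Suc j)
  then show ?case using cone_mult[OF assms Suc] by simp
qed (use assms in simp)

lemma mk_support:
  assumes "k \<le> m" "\<And>n. k < n \<Longrightarrow> n \<le> m \<Longrightarrow> r n = 0"
  shows "mk r m x y = mk r k x y"
  unfolding mk_def by (rule sum.mono_neutral_right) (use assms in auto)

text \<open>Allows symbols with different cut-offs to be multiplied at the larger one and the
  product to be brought back to the smaller one.\<close>

lemma cone_support:
  assumes "k \<le> m" "\<And>n. k < n \<Longrightarrow> n \<le> m \<Longrightarrow> r n = 0"
  shows "cone m r \<longleftrightarrow> cone k r"
  unfolding cone_def using mk_support[of k m r, OF assms] by simp

section \<open>Coefficients of the de la Vallee-Poussin kernel\<close>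

text \<open>The Fourier coefficients of the de la Vallee-Poussin kernel \<open>(1 + cos t)\<^sup>m\<close>, normalised.\<close>

definition bp :: "nat \<Rightarrow> nat \<Rightarrow> real" where
  "bp m n = real ((2 * m) choose (m + n)) / real ((2 * m) choose m)"

text \<open>Since (1 + e^(it))^2 = e^(it) (2 + 2 cos t), the binomial theorem with exponent
  \<open>2 * m\<close> gives the expansion after removal of the phase e^(imt); the terms
  \<open>m + n\<close> and \<open>m - n\<close> pair up to cosines.\<close>

lemma one_plus_cos_power:
  "(2 + 2 * cos t) ^ m = real ((2 * m) choose m) + 2 * (\<Sum>n\<in>{1..m}. real ((2 * m) choose (m + n)) * cos (real n * t))"
proof -
  have sq: "(1 + cis t)\<^sup>2 = cis t * of_real (2 + 2 * cos t)"
  proof -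
    have "1 = cis t * cis (- t)" by (simp add: cis_mult)
    then have "(1 + cis t)\<^sup>2 = cis t * (2 + (cis t + cis (- t)))" by (simp add: power2_eq_square algebra_simps)
    also have "cis t + cis (- t) = of_real (2 * cos t)" by (simp add: complex_eq_iff)
    finally show ?thesis by simp
  qed
  have "((1 + cis t)\<^sup>2) ^ m = cis t ^ m * of_real ((2 + 2 * cos t) ^ m)"
    unfolding sq power_mult_distrib by simp
  then have "cis (real m * t) * of_real ((2 + 2 * cos t) ^ m) = ((1 + cis t)\<^sup>2) ^ m"
    unfolding Complex.DeMoivre by (rule sym)
  also have "\<dots> = (cis t + 1) ^ (2 * m)" by (simp add: power_mult add.commute)
  also have "\<dots> = (\<Sum>j\<le>2 * m. of_nat ((2 * m) choose j) * cis (real j * t))"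
    unfolding binomial_ring by (simp add: Complex.DeMoivre)
  finally have "cis (- (real m * t)) * (cis (real m * t) * of_real ((2 + 2 * cos t) ^ m)) 
    = (\<Sum>j\<le>2 * m. of_nat ((2 * m) choose j) * (cis (- (real m * t)) * cis (real j * t)))"
    by (simp add: sum_distrib_left mult_ac)
  also have "cis (- (real m * t)) * (cis (real m * t) * of_real ((2 + 2 * cos t) ^ m)) = of_real ((2 + 2 * cos t) ^ m)"
    by (simp add: mult.assoc[symmetric] cis_mult)
  finally have "(2 + 2 * cos t) ^ m = Re (\<Sum>j\<le>2 * m. of_nat ((2 * m) choose j) * (cis (- (real m * t)) * cis (real j * t)))"
    by (metis Re_complex_of_real)
  also have "\<dots> = (\<Sum>j\<le>2 * m. real ((2 * m) choose j) * cos ((real j - real m) * t))"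
    by (simp add: cis_mult left_diff_distrib)
  also have "\<dots> = (\<Sum>k\<in>{- int m..int m}. real ((2 * m) choose nat (int m + k)) * cos (of_int k * t))"
    by (rule sum.reindex_bij_witness[of _ "\<lambda>k. nat (int m + k)" "\<lambda>j. int j - int m"]) auto
  also have "\<dots> = real ((2 * m) choose m) + (\<Sum>n\<in>{1..m}. real ((2 * m) choose (m + n)) * cos (real n * t)
      + real ((2 * m) choose (m - n)) * cos (real n * t))"
    unfolding sum_int_interval by (simp add: nat_add_distrib nat_diff_distrib' flip: of_nat_diff)
  also have "(\<Sum>n\<in>{1..m}. real ((2 * m) choose (m + n)) * cos (real n * t) + real ((2 * m) choose (m - n)) * cos (real n * t))
    = (\<Sum>n\<in>{1..m}. 2 * (real ((2 * m) choose (m + n)) * cos (real n * t)))"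
  proof (rule sum.cong[OF refl])
    fix n assume "n \<in> {1..m}"
    then have "(2 * m) choose (m - n) = (2 * m) choose (m + n)"
      using binomial_symmetric[of "m + n" "2 * m"] by (simp add: mult_2)
    then show "real ((2 * m) choose (m + n)) * cos (real n * t) + real ((2 * m) choose (m - n)) * cos (real n * t)
      = 2 * (real ((2 * m) choose (m + n)) * cos (real n * t))" by simp
  qed
  finally show ?thesis by (simp add: sum_distrib_left)
qed

text \<open>The kernel is a positive multiple of the difference of (2 + 2 cos)^m at
  \<open>x - y\<close> and \<open>x + y\<close>. As cos (x - y) - cos (x + y) = 2 sin x sin y and
  the power is monotone on nonnegative numbers, the signs agree.\<close>

lemma cone_bp: "cone m (bp m)"
  unfolding cone_def
proof (intro allI)
  fix x y
  define C where "C = real ((2 * m) choose m)"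
  have C: "C > 0" by (simp add: C_def)
  have "(2 + 2 * cos (x - y)) ^ m - (2 + 2 * cos (x + y)) ^ m
    = 2 * (\<Sum>n\<in>{1..m}. real ((2 * m) choose (m + n)) * (cos (real n * (x - y)) - cos (real n * (x + y))))"
    by (simp add: one_plus_cos_power sum_subtractf right_diff_distrib)
  also have "(\<Sum>n\<in>{1..m}. real ((2 * m) choose (m + n)) * (cos (real n * (x - y)) - cos (real n * (x + y))))
    = (\<Sum>n\<in>{1..m}. 2 * C * (bp m n * (sin (real n * x) * sin (real n * y))))"
  proof (rule sum.cong[OF refl])
    fix n
    have "cos (real n * (x - y)) - cos (real n * (x + y)) = 2 * (sin (real n * x) * sin (real n * y))"
      by (simp add: right_diff_distrib distrib_left cos_add cos_diff)
    then show "real ((2 * m) choose (m + n)) * (cos (real n * (x - y)) - cos (real n * (x + y)))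
      = 2 * C * (bp m n * (sin (real n * x) * sin (real n * y)))"
      using C by (simp add: bp_def C_def)
  qed
  also have "\<dots> = 2 * C * mk (bp m) m x y" by (simp add: mk_def sum_distrib_left)
  finally have eq: "(2 + 2 * cos (x - y)) ^ m - (2 + 2 * cos (x + y)) ^ m = 4 * C * mk (bp m) m x y" by simp
  have nn: "0 \<le> 2 + 2 * cos t" for t :: real using cos_ge_minus_one[of t] by linarith
  have ss: "cos (x - y) - cos (x + y) = 2 * (sin x * sin y)" by (simp add: cos_add cos_diff)
  have "0 \<le> ((2 + 2 * cos (x - y)) ^ m - (2 + 2 * cos (x + y)) ^ m) * (sin x * sin y)"
  proof (cases "0 \<le> sin x * sin y")
    case True
    then have "(2 + 2 * cos (x + y)) ^ m \<le> (2 + 2 * cos (x - y)) ^ m"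
      using ss by (intro power_mono nn) auto
    with True show ?thesis by simp
  next
    case False
    then have "(2 + 2 * cos (x - y)) ^ m \<le> (2 + 2 * cos (x + y)) ^ m"
      using ss by (intro power_mono nn) auto
    with False show ?thesis by (simp add: mult_nonpos_nonpos)
  qed
  then have "0 \<le> 4 * C * (mk (bp m) m x y * (sin x * sin y))" unfolding eq by (simp add: mult_ac)
  then show "0 \<le> mk (bp m) m x y * (sin x * sin y)" using C by (simp add: zero_le_mult_iff)
qed

lemma bp_0: "bp m 0 = 1" by (simp add: bp_def)

lemma bp_nonneg: "0 \<le> bp m n" by (simp add: bp_def)

lemma bp_eq_0: "m < n \<Longrightarrow> bp m n = 0" by (simp add: bp_def binomial_eq_0)

lemma bp_Suc: "bp m (Suc n) * (real m + real n + 1) = bp m n * (real m - real n)"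
proof (cases "n \<le> m")
  case True
  have "Suc (m + n) * ((2 * m) choose Suc (m + n)) = (2 * m - (m + n)) * ((2 * m) choose (m + n))"
    by (simp only: binomial_absorption binomial_absorb_comp)
  also have "2 * m - (m + n) = m - n" by simp
  finally have "real (Suc (m + n)) * real ((2 * m) choose Suc (m + n)) = (real m - real n) * real ((2 * m) choose (m + n))"
    using True by (metis of_nat_diff of_nat_mult)
  then show ?thesis by (simp add: bp_def field_simps)
qed (simp add: bp_eq_0)

text \<open>The ratio of consecutive coefficients, (m - n) / (m + n + 1), as a recursion for the
  defect \<open>1 - bp m n\<close>. Multiplied by \<open>m\<close>, the increments are at most
  \<open>2 * n + 1\<close> and tend to it; these odd numbers sum to n^2, which gives both the bound
  and the limit of the symbol.\<close>

lemma bp_Suc_diff: "1 - bp m (Suc n) = (1 - bp m n) + bp m n * ((2 * real n + 1) / (real m + real n + 1))"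
proof -
  have p: "real m + real n + 1 > 0" by simp
  have "bp m (Suc n) = bp m n * (real m - real n) / (real m + real n + 1)"
    using bp_Suc[of m n] p by (simp add: field_simps)
  moreover have "bp m n * (real m - real n) / (real m + real n + 1) = bp m n - bp m n * ((2 * real n + 1) / (real m + real n + 1))"
    using p by (simp add: field_simps)
  ultimately show ?thesis by simp
qed

lemma bp_le_1: "bp m n \<le> 1"
proof (induction n)
  case (Suc n)
  have "0 \<le> bp m n * ((2 * real n + 1) / (real m + real n + 1))" by (intro mult_nonneg_nonneg bp_nonneg) auto
  then show ?case using Suc bp_Suc_diff[of m n] by linarith
qed (simp add: bp_0)

lemma bp_less_1: assumes "n \<ge> 1" shows "bp m n < 1"
proof -
  have "0 < 1 - bp m (Suc n)" for n
  proof (induction n)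
    case 0
    show ?case unfolding bp_Suc_diff by (simp add: bp_0)
  next
    case (Suc n)
    have "0 \<le> bp m (Suc n) * ((2 * real (Suc n) + 1) / (real m + real (Suc n) + 1))" by (intro mult_nonneg_nonneg bp_nonneg) auto
    then show ?case using Suc bp_Suc_diff[of m "Suc n"] by linarith
  qed
  from this[of "n - 1"] assms show ?thesis by simp
qed

lemma bp_defect_le: "real m * (1 - bp m n) \<le> (real n)\<^sup>2"
proof (induction n)
  case (Suc n)
  have "real m * (bp m n * ((2 * real n + 1) / (real m + real n + 1))) = bp m n * (2 * real n + 1) * (real m / (real m + real n + 1))"
    by simp
  also have "\<dots> \<le> bp m n * (2 * real n + 1) * 1"
    by (intro mult_left_mono mult_nonneg_nonneg bp_nonneg) auto
  also have "\<dots> \<le> 1 * (2 * real n + 1) * 1" by (intro mult_right_mono bp_le_1) auto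
  finally have "real m * (bp m n * ((2 * real n + 1) / (real m + real n + 1))) \<le> 2 * real n + 1" by simp
  then show ?case unfolding bp_Suc_diff using Suc by (simp add: distrib_left power2_eq_square algebra_simps)
qed (simp add: bp_0)

lemma bp_limits: "(\<lambda>m. bp m n) \<longlonglongrightarrow> 1 \<and> (\<lambda>m. real m * (1 - bp m n)) \<longlonglongrightarrow> (real n)\<^sup>2"
proof (induction n)
  case 0 show ?case by (simp add: bp_0)
next
  case (Suc n)
  then have b: "(\<lambda>m. bp m n) \<longlonglongrightarrow> 1" and d: "(\<lambda>m. real m * (1 - bp m n)) \<longlonglongrightarrow> (real n)\<^sup>2" by auto
  have inv: "(\<lambda>m. 1 / (real m + real n + 1)) \<longlonglongrightarrow> 0"
  proof -
    have "(\<lambda>m. inverse (real (Suc (m + n)))) \<longlonglongrightarrow> 0"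
      using LIMSEQ_ignore_initial_segment[OF LIMSEQ_inverse_real_of_nat, of n] by simp
    then show ?thesis by (simp add: inverse_eq_divide add_ac)
  qed
  have r: "(\<lambda>m. real m / (real m + real n + 1)) \<longlonglongrightarrow> 1"
  proof -
    have "(\<lambda>m. 1 - (real n + 1) * (1 / (real m + real n + 1))) \<longlonglongrightarrow> 1 - (real n + 1) * 0"
      by (intro tendsto_intros inv)
    moreover have "1 - (real n + 1) * (1 / (real m + real n + 1)) = real m / (real m + real n + 1)" for m
      by (simp add: field_simps)
    ultimately show ?thesis by simp
  qed
  have "(\<lambda>m. 1 - ((1 - bp m n) + bp m n * (2 * real n + 1) * (1 / (real m + real n + 1)))) \<longlonglongrightarrow> 1 - ((1 - 1) + 1 * (2 * real n + 1) * 0)"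
    by (intro tendsto_intros b inv)
  moreover have "1 - ((1 - bp m n) + bp m n * (2 * real n + 1) * (1 / (real m + real n + 1))) = bp m (Suc n)" for m
    using bp_Suc_diff[of m n] by simp
  ultimately have 1: "(\<lambda>m. bp m (Suc n)) \<longlonglongrightarrow> 1" by simp
  have "(\<lambda>m. real m * (1 - bp m n) + bp m n * (2 * real n + 1) * (real m / (real m + real n + 1))) \<longlonglongrightarrow> (real n)\<^sup>2 + 1 * (2 * real n + 1) * 1"
    by (intro tendsto_intros b d r)
  moreover have "real m * (1 - bp m n) + bp m n * (2 * real n + 1) * (real m / (real m + real n + 1)) = real m * (1 - bp m (Suc n))" for m
    unfolding bp_Suc_diff by (simp add: algebra_simps add_divide_distrib)
  moreover have "(real n)\<^sup>2 + 1 * (2 * real n + 1) * 1 = (real (Suc n))\<^sup>2" by (simp add: power2_eq_square algebra_simps)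
  ultimately have 2: "(\<lambda>m. real m * (1 - bp m (Suc n))) \<longlonglongrightarrow> (real (Suc n))\<^sup>2" by simp
  from 1 2 show ?case by simp
qed

text \<open>The first term is \<open>- a\<close>, and each step multiplies by (j - a) / (j + 1) with
  \<open>j \<ge> 1\<close>, which is nonnegative because \<open>a \<le> 1\<close>. This is the point
  at which \<alpha> \<le> 2 is decisive.\<close>

lemma alternating_gbinomial_nonpos:
  fixes a :: real
  assumes a: "0 \<le> a" "a \<le> 1"
  shows "(a gchoose Suc j) * (- 1) ^ Suc j \<le> 0"
proof (induction j)
  case (Suc j)
  have "(a gchoose Suc (Suc j)) = (a gchoose Suc j) * ((a - real (Suc j)) / real (Suc (Suc j)))"
    using gbinomial_mult_1[of a "Suc j"] by (simp add: field_simps)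
  moreover have "(- 1 :: real) ^ Suc (Suc j) = - ((- 1) ^ Suc j)" by simp
  moreover have "(real (Suc j) - a) / real (Suc (Suc j)) = - ((a - real (Suc j)) / real (Suc (Suc j)))"
    by (simp only: minus_divide_left minus_diff_eq)
  ultimately have "(a gchoose Suc (Suc j)) * (- 1) ^ Suc (Suc j) = (a gchoose Suc j) * (- 1) ^ Suc j * ((real (Suc j) - a) / real (Suc (Suc j)))"
    by (simp only: mult_ac mult_minus_left mult_minus_right)
  also have "\<dots> \<le> 0"
    using a by (intro mult_nonpos_nonneg Suc) auto
  finally show ?case .
qed (use a in simp)

text \<open>Subtracting from 1 removes the constant term of the binomial series, so only powers with
  positive exponent, as in \<open>cone_power\<close>, remain.\<close>

lemma cone_fractional:
  assumes a: "0 \<le> a" "a \<le> 1"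
  shows "cone m (\<lambda>n. 1 - (1 - bp m n) powr a)"
proof (rule cone_sums)
  show "cone m (\<lambda>n. - ((a gchoose Suc j) * (- 1) ^ Suc j) * bp m n ^ Suc j)" for j
    using alternating_gbinomial_nonpos[OF a, of j] by (intro cone_scale cone_power cone_bp) auto
  fix n assume "n \<in> {1..m}"
  then have "\<bar>- bp m n\<bar> < 1" using bp_less_1[of n m] bp_nonneg[of m n] by simp
  from gen_binomial_real[OF this, of a]
  have "(\<lambda>j. (a gchoose j) * (- bp m n) ^ j) sums (1 - bp m n) powr a" by simp
  then have "(\<lambda>j. (a gchoose Suc j) * (- bp m n) ^ Suc j) sums ((1 - bp m n) powr a - 1)"
    by (subst sums_Suc_iff) simp
  from sums_minus[OF this]
  show "(\<lambda>j. - ((a gchoose Suc j) * (- 1) ^ Suc j) * bp m n ^ Suc j) sums (1 - (1 - bp m n) powr a)"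
    by (simp add: power_minus[of "bp m n"] mult_ac)
qed

text \<open>Approximations \<open>ps a m n \<le> n powr (2 * a)\<close> of the symbol of the fractional Laplacian.\<close>

definition ps :: "real \<Rightarrow> nat \<Rightarrow> nat \<Rightarrow> real" where
  "ps a m n = (real m * (1 - bp m n)) powr a"

lemma ps_eq: "ps a m n = real m powr a * (1 - bp m n) powr a"
  using bp_le_1[of m n] by (simp add: ps_def powr_mult)

lemma nat_sq_powr: "((real n)\<^sup>2) powr a = real n powr (2 * a)"
proof (cases "n = 0")
  case False
  then have "(real n)\<^sup>2 = real n powr 2" by simp
  then show ?thesis by (simp only: powr_powr)
qed simp

lemma ps_le: "a \<ge> 0 \<Longrightarrow> ps a m n \<le> real n powr (2 * a)"
  unfolding ps_def nat_sq_powr[symmetric] using bp_defect_le[of m n] bp_le_1[of m n]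
  by (intro powr_mono2) auto

lemma ps_limit: assumes "n \<ge> 1" shows "(\<lambda>m. ps a m n) \<longlonglongrightarrow> real n powr (2 * a)"
  unfolding ps_def nat_sq_powr[symmetric]
  using bp_limits[of n] assms by (intro tendsto_powr tendsto_const) auto

text \<open>With \<open>K = m powr a\<close> and the cone symbol \<open>Q\<close>, one has
  \<open>ps a m n = K * (1 - Q n)\<close>, so 1 / (M + ps) is 1 / (M + K) times a geometric series
  in \<open>\<rho> * Q\<close>, where \<open>\<rho> = K / (M + K) < 1\<close>. The subtracted term
  is the constant one of the series; it tends to zero as \<open>m\<close> grows.\<close>

lemma cone_resolvent:
  assumes a: "0 < a" "a \<le> 1" and M: "M > 0" and m: "m \<ge> 1"
  shows "cone m (\<lambda>n. 1 / (M + ps a m n) - 1 / (M + real m powr a))"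
proof (rule cone_sums)
  define K where "K = real m powr a"
  define Q where "Q n = 1 - (1 - bp m n) powr a" for n
  define \<rho> where "\<rho> = K / (M + K)"
  have K: "K > 0" using m by (simp add: K_def)
  have rho: "0 \<le> \<rho>" "\<rho> < 1" using M K by (auto simp: \<rho>_def)
  show "cone m (\<lambda>n. (1 / (M + K) * \<rho> ^ Suc j) * Q n ^ Suc j)" for j
    unfolding Q_def using a M K rho by (intro cone_scale cone_power cone_fractional) auto
  fix n assume "n \<in> {1..m}"
  have "0 \<le> (1 - bp m n) powr a" "(1 - bp m n) powr a \<le> 1"
    using bp_le_1[of m n] bp_nonneg[of m n] a by (auto intro!: powr_le1)
  then have Q: "0 \<le> Q n" "Q n \<le> 1" by (auto simp: Q_def)
  have lt: "norm (\<rho> * Q n) < 1"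
    using rho Q mult_left_le[of "Q n" \<rho>] by (simp add: abs_mult)
  have "(\<lambda>j. (\<rho> * Q n) ^ j) sums (1 / (1 - \<rho> * Q n))" by (rule geometric_sums[OF lt])
  then have "(\<lambda>j. (\<rho> * Q n) ^ Suc j) sums (1 / (1 - \<rho> * Q n) - 1)" by (subst sums_Suc_iff) simp
  from sums_mult[OF this, of "1 / (M + K)"]
  have s: "(\<lambda>j. 1 / (M + K) * (\<rho> * Q n) ^ Suc j) sums (1 / (M + K) * (1 / (1 - \<rho> * Q n) - 1))" .
  have ps: "ps a m n = K * (1 - Q n)" by (simp add: ps_eq K_def Q_def)
  have "(M + K) * (1 - \<rho> * Q n) = M + ps a m n"
    using M K by (simp add: \<rho>_def ps field_simps)
  then have "1 / (M + K) * (1 / (1 - \<rho> * Q n) - 1) = 1 / (M + ps a m n) - 1 / (M + K)"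
    by (simp add: right_diff_distrib)
  with s show "(\<lambda>j. (1 / (M + K) * \<rho> ^ Suc j) * Q n ^ Suc j) sums (1 / (M + ps a m n) - 1 / (M + real m powr a))"
    by (simp add: power_mult_distrib mult_ac K_def)
qed

text \<open>The factor \<open>bp k\<close> confines the symbol to frequencies up to
  \<open>k\<close>. The cut-off thus stays fixed while \<open>m\<close> tends to infinity, where
  \<open>ps a m n\<close> becomes the exact power and the constant subtracted in
  \<open>cone_resolvent\<close> disappears.\<close>

lemma cone_bp_resolvent:
  assumes a: "0 < a" "a \<le> 1" and M: "M > 0"
  shows "cone k (\<lambda>n. bp k n * (1 / (M + real n powr (2 * a))) ^ Suc j)"
proof (rule cone_limit[where b = "Suc k"])
  fix m assume m: "Suc k \<le> m"
  have "cone m (bp k)"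
    using cone_support[of k m "bp k"] cone_bp[of k] m by (simp add: bp_eq_0)
  then have "cone m (\<lambda>n. bp k n * (1 / (M + ps a m n) - 1 / (M + real m powr a)) ^ Suc j)"
    using m by (intro cone_mult cone_power cone_resolvent a M) auto
  then show "cone k (\<lambda>n. bp k n * (1 / (M + ps a m n) - 1 / (M + real m powr a)) ^ Suc j)"
    by (subst (asm) cone_support[of k m]) (use m in \<open>auto simp: bp_eq_0\<close>)
next
  fix n assume n: "n \<in> {1..k}"
  have "(\<lambda>m. 1 / (M + real m powr a)) \<longlonglongrightarrow> 0"
  proof (rule Lim_null_comparison)
    show "\<forall>\<^sub>F m in sequentially. norm (1 / (M + real m powr a)) \<le> real m powr (- a)"
      using eventually_gt_at_top[of 0]
    proof eventually_elim
      fix m :: nat assume "0 < m"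
      then have "0 < real m powr a" by simp
      then show "norm (1 / (M + real m powr a)) \<le> real m powr (- a)"
        using M by (simp add: powr_minus inverse_eq_divide frac_le)
    qed
    show "(\<lambda>m. real m powr (- a)) \<longlonglongrightarrow> 0"
      using a by (intro tendsto_neg_powr filterlim_real_sequentially) auto
  qed
  moreover have "M + real n powr (2 * a) \<noteq> 0" using M by (smt (verit) powr_ge_zero)
  ultimately have "(\<lambda>m. bp k n * (1 / (M + ps a m n) - 1 / (M + real m powr a)) ^ Suc j) \<longlonglongrightarrow> bp k n * (1 / (M + real n powr (2 * a)) - 0) ^ Suc j"
    using n by (intro tendsto_intros ps_limit) auto
  then show "(\<lambda>m. bp k n * (1 / (M + ps a m n) - 1 / (M + real m powr a)) ^ Suc j) \<longlonglongrightarrow> bp k n * (1 / (M + real n powr (2 * a))) ^ Suc j"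
    by simp
qed

lemma cone_apply:
  assumes r: "cone m r" and f: "integrable circ f" and sgn: "AE y in circ. 0 \<le> f y * sin y"
  shows "0 \<le> (\<Sum>n\<in>{1..m}. r n * Sc f (real n) * sin (real n * x)) * sin x"
proof -
  have i: "integrable circ (\<lambda>y. r n * sin (real n * x) * (f y * sin (real n * y)))" for n
    using integrable_mult_sin[OF f, of "real n"] by simp
  have "AE y in circ. 0 \<le> f y * mk r m x y * sin x"
    using sgn
  proof eventually_elim
    fix y assume "0 \<le> f y * sin y"
    show "0 \<le> f y * mk r m x y * sin x"
    proof (cases "sin y = 0")
      case False
      have "0 \<le> (f y * sin y) * (mk r m x y * (sin x * sin y))"
        by (rule mult_nonneg_nonneg[OF _ coneD[OF r]]) fact
      also have "\<dots> = (f y * mk r m x y * sin x) * (sin y)\<^sup>2" by (simp add: power2_eq_square mult_ac)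
      finally show ?thesis using False by (simp add: zero_le_mult_iff)
    qed (simp add: mk_zero)
  qed
  then have "0 \<le> (\<integral>y. f y * mk r m x y * sin x \<partial>circ)" by (rule Bochner_Integration.integral_nonneg_AE)
  also have "(\<integral>y. f y * mk r m x y * sin x \<partial>circ) = (\<integral>y. f y * mk r m x y \<partial>circ) * sin x" by simp
  also have "(\<integral>y. f y * mk r m x y \<partial>circ) = (\<integral>y. (\<Sum>n\<in>{1..m}. r n * sin (real n * x) * (f y * sin (real n * y))) \<partial>circ)"
    unfolding mk_def sum_distrib_left by (intro Bochner_Integration.integral_cong sum.cong refl) (simp add: mult_ac)
  also have "\<dots> = (\<Sum>n\<in>{1..m}. r n * sin (real n * x) * Sc f (real n))"
    by (subst Bochner_Integration.integral_sum[OF i]) (simp add: Sc_def)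
  also have "\<dots> = (\<Sum>n\<in>{1..m}. r n * Sc f (real n) * sin (real n * x))"
    by (simp add: mult_ac)
  finally show ?thesis .
qed

text \<open>Apply the multiplier to \<open>f\<close>: by \<open>cone_apply\<close> the result has
  the sign of \<open>sin\<close>, hence a nonnegative product with \<open>g\<close>. This bilinear
  version fits the factorized coefficient differences of a polarization.\<close>

lemma cone_form_nonneg:
  assumes r: "cone m r" and f: "integrable circ f" "AE y in circ. 0 \<le> f y * sin y"
    and g: "integrable circ g" "AE y in circ. 0 \<le> g y * sin y"
  shows "0 \<le> (\<Sum>n\<in>{1..m}. r n * (Sc f (real n) * Sc g (real n)))"
proof -
  define F where "F x = (\<Sum>n\<in>{1..m}. r n * Sc f (real n) * sin (real n * x))" for x
  have i: "integrable circ (\<lambda>x. r n * Sc f (real n) * (g x * sin (real n * x)))" for n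
    using integrable_mult_sin[OF g(1), of "real n"] by simp
  have F: "0 \<le> F x * sin x" for x unfolding F_def by (rule cone_apply[OF r f])
  have "AE x in circ. 0 \<le> g x * F x"
    using g(2)
  proof eventually_elim
    fix x assume "0 \<le> g x * sin x"
    show "0 \<le> g x * F x"
    proof (cases "sin x = 0")
      case True then show ?thesis by (simp add: F_def sin_nat_zero)
    next
      case False
      have "0 \<le> (g x * sin x) * (F x * sin x)" by (rule mult_nonneg_nonneg[OF _ F]) fact
      also have "\<dots> = (g x * F x) * (sin x)\<^sup>2" by (simp add: power2_eq_square mult_ac)
      finally show ?thesis using False by (simp add: zero_le_mult_iff)
    qed
  qed
  then have "0 \<le> (\<integral>x. g x * F x \<partial>circ)" by (rule Bochner_Integration.integral_nonneg_AE)
  also have "\<dots> = (\<integral>x. (\<Sum>n\<in>{1..m}. r n * Sc f (real n) * (g x * sin (real n * x))) \<partial>circ)"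
    unfolding F_def sum_distrib_left by (intro Bochner_Integration.integral_cong sum.cong refl) (simp add: mult_ac)
  also have "\<dots> = (\<Sum>n\<in>{1..m}. r n * Sc f (real n) * Sc g (real n))"
    by (subst Bochner_Integration.integral_sum[OF i]) (simp add: Sc_def[of g])
  also have "\<dots> = (\<Sum>n\<in>{1..m}. r n * (Sc f (real n) * Sc g (real n)))"
    by (simp add: mult.assoc)
  finally show ?thesis .
qed

section \<open>Translation and polarization\<close>

lemma
  fixes f g :: "'a \<Rightarrow> real"
  assumes f: "f summable_on A" and g: "g summable_on A"
  shows summable_on_difference: "(\<lambda>x. f x - g x) summable_on A"
    and infsum_difference: "infsum (\<lambda>x. f x - g x) A = infsum f A - infsum g A"
proof -
  have g': "(\<lambda>x. (-1) * g x) summable_on A" by (intro summable_on_cmult_right g)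
  have *: "(\<lambda>x. f x - g x) = (\<lambda>x. f x + (-1) * g x)" by (simp add: fun_eq_iff)
  show "(\<lambda>x. f x - g x) summable_on A" unfolding * by (rule summable_on_add[OF f g'])
  have "infsum (\<lambda>x. f x - g x) A = infsum f A + infsum (\<lambda>x. (-1) * g x) A"
    unfolding * by (rule infsum_add[OF f g'])
  also have "infsum (\<lambda>x. (-1) * g x) A = (-1) * infsum g A" by (rule infsum_cmult_right')
  finally show "infsum (\<lambda>x. f x - g x) A = infsum f A - infsum g A" by simp
qed

definition sh :: "real \<Rightarrow> (real \<Rightarrow> real) \<Rightarrow> real \<Rightarrow> real" where "sh p u y = u (y + p)"

lemma per2pi_sh: "per2pi u \<Longrightarrow> per2pi (sh p u)"
proof -
  assume u: "per2pi u"
  have "u (x + p + 2 * pi) = u (x + p)" for x using u unfolding per2pi_def by blast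
  then show ?thesis by (simp add: per2pi_def sh_def algebra_simps)
qed

lemma measurable_sh: "u \<in> borel_measurable lebesgue \<Longrightarrow> sh p u \<in> borel_measurable lebesgue"
  using measurable_lebesgue_affine[of u 1 p] by (simp add: sh_def[abs_def] add.commute)

lemma
  fixes f :: "real \<Rightarrow> real"
  assumes "per2pi u" "integrable circ (\<lambda>x. f (u x))"
  shows integrable_sh: "integrable circ (\<lambda>x. f (sh p u x))"
    and integral_sh: "(\<integral>x. f (sh p u x) \<partial>circ) = (\<integral>x. f (u x) \<partial>circ)"
  using integrable_circ_shift[of "\<lambda>x. f (u x)" p] integral_circ_shift[of "\<lambda>x. f (u x)" p] assms
  by (auto simp: sh_def per2pi_def)

lemma sq_int_sh:
  assumes "per2pi u" "u \<in> borel_measurable lebesgue" "sq_int circ u"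
  shows "sq_int circ (sh p u)"
  using integrable_sh[of u "\<lambda>x. x\<^sup>2" p] measurable_circ_lebesgue[OF measurable_sh[OF assms(2)]] assms
  by (simp add: sq_int_def)

lemma fcoeff_sh:
  assumes u: "per2pi u" "integrable circ u"
  shows "fcoeff (sh p u) n = cis (of_int n * p) * fcoeff u n"
proof -
  let ?f = "\<lambda>x. of_real (u x) * cis (- (of_int n * x))"
  have int: "integrable circ ?f" by (rule integrable_mult_bounded[of _ _ _ 1]) (use u in auto)
  have per: "?f (x + 2 * pi) = ?f x" for x
  proof -
    have "cis (- (of_int n * (x + 2 * pi))) = cis (- (of_int n * x)) * cis (2 * pi * of_int (- n))"
      by (simp add: cis_mult algebra_simps)
    then show ?thesis using u(1) cis_multiple_2pi[of "of_int (- n)"] by (simp add: per2pi_def)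
  qed
  have "(\<integral>x. of_real (sh p u x) * cis (- (of_int n * x)) \<partial>circ) = (\<integral>x. cis (of_int n * p) * ?f (x + p) \<partial>circ)"
  proof (intro Bochner_Integration.integral_cong refl)
    fix x
    have "cis (- (of_int n * x)) = cis (of_int n * p) * cis (- (of_int n * (x + p)))"
      by (simp add: cis_mult algebra_simps)
    then show "of_real (sh p u x) * cis (- (of_int n * x)) = cis (of_int n * p) * ?f (x + p)"
      by (simp add: sh_def)
  qed
  also have "\<dots> = cis (of_int n * p) * (\<integral>x. ?f x \<partial>circ)"
    using integral_circ_shift[of ?f p, OF per int] by simp
  finally show ?thesis by (simp add: fcoeff_circ)
qed

lemma cmod_fcoeff_sh: "per2pi u \<Longrightarrow> integrable circ u \<Longrightarrow> cmod (fcoeff (sh p u) n) = cmod (fcoeff u n)"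
  by (simp add: fcoeff_sh norm_mult)

lemma dq_sh: "per2pi u \<Longrightarrow> integrable circ u \<Longrightarrow> dq t (sh p u) = dq t u"
  by (simp add: dq_def cmod_fcoeff_sh)

lemma A0_sh:
  assumes u: "u \<in> A0 t" and t: "t > 1/2" shows "sh p u \<in> A0 t"
proof -
  have per: "per2pi u" and m: "u \<in> borel_measurable lebesgue" and H: "Hs t u" and z: "(\<integral>x. u x \<partial>circ) = 0"
    and one: "(\<integral>x. u x ^ 4 \<partial>circ) = 1" using u by (auto simp: A0_def H0_def)
  note i = Hs_integrable[OF H]
  have "Hs t (sh p u)" using sq_int_sh[OF per m Hs_sq_int[OF H]] H by (simp add: Hs_def cmod_fcoeff_sh[OF per i])
  then show ?thesis
    using per2pi_sh[OF per] measurable_sh[OF m] integral_sh[of u "\<lambda>x. x" p] integral_sh[of u "\<lambda>x. x ^ 4" p]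
      per i z one Sobolev_L4(1)[OF H t] by (simp add: A0_def H0_def)
qed

lemma Bc_sh:
  assumes u: "u \<in> A0 t" shows "Bc t c (sh p u) = Bc t c u"
proof -
  have per: "per2pi u" and H: "Hs t u" using u by (auto simp: A0_def H0_def)
  show ?thesis using integral_sh[of u "\<lambda>x. x\<^sup>2" p] per Hs_sq_int[OF H]
    by (simp add: Bc_eq dq_sh[OF per Hs_integrable[OF H]] sq_int_def)
qed

section \<open>Polarization with respect to the reflection of y into -y\<close>

definition pol :: "(real \<Rightarrow> real) \<Rightarrow> real \<Rightarrow> real" where
  "pol u y = (if 0 \<le> sin y then max (u y) (u (- y)) else min (u y) (u (- y)))"

lemma per2pi_neg: assumes "per2pi u" shows "u (- (y + 2 * pi)) = u (- y)"
proof -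
  have "u (- (y + 2 * pi) + 2 * pi) = u (- (y + 2 * pi))" using assms unfolding per2pi_def by blast
  then show ?thesis by simp
qed

lemma per2pi_sin_zero:
  assumes "per2pi u" "sin y = 0" shows "u (- y) = u y"
proof -
  obtain k :: int where k: "y = of_int k * pi" using assms(2) by (auto simp: sin_zero_iff_int2)
  have "u (- y + 2 * pi * of_int k) = u (- y)"
    by (rule periodic_int_multiple) (use assms(1) in \<open>simp add: per2pi_def\<close>)
  moreover have "- y + 2 * pi * of_int k = y" using k by simp
  ultimately show ?thesis by (simp only:)
qed

lemma per2pi_pol: "per2pi u \<Longrightarrow> per2pi (pol u)"
  unfolding per2pi_def[of "pol u"] pol_def using per2pi_neg[of u] by (auto simp: per2pi_def)

lemma measurable_pol:
  assumes "u \<in> borel_measurable lebesgue" shows "pol u \<in> borel_measurable lebesgue"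
proof -
  have [measurable]: "u \<in> borel_measurable lebesgue" by fact
  have [measurable]: "(\<lambda>y. u (- y)) \<in> borel_measurable lebesgue"
    using measurable_lebesgue_affine[OF assms, of "-1" 0] by simp
  have [measurable]: "sin \<in> borel_measurable (lebesgue :: real measure)"
    by (intro borel_measurable_continuous_onI continuous_intros measurable_completion) simp
  show ?thesis unfolding pol_def[abs_def] by measurable
qed

text \<open>At zeros of \<open>sin\<close> the points \<open>y\<close> and \<open>- y\<close>
  coincide modulo the period, so there the choice between maximum and minimum is immaterial.\<close>

lemma pol_cases: "per2pi u \<Longrightarrow> (pol u y = u y \<and> pol u (- y) = u (- y)) \<or> (pol u y = u (- y) \<and> pol u (- y) = u y)"
  using per2pi_sin_zero[of u y] by (auto simp: pol_def max_def min_def)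

lemma pol_sin_nonneg: "0 \<le> (pol u y - u y) * sin y" "0 \<le> (pol u y - u (- y)) * sin y"
  by (auto simp: pol_def max_def min_def zero_le_mult_iff)

lemma pol_dominated:
  fixes f :: "real \<Rightarrow> real"
  assumes per: "per2pi u" and int: "integrable circ (\<lambda>y. f (u y))" and m: "(\<lambda>y. f (pol u y)) \<in> borel_measurable circ"
  shows "integrable circ (\<lambda>y. f (pol u y))"
proof (rule Bochner_Integration.integrable_bound[OF _ m])
  show "integrable circ (\<lambda>y. \<bar>f (u y)\<bar> + \<bar>f (u (- y))\<bar>)"
    using int integrable_circ_reflect[of "\<lambda>y. f (u y)"] by simp
  show "AE y in circ. norm (f (pol u y)) \<le> norm (\<bar>f (u y)\<bar> + \<bar>f (u (- y))\<bar>)"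
  proof (rule AE_I2)
    fix y show "norm (f (pol u y)) \<le> norm (\<bar>f (u y)\<bar> + \<bar>f (u (- y))\<bar>)"
      using pol_cases[OF per, of y] by auto
  qed
qed

text \<open>Polarization only permutes the two values at \<open>y\<close> and \<open>- y\<close>,
  and an even weight does not notice. Weight 1 gives all integrals of functions of \<open>u\<close>,
  cosine weights give the cosine coefficients.\<close>

lemma integral_pol_even:
  fixes f e :: "real \<Rightarrow> real"
  assumes per: "per2pi u" and e: "\<And>y. e (- y) = e y"
    and int: "integrable circ (\<lambda>y. f (u y) * e y)" "integrable circ (\<lambda>y. f (pol u y) * e y)"
  shows "(\<integral>y. f (pol u y) * e y \<partial>circ) = (\<integral>y. f (u y) * e y \<partial>circ)"
proof -
  have int': "integrable circ (\<lambda>y. f (u (- y)) * e y)" "integrable circ (\<lambda>y. f (pol u (- y)) * e y)"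
    using integrable_circ_reflect[of "\<lambda>y. f (u y) * e y"] integrable_circ_reflect[of "\<lambda>y. f (pol u y) * e y"] int
    by (simp_all add: e)
  have r: "(\<integral>y. f (u (- y)) * e y \<partial>circ) = (\<integral>y. f (u y) * e y \<partial>circ)"
    "(\<integral>y. f (pol u (- y)) * e y \<partial>circ) = (\<integral>y. f (pol u y) * e y \<partial>circ)"
    using integral_circ_reflect[of "\<lambda>y. f (u y) * e y"] integral_circ_reflect[of "\<lambda>y. f (pol u y) * e y"]
    by (simp_all add: e)
  have "(\<integral>y. f (pol u y) * e y + f (pol u (- y)) * e y \<partial>circ) = (\<integral>y. f (u y) * e y + f (u (- y)) * e y \<partial>circ)"
  proof (intro Bochner_Integration.integral_cong refl)
    fix y show "f (pol u y) * e y + f (pol u (- y)) * e y = f (u y) * e y + f (u (- y)) * e y"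
      using pol_cases[OF per, of y] by auto
  qed
  then show ?thesis using int int' r by simp
qed

lemma Sc_reflect: "Sc (\<lambda>y. u (- y)) a = - Sc u a"
proof -
  have "Sc (\<lambda>y. u (- y)) a = (\<integral>y. - (u (- y) * sin (a * (- y))) \<partial>circ)" by (simp add: Sc_def)
  also have "\<dots> = - (\<integral>y. u (- y) * sin (a * (- y)) \<partial>circ)" by (rule Bochner_Integration.integral_minus)
  also have "(\<integral>y. u (- y) * sin (a * (- y)) \<partial>circ) = Sc u a"
    unfolding Sc_def by (rule integral_circ_reflect)
  finally show ?thesis .
qed

lemma Sc_diff: "integrable circ u \<Longrightarrow> integrable circ v \<Longrightarrow> Sc (\<lambda>x. u x - v x) a = Sc u a - Sc v a"
  using integrable_mult_sin[of u a] integrable_mult_sin[of v a] by (simp add: Sc_def left_diff_distrib)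

lemma Sc_neg: "Sc u (- a) = - Sc u a" by (simp add: Sc_def)

text \<open>With \<open>f = pol u - u \<circ> uminus\<close> and \<open>h = pol u - u\<close>, both of the sign of \<open>sin\<close>, the sine coefficients satisfy
  \<open>S f * S h = (S (pol u))\<^sup>2 - (S u)\<^sup>2\<close>, while the cosine coefficients of \<open>pol u\<close> and \<open>u\<close> agree.\<close>

theorem polarization_inequality:
  assumes a: "0 < a" "a \<le> 1" and per: "per2pi u" and m: "u \<in> borel_measurable lebesgue" and H: "Hs (2 * a) u"
  shows "Hs (2 * a) (pol u)" "dq (2 * a) (pol u) \<le> dq (2 * a) u"
    "(\<integral>y. (pol u y)\<^sup>2 \<partial>circ) = (\<integral>y. (u y)\<^sup>2 \<partial>circ)" "\<And>b. Cc (pol u) b = Cc u b"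
proof -
  let ?P = "pol u"
  have mP [measurable]: "?P \<in> borel_measurable circ" by (rule measurable_circ_lebesgue[OF measurable_pol[OF m]])
  have s: "sq_int circ u" by (rule Hs_sq_int[OF H])
  have iu: "integrable circ u" by (rule Hs_integrable[OF H])
  have iu': "integrable circ (\<lambda>y. u (- y))" using iu integrable_circ_reflect[of u] by simp
  have sP: "sq_int circ ?P"
    using pol_dominated[OF per, of "\<lambda>x. x\<^sup>2"] s by (simp add: sq_int_def)
  have iP: "integrable circ ?P" by (rule sq_int_integrable[OF finite_measure_circ sP])
  show C: "Cc ?P b = Cc u b" for b
    unfolding Cc_def using integral_pol_even[OF per, of "\<lambda>y. cos (b * y)" "\<lambda>x. x"] integrable_mult_cos[OF iu, of b] integrable_mult_cos[OF iP, of b]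
    by simp
  show sqeq: "(\<integral>y. (?P y)\<^sup>2 \<partial>circ) = (\<integral>y. (u y)\<^sup>2 \<partial>circ)"
    using integral_pol_even[OF per, of "\<lambda>y. 1" "\<lambda>x. x\<^sup>2"] s sP by (simp add: sq_int_def)
  have SS: "Sc (\<lambda>y. ?P y - u (- y)) b * Sc (\<lambda>y. ?P y - u y) b = (Sc ?P b)\<^sup>2 - (Sc u b)\<^sup>2" for b
    by (simp add: Sc_diff iu iu' iP Sc_reflect power2_eq_square algebra_simps)
  define d where "d k = (cmod (fcoeff ?P k))\<^sup>2 - (cmod (fcoeff u k))\<^sup>2" for k
  have d: "d k = ((Sc ?P (of_int k))\<^sup>2 - (Sc u (of_int k))\<^sup>2) / (4 * pi\<^sup>2)" for k
    by (simp add: d_def cmod_fcoeff[OF iu] cmod_fcoeff[OF iP] C diff_divide_distrib[symmetric])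
  have dneg: "d (- k) = d k" for k by (simp add: d Sc_neg)
  have d0: "d 0 = 0" by (simp add: d Sc_def)
  \<comment> \<open>Equality of the L^2 norms: by Parseval the changes of the squared coefficients
    add up to zero.\<close>
  have sums: "d summable_on UNIV" "infsum d UNIV = 0"
  proof -
    note p = Parseval_summable[OF sP] Parseval_summable[OF s]
    show "d summable_on UNIV" unfolding d_def by (rule summable_on_difference[OF p])
    have "infsum d UNIV = (\<Sum>\<^sub>\<infinity>k. (cmod (fcoeff ?P k))\<^sup>2) - (\<Sum>\<^sub>\<infinity>k. (cmod (fcoeff u k))\<^sup>2)"
      unfolding d_def by (rule infsum_difference[OF p])
    then show "infsum d UNIV = 0" using sqeq by (simp add: Parseval[OF s] Parseval[OF sP])
  qed
  \<comment> \<open>Finite sums with the approximate symbol \<open>ps a m\<close> are bounded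
    uniformly in \<open>m\<close>; then \<open>m\<close> tends to infinity with \<open>N\<close>
    fixed.\<close>
  have key: "(\<Sum>k\<in>{- int N..int N}. \<bar>real_of_int k\<bar> powr (2 * a) * (cmod (fcoeff ?P k))\<^sup>2) \<le> dq (2 * a) u" for N
  proof (rule LIMSEQ_le_const2)
    have psl: "(\<lambda>m. ps a m (nat \<bar>k\<bar>)) \<longlonglongrightarrow> \<bar>real_of_int k\<bar> powr (2 * a)" for k
    proof (cases "k = 0")
      case False
      then show ?thesis using ps_limit[of "nat \<bar>k\<bar>" a] by simp
    qed (simp add: ps_def bp_0)
    show "(\<lambda>m. \<Sum>k\<in>{- int N..int N}. ps a m (nat \<bar>k\<bar>) * (cmod (fcoeff ?P k))\<^sup>2)
      \<longlonglongrightarrow> (\<Sum>k\<in>{- int N..int N}. \<bar>real_of_int k\<bar> powr (2 * a) * (cmod (fcoeff ?P k))\<^sup>2)"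
      by (intro tendsto_intros psl)
    have "(\<Sum>k\<in>{- int N..int N}. ps a m (nat \<bar>k\<bar>) * (cmod (fcoeff ?P k))\<^sup>2) \<le> dq (2 * a) u" for m
    proof -
      define W where "W k = (1 - bp m (nat \<bar>k\<bar>)) powr a" for k :: int
      have W: "0 \<le> W k" "W k \<le> 1" for k
        unfolding W_def using bp_le_1[of m] bp_nonneg[of m] a by (auto intro!: powr_le1)
      have ps: "ps a m (nat \<bar>k\<bar>) = real m powr a * W k" for k by (simp add: ps_eq W_def)
      have sW: "(\<lambda>k. W k * (cmod (fcoeff v k))\<^sup>2) summable_on UNIV" if "sq_int circ v" for v
        by (rule summable_on_comparison_test[OF Parseval_summable[OF that]]) (auto simp: W mult_left_le_one_le)
      have "0 \<le> (\<Sum>n\<in>{1..m}. (1 - (1 - bp m n) powr a) * (Sc (\<lambda>y. ?P y - u (- y)) (real n) * Sc (\<lambda>y. ?P y - u y) (real n)))"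
        by (rule cone_form_nonneg[OF cone_fractional])
          (use a iu iu' iP pol_sin_nonneg in \<open>auto intro!: AE_I2\<close>)
      also have "\<dots> = 4 * pi\<^sup>2 * (\<Sum>n\<in>{1..m}. (1 - W (int n)) * d (int n))"
        unfolding sum_distrib_left SS by (intro sum.cong refl) (simp add: W_def d)
      finally have "0 \<le> (\<Sum>n\<in>{1..m}. (1 - W (int n)) * d (int n))"
        by (simp add: zero_le_mult_iff)
      moreover have "(\<Sum>k\<in>{- int m..int m}. (1 - W k) * d k) = 2 * (\<Sum>n\<in>{1..m}. (1 - W (int n)) * d (int n))"
        unfolding sum_int_interval by (simp add: d0 dneg W_def sum.distrib sum_distrib_left mult_ac)
      ultimately have nn: "0 \<le> (\<Sum>k\<in>{- int m..int m}. (1 - W k) * d k)" by simp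
      \<comment> \<open>Above frequency \<open>m\<close> the coefficients \<open>bp\<close> vanish
        and \<open>W k = 1\<close>, so the infinite sum is the finite one.\<close>
      have "(\<Sum>\<^sub>\<infinity>k. (1 - W k) * d k) = (\<Sum>\<^sub>\<infinity>k\<in>{- int m..int m}. (1 - W k) * d k)"
        by (rule infsum_cong_neutral) (auto simp: W_def bp_eq_0)
      with nn have nn': "0 \<le> (\<Sum>\<^sub>\<infinity>k. (1 - W k) * d k)" by simp
      have sWd: "(\<lambda>k. W k * d k) summable_on UNIV"
        unfolding d_def right_diff_distrib by (intro summable_on_difference sW s sP)
      \<comment> \<open>As \<open>d\<close> sums to zero, a nonnegative sum of
        \<open>(1 - W k) * d k\<close> is a nonpositive sum of \<open>W k * d k\<close>.\<close>
      have "(\<Sum>\<^sub>\<infinity>k. (1 - W k) * d k) = infsum d UNIV - (\<Sum>\<^sub>\<infinity>k. W k * d k)"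
        unfolding left_diff_distrib mult_1 by (rule infsum_difference[OF sums(1) sWd])
      also have "(\<Sum>\<^sub>\<infinity>k. W k * d k) = (\<Sum>\<^sub>\<infinity>k. W k * (cmod (fcoeff ?P k))\<^sup>2) - (\<Sum>\<^sub>\<infinity>k. W k * (cmod (fcoeff u k))\<^sup>2)"
        unfolding d_def right_diff_distrib by (intro infsum_difference sW s sP)
      finally have le: "(\<Sum>\<^sub>\<infinity>k. W k * (cmod (fcoeff ?P k))\<^sup>2) \<le> (\<Sum>\<^sub>\<infinity>k. W k * (cmod (fcoeff u k))\<^sup>2)"
        using nn' sums(2) by simp
      have "(\<Sum>k\<in>{- int N..int N}. ps a m (nat \<bar>k\<bar>) * (cmod (fcoeff ?P k))\<^sup>2) = real m powr a * (\<Sum>k\<in>{- int N..int N}. W k * (cmod (fcoeff ?P k))\<^sup>2)"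
        by (simp add: ps sum_distrib_left mult.assoc)
      also have "\<dots> \<le> real m powr a * (\<Sum>\<^sub>\<infinity>k. W k * (cmod (fcoeff ?P k))\<^sup>2)"
        by (intro mult_left_mono finite_sum_le_infsum sW sP) (auto simp: W)
      also have "\<dots> \<le> real m powr a * (\<Sum>\<^sub>\<infinity>k. W k * (cmod (fcoeff u k))\<^sup>2)"
        by (intro mult_left_mono le) auto
      also have "\<dots> = (\<Sum>\<^sub>\<infinity>k. real m powr a * (W k * (cmod (fcoeff u k))\<^sup>2))"
        by (rule infsum_cmult_right'[symmetric])
      also have "\<dots> \<le> dq (2 * a) u"
        unfolding dq_def
      proof (rule infsum_mono)
        show "(\<lambda>k. real m powr a * (W k * (cmod (fcoeff u k))\<^sup>2)) summable_on UNIV" by (intro summable_on_cmult_right sW s)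
        show "(\<lambda>k. \<bar>real_of_int k\<bar> powr (2 * a) * (cmod (fcoeff u k))\<^sup>2) summable_on UNIV" using a by (intro dq_summable H) auto
        show "real m powr a * (W k * (cmod (fcoeff u k))\<^sup>2) \<le> \<bar>real_of_int k\<bar> powr (2 * a) * (cmod (fcoeff u k))\<^sup>2" for k
          unfolding mult.assoc[symmetric] ps[symmetric] using ps_le[of a m "nat \<bar>k\<bar>"] a by (intro mult_right_mono) auto
      qed
      finally show ?thesis .
    qed
    then show "\<exists>M. \<forall>m\<ge>M. (\<Sum>k\<in>{- int N..int N}. ps a m (nat \<bar>k\<bar>) * (cmod (fcoeff ?P k))\<^sup>2) \<le> dq (2 * a) u" by blast
  qed
  note S = int_summable_bounded[where f = "\<lambda>k. \<bar>real_of_int k\<bar> powr (2 * a) * (cmod (fcoeff ?P k))\<^sup>2", OF dq_term_nonneg key]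
  show "dq (2 * a) ?P \<le> dq (2 * a) u" unfolding dq_def[of "2 * a" ?P] by (rule S(2))
  have "(\<lambda>k. jb (2 * a / 2) k * (cmod (fcoeff ?P k))\<^sup>2) summable_on UNIV"
  proof (rule summable_on_comparison_test)
    show "(\<lambda>k. 2 powr a * (\<bar>real_of_int k\<bar> powr (2 * a) * (cmod (fcoeff ?P k))\<^sup>2) + (cmod (fcoeff ?P k))\<^sup>2) summable_on UNIV"
      by (intro summable_on_add summable_on_cmult_right S(1) Parseval_summable sP)
    fix k :: int
    have "jb a k \<le> 2 powr a * \<bar>real_of_int k\<bar> powr (2 * a) + 1"
    proof (cases "k = 0")
      case False
      then have "1 \<le> \<bar>real_of_int k\<bar>" by linarith
      then have "1\<^sup>2 \<le> \<bar>real_of_int k\<bar>\<^sup>2" by (rule power_mono) simp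
      then have "jb a k \<le> (2 * (of_int k)\<^sup>2) powr a"
        unfolding jb_def using a by (intro powr_mono2) auto
      also have "\<dots> = 2 powr a * \<bar>real_of_int k\<bar> powr (2 * a)"
      proof -
        have "(real_of_int k)\<^sup>2 = \<bar>real_of_int k\<bar> powr 2" using False by simp
        then show ?thesis by (simp add: powr_mult powr_powr del: powr_numeral)
      qed
      finally show ?thesis by simp
    qed (simp add: jb_def)
    from mult_right_mono[OF this, of "(cmod (fcoeff ?P k))\<^sup>2"]
    show "jb (2 * a / 2) k * (cmod (fcoeff ?P k))\<^sup>2 \<le> 2 powr a * (\<bar>real_of_int k\<bar> powr (2 * a) * (cmod (fcoeff ?P k))\<^sup>2) + (cmod (fcoeff ?P k))\<^sup>2"
      by (simp add: distrib_right mult.assoc)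
  qed (simp add: less_imp_le[OF jb_pos])
  then show "Hs (2 * a) ?P" using sP by (simp add: Hs_def)
qed

lemma A0_pol:
  assumes t: "1/2 < t" "t \<le> 2" and u: "u \<in> A0 t"
  shows "pol u \<in> A0 t" "Bc t c (pol u) \<le> Bc t c u"
proof -
  have per: "per2pi u" and m: "u \<in> borel_measurable lebesgue" and H: "Hs t u" and z: "(\<integral>x. u x \<partial>circ) = 0"
    and one: "(\<integral>x. u x ^ 4 \<partial>circ) = 1" using u by (auto simp: A0_def H0_def)
  note P = polarization_inequality[of "t / 2" u, simplified, OF _ _ per m H]
  have HP: "Hs t (pol u)" by (rule P(1)) (use t in auto)
  have zP: "(\<integral>x. pol u x \<partial>circ) = 0" using P(4)[of 0] t z by (simp add: Cc_def)
  have "(\<integral>x. pol u x ^ 4 \<partial>circ) = 1"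
    using integral_pol_even[OF per, of "\<lambda>y. 1" "\<lambda>x. x ^ 4"] Sobolev_L4(1)[OF H t(1)] Sobolev_L4(1)[OF HP t(1)] one by simp
  then show "pol u \<in> A0 t" using HP zP per2pi_pol[OF per] measurable_pol[OF m] by (simp add: A0_def H0_def)
  show "Bc t c (pol u) \<le> Bc t c u"
    using P(2,3) t by (simp add: Bc_eq)
qed

section \<open>Balanced functions\<close>

text \<open>\<open>u\<close> and \<open>- u\<close> are equimeasurable. Unlike oddness, this is preserved by all polarizations,
  and every function of the class has a rearrangement that is odd.\<close>

definition bal :: "(real \<Rightarrow> real) \<Rightarrow> bool" where
  "bal u \<longleftrightarrow> (\<forall>f. (\<forall>x. f (- x) = - f x) \<and> (\<forall>x y. \<bar>f x - f y\<bar> \<le> \<bar>x - y\<bar>) \<longrightarrow> (\<integral>x. f (u x) \<partial>circ) = 0)"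

lemma balD:
  assumes "bal u" "\<And>x. f (- x) = - f x" "\<And>x y. \<bar>f x - f y\<bar> \<le> \<bar>x - y\<bar>"
  shows "(\<integral>x. f (u x) \<partial>circ) = 0"
  using assms unfolding bal_def by blast

lemma odd_Lipschitz:
  fixes f :: "real \<Rightarrow> real"
  assumes o: "\<And>x. f (- x) = - f x" and L: "\<And>x y. \<bar>f x - f y\<bar> \<le> \<bar>x - y\<bar>"
  shows "\<bar>f x\<bar> \<le> \<bar>x\<bar>" "f \<in> borel_measurable borel"
proof -
  have "f 0 = 0" using o[of 0] by simp
  then show "\<bar>f x\<bar> \<le> \<bar>x\<bar>" using L[of x 0] by simp
  have "continuous_on UNIV f"
    unfolding continuous_on_iff dist_real_def using L by (meson le_less_trans)
  then show "f \<in> borel_measurable borel" by (rule borel_measurable_continuous_onI)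
qed

lemma odd_Lipschitz_integrable:
  fixes f :: "real \<Rightarrow> real"
  assumes o: "\<And>x. f (- x) = - f x" and L: "\<And>x y. \<bar>f x - f y\<bar> \<le> \<bar>x - y\<bar>" and u: "integrable M u"
  shows "integrable M (\<lambda>x. f (u x))"
proof (rule Bochner_Integration.integrable_bound[OF u])
  show "(\<lambda>x. f (u x)) \<in> borel_measurable M"
    using measurable_compose[OF borel_measurable_integrable[OF u] odd_Lipschitz(2)[OF o L]] .
  show "AE x in M. norm (f (u x)) \<le> norm (u x)" using odd_Lipschitz(1)[OF o L] by auto
qed

lemma bal_odd: "odd_fun u \<Longrightarrow> bal u"
  unfolding bal_def by (intro allI impI integral_odd_fun) (auto simp: odd_fun_def)

lemma bal_sh: "per2pi u \<Longrightarrow> integrable circ u \<Longrightarrow> bal u \<Longrightarrow> bal (sh p u)"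
  unfolding bal_def
proof (intro allI impI)
  fix f :: "real \<Rightarrow> real"
  assume per: "per2pi u" and i: "integrable circ u"
    and b: "\<forall>f. (\<forall>x. f (- x) = - f x) \<and> (\<forall>x y. \<bar>f x - f y\<bar> \<le> \<bar>x - y\<bar>) \<longrightarrow> (\<integral>x. f (u x) \<partial>circ) = 0"
    and f: "(\<forall>x. f (- x) = - f x) \<and> (\<forall>x y. \<bar>f x - f y\<bar> \<le> \<bar>x - y\<bar>)"
  have "integrable circ (\<lambda>x. f (u x))" by (rule odd_Lipschitz_integrable) (use f i in auto)
  from integral_sh[OF per this, of p] b[rule_format, OF f] show "(\<integral>x. f (sh p u x) \<partial>circ) = 0" by simp
qed

lemma bal_pol:
  assumes per: "per2pi u" and i: "integrable circ u" "integrable circ (pol u)" and b: "bal u"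
  shows "bal (pol u)"
  unfolding bal_def
proof (intro allI impI)
  fix f :: "real \<Rightarrow> real" assume "(\<forall>x. f (- x) = - f x) \<and> (\<forall>x y. \<bar>f x - f y\<bar> \<le> \<bar>x - y\<bar>)"
  then have o: "\<And>x. f (- x) = - f x" and L: "\<And>x y. \<bar>f x - f y\<bar> \<le> \<bar>x - y\<bar>" by auto
  have "(\<integral>x. f (pol u x) * 1 \<partial>circ) = (\<integral>x. f (u x) * 1 \<partial>circ)"
    by (rule integral_pol_even[OF per]) (use odd_Lipschitz_integrable[OF o L] i in auto)
  then show "(\<integral>x. f (pol u x) \<partial>circ) = 0" using balD[OF b o L] by simp
qed

text \<open>Lipschitz test functions make the defining integrals continuous with respect to L^2
  convergence, which is the reason for expressing equimeasurability through them instead of level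
  sets.\<close>

lemma bal_closed:
  assumes u: "\<And>k. sq_int circ (u k)" "\<And>k. bal (u k)" and v: "sq_int circ v"
    and lim: "(\<lambda>k. \<integral>x. (u k x - v x)\<^sup>2 \<partial>circ) \<longlonglongrightarrow> 0"
  shows "bal v"
  unfolding bal_def
proof (intro allI impI)
  fix f :: "real \<Rightarrow> real" assume "(\<forall>x. f (- x) = - f x) \<and> (\<forall>x y. \<bar>f x - f y\<bar> \<le> \<bar>x - y\<bar>)"
  then have o: "\<And>x. f (- x) = - f x" and L: "\<And>x y. \<bar>f x - f y\<bar> \<le> \<bar>x - y\<bar>" by auto
  note i = odd_Lipschitz_integrable[OF o L sq_int_integrable[OF finite_measure_circ]]
  have one: "sq_int circ (\<lambda>_. 1)" by (rule sq_int_bounded[OF finite_measure_circ]) auto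
  have d: "sq_int circ (\<lambda>x. \<bar>u k x - v x\<bar>)" for k
    using sq_int_diff[OF u(1) v, of k] borel_measurable_abs[of "\<lambda>x. u k x - v x" circ] by (simp add: sq_int_def)
  have "norm (\<integral>x. f (v x) \<partial>circ) \<le> sqrt (\<integral>x. (u k x - v x)\<^sup>2 \<partial>circ) * sqrt (2 * pi)" for k
  proof -
    have "(\<integral>x. f (v x) \<partial>circ) = (\<integral>x. f (v x) - f (u k x) \<partial>circ)"
      using i[OF v] i[OF u(1)[of k]] balD[OF u(2) o L] by simp
    also have "norm \<dots> \<le> (\<integral>x. \<bar>f (v x) - f (u k x)\<bar> \<partial>circ)"
      using integral_abs_bound[of circ "\<lambda>x. f (v x) - f (u k x)"] by simp
    also have "\<dots> \<le> (\<integral>x. \<bar>u k x - v x\<bar> * 1 \<partial>circ)"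
      using i[OF v] i[OF u(1)[of k]] sq_int_mult[OF d one, of k] L
      by (intro integral_mono) (auto simp: abs_minus_commute)
    also have "\<dots> \<le> sqrt (\<integral>x. (u k x - v x)\<^sup>2 \<partial>circ) * sqrt (2 * pi)"
      using Cauchy_Schwarz_integral_abs[OF d one, of k] by (simp add: measure_circ)
    finally show ?thesis .
  qed
  note le = this
  have "(\<lambda>k. sqrt (\<integral>x. (u k x - v x)\<^sup>2 \<partial>circ) * sqrt (2 * pi)) \<longlonglongrightarrow> sqrt 0 * sqrt (2 * pi)"
    by (intro tendsto_intros lim)
  then have "(\<lambda>k. \<integral>x. f (v x) \<partial>circ) \<longlonglongrightarrow> 0"
    by (intro Lim_null_comparison[OF always_eventually[OF allI[OF le]]]) simp
  then show "(\<integral>x. f (v x) \<partial>circ) = 0" by (simp add: LIMSEQ_const_iff)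
qed

text \<open>An explicit competitor, showing that the admissible classes are nonempty.\<close>

definition normsin :: "real \<Rightarrow> real" where
  "normsin x = sin x / root 4 (\<integral>x. sin x ^ 4 \<partial>circ)"

lemma Sc_sin:
  fixes n :: nat
  assumes "n \<ge> 1"
  shows "Sc (\<lambda>x. sin (real n * x)) (of_int k) = (if k = int n then pi else if k = - int n then - pi else 0)"
proof -
  have pos: "Sc (\<lambda>x. sin (real n * x)) (real l) = (if l = n then pi else 0)" if "l \<ge> 1" for l
    using integral_circ_sin_sin[OF assms that] by (auto simp: Sc_def)
  consider l where "l \<ge> 1" "k = int l" | "k = 0" | l where "l \<ge> 1" "k = - int l"
    by (metis int_cases2 less_one linorder_not_less neg_0_equal_iff_equal of_nat_0)
  then show ?thesis
    by cases (use pos assms in \<open>auto simp: Sc_neg Sc_def[of _ 0]\<close>)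
qed

lemma normsin_A0: "normsin \<in> A0 t" "odd_fun normsin"
proof -
  define K where "K = root 4 (\<integral>x. sin x ^ 4 \<partial>circ)"
  have i4: "integrable circ (\<lambda>x. sin x ^ 4)" by (intro integrable_circ_continuous continuous_intros)
  have "(\<integral>x. sin x ^ 4 \<partial>circ) > 0"
  proof (rule ccontr)
    assume "\<not> ?thesis"
    moreover have "0 \<le> (\<integral>x. sin x ^ 4 \<partial>circ)" by (rule Bochner_Integration.integral_nonneg) simp
    ultimately have "(\<integral>x. sin x ^ 4 \<partial>circ) = 0" by linarith
    then have "AE x in circ. sin x ^ 4 = 0" using i4 by (subst (asm) integral_nonneg_eq_0_iff_AE) auto
    then have "(\<integral>x. sin (real 1 * x) * sin (real 1 * x) \<partial>circ) = 0" by (intro integral_eq_zero_AE) auto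
    then show False using integral_circ_sin_sin[of 1 1] by simp
  qed
  then have K: "K > 0" "K ^ 4 = (\<integral>x. sin x ^ 4 \<partial>circ)" by (auto simp: K_def)
  have ns: "normsin = (\<lambda>x. (1 / K) * sin x)" by (simp add: normsin_def K_def fun_eq_iff)
  show o: "odd_fun normsin" by (simp add: odd_fun_def ns)
  have c: "continuous_on UNIV normsin" unfolding ns by (intro continuous_intros)
  have s: "sq_int circ normsin" by (rule sq_int_continuous[OF c])
  have isn: "integrable circ (\<lambda>x. sin x)" by (intro integrable_circ_continuous continuous_intros)
  have Ccsin: "Cc (\<lambda>x. sin x) a = 0" for a
    unfolding Cc_def by (rule integral_odd_fun) (simp add: odd_fun_def)
  have Scsin: "Sc (\<lambda>x. sin x) (of_int k) = (if k = 1 then pi else if k = -1 then - pi else 0)" for k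
    using Sc_sin[of 1 k] by simp
  have "fcoeff normsin k = 0" if "k \<noteq> 1" "k \<noteq> -1" for k
    unfolding ns fcoeff_cmult[OF isn] using that by (simp add: fcoeff_Cc_Sc[OF isn] Ccsin Scsin complex_eq_iff)
  then have "{k \<in> UNIV. jb (t/2) k * (cmod (fcoeff normsin k))\<^sup>2 \<noteq> 0} \<subseteq> {1, -1}" by auto
  then have "(\<lambda>k. jb (t/2) k * (cmod (fcoeff normsin k))\<^sup>2) summable_on UNIV"
    by (rule finite_nonzero_values_imp_summable_on[OF finite_subset]) simp
  then have "Hs t normsin" using s by (simp add: Hs_def)
  moreover have "(\<integral>x. normsin x ^ 4 \<partial>circ) = 1"
  proof -
    have "(\<integral>x. normsin x ^ 4 \<partial>circ) = (1 / K) ^ 4 * (\<integral>x. sin x ^ 4 \<partial>circ)"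
      unfolding ns power_mult_distrib by (rule integral_mult_right_zero)
    also have "\<dots> = (1 / K * K) ^ 4" unfolding K(2)[symmetric] by (rule power_mult_distrib[symmetric])
    finally show ?thesis using K(1) by simp
  qed
  moreover have "normsin \<in> borel_measurable lebesgue"
    using c by (intro measurable_completion) (simp add: borel_measurable_continuous_onI)
  moreover have "per2pi normsin" by (simp add: per2pi_def ns)
  ultimately show "normsin \<in> A0 t" by (simp add: A0_def H0_def integral_odd_fun[OF o])
qed

lemma A0_sq_int: "u \<in> A0 t \<Longrightarrow> sq_int circ u"
  by (auto simp: A0_def H0_def intro: Hs_sq_int)

lemma A0_integrable: "u \<in> A0 t \<Longrightarrow> integrable circ u"
  by (rule sq_int_integrable[OF finite_measure_circ A0_sq_int])

text \<open>Among the minimizers in the balanced class, one that maximizes \<open>\<integral> u sin\<close> is invariant under all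
  polarizations towards \<open>pi / 2\<close>.\<close>

theorem polarized_minimizer:
  assumes t: "1/2 < t" "t \<le> 2" and c: "c > -1"
  obtains g where "g \<in> A0 t" "bal g" "\<And>u. u \<in> A0 t \<Longrightarrow> bal u \<Longrightarrow> Bc t c g \<le> Bc t c u"
    "\<And>p. cos p > 0 \<Longrightarrow> AE y in circ. pol (sh p g) y = sh p g y"
proof -
  define X where "X = {u \<in> A0 t. bal u}"
  have "\<exists>v\<in>X. \<forall>u\<in>X. Bc t c v \<le> Bc t c u"
  proof (rule exists_minimizer[OF t(1) c])
    show "X \<subseteq> A0 t" by (auto simp: X_def)
    show "X \<noteq> {}" using normsin_A0 by (auto simp: X_def intro: bal_odd)
    fix u :: "nat \<Rightarrow> real \<Rightarrow> real" assume u: "\<And>k. u k \<in> X" and p: "plim u \<in> A0 t" and l: "(\<lambda>k. \<integral>x. (u k x - plim u x)\<^sup>2 \<partial>circ) \<longlonglongrightarrow> 0"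
    have "bal (plim u)" by (rule bal_closed[OF _ _ A0_sq_int[OF p] l]) (use u A0_sq_int in \<open>auto simp: X_def\<close>)
    with p show "plim u \<in> X" by (simp add: X_def)
  qed
  then obtain v where v: "v \<in> X" "\<And>u. u \<in> X \<Longrightarrow> Bc t c v \<le> Bc t c u" by blast
  \<comment> \<open>The balanced minimizers; translates of one are others, and maximizing
    \<open>J\<close> over them fixes the position.\<close>
  define Y where "Y = {u \<in> X. Bc t c u = Bc t c v}"
  define J where "J u = (\<integral>x. u x * sin x \<partial>circ)" for u
  \<comment> \<open>From u sin \<le> |u| \<le> 1 + u^4 and the constraint.\<close>
  have Jle: "J u \<le> 2 * pi + 1" if u: "u \<in> Y" for u
  proof -
    have uA: "u \<in> A0 t" using u by (auto simp: X_def Y_def)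
    then have H: "Hs t u" and one: "(\<integral>x. u x ^ 4 \<partial>circ) = 1" by (auto simp: A0_def H0_def)
    have i4: "integrable circ (\<lambda>x. u x ^ 4)" by (rule Sobolev_L4(1)[OF H t(1)])
    have "J u \<le> (\<integral>x. 1 + u x ^ 4 \<partial>circ)"
      unfolding J_def
    proof (rule integral_mono)
      show "integrable circ (\<lambda>x. u x * sin x)" using integrable_mult_sin[OF A0_integrable[OF uA], of 1] by simp
      show "integrable circ (\<lambda>x. 1 + u x ^ 4)" using i4 by simp
      fix x
      have "u x * sin x \<le> \<bar>u x\<bar> * 1" 
      proof -
        have "\<bar>u x * sin x\<bar> \<le> \<bar>u x\<bar> * 1" unfolding abs_mult by (intro mult_left_mono) auto
        then show ?thesis by linarith
      qed
      note le = this
      show "u x * sin x \<le> 1 + u x ^ 4"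
      proof (cases "\<bar>u x\<bar> \<le> 1")
        case True
        moreover have "0 \<le> u x ^ 4" by simp
        ultimately show ?thesis using le by linarith
      next
        case False
        then have "\<bar>u x\<bar> ^ 1 \<le> \<bar>u x\<bar> ^ 4" by (intro power_increasing) auto
        moreover have "0 \<le> u x ^ 4" by simp
        ultimately show ?thesis using le by simp
      qed
    qed
    also have "\<dots> = 2 * pi + 1" using i4 one by (simp add: measure_circ)
    finally show ?thesis .
  qed
  have vY: "v \<in> Y" using v(1) by (simp add: Y_def)
  define s where "s = Sup (J ` Y)"
  have bdd: "bdd_above (J ` Y)" using Jle by (auto intro!: bdd_aboveI)
  have Js: "J u \<le> s" if "u \<in> Y" for u unfolding s_def using bdd that by (intro cSup_upper) auto
  have "\<exists>u\<in>Y. s - 1 / real (Suc k) < J u" for k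
  proof -
    have "s - 1 / real (Suc k) < Sup (J ` Y)" by (simp add: s_def)
    then show ?thesis using less_cSup_iff[of "J ` Y"] bdd vY by auto
  qed
  then obtain u where u: "\<And>k. u k \<in> Y" "\<And>k. s - 1 / real (Suc k) < J (u k)" by metis
  have uA: "u k \<in> A0 t" and ub: "bal (u k)" and uB: "Bc t c (u k) = Bc t c v" for k using u(1)[of k] by (auto simp: Y_def X_def)
  have JL: "(\<lambda>k. J (u k)) \<longlonglongrightarrow> s"
  proof (rule real_tendsto_sandwich)
    show "\<forall>\<^sub>F k in sequentially. s - 1 / real (Suc k) \<le> J (u k)" by (intro always_eventually allI less_imp_le u(2))
    show "\<forall>\<^sub>F k in sequentially. J (u k) \<le> s" using Js u(1) by simp
    show "(\<lambda>k. s - 1 / real (Suc k)) \<longlonglongrightarrow> s"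
      using tendsto_diff[OF tendsto_const LIMSEQ_inverse_real_of_nat, of s] by (simp add: inverse_eq_divide)
  qed simp
  \<comment> \<open>The energies are constant along the maximizing sequence, so
    \<open>A0_compact\<close> yields a limit that is a minimizer again; \<open>J\<close> is
    continuous in L^2.\<close>
  have "(\<lambda>k. Bc t c (u k)) \<longlonglongrightarrow> Bc t c v" by (simp add: uB)
  from A0_compact[OF t(1) c uA this] obtain r where r: "strict_mono r" "plim (\<lambda>k. u (r k)) \<in> A0 t"
    "(\<lambda>k. \<integral>x. (u (r k) x - plim (\<lambda>k. u (r k)) x)\<^sup>2 \<partial>circ) \<longlonglongrightarrow> 0"
    "Bc t c (plim (\<lambda>k. u (r k))) \<le> Bc t c v" by blast
  define g where "g = plim (\<lambda>k. u (r k))"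
  note r = r[folded g_def]
  have bg: "bal g" by (rule bal_closed[OF A0_sq_int[OF uA] ub A0_sq_int[OF r(2)] r(3)])
  have gX: "g \<in> X" using r(2) bg by (simp add: X_def)
  then have gY: "g \<in> Y" using r(4) v(2)[OF gX] by (simp add: Y_def)
  have "sq_int circ (\<lambda>x. sin x)" by (intro sq_int_continuous continuous_intros)
  from integral_mult_L2_limit[OF A0_sq_int[OF uA] A0_sq_int[OF r(2)] this r(3)]
  have "(\<lambda>k. J (u (r k))) \<longlonglongrightarrow> J g" by (simp add: J_def)
  moreover have "(\<lambda>k. J (u (r k))) \<longlonglongrightarrow> s" using LIMSEQ_subseq_LIMSEQ[OF JL r(1)] by (simp add: o_def)
  ultimately have Jg: "J g = s" by (rule LIMSEQ_unique)
  show thesis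
  proof (rule that[OF r(2) bg])
    show "Bc t c g \<le> Bc t c w" if "w \<in> A0 t" "bal w" for w
      using v(2)[of w] that r(4) by (simp add: X_def)
    \<comment> \<open>Since sin (pi/2 - p) = cos p, the condition says that the half-circle
      receiving the larger values, where sin (x - p) is nonnegative, contains pi/2 in its
      interior.\<close>
    fix p :: real assume p: "cos p > 0"
    define G where "G = sh p g"
    have GA: "G \<in> A0 t" unfolding G_def by (rule A0_sh[OF r(2) t(1)])
    have gper: "per2pi g" using r(2) by (simp add: A0_def H0_def)
    have per: "per2pi G" using GA by (simp add: A0_def H0_def)
    have PA: "pol G \<in> A0 t" by (rule A0_pol[OF t GA])
    have pper: "per2pi (pol G)" using PA by (simp add: A0_def H0_def)
    \<comment> \<open>Translated back, this is the polarization of \<open>g\<close> with respect to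
      the reflection of x into 2p - x. It is again a balanced minimizer, hence a competitor for
      \<open>J\<close>.\<close>
    define w where "w = sh (- p) (pol G)"
    have wA: "w \<in> A0 t" unfolding w_def by (rule A0_sh[OF PA t(1)])
    have wper: "per2pi w" using wA by (simp add: A0_def H0_def)
    have bG: "bal G" unfolding G_def by (rule bal_sh[OF gper A0_integrable[OF r(2)] bg])
    have "bal (pol G)" by (rule bal_pol[OF per A0_integrable[OF GA] A0_integrable[OF PA] bG])
    then have bw: "bal w" unfolding w_def by (rule bal_sh[OF pper A0_integrable[OF PA]])
    have wX: "w \<in> X" using wA bw by (simp add: X_def)
    have "Bc t c w = Bc t c (pol G)" unfolding w_def by (rule Bc_sh[OF PA])
    also have "\<dots> \<le> Bc t c G" by (rule A0_pol[OF t GA])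
    also have "\<dots> = Bc t c g" unfolding G_def by (rule Bc_sh[OF r(2)])
    also have "\<dots> \<le> Bc t c v" by (rule r(4))
    finally have "w \<in> Y" using wX v(2)[OF wX] by (simp add: Y_def)
    then have Jw: "J w \<le> J g" using Js Jg by simp
    \<comment> \<open>Polarization keeps the cosine coefficients, so by this formula
      \<open>J w - J g\<close> is \<open>cos p\<close> times the integral of
      \<open>(pol G y - G y) * sin y\<close>, whose integrand is nonnegative. Maximality forces it
      to vanish.\<close>
    have Jsh: "J z = cos p * Sc (sh p z) 1 + sin p * Cc (sh p z) 1" if zper: "per2pi z" and zi: "integrable circ z" for z
    proof -
      have i: "integrable circ (\<lambda>x. z x * sin x)" using integrable_mult_sin[OF zi, of 1] by simp
      have shi: "integrable circ (sh p z)" using integrable_sh[of z "\<lambda>x. x"] zper zi by simp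
      have "J z = (\<integral>x. z (x + p) * sin (x + p) \<partial>circ)" unfolding J_def
        by (rule integral_circ_shift[symmetric, OF _ i]) (use zper in \<open>simp add: per2pi_def\<close>)
      also have "\<dots> = (\<integral>x. cos p * (sh p z x * sin (1 * x)) + sin p * (sh p z x * cos (1 * x)) \<partial>circ)"
        by (intro Bochner_Integration.integral_cong refl) (simp add: sh_def sin_add algebra_simps)
      also have "\<dots> = cos p * Sc (sh p z) 1 + sin p * Cc (sh p z) 1"
        using integrable_mult_sin[OF shi, of 1] integrable_mult_cos[OF shi, of 1] by (simp add: Sc_def Cc_def)
      finally show ?thesis .
    qed
    have shw: "sh p w = pol G" by (simp add: w_def sh_def fun_eq_iff)
    have "Cc (pol G) 1 = Cc G 1"
      using polarization_inequality(4)[of "t/2" G 1] t GA by (simp add: A0_def H0_def)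
    then have "cos p * Sc (pol G) 1 \<le> cos p * Sc G 1"
      using Jw unfolding Jsh[OF wper A0_integrable[OF wA]] Jsh[OF gper A0_integrable[OF r(2)]] shw G_def[symmetric] by simp
    then have "Sc (\<lambda>y. pol G y - G y) 1 \<le> 0"
      using p by (simp add: Sc_diff A0_integrable[OF GA] A0_integrable[OF PA])
    moreover have ii: "integrable circ (\<lambda>y. (pol G y - G y) * sin y)"
      using integrable_mult_sin[of "\<lambda>y. pol G y - G y" 1] A0_integrable[OF GA] A0_integrable[OF PA] by simp
    moreover have "0 \<le> (\<integral>y. (pol G y - G y) * sin y \<partial>circ)"
      by (intro Bochner_Integration.integral_nonneg pol_sin_nonneg)
    ultimately have "(\<integral>y. (pol G y - G y) * sin y \<partial>circ) = 0" by (simp add: Sc_def)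
    then have "AE y in circ. (pol G y - G y) * sin y = 0"
      using ii pol_sin_nonneg by (subst (asm) integral_nonneg_eq_0_iff_AE) auto
    then have "AE y in circ. pol G y = G y"
    proof eventually_elim
      fix y assume "(pol G y - G y) * sin y = 0"
      then show "pol G y = G y"
        using per2pi_sin_zero[OF per, of y] by (cases "sin y = 0") (auto simp: pol_def)
    qed
    then show "AE y in circ. pol (sh p g) y = sh p g y" by (simp add: G_def)
  qed
qed

section \<open>Monotonicity and oddness of polarized functions\<close>

text \<open>The de la Vallee-Poussin mean: convolution with the normalised kernel (1 + cos t)^m. It
  is continuous, depends only on the Fourier coefficients, and by \<open>cone_bp\<close> preserves
  the sign of reflection differences, so properties known almost everywhere become pointwise
  ones.\<close>

definition vp :: "nat \<Rightarrow> (real \<Rightarrow> real) \<Rightarrow> real \<Rightarrow> real" where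
  "vp m u = psum (\<lambda>k. of_real (bp m (nat \<bar>k\<bar>)) * fcoeff u k) m"

lemma herm_vp: "integrable circ u \<Longrightarrow> herm (\<lambda>k. of_real (bp m (nat \<bar>k\<bar>)) * fcoeff u k)"
  by (simp add: herm_def fcoeff_minus)

lemma continuous_on_vp: "continuous_on S (vp m u)"
  unfolding vp_def by (rule continuous_on_psum)

lemma sq_int_vp: "sq_int circ (vp m u)"
  unfolding vp_def by (rule sq_int_psum)

lemma fcoeff_vp:
  assumes "integrable circ u"
  shows "fcoeff (vp m u) k = of_real (bp m (nat \<bar>k\<bar>)) * fcoeff u k"
proof -
  have "bp m (nat \<bar>k\<bar>) = 0" if "\<not> \<bar>k\<bar> \<le> int m"
    using that by (intro bp_eq_0) linarith
  then show ?thesis unfolding vp_def fcoeff_psum[OF herm_vp[OF assms]] by auto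
qed

lemma Cc_neg: "Cc u (- a) = Cc u a" by (simp add: Cc_def)

lemma psum_real:
  assumes u: "integrable circ u"
  shows "psum (\<lambda>k. of_real (f (nat \<bar>k\<bar>)) * fcoeff u k) m x
    = f 0 * ((\<integral>x. u x \<partial>circ) / (2 * pi)) + (\<Sum>n\<in>{1..m}. f n * (Cc u (real n) * cos (real n * x) + Sc u (real n) * sin (real n * x))) / pi"
proof -
  have "psum (\<lambda>k. of_real (f (nat \<bar>k\<bar>)) * fcoeff u k) m x
    = (\<Sum>k\<in>{- int m..int m}. f (nat \<bar>k\<bar>) * Re (fcoeff u k * cis (of_int k * x)))"
    unfolding psum_def trigp_def Re_sum by (intro sum.cong refl) (simp add: mult.assoc)
  also have "\<dots> = f 0 * Re (fcoeff u 0) + (\<Sum>n\<in>{1..m}. f n * Re (fcoeff u (int n) * cis (real n * x)) + f n * Re (fcoeff u (- int n) * cis (- (real n * x))))"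
    unfolding sum_int_interval by simp
  also have "(\<Sum>n\<in>{1..m}. f n * Re (fcoeff u (int n) * cis (real n * x)) + f n * Re (fcoeff u (- int n) * cis (- (real n * x))))
    = (\<Sum>n\<in>{1..m}. f n * (Cc u (real n) * cos (real n * x) + Sc u (real n) * sin (real n * x)) / pi)"
    by (intro sum.cong refl) (simp add: fcoeff_Cc_Sc[OF u] Cc_neg Sc_neg field_simps)
  finally show ?thesis by (simp add: fcoeff_0 sum_divide_distrib)
qed

lemma vp_real:
  assumes u: "integrable circ u"
  shows "vp m u x = (\<integral>x. u x \<partial>circ) / (2 * pi) + (\<Sum>n\<in>{1..m}. bp m n * (Cc u (real n) * cos (real n * x) + Sc u (real n) * sin (real n * x))) / pi"
  unfolding vp_def psum_real[OF u] by (simp add: bp_0)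

lemma Sc_sh:
  assumes u: "per2pi u" "integrable circ u"
  shows "Sc (sh p u) (real n) = Sc u (real n) * cos (real n * p) - Cc u (real n) * sin (real n * p)"
proof -
  have i: "integrable circ (sh p u)" using integrable_sh[of u "\<lambda>x. x"] u by simp
  have "- Sc (sh p u) (real n) / (2 * pi) = Im (fcoeff (sh p u) (int n))" by (simp add: fcoeff_Cc_Sc[OF i])
  also have "\<dots> = (- Sc u (real n) * cos (real n * p) + Cc u (real n) * sin (real n * p)) / (2 * pi)"
    unfolding fcoeff_sh[OF u] fcoeff_Cc_Sc[OF u(2)] by (simp add: field_simps)
  finally show ?thesis by (simp add: field_simps)
qed

text \<open>The difference of the values at two points symmetric about \<open>p\<close> is a pure
  sine sum in \<open>s\<close>, the form to which \<open>cone_apply\<close> applies.\<close>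

lemma vp_diff:
  assumes u: "per2pi u" "integrable circ u"
  shows "vp m u (p + s) - vp m u (p - s) = 2 / pi * (\<Sum>n\<in>{1..m}. bp m n * Sc (sh p u) (real n) * sin (real n * s))"
proof -
  have "vp m u (p + s) - vp m u (p - s)
    = (\<Sum>n\<in>{1..m}. bp m n * (Cc u (real n) * cos (real n * (p + s)) + Sc u (real n) * sin (real n * (p + s)))
        - bp m n * (Cc u (real n) * cos (real n * (p - s)) + Sc u (real n) * sin (real n * (p - s)))) / pi"
    unfolding vp_real[OF u(2)] by (simp add: sum_subtractf diff_divide_distrib)
  also have "(\<Sum>n\<in>{1..m}. bp m n * (Cc u (real n) * cos (real n * (p + s)) + Sc u (real n) * sin (real n * (p + s)))
        - bp m n * (Cc u (real n) * cos (real n * (p - s)) + Sc u (real n) * sin (real n * (p - s))))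
    = (\<Sum>n\<in>{1..m}. 2 * (bp m n * Sc (sh p u) (real n) * sin (real n * s)))"
  proof (intro sum.cong refl)
    fix n
    have "cos (real n * (p + s)) - cos (real n * (p - s)) = - 2 * sin (real n * p) * sin (real n * s)"
      "sin (real n * (p + s)) - sin (real n * (p - s)) = 2 * cos (real n * p) * sin (real n * s)"
      by (simp_all add: distrib_left right_diff_distrib cos_add cos_diff sin_add sin_diff)
    note d = this
    have "bp m n * (Cc u (real n) * cos (real n * (p + s)) + Sc u (real n) * sin (real n * (p + s)))
        - bp m n * (Cc u (real n) * cos (real n * (p - s)) + Sc u (real n) * sin (real n * (p - s)))
      = bp m n * (Cc u (real n) * (cos (real n * (p + s)) - cos (real n * (p - s))) + Sc u (real n) * (sin (real n * (p + s)) - sin (real n * (p - s))))"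
      by (simp add: algebra_simps)
    also have "\<dots> = 2 * (bp m n * Sc (sh p u) (real n) * sin (real n * s))"
      unfolding d Sc_sh[OF u] by (simp add: algebra_simps)
    finally show "bp m n * (Cc u (real n) * cos (real n * (p + s)) + Sc u (real n) * sin (real n * (p + s)))
        - bp m n * (Cc u (real n) * cos (real n * (p - s)) + Sc u (real n) * sin (real n * (p - s)))
      = 2 * (bp m n * Sc (sh p u) (real n) * sin (real n * s))" .
  qed
  finally show ?thesis by (simp add: sum_distrib_left[symmetric])
qed

lemma vp_periodic: 
  assumes u: "integrable circ u" shows "vp m u (x + 2 * pi) = vp m u x"
proof -
  have "sin (real n * (x + 2 * pi)) = sin (real n * x)" "cos (real n * (x + 2 * pi)) = cos (real n * x)" for n
    using sin.plus_of_nat[of "real n * x" n] cos.plus_of_nat[of "real n * x" n] by (simp_all add: distrib_left mult_ac)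
  then show ?thesis unfolding vp_real[OF u] by simp
qed

lemma vp_L2:
  assumes u: "sq_int circ u"
  shows "(\<lambda>m. \<integral>x. (vp m u x - u x)\<^sup>2 \<partial>circ) \<longlonglongrightarrow> 0"
proof (rule LIMSEQ_I)
  fix e :: real assume e: "e > 0"
  have i: "integrable circ u" by (rule sq_int_integrable[OF finite_measure_circ u])
  have iv: "integrable circ (vp m u)" for m by (rule sq_int_integrable[OF finite_measure_circ sq_int_vp])
  define a where "a k = (cmod (fcoeff u k))\<^sup>2" for k
  have sa: "a summable_on UNIV" unfolding a_def by (rule Parseval_summable[OF u])
  define w where "w m k = (1 - bp m (nat \<bar>k\<bar>))\<^sup>2" for m k
  have w: "0 \<le> w m k" "w m k \<le> 1" for m k
    unfolding w_def using bp_nonneg[of m "nat \<bar>k\<bar>"] bp_le_1[of m "nat \<bar>k\<bar>"] by (auto intro: power_le_one)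
  have eq: "(\<integral>x. (vp m u x - u x)\<^sup>2 \<partial>circ) = 2 * pi * (\<Sum>\<^sub>\<infinity>k. w m k * a k)" for m
  proof -
    have "(cmod (fcoeff (\<lambda>x. vp m u x - u x) k))\<^sup>2 = w m k * a k" for k
    proof -
      have "fcoeff (\<lambda>x. vp m u x - u x) k = of_real (bp m (nat \<bar>k\<bar>) - 1) * fcoeff u k"
        by (simp add: fcoeff_diff[OF iv i] fcoeff_vp[OF i] left_diff_distrib)
      then have "cmod (fcoeff (\<lambda>x. vp m u x - u x) k) = \<bar>bp m (nat \<bar>k\<bar>) - 1\<bar> * cmod (fcoeff u k)"
        by (simp only: norm_mult norm_of_real)
      then show ?thesis by (simp add: w_def a_def power_mult_distrib power2_commute)
    qed
    then show ?thesis using Parseval[OF sq_int_diff[OF sq_int_vp u], of m] by simp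
  qed
  have sw: "(\<lambda>k. w m k * a k) summable_on UNIV" for m
    by (rule summable_on_comparison_test[OF sa]) (auto simp: a_def w mult_left_le_one_le)
  \<comment> \<open>The tail beyond \<open>N\<close> and the weighted sum up to \<open>N\<close> are
    each less than \<open>d\<close>, and \<open>2 * pi * (2 * d) = e\<close>.\<close>
  define d where "d = e / (4 * pi)"
  have d: "d > 0" using e by (simp add: d_def)
  have "\<forall>\<^sub>F N in sequentially. infsum a UNIV - d < (\<Sum>k\<in>{- int N..int N}. a k)"
    by (rule order_tendstoD(1)[OF int_interval_sums_limit[OF sa]]) (use d in simp)
  then obtain N where N: "infsum a UNIV - d < (\<Sum>k\<in>{- int N..int N}. a k)" by (auto simp: eventually_sequentially)
  let ?F = "{- int N..int N}"
  have "(\<lambda>m. \<Sum>k\<in>?F. w m k * a k) \<longlonglongrightarrow> (\<Sum>k\<in>?F. (1 - 1)\<^sup>2 * a k)"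
    unfolding w_def using bp_limits by (intro tendsto_intros) auto
  then have "\<forall>\<^sub>F m in sequentially. (\<Sum>k\<in>?F. w m k * a k) < d" using d by (intro order_tendstoD(2)) auto
  then obtain M where M: "\<And>m. m \<ge> M \<Longrightarrow> (\<Sum>k\<in>?F. w m k * a k) < d" by (auto simp: eventually_sequentially)
  have "norm ((\<integral>x. (vp m u x - u x)\<^sup>2 \<partial>circ) - 0) < e" if "m \<ge> M" for m
  proof -
    define b where "b k = (if k \<in> ?F then w m k * a k - a k else 0)" for k
    have sb: "b summable_on UNIV"
      by (rule finite_nonzero_values_imp_summable_on[OF finite_subset[of _ ?F]]) (auto simp: b_def)
    have "(\<Sum>\<^sub>\<infinity>k. w m k * a k) \<le> (\<Sum>\<^sub>\<infinity>k. a k + b k)"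
    proof (rule infsum_mono[OF sw summable_on_add[OF sa sb]])
      fix k show "w m k * a k \<le> a k + b k"
        using mult_right_mono[OF w(2), of "a k" m k] by (auto simp: b_def a_def)
    qed
    also have "\<dots> = infsum a UNIV + infsum b UNIV" by (rule infsum_add[OF sa sb])
    also have "infsum b UNIV = infsum b ?F" by (rule infsum_cong_neutral) (auto simp: b_def)
    also have "\<dots> = (\<Sum>k\<in>?F. w m k * a k) - (\<Sum>k\<in>?F. a k)" by (simp add: b_def sum_subtractf)
    finally have "(\<Sum>\<^sub>\<infinity>k. w m k * a k) < 2 * d" using N M[OF that] by linarith
    then have "2 * pi * (\<Sum>\<^sub>\<infinity>k. w m k * a k) < 2 * pi * (2 * d)" by (intro mult_strict_left_mono) auto
    also have "\<dots> = e" by (simp add: d_def)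
    finally have "(\<integral>x. (vp m u x - u x)\<^sup>2 \<partial>circ) < e" unfolding eq .
    then show ?thesis by simp
  qed
  then show "\<exists>M. \<forall>m\<ge>M. norm ((\<integral>x. (vp m u x - u x)\<^sup>2 \<partial>circ) - 0) < e" by blast
qed

lemma sin_zero_pi_multiple: "sin s = 0 \<Longrightarrow> \<exists>k::int. s = of_int k * pi"
  by (auto simp: sin_zero_iff_int2)

text \<open>With midpoint \<open>p\<close> and half-difference \<open>s\<close>, sin y - sin x = 2
  cos p sin s, so the increment \<open>D p s\<close> must have the sign of
  \<open>cos p * sin s\<close>. For \<open>cos p > 0\<close> the function is its own polarization
  about \<open>p\<close> and the kernel keeps the sign; the pair \<open>p + pi\<close>,
  \<open>s - pi\<close> reduces \<open>cos p < 0\<close> to this case; \<open>cos p = 0\<close>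
  follows by continuity.\<close>

lemma vp_mono_sin:
  assumes per: "per2pi g" and i: "integrable circ g" and iP: "\<And>p. integrable circ (pol (sh p g))"
    and pol: "\<And>p. cos p > 0 \<Longrightarrow> AE y in circ. pol (sh p g) y = sh p g y"
    and le: "sin x \<le> sin y"
  shows "vp m g x \<le> vp m g y"
proof -
  let ?G = "vp m g"
  define D where "D p s = ?G (p + s) - ?G (p - s)" for p s
  have Gk: "?G (x + 2 * pi * of_int k) = ?G x" for x k
    by (rule periodic_int_multiple) (rule vp_periodic[OF i])
  have 1: "0 \<le> D p s * sin s" if p: "cos p > 0" for p s
  proof -
    let ?U = "sh p g"
    have iU: "integrable circ ?U" using integrable_sh[of g "\<lambda>x. x"] per i by simp
    have iU': "integrable circ (\<lambda>y. ?U (- y))" using iU integrable_circ_reflect[of ?U] by simp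
    define f where "f y = pol ?U y - ?U (- y)" for y
    have fi: "integrable circ f" unfolding f_def using iP[of p] iU' by simp
    have "AE y in circ. 0 \<le> f y * sin y" unfolding f_def by (intro AE_I2 pol_sin_nonneg)
    from cone_apply[OF cone_bp fi this, of m s]
    have *: "0 \<le> (\<Sum>n\<in>{1..m}. bp m n * Sc f (real n) * sin (real n * s)) * sin s" .
    have "Sc (pol ?U) a = Sc ?U a" for a
      unfolding Sc_def by (rule integral_cong_AE) (use iP[of p] iU pol[OF p] in auto)
    then have "Sc f a = 2 * Sc ?U a" for a
      unfolding f_def by (simp add: Sc_diff[OF iP iU'] Sc_reflect)
    then have "0 \<le> 2 * ((\<Sum>n\<in>{1..m}. bp m n * Sc ?U (real n) * sin (real n * s)) * sin s)"
      using * by (simp add: sum_distrib_left sum_distrib_right mult_ac)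
    then have "0 \<le> 2 / pi * ((\<Sum>n\<in>{1..m}. bp m n * Sc ?U (real n) * sin (real n * s)) * sin s)"
      by simp
    then show ?thesis unfolding D_def vp_diff[OF per i] by (simp only: mult.assoc)
  qed
  have 2: "0 \<le> D p s * sin s * cos p" for p s
  proof -
    consider "cos p > 0" | "cos p = 0" | "cos p < 0" by linarith
    then show ?thesis
    proof cases
      case 1 then show ?thesis using \<open>cos p > 0 \<Longrightarrow> 0 \<le> D p s * sin s\<close>[OF 1] by simp
    next
      case 3
      then have "cos (p + pi) > 0" by simp
      from 1[OF this, of "s - pi"] have "0 \<le> D (p + pi) (s - pi) * (- sin s)" by simp
      moreover have "D (p + pi) (s - pi) = D p s"
        using vp_periodic[OF i, of m "p - s"] by (simp add: D_def algebra_simps)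
      ultimately have "D p s * sin s \<le> 0" by simp
      then show ?thesis using 3 by (simp add: mult_nonpos_nonpos)
    qed simp
  qed
  have Dk: "D p s = 0" if z: "sin s = 0" for p s
  proof -
    obtain k :: int where "s = of_int k * pi" using sin_zero_pi_multiple[OF z] by blast
    then have "p + s = (p - s) + 2 * pi * of_int k" by simp
    then have "?G (p + s) = ?G ((p - s) + 2 * pi * of_int k)" by (rule arg_cong)
    also have "\<dots> = ?G (p - s)" by (rule Gk)
    finally show ?thesis by (simp add: D_def)
  qed
  have 3: "D p s * sin s = 0" if p: "cos p = 0" for p s
  proof -
    \<comment> \<open>Approaching \<open>p\<close> from the two sides (\<open>c = 1\<close> and
      \<open>c = -1\<close>) gives \<open>cos\<close> opposite signs, so the limit of
      \<open>D * sin s\<close> is bounded by zero from both sides.\<close>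
    have lim: "(\<lambda>k. D (p + c * inverse (real (Suc k))) s * sin s * (- sin p * c)) \<longlonglongrightarrow> D (p + c * 0) s * sin s * (- sin p * c)" for c
      unfolding D_def
      by (intro tendsto_intros LIMSEQ_inverse_real_of_nat continuous_on_tendsto_compose[OF continuous_on_vp[of UNIV]]) auto
    have nn: "0 \<le> D (p + c * inverse (real (Suc k))) s * sin s * (- sin p * c)" if c: "c = 1 \<or> c = -1" for c k
    proof -
      let ?e = "inverse (real (Suc k))"
      have "?e \<le> 1" by (simp add: field_simps)
      then have "?e < pi" using pi_gt3 by linarith
      then have "sin ?e > 0" by (intro sin_gt_zero) auto
      moreover have "cos (p + c * ?e) = (- sin p * c) * sin ?e" using c p by (auto simp: cos_add)
      moreover have "0 \<le> D (p + c * ?e) s * sin s * cos (p + c * ?e)" by (rule 2)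
      ultimately have "0 \<le> (D (p + c * ?e) s * sin s * (- sin p * c)) * sin ?e" by (simp only: mult.assoc)
      moreover have "0 \<le> a" if "0 \<le> a * b" "0 < b" for a b :: real using that by (simp add: zero_le_mult_iff)
      ultimately show ?thesis using \<open>sin ?e > 0\<close> by blast
    qed
    have "0 \<le> D p s * sin s * (- sin p * c)" if c: "c = 1 \<or> c = -1" for c
      using LIMSEQ_le_const[OF lim[of c], of 0] nn[OF c] by simp
    from this[of 1] this[of "-1"] have "D p s * sin s * sin p = 0" by simp
    moreover have "sin p \<noteq> 0" using p sin_cos_squared_add[of p] by auto
    ultimately show ?thesis by simp
  qed
  define p where "p = (x + y) / 2"
  define s where "s = (y - x) / 2"
  have xy: "y = p + s" "x = p - s" by (simp_all add: p_def s_def field_simps)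
  have cs: "sin y - sin x = 2 * cos p * sin s" unfolding xy by (simp add: sin_add sin_diff)
  have "0 \<le> D p s"
  proof (cases "cos p = 0")
    case True
    then show ?thesis using 3[OF True, of s] Dk[of s p] by auto
  next
    case F: False
    show ?thesis
    proof (cases "sin s = 0")
      case False
      have "0 \<le> 2 * (cos p * sin s)" using cs le by (simp only: mult.assoc)
      moreover have "cos p * sin s \<noteq> 0" using F False by simp
      ultimately have "0 < cos p * sin s" by linarith
      moreover have "0 \<le> D p s * (cos p * sin s)" using 2[of p s] by (simp only: mult_ac)
      ultimately show ?thesis by (metis linorder_not_le mult_neg_pos order_less_irrefl order_less_le_trans)
    qed (use Dk in simp)
  qed
  then show ?thesis by (simp add: D_def xy)
qed

text \<open>Convergence at \<open>x\<close> and at \<open>- x\<close> along one subsequence, since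
  oddness compares the two values.\<close>

lemma vp_AE_subseq:
  assumes u: "sq_int circ u"
  obtains r where "strict_mono r" "AE x in circ. (\<lambda>n. vp (r n) u x) \<longlonglongrightarrow> u x \<and> (\<lambda>n. vp (r n) u (- x)) \<longlonglongrightarrow> u (- x)"
proof -
  obtain r1 where r1: "strict_mono r1" "AE x in circ. (\<lambda>n. vp (r1 n) u x) \<longlonglongrightarrow> u x"
    by (rule L2_limit_AE_subseq[where u = "\<lambda>m. vp m u", OF finite_measure_circ sq_int_vp u vp_L2[OF u]])
  have refl: "sq_int circ (\<lambda>x. v (- x))" if "sq_int circ v" for v
  proof -
    have i: "integrable circ v" by (rule sq_int_integrable[OF finite_measure_circ that])
    then have "integrable circ (\<lambda>x. v (- x))" using integrable_circ_reflect[of v] by simp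
    then show ?thesis using that integrable_circ_reflect[of "\<lambda>x. (v x)\<^sup>2"] by (simp add: sq_int_def)
  qed
  have "(\<lambda>n. \<integral>x. (vp (r1 n) u (- x) - u (- x))\<^sup>2 \<partial>circ) \<longlonglongrightarrow> 0"
    using LIMSEQ_subseq_LIMSEQ[OF vp_L2[OF u] r1(1)] integral_circ_reflect[of "\<lambda>x. (vp (r1 n) u x - u x)\<^sup>2" for n]
    by (simp add: o_def)
  from L2_limit_AE_subseq[where u = "\<lambda>n x. vp (r1 n) u (- x)", OF finite_measure_circ refl[OF sq_int_vp] refl[OF u] this]
  obtain r2 where r2: "strict_mono r2" "AE x in circ. (\<lambda>n. vp (r1 (r2 n)) u (- x)) \<longlonglongrightarrow> u (- x)" by blast
  show thesis
  proof (rule that[of "\<lambda>n. r1 (r2 n)"])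
    show "strict_mono (\<lambda>n. r1 (r2 n))" using strict_mono_o[OF r1(1) r2(1)] by (simp add: o_def)
    show "AE x in circ. (\<lambda>n. vp (r1 (r2 n)) u x) \<longlonglongrightarrow> u x \<and> (\<lambda>n. vp (r1 (r2 n)) u (- x)) \<longlonglongrightarrow> u (- x)"
      using r1(2) r2(2)
    proof eventually_elim
      fix x assume a: "(\<lambda>n. vp (r1 n) u x) \<longlonglongrightarrow> u x" "(\<lambda>n. vp (r1 (r2 n)) u (- x)) \<longlonglongrightarrow> u (- x)"
      then show "(\<lambda>n. vp (r1 (r2 n)) u x) \<longlonglongrightarrow> u x \<and> (\<lambda>n. vp (r1 (r2 n)) u (- x)) \<longlonglongrightarrow> u (- x)"
        using LIMSEQ_subseq_LIMSEQ[OF a(1) r2(1)] by (simp add: o_def)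
    qed
  qed
qed

text \<open>Both \<open>g\<close> and \<open>h x = - g (- x)\<close> are nondecreasing functions of \<open>sin x\<close> and they are equimeasurable.
  If \<open>h x < a < b < g x\<close> for some \<open>x\<close>, then the truncation to \<open>{a..b}\<close> of \<open>g\<close> dominates that of \<open>h\<close>
  everywhere, so they agree almost everywhere.\<close>

lemma balanced_monotone_odd_AE:
  assumes b: "bal g" and s: "sq_int circ g" and mono: "\<And>m x y. sin x \<le> sin y \<Longrightarrow> vp m g x \<le> vp m g y"
  shows "AE x in circ. g (- x) = - g x"
proof -
  have i: "integrable circ g" by (rule sq_int_integrable[OF finite_measure_circ s])
  have i': "integrable circ (\<lambda>x. g (- x))" using i integrable_circ_reflect[of g] by simp
  obtain r where r: "AE x in circ. (\<lambda>n. vp (r n) g x) \<longlonglongrightarrow> g x \<and> (\<lambda>n. vp (r n) g (- x)) \<longlonglongrightarrow> g (- x)"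
    using vp_AE_subseq[OF s] by blast
  define N where "N x \<longleftrightarrow> (\<lambda>n. vp (r n) g x) \<longlonglongrightarrow> g x \<and> (\<lambda>n. vp (r n) g (- x)) \<longlonglongrightarrow> g (- x)" for x
  have N: "AE x in circ. N x" using r by (simp add: N_def)
  have gm: "g x \<le> g y" if "N x" "N y" "sin x \<le> sin y" for x y
    using that mono[OF that(3)] unfolding N_def by (auto intro: LIMSEQ_le)
  have hm: "- g (- x) \<le> - g (- y)" if n: "N x" "N y" and "sin x \<le> sin y" for x y
  proof -
    have "sin (- y) \<le> sin (- x)" using that by simp
    from mono[OF this] n have "g (- y) \<le> g (- x)" unfolding N_def by (auto intro: LIMSEQ_le)
    then show ?thesis by simp
  qed
  have ab: "AE x in circ. \<not> (- g (- x) < a \<and> b < g x)" if "a < b" for a b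
  proof (cases "\<exists>x1. N x1 \<and> - g (- x1) < a \<and> b < g x1")
    case False
    show ?thesis using N by eventually_elim (use False in blast)
  next
    case True
    then obtain x1 where x1: "N x1" "- g (- x1) < a" "b < g x1" by blast
    define \<rho> where "\<rho> t = max 0 (min (b - a) (t - a))" for t
    \<comment> \<open>The odd part of the truncation is an admissible test function for
      \<open>bal\<close>; it gives equal integrals of \<open>\<rho> (g x)\<close> and
      \<open>\<rho> (- g x)\<close>.\<close>
    define f where "f t = (\<rho> t - \<rho> (- t)) / 2" for t
    have L\<rho>: "\<bar>\<rho> x - \<rho> y\<bar> \<le> \<bar>x - y\<bar>" for x y by (auto simp: \<rho>_def)
    have "f (- t) = - f t" for t by (simp add: f_def field_simps)
    moreover have "\<bar>f x - f y\<bar> \<le> \<bar>x - y\<bar>" for x y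
    proof -
      have "f x - f y = (\<rho> x - \<rho> y) / 2 - (\<rho> (- x) - \<rho> (- y)) / 2" by (simp add: f_def field_simps)
      moreover have "\<bar>\<rho> (- x) - \<rho> (- y)\<bar> \<le> \<bar>x - y\<bar>" using L\<rho>[of "- x" "- y"] by (simp add: abs_minus_commute)
      moreover have "\<bar>a / 2 - b / 2\<bar> \<le> d" if "\<bar>a\<bar> \<le> d" "\<bar>b\<bar> \<le> d" for a b d :: real
        using that by (auto simp: abs_le_iff)
      ultimately show ?thesis using L\<rho>[of x y] by (simp only:)
    qed
    ultimately have z: "(\<integral>x. f (g x) \<partial>circ) = 0" by (rule balD[OF b])
    have \<rho>m: "\<rho> \<in> borel_measurable borel" unfolding \<rho>_def by measurable
    have ii: "integrable circ (\<lambda>x. \<rho> (v x))" if "integrable circ v" for v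
    proof (rule circ.integrable_const_bound[of _ "b - a"])
      show "AE x in circ. norm (\<rho> (v x)) \<le> b - a" using \<open>a < b\<close> by (auto simp: \<rho>_def)
      show "(\<lambda>x. \<rho> (v x)) \<in> borel_measurable circ"
        using measurable_compose[OF borel_measurable_integrable[OF that] \<rho>m] .
    qed
    have ig: "integrable circ (\<lambda>x. \<rho> (g x))" and ih: "integrable circ (\<lambda>x. \<rho> (- g (- x)))" and ih': "integrable circ (\<lambda>x. \<rho> (- g x))"
      using ii[OF i] ii[of "\<lambda>x. - g (- x)"] ii[of "\<lambda>x. - g x"] i i' by auto
    have "(\<integral>x. \<rho> (g x) \<partial>circ) = (\<integral>x. \<rho> (- g x) \<partial>circ)"
      using z ig ih' by (simp add: f_def)
    also have "\<dots> = (\<integral>x. \<rho> (- g (- x)) \<partial>circ)"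
      using integral_circ_reflect[of "\<lambda>x. \<rho> (- g x)"] by simp
    finally have z2: "(\<integral>x. \<rho> (g x) - \<rho> (- g (- x)) \<partial>circ) = 0" using ig ih by simp
    have nn: "AE x in circ. 0 \<le> \<rho> (g x) - \<rho> (- g (- x))"
      using N
    proof eventually_elim
      fix x assume x: "N x"
      \<comment> \<open>The point \<open>x1\<close> separates the circle: where \<open>sin x\<close>
        is at least \<open>sin x1\<close>, \<open>g\<close> exceeds \<open>b\<close> and its
        truncation is maximal; elsewhere \<open>- g (- x)\<close> is below \<open>a\<close> and its
        truncation is zero.\<close>
      show "0 \<le> \<rho> (g x) - \<rho> (- g (- x))"
      proof (cases "sin x1 \<le> sin x")
        case True
        from gm[OF x1(1) x this] x1(3) show ?thesis using \<open>a < b\<close> by (auto simp: \<rho>_def)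
      next
        case False
        then have "sin x \<le> sin x1" by simp
        from hm[OF x x1(1) this] x1(2) show ?thesis using \<open>a < b\<close> by (auto simp: \<rho>_def)
      qed
    qed
    have "AE x in circ. \<rho> (g x) - \<rho> (- g (- x)) = 0"
      using z2 nn ig ih by (subst (asm) integral_nonneg_eq_0_iff_AE) auto
    then show ?thesis by eventually_elim (use \<open>a < b\<close> in \<open>auto simp: \<rho>_def\<close>)
  qed
  \<comment> \<open>Rational thresholds, so that countably many null sets suffice.\<close>
  have "AE x in circ. \<forall>q1 q2 :: rat. q1 < q2 \<longrightarrow> \<not> (- g (- x) < of_rat q1 \<and> of_rat q2 < g x)"
    unfolding AE_all_countable
  proof (intro allI)
    fix q1 q2 :: rat
    show "AE x in circ. q1 < q2 \<longrightarrow> \<not> (- g (- x) < of_rat q1 \<and> of_rat q2 < g x)"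
      using ab[of "of_rat q1" "of_rat q2"] by (cases "q1 < q2") (auto simp: of_rat_less)
  qed
  then have le: "AE x in circ. g x \<le> - g (- x)"
  proof eventually_elim
    fix x assume q: "\<forall>q1 q2 :: rat. q1 < q2 \<longrightarrow> \<not> (- g (- x) < of_rat q1 \<and> of_rat q2 < g x)"
    show "g x \<le> - g (- x)"
    proof (rule ccontr)
      assume "\<not> g x \<le> - g (- x)"
      then obtain q1 where q1: "- g (- x) < of_rat q1" "of_rat q1 < g x" using of_rat_dense[of "- g (- x)" "g x"] by auto
      then obtain q2 where q2: "of_rat q1 < (of_rat q2 :: real)" "of_rat q2 < g x" using of_rat_dense[of "of_rat q1" "g x"] by auto
      then have "q1 < q2" by (simp add: of_rat_less)
      with q q1 q2 show False by blast
    qed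
  qed
  \<comment> \<open>The one-sided inequality becomes an equality because both sides have integral
    zero.\<close>
  have "(\<integral>x. g x \<partial>circ) = 0" using balD[OF b, of "\<lambda>x. x"] by simp
  then have "(\<integral>x. - g (- x) - g x \<partial>circ) = 0" using i i' integral_circ_reflect[of g] by simp
  then have "AE x in circ. - g (- x) - g x = 0"
    using le i i' by (subst (asm) integral_nonneg_eq_0_iff_AE) auto
  then show ?thesis by eventually_elim simp
qed

lemma A0_cong_AE:
  assumes g: "g \<in> A0 t" and h: "per2pi h" "h \<in> borel_measurable lebesgue" and hg: "AE x in circ. h x = g x"
  shows "h \<in> A0 t" "\<And>k. fcoeff h k = fcoeff g k" "Bc t c h = Bc t c g"
proof -
  have H: "Hs t g" and z: "(\<integral>x. g x \<partial>circ) = 0" and one: "(\<integral>x. g x ^ 4 \<partial>circ) = 1" and m: "g \<in> borel_measurable lebesgue"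
    using g by (auto simp: A0_def H0_def)
  have hc: "h \<in> borel_measurable circ" by (rule measurable_circ_lebesgue[OF h(2)])
  have gc: "g \<in> borel_measurable circ" by (rule measurable_circ_lebesgue[OF m])
  have "integrable circ (\<lambda>x. (h x)\<^sup>2)"
  proof (rule integrable_cong_AE[THEN iffD1])
    show "integrable circ (\<lambda>x. (g x)\<^sup>2)" using Hs_sq_int[OF H] by (simp add: sq_int_def)
    show "AE x in circ. (g x)\<^sup>2 = (h x)\<^sup>2" using hg by eventually_elim simp
  qed (use hc gc in auto)
  then have hs: "sq_int circ h" using hc by (simp add: sq_int_def)
  show f: "fcoeff h k = fcoeff g k" for k
    by (rule fcoeff_cong_AE[OF sq_int_integrable[OF finite_measure_circ hs] Hs_integrable[OF H] hg])
  have int: "(\<integral>x. F (h x) \<partial>circ) = (\<integral>x. F (g x) \<partial>circ)" if "F \<in> borel_measurable borel" for F :: "real \<Rightarrow> real"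
  proof (rule integral_cong_AE)
    show "(\<lambda>x. F (h x)) \<in> borel_measurable circ" "(\<lambda>x. F (g x)) \<in> borel_measurable circ"
      using measurable_compose[OF hc that] measurable_compose[OF gc that] by auto
    show "AE x in circ. F (h x) = F (g x)" using hg by eventually_elim simp
  qed
  have "Hs t h" using H hs by (simp add: Hs_def f)
  then show "h \<in> A0 t"
    using h int[of "\<lambda>x. x"] int[of "\<lambda>x. x ^ 4"] z one by (simp add: A0_def H0_def)
  show "Bc t c h = Bc t c g" using int[of "\<lambda>x. x\<^sup>2"] by (simp add: Bc_eq dq_def f)
qed

text \<open>Monotonicity is stated for the means \<open>vp\<close> because these are unchanged when
  \<open>g\<close> is modified on a null set.\<close>

theorem odd_monotone_minimizer:
  assumes t: "1/2 < t" "t \<le> 2" and c: "c > -1"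
  obtains g where "g \<in> A0 t" "odd_fun g" "\<And>u. u \<in> A0 t \<Longrightarrow> odd_fun u \<Longrightarrow> Bc t c g \<le> Bc t c u"
    "\<And>m x y. sin x \<le> sin y \<Longrightarrow> vp m g x \<le> vp m g y"
proof -
  obtain g where g: "g \<in> A0 t" "bal g" "\<And>u. u \<in> A0 t \<Longrightarrow> bal u \<Longrightarrow> Bc t c g \<le> Bc t c u"
    "\<And>p. cos p > 0 \<Longrightarrow> AE y in circ. pol (sh p g) y = sh p g y"
    using polarized_minimizer[OF t c] by blast
  have per: "per2pi g" and m: "g \<in> borel_measurable lebesgue" and H: "Hs t g" using g(1) by (auto simp: A0_def H0_def)
  note i = Hs_integrable[OF H]
  have iP: "integrable circ (pol (sh p g))" for p
    by (rule A0_integrable[OF A0_pol(1)[OF t A0_sh[OF g(1) t(1)]]])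
  have mono: "vp m g x \<le> vp m g y" if "sin x \<le> sin y" for m x y
    by (rule vp_mono_sin[OF per i iP g(4) that])
  have odd: "AE x in circ. g (- x) = - g x"
    by (rule balanced_monotone_odd_AE[OF g(2) Hs_sq_int[OF H] mono])
  \<comment> \<open>The odd part agrees with \<open>g\<close> almost everywhere and is odd at every
    point, as \<open>odd_fun\<close> demands.\<close>
  define h where "h x = (g x - g (- x)) / 2" for x
  have hg: "AE x in circ. h x = g x" using odd by eventually_elim (simp add: h_def)
  have hm: "h \<in> borel_measurable lebesgue"
  proof -
    have [measurable]: "(\<lambda>x. g (- x)) \<in> borel_measurable lebesgue"
      using measurable_lebesgue_affine[OF m, of "-1" 0] by simp
    have [measurable]: "g \<in> borel_measurable lebesgue" by fact
    show ?thesis unfolding h_def[abs_def] by measurable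
  qed
  have ho: "odd_fun h" by (simp add: odd_fun_def h_def field_simps)
  have hp: "per2pi h"
    using per per2pi_neg[OF per] by (simp add: per2pi_def h_def)
  note C = A0_cong_AE[OF g(1) hp hm hg]
  show thesis
  proof (rule that[OF C(1) ho])
    show "Bc t c h \<le> Bc t c u" if "u \<in> A0 t" "odd_fun u" for u
      unfolding C(3) using g(3)[OF that(1) bal_odd[OF that(2)]] .
    show "vp m h x \<le> vp m h y" if "sin x \<le> sin y" for m x y
      using mono[OF that, of m] by (simp add: vp_def C(2))
  qed
qed

lemma tannery:
  fixes a :: "nat \<Rightarrow> nat \<Rightarrow> real"
  assumes "\<And>k. (\<lambda>n. a k n) \<longlonglongrightarrow> b k" "\<And>k n. \<bar>a k n\<bar> \<le> M k" "summable M"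
  shows "(\<lambda>n. \<Sum>k. a k n) \<longlonglongrightarrow> (\<Sum>k. b k)"
proof -
  have "eventually (\<lambda>(k, n). norm (a k n) \<le> M k) (at_top \<times>\<^sub>F sequentially)"
    using assms(2) by (intro always_eventually) simp
  from tannerys_theorem[OF assms(1) this assms(3)] show ?thesis by simp
qed

section \<open>The Euler-Lagrange equation\<close>

lemma Cc_odd: "odd_fun u \<Longrightarrow> Cc u a = 0"
  unfolding Cc_def by (rule integral_odd_fun) (simp add: odd_fun_def)

lemma Sc_add: "integrable circ u \<Longrightarrow> integrable circ v \<Longrightarrow> Sc (\<lambda>x. u x + v x) a = Sc u a + Sc v a"
  using integrable_mult_sin[of u a] integrable_mult_sin[of v a] by (simp add: Sc_def distrib_right)

lemma integrable_power_le_fourth: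
  fixes u :: "'a \<Rightarrow> real"
  assumes "finite_measure M" "u \<in> borel_measurable M" "integrable M (\<lambda>x. u x ^ 4)" "j \<le> 4"
  shows "integrable M (\<lambda>x. u x ^ j)"
proof (rule Bochner_Integration.integrable_bound)
  interpret finite_measure M by fact
  show "integrable M (\<lambda>x. 1 + u x ^ 4)" using assms(3) by simp
  show "(\<lambda>x. u x ^ j) \<in> borel_measurable M" using assms(2) by measurable
  show "AE x in M. norm (u x ^ j) \<le> norm (1 + u x ^ 4)"
  proof (rule AE_I2)
    fix x
    have p: "0 \<le> u x ^ 4" by simp
    have "\<bar>u x\<bar> ^ j \<le> 1 + u x ^ 4"
    proof (cases "\<bar>u x\<bar> \<le> 1")
      case True
      then have "\<bar>u x\<bar> ^ j \<le> 1" by (intro power_le_one) auto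
      with p show ?thesis by linarith
    next
      case False
      then have "\<bar>u x\<bar> ^ j \<le> \<bar>u x\<bar> ^ 4" using assms(4) by (intro power_increasing) auto
      then show ?thesis by simp
    qed
    with p show "norm (u x ^ j) \<le> norm (1 + u x ^ 4)" by (simp add: power_abs)
  qed
qed

text \<open>The constrained problem in homogeneous form, by scaling to unit L^4 norm; for zero L^4
  norm it is nonnegativity of the energy. It allows perturbations that leave the constraint set, so
  the Lagrange multiplier comes out of a one-variable derivative.\<close>

lemma Bc_ge_L4_norm:
  assumes t: "t > 1/2" and c: "c > -1"
    and min: "\<And>u. u \<in> A0 t \<Longrightarrow> odd_fun u \<Longrightarrow> q \<le> Bc t c u"
    and v: "v \<in> H0 t" "odd_fun v"
  shows "q * sqrt (\<integral>x. v x ^ 4 \<partial>circ) \<le> Bc t c v"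
proof -
  have per: "per2pi v" and m: "v \<in> borel_measurable lebesgue" and H: "Hs t v" and z: "(\<integral>x. v x \<partial>circ) = 0"
    using v by (auto simp: H0_def)
  note i = Hs_integrable[OF H]
  define K where "K = (\<integral>x. v x ^ 4 \<partial>circ)"
  have K0: "K \<ge> 0" by (simp add: K_def)
  show ?thesis
  proof (cases "K = 0")
    case True
    have "pi * min 1 (1 + c) * dq t v \<le> Bc t c v" by (rule Bc_coercive[OF H _ z c]) (use t in simp)
    moreover have "0 \<le> pi * min 1 (1 + c) * dq t v" using c by (intro mult_nonneg_nonneg dq_nonneg) auto
    ultimately show ?thesis using True by (simp add: K_def)
  next
    case False
    then have K: "K > 0" using K0 by simp
    define s where "s = 1 / root 4 K"
    have s4: "s ^ 4 = 1 / K" using K by (simp add: s_def power_divide)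
    have "(s\<^sup>2)\<^sup>2 = (1 / sqrt K)\<^sup>2" using s4 K by (simp add: power_divide)
    then have s2: "s\<^sup>2 = 1 / sqrt K" using K by (subst (asm) power2_eq_iff_nonneg) auto
    define w where "w x = s * v x" for x
    have sw: "sq_int circ w" unfolding w_def by (rule sq_int_cmult[OF Hs_sq_int[OF H]])
    have f: "(cmod (fcoeff w k))\<^sup>2 = s\<^sup>2 * (cmod (fcoeff v k))\<^sup>2" for k
      unfolding w_def fcoeff_cmult[OF i] by (simp add: norm_mult power_mult_distrib)
    have "(\<lambda>k. s\<^sup>2 * (jb (t/2) k * (cmod (fcoeff v k))\<^sup>2)) summable_on UNIV"
      using H by (intro summable_on_cmult_right) (simp add: Hs_def)
    then have Hw: "Hs t w" using sw by (simp add: Hs_def f mult.left_commute)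
    have w4: "(\<integral>x. w x ^ 4 \<partial>circ) = 1"
      using s4 K by (simp add: w_def power_mult_distrib K_def[symmetric])
    have "w \<in> borel_measurable lebesgue" using m unfolding w_def[abs_def] by measurable
    moreover have "(\<integral>x. w x \<partial>circ) = 0" by (simp add: w_def z)
    moreover have "per2pi w" using per by (simp add: per2pi_def w_def)
    ultimately have wA: "w \<in> A0 t" using Hw w4 by (simp add: A0_def H0_def)
    have wo: "odd_fun w" using v(2) by (simp add: odd_fun_def w_def)
    have "dq t w = s\<^sup>2 * dq t v"
      unfolding dq_def f using infsum_cmult_right'[of "s\<^sup>2" "\<lambda>k. \<bar>real_of_int k\<bar> powr t * (cmod (fcoeff v k))\<^sup>2" UNIV]
      by (simp add: mult.left_commute)
    moreover have "(\<integral>x. (w x)\<^sup>2 \<partial>circ) = s\<^sup>2 * (\<integral>x. (v x)\<^sup>2 \<partial>circ)" by (simp add: w_def power_mult_distrib)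
    ultimately have "Bc t c w = s\<^sup>2 * Bc t c v" by (simp add: Bc_eq algebra_simps)
    then have "q \<le> Bc t c v / sqrt K" using min[OF wA wo] by (simp add: s2)
    then show ?thesis using K by (simp add: K_def[symmetric] field_simps)
  qed
qed

text \<open>Only the coefficients at \<open>n\<close> and \<open>- n\<close> change, so the energy
  is an exact quadratic polynomial in \<open>e\<close>.\<close>

lemma dq_add_sin:
  fixes n :: nat
  assumes H: "Hs t g" and t: "t \<ge> 0" and o: "odd_fun g" and n: "n \<ge> 1"
  shows "Hs t (\<lambda>x. g x + e * sin (real n * x))"
    "pi * dq t (\<lambda>x. g x + e * sin (real n * x)) = pi * dq t g + real n powr t * (e * Sc g (real n) + e\<^sup>2 * pi / 2)"
    "(\<integral>x. (g x + e * sin (real n * x))\<^sup>2 \<partial>circ) = (\<integral>x. (g x)\<^sup>2 \<partial>circ) + 2 * (e * Sc g (real n) + e\<^sup>2 * pi / 2)"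
proof -
  define v where "v x = g x + e * sin (real n * x)" for x
  have i: "integrable circ g" by (rule Hs_integrable[OF H])
  have sn: "sq_int circ (\<lambda>x. e * sin (real n * x))" by (intro sq_int_continuous continuous_intros)
  have in1: "integrable circ (\<lambda>x. e * sin (real n * x))" by (rule sq_int_integrable[OF finite_measure_circ sn])
  have sv: "sq_int circ v" unfolding v_def by (rule sq_int_add[OF Hs_sq_int[OF H] sn])
  have iv: "integrable circ v" by (rule sq_int_integrable[OF finite_measure_circ sv])
  have vo: "odd_fun v" using o by (simp add: odd_fun_def v_def)
  have Sv: "Sc v (of_int k) = Sc g (of_int k) + e * (if k = int n then pi else if k = - int n then - pi else 0)" for k
  proof -
    have "Sc (\<lambda>x. e * sin (real n * x)) (of_int k) = e * Sc (\<lambda>x. sin (real n * x)) (of_int k)"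
      by (simp add: Sc_def mult.assoc)
    then show ?thesis unfolding v_def Sc_add[OF i in1] by (simp add: Sc_sin[OF n])
  qed
  define D where "D = (2 * e * pi * Sc g (real n) + e\<^sup>2 * pi\<^sup>2) / (4 * pi\<^sup>2)"
  have f: "(cmod (fcoeff v k))\<^sup>2 = (cmod (fcoeff g k))\<^sup>2 + (if k \<in> {int n, - int n} then D else 0)" for k
    unfolding cmod_fcoeff[OF iv] cmod_fcoeff[OF i] Cc_odd[OF vo] Cc_odd[OF o] Sv D_def
    using Sc_neg[of g "real n"] by (auto simp: power2_sum add_divide_distrib power_mult_distrib power2_diff diff_divide_distrib)
  have fin: "(\<lambda>k. h k * (if k \<in> {int n, - int n} then D else 0)) summable_on UNIV"
    "(\<Sum>\<^sub>\<infinity>k. h k * (if k \<in> {int n, - int n} then D else 0)) = (h (int n) + h (- int n)) * D" for h :: "int \<Rightarrow> real"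
  proof -
    show "(\<lambda>k. h k * (if k \<in> {int n, - int n} then D else 0)) summable_on UNIV"
      by (rule finite_nonzero_values_imp_summable_on[OF finite_subset[of _ "{int n, - int n}"]]) auto
    have "(\<Sum>\<^sub>\<infinity>k. h k * (if k \<in> {int n, - int n} then D else 0)) = (\<Sum>\<^sub>\<infinity>k\<in>{int n, - int n}. h k * D)"
      by (rule infsum_cong_neutral) auto
    also have "\<dots> = (h (int n) + h (- int n)) * D" using n by (simp add: distrib_right)
    finally show "(\<Sum>\<^sub>\<infinity>k. h k * (if k \<in> {int n, - int n} then D else 0)) = (h (int n) + h (- int n)) * D" .
  qed
  have Hv: "Hs t v"
    using H sv fin(1)[of "jb (t/2)"] by (auto simp: Hs_def f distrib_left intro: summable_on_add)
  then show "Hs t (\<lambda>x. g x + e * sin (real n * x))" by (simp add: v_def[abs_def])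
  have "dq t v = dq t g + (\<bar>real_of_int (int n)\<bar> powr t + \<bar>real_of_int (- int n)\<bar> powr t) * D"
    unfolding dq_def f distrib_left infsum_add[OF dq_summable[OF H t] fin(1)[of "\<lambda>k. \<bar>real_of_int k\<bar> powr t"]]
      fin(2)[of "\<lambda>k. \<bar>real_of_int k\<bar> powr t"] ..
  then have "pi * dq t v = pi * dq t g + real n powr t * (2 * pi * D)" by (simp add: distrib_left)
  also have "2 * pi * D = e * Sc g (real n) + e\<^sup>2 * pi / 2"
    by (simp add: D_def power2_eq_square field_simps)
  finally show "pi * dq t (\<lambda>x. g x + e * sin (real n * x)) = pi * dq t g + real n powr t * (e * Sc g (real n) + e\<^sup>2 * pi / 2)"
    by (simp add: v_def[abs_def])
  have ss: "(\<integral>x. sin (real n * x) * sin (real n * x) \<partial>circ) = pi" using integral_circ_sin_sin[OF n n] by simp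
  have is2: "integrable circ (\<lambda>x. e\<^sup>2 * (sin (real n * x) * sin (real n * x)))"
    by (intro integrable_circ_continuous continuous_intros)
  have "(\<integral>x. (v x)\<^sup>2 \<partial>circ) = (\<integral>x. (g x)\<^sup>2 + 2 * e * (g x * sin (real n * x)) + e\<^sup>2 * (sin (real n * x) * sin (real n * x)) \<partial>circ)"
    by (intro Bochner_Integration.integral_cong refl) (simp add: v_def power2_eq_square algebra_simps)
  also have "\<dots> = (\<integral>x. (g x)\<^sup>2 \<partial>circ) + 2 * e * Sc g (real n) + e\<^sup>2 * pi"
    using Hs_sq_int[OF H] integrable_mult_sin[OF i, of "real n"] is2 ss by (simp add: Sc_def sq_int_def)
  finally show "(\<integral>x. (g x + e * sin (real n * x))\<^sup>2 \<partial>circ) = (\<integral>x. (g x)\<^sup>2 \<partial>circ) + 2 * (e * Sc g (real n) + e\<^sup>2 * pi / 2)"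
    by (simp add: v_def)
qed

text \<open>The gap \<open>F e\<close> in the homogeneous inequality for
  \<open>g + e * sin (n x)\<close> is nonnegative and vanishes at 0, so its derivative there is
  zero. The factor 2 arises from differentiating the square root of the fourth-power
  integral.\<close>

theorem Euler_Lagrange:
  fixes n :: nat
  assumes t: "t > 1/2" and c: "c > -1" and g: "g \<in> A0 t" "odd_fun g"
    and min: "\<And>u. u \<in> A0 t \<Longrightarrow> odd_fun u \<Longrightarrow> Bc t c g \<le> Bc t c u" and n: "n \<ge> 1"
  shows "(real n powr t + c) * Sc g (real n) = 2 * Bc t c g * Sc (\<lambda>x. g x ^ 3) (real n)"
proof -
  have per: "per2pi g" and m: "g \<in> borel_measurable lebesgue" and H: "Hs t g" and z: "(\<integral>x. g x \<partial>circ) = 0"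
    and one: "(\<integral>x. g x ^ 4 \<partial>circ) = 1" using g(1) by (auto simp: A0_def H0_def)
  note i = Hs_integrable[OF H]
  have t0: "t \<ge> 0" using t by simp
  let ?s = "\<lambda>x. sin (real n * x)"
  define q where "q = Bc t c g"
  define L where "L = real n powr t + c"
  have i4: "integrable circ (\<lambda>x. g x ^ 4)" by (rule Sobolev_L4(1)[OF H t])
  have ij: "integrable circ (\<lambda>x. g x ^ j * ?s x ^ k)" if "j \<le> 4" for j k
  proof (rule integrable_mult_bounded[of _ _ _ 1])
    show "integrable circ (\<lambda>x. g x ^ j)"
      by (rule integrable_power_le_fourth[OF finite_measure_circ borel_measurable_integrable[OF i] i4 that])
    show "norm (?s x ^ k) \<le> 1" for x by (simp add: power_abs power_le_one)
  qed simp
  \<comment> \<open>The integral of the fourth power is an exact polynomial in \<open>e\<close>, so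
    it can be differentiated as such.\<close>
  define P where "P e = 1 + e * (4 * (\<integral>x. g x ^ 3 * ?s x ^ 1 \<partial>circ)) + e ^ 2 * (6 * (\<integral>x. g x ^ 2 * ?s x ^ 2 \<partial>circ))
    + e ^ 3 * (4 * (\<integral>x. g x ^ 1 * ?s x ^ 3 \<partial>circ)) + e ^ 4 * (\<integral>x. g x ^ 0 * ?s x ^ 4 \<partial>circ)" for e
  have P: "(\<integral>x. (g x + e * ?s x) ^ 4 \<partial>circ) = P e" for e
  proof -
    have "(\<integral>x. (g x + e * ?s x) ^ 4 \<partial>circ) = (\<integral>x. g x ^ 4 + (e * 4) * (g x ^ 3 * ?s x ^ 1) + (e ^ 2 * 6) * (g x ^ 2 * ?s x ^ 2)
      + (e ^ 3 * 4) * (g x ^ 1 * ?s x ^ 3) + e ^ 4 * (g x ^ 0 * ?s x ^ 4) \<partial>circ)"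
      by (intro Bochner_Integration.integral_cong refl) (simp add: power4_eq_xxxx power3_eq_cube power2_eq_square algebra_simps)
    also have "\<dots> = P e"
      using ij[of 3 1] ij[of 2 2] ij[of 1 3] ij[of 0 4] i4 one by (simp add: P_def)
    finally show ?thesis .
  qed
  define F where "F e = q + L * (e * Sc g (real n) + e\<^sup>2 * pi / 2) - q * sqrt (P e)" for e
  have F0: "F 0 = 0" by (simp add: F_def P_def)
  have Fnn: "0 \<le> F e" for e
  proof -
    define v where "v x = g x + e * ?s x" for x
    note d = dq_add_sin[OF H t0 g(2) n, of e, folded v_def]
    have vo: "odd_fun v" using g(2) by (simp add: odd_fun_def v_def)
    have "per2pi v"
    proof -
      have "?s (x + 2 * pi) = ?s x" for x
        using sin.plus_of_nat[of "real n * x" n] by (simp add: distrib_left mult_ac)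
      then show ?thesis using per by (simp add: per2pi_def v_def)
    qed
    moreover have "v \<in> borel_measurable lebesgue"
    proof -
      have [measurable]: "?s \<in> borel_measurable (lebesgue :: real measure)"
        by (intro measurable_completion) (simp add: borel_measurable_continuous_onI continuous_intros)
      show ?thesis using m unfolding v_def[abs_def] by measurable
    qed
    ultimately have "v \<in> H0 t" using d(1) integral_odd_fun[OF vo] by (simp add: H0_def)
    from Bc_ge_L4_norm[OF t c min[folded q_def] this vo]
    have "q * sqrt (P e) \<le> Bc t c v" by (simp add: P[symmetric] v_def)
    also have "Bc t c v = q + L * (e * Sc g (real n) + e\<^sup>2 * pi / 2)"
      unfolding Bc_eq d(2,3) q_def L_def by (simp add: algebra_simps)
    finally show ?thesis by (simp add: F_def)
  qed
  have P0: "P 0 = 1" by (simp add: P_def)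
  have "(F has_field_derivative L * Sc g (real n) - q * (2 * (\<integral>x. g x ^ 3 * ?s x ^ 1 \<partial>circ))) (at 0)"
  proof -
    have Pd: "(P has_field_derivative 4 * (\<integral>x. g x ^ 3 * ?s x ^ 1 \<partial>circ)) (at 0)"
      unfolding P_def by (auto intro!: derivative_eq_intros)
    have "((\<lambda>e. sqrt (P e)) has_field_derivative (inverse (sqrt (P 0)) / 2) * (4 * (\<integral>x. g x ^ 3 * ?s x ^ 1 \<partial>circ))) (at 0)"
      by (rule DERIV_chain2[OF DERIV_real_sqrt Pd]) (simp add: P0)
    then have Sd: "((\<lambda>e. sqrt (P e)) has_field_derivative 2 * (\<integral>x. g x ^ 3 * ?s x ^ 1 \<partial>circ)) (at 0)"
      by (simp add: P0)
    show ?thesis unfolding F_def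
      by (rule derivative_eq_intros Sd refl | simp)+
  qed
  from DERIV_local_min[OF this, of 1] have "L * Sc g (real n) - q * (2 * (\<integral>x. g x ^ 3 * ?s x ^ 1 \<partial>circ)) = 0"
    using F0 Fnn by simp
  then show ?thesis by (simp add: L_def q_def Sc_def)
qed

section \<open>Regularity\<close>

lemma vp_odd:
  assumes "integrable circ g" "odd_fun g"
  shows "vp m g x = (\<Sum>n\<in>{1..m}. bp m n * Sc g (real n) * sin (real n * x)) / pi"
  using integral_odd_fun[OF assms(2)] by (simp add: vp_real[OF assms(1)] Cc_odd[OF assms(2)] mult.assoc)

text \<open>Interpolates between the bounds 2 and \<open>z\<close>, here between boundedness and
  Lipschitz continuity of the cosine.\<close>

lemma min_2_le_powr:
  fixes z a w :: real
  assumes "z > 0" "0 \<le> a" "a \<le> 1" "w \<le> 2" "w \<le> z"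
  shows "w \<le> 2 * z powr a"
proof (cases "z \<le> 1")
  case True
  then have "z powr 1 \<le> z powr a" using assms by (intro powr_mono') auto
  then show ?thesis using assms by (smt (verit) powr_ge_zero powr_one)
next
  case False
  then have "1 \<le> z powr a" using assms by (intro ge_one_powr_ge_zero) auto
  then show ?thesis using assms by linarith
qed

text \<open>A function that is nondecreasing on \<open>[x, pi/2]\<close> is bounded at \<open>x\<close> by its average, which gains
  one power of the frequency.\<close>

lemma vp_pointwise_bound:
  assumes i: "integrable circ g" and o: "odd_fun g"
    and mono: "\<And>m x y. sin x \<le> sin y \<Longrightarrow> vp m g x \<le> vp m g y"
    and ga: "0 \<le> ga" "ga \<le> 1" and sm: "summable (\<lambda>n. \<bar>Sc g (real n)\<bar> * real n powr (- ga))"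
    and x: "0 \<le> x" "x < pi / 2"
  shows "vp m g x \<le> 2 / pi * (\<Sum>n. \<bar>Sc g (real n)\<bar> * real n powr (- ga)) * (pi / 2 - x) powr (- ga)"
proof -
  let ?S = "\<Sum>n. \<bar>Sc g (real n)\<bar> * real n powr (- ga)"
  define d where "d = pi / 2 - x"
  have d: "d > 0" using x by (simp add: d_def)
  define V where "V y = (\<Sum>n\<in>{1..m}. bp m n * Sc g (real n) * (- cos (real n * y) / real n)) / pi" for y
  have I2: "(vp m g has_integral (V (pi / 2) - V x)) {x..pi/2}"
  proof (rule fundamental_theorem_of_calculus)
    show "x \<le> pi / 2" using x by simp
    fix y
    have "(V has_field_derivative (\<Sum>n\<in>{1..m}. bp m n * Sc g (real n) * sin (real n * y)) / pi) (at y)"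
      unfolding V_def
      by (auto intro!: derivative_eq_intros sum.cong)
    then show "(V has_vector_derivative vp m g y) (at y within {x..pi/2})"
      unfolding vp_odd[OF i o] by (simp add: has_real_derivative_iff_has_vector_derivative has_vector_derivative_at_within)
  qed
  have I1: "((\<lambda>_. vp m g x) has_integral (d * vp m g x)) {x..pi/2}"
    using has_integral_const_real[of "vp m g x" x "pi/2"] x by (simp add: d_def)
  have "d * vp m g x \<le> V (pi / 2) - V x"
  proof (rule has_integral_le[OF I1 I2])
    fix y assume "y \<in> {x..pi/2}"
    then show "vp m g x \<le> vp m g y" using x by (intro mono sin_monotone_2pi_le) auto
  qed
  also have "\<dots> = (\<Sum>n\<in>{1..m}. bp m n * Sc g (real n) * ((cos (real n * x) - cos (real n * (pi / 2))) / real n)) / pi"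
    by (simp add: V_def diff_divide_distrib[symmetric] sum_subtractf[symmetric] right_diff_distrib)
  also have "\<dots> \<le> (\<Sum>n\<in>{1..m}. 2 * d powr (1 - ga) * (\<bar>Sc g (real n)\<bar> * real n powr (- ga))) / pi"
  proof (intro divide_right_mono sum_mono)
    fix n assume n: "n \<in> {1..m}"
    then have n0: "real n > 0" by simp
    have "\<bar>cos (real n * x) - cos (real n * (pi / 2))\<bar> \<le> 2"
      using abs_triangle_ineq4[of "cos (real n * x)" "cos (real n * (pi / 2))"] abs_cos_le_one[of "real n * x"] abs_cos_le_one[of "real n * (pi / 2)"]
      by linarith
    moreover have "\<bar>cos (real n * x) - cos (real n * (pi / 2))\<bar> \<le> real n * d"
    proof -
      have "\<bar>cos (real n * x) - cos (real n * (pi / 2))\<bar> \<le> \<bar>real n * x - real n * (pi / 2)\<bar>"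
      proof -
        have "cos a - cos b = 2 * sin ((a + b) / 2) * sin ((b - a) / 2)" for a b :: real by (rule cos_diff_cos)
        then have "\<bar>cos a - cos b\<bar> \<le> 2 * 1 * \<bar>(b - a) / 2\<bar>" for a b :: real
          unfolding abs_mult by (simp only: abs_mult abs_numeral) (intro mult_mono abs_sin_le_one abs_sin_x_le_abs_x, auto)
        then show ?thesis by (simp add: abs_minus_commute)
      qed
      also have "real n * x - real n * (pi / 2) = - (real n * d)" by (simp add: d_def algebra_simps)
      also have "\<bar>- (real n * d)\<bar> = real n * d" using n0 d by simp
      finally show ?thesis .
    qed
    \<comment> \<open>The exponent \<open>1 - ga\<close> leaves \<open>n powr (- ga)\<close> after
      division by \<open>n\<close>, matching the assumed summability, and the singularity of order
      \<open>ga\<close> after division by \<open>d\<close>.\<close>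
    ultimately have "\<bar>cos (real n * x) - cos (real n * (pi / 2))\<bar> \<le> 2 * (real n * d) powr (1 - ga)"
      using ga n0 d by (intro min_2_le_powr) auto
    also have "\<dots> = 2 * d powr (1 - ga) * (real n * real n powr (- ga))"
      using n0 d by (simp add: powr_mult powr_diff powr_minus field_simps)
    finally have "\<bar>cos (real n * x) - cos (real n * (pi / 2))\<bar> / real n \<le> 2 * d powr (1 - ga) * real n powr (- ga)"
      using n0 by (simp add: field_simps)
    then have "\<bar>(cos (real n * x) - cos (real n * (pi / 2))) / real n\<bar> \<le> 2 * d powr (1 - ga) * real n powr (- ga)"
      using n0 by simp
    then have "\<bar>bp m n * Sc g (real n)\<bar> * \<bar>(cos (real n * x) - cos (real n * (pi / 2))) / real n\<bar> \<le> \<bar>Sc g (real n)\<bar> * (2 * d powr (1 - ga) * real n powr (- ga))"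
      using bp_le_1[of m n] bp_nonneg[of m n] by (intro mult_mono) (auto simp: abs_mult mult_left_le_one_le)
    then have "bp m n * Sc g (real n) * ((cos (real n * x) - cos (real n * (pi / 2))) / real n) \<le> \<bar>Sc g (real n)\<bar> * (2 * d powr (1 - ga) * real n powr (- ga))"
      unfolding abs_mult[symmetric] by (rule order_trans[OF abs_ge_self])
    then show "bp m n * Sc g (real n) * ((cos (real n * x) - cos (real n * (pi / 2))) / real n) \<le> 2 * d powr (1 - ga) * (\<bar>Sc g (real n)\<bar> * real n powr (- ga))"
      by (simp only: mult_ac)
  qed simp
  also have "\<dots> \<le> 2 * d powr (1 - ga) * ?S / pi"
    unfolding sum_distrib_left[symmetric] by (intro divide_right_mono mult_left_mono sum_le_suminf sm) auto
  finally have "vp m g x \<le> 2 * d powr (1 - ga) * ?S / pi / d" using d by (simp add: field_simps)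
  also have "\<dots> = 2 / pi * ?S * d powr (- ga)" using d by (simp add: powr_diff powr_minus field_simps)
  finally show ?thesis by (simp add: d_def)
qed

text \<open>Symmetry about 0 and pi/2 reduces the integral to four quarter periods. The quarter
  [0, pi/2] is cut at pi/2 - 1/n: on the left the second mean value theorem for the monotone cube
  gains 1/n against its last value, of order n^(3 ga); on the right the singularity of order 3 ga <
  1 is integrated. Both parts have order n^(3 ga - 1).\<close>

lemma vp_cube_coeff_bound:
  assumes i: "integrable circ g" and o: "odd_fun g"
    and mono: "\<And>x y. sin x \<le> sin y \<Longrightarrow> vp m g x \<le> vp m g y"
    and ga: "0 \<le> ga" "ga < 1/3" and K: "K \<ge> 0"
    and bound: "\<And>x. 0 \<le> x \<Longrightarrow> x < pi / 2 \<Longrightarrow> vp m g x \<le> K * (pi / 2 - x) powr (- ga)"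
    and n: "n \<ge> (1::nat)"
  shows "\<bar>Sc (\<lambda>x. vp m g x ^ 3) (real n)\<bar> \<le> 4 * K ^ 3 * (2 + 1 / (1 - 3 * ga)) * real n powr (3 * ga - 1)"
proof -
  define G where "G = vp m g"
  define f where "f x = G x ^ 3 * sin (real n * x)" for x
  have cG: "continuous_on S G" for S unfolding G_def by (rule continuous_on_vp)
  have cf: "continuous_on S f" for S unfolding f_def by (intro continuous_intros cG)
  have fi: "f integrable_on {a..b}" for a b by (rule integrable_continuous_interval[OF cf])
  have Gneg: "G (- x) = - G x" for x
    by (simp add: G_def vp_odd[OF i o] sum_negf)
  have Gpi: "G (pi - x) = G x" for x
    unfolding G_def by (intro antisym mono) auto
  have feven: "f (- x) = f x" for x by (simp add: f_def Gneg)
  define I where "I = integral {0..pi/2} f"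
  have refl: "integral {- b..- a} f = integral {a..b} f" for a b
    using Henstock_Kurzweil_Integration.integral_reflect_real[of b a f] by (simp add: feven)
  \<comment> \<open>Reflection about pi/2 keeps the mean and multiplies the sine by
    \<open>- cos (n pi)\<close>.\<close>
  have "integral {pi/2..pi} f = - cos (real n * pi) * I"
  proof -
    have "integral {pi/2..pi} f = integral {- pi..- (pi/2)} f" by (rule refl[symmetric])
    also have "\<dots> = integral {- pi - (- pi)..- (pi/2) - (- pi)} (\<lambda>x. f (x + (- pi)))"
      by (rule integral_shift_real_ivl[symmetric])
    also have "{- pi - (- pi)..- (pi/2) - (- pi)} = {0..pi/2}" by simp
    also have "(\<lambda>x. f (x + (- pi))) = (\<lambda>x. (- cos (real n * pi)) * f x)"
    proof
      fix x
      have "f (x + (- pi)) = f (pi - x)" using feven[of "pi - x"] by simp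
      also have "\<dots> = - cos (real n * pi) * f x"
        by (simp add: f_def Gpi right_diff_distrib sin_diff)
      finally show "f (x + (- pi)) = (- cos (real n * pi)) * f x" .
    qed
    also have "integral {0..pi/2} (\<lambda>x. (- cos (real n * pi)) * f x) = - cos (real n * pi) * I"
      unfolding I_def by (rule integral_mult_right)
    finally show ?thesis .
  qed
  then have "\<bar>integral {pi/2..pi} f\<bar> \<le> \<bar>I\<bar>"
    using mult_right_mono[OF abs_cos_le_one[of "real n * pi"], of "\<bar>I\<bar>"] by (simp add: abs_mult)
  moreover have "Sc (\<lambda>x. vp m g x ^ 3) (real n) = integral {- pi..pi} f"
    unfolding Sc_def G_def[symmetric] f_def[symmetric] by (rule integral_circ_HK[OF integrable_circ_continuous[OF cf]])
  moreover have "integral {- pi..pi} f = integral {- pi..0} f + integral {0..pi} f"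
    by (rule Henstock_Kurzweil_Integration.integral_combine[symmetric]) (auto simp: fi)
  moreover have "integral {- pi..0} f = integral {0..pi} f" using refl[of pi 0] by simp
  moreover have "integral {0..pi} f = I + integral {pi/2..pi} f"
    unfolding I_def by (rule Henstock_Kurzweil_Integration.integral_combine[symmetric]) (auto simp: fi)
  ultimately have Sc: "\<bar>Sc (\<lambda>x. vp m g x ^ 3) (real n)\<bar> \<le> 4 * \<bar>I\<bar>" by linarith
  have Gm: "G x \<le> G y" if "0 \<le> x" "x \<le> y" "y \<le> pi / 2" for x y
    unfolding G_def by (rule mono) (use that in \<open>auto intro!: sin_monotone_2pi_le\<close>)
  have G0: "G 0 = 0" using Gneg[of 0] by simp
  have Gnn: "0 \<le> G x" if "0 \<le> x" "x \<le> pi / 2" for x using Gm[of 0 x] that G0 by simp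
  define d where "d = 1 / real n"
  have d: "d > 0" "d \<le> 1" using n by (auto simp: d_def)
  define y where "y = pi / 2 - d"
  have y: "0 \<le> y" "y < pi / 2" using d pi_gt3 by (auto simp: y_def)
  have dp: "d powr (- a) = real n powr a" for a using n by (simp add: d_def powr_minus powr_divide inverse_eq_divide)
  have n0: "real n > 0" using n by simp
  have "\<bar>integral {0..y} f\<bar> \<le> 2 * K ^ 3 * real n powr (3 * ga - 1)"
  proof -
    have sint: "(\<lambda>x. sin (real n * x)) integrable_on {0..y}"
      by (intro integrable_continuous_interval continuous_intros)
    have G3m: "G a ^ 3 \<le> G b ^ 3" if "0 \<le> a" "a \<le> b" "b \<le> y" for a b
      using that y by (intro power_mono Gm Gnn) auto
    \<comment> \<open>The first of the two terms disappears because \<open>G 0 = 0\<close> by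
      oddness.\<close>
    obtain c where c: "c \<in> {0..y}" "integral {0..y} (\<lambda>x. G x ^ 3 * sin (real n * x))
        = G 0 ^ 3 * integral {0..c} (\<lambda>x. sin (real n * x)) + G y ^ 3 * integral {c..y} (\<lambda>x. sin (real n * x))"
      by (rule second_mean_value_theorem[OF sint y(1) G3m])
    have "((\<lambda>x. sin (real n * x)) has_integral ((- cos (real n * y) / real n) - (- cos (real n * c) / real n))) {c..y}"
    proof (rule fundamental_theorem_of_calculus)
      show "c \<le> y" using c by simp
      fix x
      have "((\<lambda>x. - cos (real n * x) / real n) has_field_derivative sin (real n * x)) (at x)"
        using n0 by (auto intro!: derivative_eq_intros)
      then show "((\<lambda>x. - cos (real n * x) / real n) has_vector_derivative sin (real n * x)) (at x within {c..y})"
        by (simp add: has_real_derivative_iff_has_vector_derivative has_vector_derivative_at_within)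
    qed
    then have "integral {c..y} (\<lambda>x. sin (real n * x)) = (cos (real n * c) - cos (real n * y)) / real n"
      by (simp add: integral_unique diff_divide_distrib)
    moreover have "\<bar>cos (real n * c) - cos (real n * y)\<bar> \<le> 2"
      using abs_cos_le_one[of "real n * c"] abs_cos_le_one[of "real n * y"] by linarith
    ultimately have s: "\<bar>integral {c..y} (\<lambda>x. sin (real n * x))\<bar> \<le> 2 / real n"
      using n0 by (simp add: abs_divide divide_right_mono)
    have "G y ^ 3 \<le> (K * (pi / 2 - y) powr (- ga)) ^ 3"
      using bound[OF y] Gnn[of y] y by (intro power_mono) (auto simp: G_def)
    also have "\<dots> = K ^ 3 * real n powr (3 * ga)"
      using dp[of ga] n0 by (simp add: y_def power_mult_distrib powr_power mult.commute)
    finally have Gy: "G y ^ 3 \<le> K ^ 3 * real n powr (3 * ga)" .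
    have "\<bar>integral {0..y} f\<bar> = G y ^ 3 * \<bar>integral {c..y} (\<lambda>x. sin (real n * x))\<bar>"
    proof -
      have "f = (\<lambda>x. G x ^ 3 * sin (real n * x))" by (simp add: f_def fun_eq_iff)
      then show ?thesis using c(2) G0 Gnn[of y] y by (simp add: abs_mult)
    qed
    also have "\<dots> \<le> K ^ 3 * real n powr (3 * ga) * (2 / real n)"
      using Gnn[of y] y K by (intro mult_mono Gy s) auto
    also have "\<dots> = 2 * K ^ 3 * real n powr (3 * ga - 1)"
      using n0 by (simp add: powr_diff)
    finally show ?thesis .
  qed
  moreover have "\<bar>integral {y..pi/2} f\<bar> \<le> K ^ 3 / (1 - 3 * ga) * real n powr (3 * ga - 1)"
  proof -
    define b where "b = 1 - 3 * ga"
    have b: "b > 0" using ga by (simp add: b_def)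
    define H where "H x = (if x = pi / 2 then G x ^ 3 else K ^ 3 * (pi / 2 - x) powr (b - 1))" for x
    define W where "W x = - (K ^ 3 * (pi / 2 - x) powr b / b)" for x
    have HI: "(H has_integral (W (pi / 2) - W y)) {y..pi/2}"
    proof (rule fundamental_theorem_of_calculus_interior)
      show "y \<le> pi / 2" using y by simp
      show "continuous_on {y..pi/2} W"
        unfolding W_def using b by (intro continuous_intros continuous_on_powr') auto
      fix x assume x: "x \<in> {y<..<pi/2}"
      have "(W has_field_derivative K ^ 3 * (pi / 2 - x) powr (b - 1)) (at x)"
        unfolding W_def using x b by (auto intro!: derivative_eq_intros)
      then show "(W has_vector_derivative H x) (at x)"
        using x by (simp add: H_def has_real_derivative_iff_has_vector_derivative)
    qed
    have fH: "\<bar>f x\<bar> \<le> H x" if x: "x \<in> {y..pi/2}" for x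
    proof -
      have x0: "0 \<le> x" "x \<le> pi / 2" using x y by auto
      have "\<bar>f x\<bar> = G x ^ 3 * \<bar>sin (real n * x)\<bar>" using Gnn[OF x0] by (simp add: f_def abs_mult)
      also have "\<dots> \<le> G x ^ 3 * 1" using Gnn[OF x0] by (intro mult_left_mono) auto
      also have "\<dots> \<le> H x"
      proof (cases "x = pi / 2")
        case False
        then have xl: "x < pi / 2" using x0 by simp
        have "G x ^ 3 \<le> (K * (pi / 2 - x) powr (- ga)) ^ 3"
          using bound[OF x0(1) xl] Gnn[OF x0] by (intro power_mono) (auto simp: G_def)
        also have "\<dots> = K ^ 3 * (pi / 2 - x) powr (b - 1)"
          using xl by (simp add: power_mult_distrib powr_power b_def mult.commute)
        finally show ?thesis using False by (simp add: H_def)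
      qed (simp add: H_def)
      finally show ?thesis .
    qed
    have "norm (integral {y..pi/2} f) \<le> integral {y..pi/2} H"
      by (rule integral_norm_bound_integral[OF fi]) (use HI fH in auto)
    also have "\<dots> = W (pi / 2) - W y" by (rule integral_unique[OF HI])
    also have "\<dots> = K ^ 3 / b * d powr b" using b by (simp add: W_def y_def)
    also have "d powr b = real n powr (3 * ga - 1)" using dp[of "- b"] by (simp add: b_def)
    finally show ?thesis by (simp add: b_def)
  qed
  moreover have "I = integral {0..y} f + integral {y..pi/2} f"
    unfolding I_def by (rule Henstock_Kurzweil_Integration.integral_combine[symmetric]) (use y in \<open>auto simp: fi\<close>)
  ultimately have "\<bar>I\<bar> \<le> 2 * K ^ 3 * real n powr (3 * ga - 1) + K ^ 3 / (1 - 3 * ga) * real n powr (3 * ga - 1)"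
    by linarith
  also have "\<dots> = K ^ 3 * (2 + 1 / (1 - 3 * ga)) * real n powr (3 * ga - 1)"
    by (simp add: algebra_simps)
  finally show ?thesis using Sc by simp
qed

lemma Hs_vp:
  assumes H: "Hs t g"
  shows "Hs t (vp m g)" "en t (vp m g) \<le> en t g"
proof -
  note i = Hs_integrable[OF H]
  have "(\<Sum>k\<in>{- int N..int N}. jb (t/2) k * (cmod (fcoeff (vp m g) k))\<^sup>2) \<le> en t g" for N
  proof -
    have "(\<Sum>k\<in>{- int N..int N}. jb (t/2) k * (cmod (fcoeff (vp m g) k))\<^sup>2) \<le> (\<Sum>k\<in>{- int N..int N}. jb (t/2) k * (cmod (fcoeff g k))\<^sup>2)"
    proof (rule sum_mono)
      fix k
      have "cmod (fcoeff (vp m g) k) \<le> cmod (fcoeff g k)"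
        unfolding fcoeff_vp[OF i] norm_mult norm_of_real using bp_le_1[of m "nat \<bar>k\<bar>"] bp_nonneg[of m "nat \<bar>k\<bar>"]
        by (simp add: mult_left_le_one_le)
      then have "(cmod (fcoeff (vp m g) k))\<^sup>2 \<le> (cmod (fcoeff g k))\<^sup>2" by (intro power_mono) auto
      then show "jb (t/2) k * (cmod (fcoeff (vp m g) k))\<^sup>2 \<le> jb (t/2) k * (cmod (fcoeff g k))\<^sup>2"
        by (rule mult_left_mono) (rule less_imp_le[OF jb_pos])
    qed
    also have "\<dots> \<le> en t g" by (rule en_sum_le[OF H]) simp
    finally show ?thesis .
  qed
  note S = int_summable_bounded[where f = "\<lambda>k. jb (t/2) k * (cmod (fcoeff (vp m g) k))\<^sup>2", OF en_term_nonneg this]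
  show "Hs t (vp m g)" using S(1) sq_int_vp by (simp add: Hs_def)
  show "en t (vp m g) \<le> en t g" unfolding en_def[of t "vp m g"] by (rule S(2))
qed

text \<open>From |u^3 - v^3| \<le> 3/2 |u - v| (u^2 + v^2) and Cauchy-Schwarz: the first factor
  tends to zero in L^2, the second is bounded in L^2 because the means do not increase the energy
  and hence have bounded L^4 norms.\<close>

lemma vp_cube_limit:
  assumes H: "Hs t g" and t: "t > 1/2"
  shows "(\<lambda>m. Sc (\<lambda>x. vp m g x ^ 3) a) \<longlonglongrightarrow> Sc (\<lambda>x. g x ^ 3) a"
proof -
  define C where "C = 2 * pi * jbsum t * (en t g)\<^sup>2"
  have p4: "((b::real)\<^sup>2)\<^sup>2 = b ^ 4" for b by simp
  have gs: "sq_int circ g" by (rule Hs_sq_int[OF H])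
  have vs: "sq_int circ (vp m g)" for m by (rule sq_int_vp)
  have g4: "integrable circ (\<lambda>x. g x ^ 4)" "(\<integral>x. g x ^ 4 \<partial>circ) \<le> C"
    using Sobolev_L4[OF H t] by (auto simp: C_def)
  have v4: "integrable circ (\<lambda>x. vp m g x ^ 4)" "(\<integral>x. vp m g x ^ 4 \<partial>circ) \<le> C" for m
  proof -
    show "integrable circ (\<lambda>x. vp m g x ^ 4)" by (rule Sobolev_L4(1)[OF Hs_vp(1)[OF H] t])
    have "(\<integral>x. vp m g x ^ 4 \<partial>circ) \<le> 2 * pi * jbsum t * (en t (vp m g))\<^sup>2" by (rule Sobolev_L4(2)[OF Hs_vp(1)[OF H] t])
    also have "\<dots> \<le> C" unfolding C_def using Hs_vp(2)[OF H, of m] by (intro mult_left_mono power_mono en_nonneg) (auto simp: jbsum_nonneg)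
    finally show "(\<integral>x. vp m g x ^ 4 \<partial>circ) \<le> C" .
  qed
  have i3: "integrable circ (\<lambda>x. u x ^ 3)" if "sq_int circ u" "integrable circ (\<lambda>x. u x ^ 4)" for u
    by (rule integrable_power_le_fourth[OF finite_measure_circ _ that(2)]) (use that(1) in \<open>auto simp: sq_int_def\<close>)
  have q: "sq_int circ (\<lambda>x. 3 / 2 * ((vp m g x)\<^sup>2 + (g x)\<^sup>2))" for m
    using gs vs[of m] g4 v4[of m] by (intro sq_int_cmult sq_int_add) (auto simp: sq_int_def)
  have Q: "(\<integral>x. (3 / 2 * ((vp m g x)\<^sup>2 + (g x)\<^sup>2))\<^sup>2 \<partial>circ) \<le> 9 * C" for m
  proof -
    have "(3 / 2 * (a + b))\<^sup>2 \<le> 9 / 2 * a\<^sup>2 + 9 / 2 * b\<^sup>2" for a b :: real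
      using sum_squares_bound[of a b] by (simp add: power_mult_distrib power2_sum power_divide)
    then have "(3 / 2 * ((vp m g x)\<^sup>2 + (g x)\<^sup>2))\<^sup>2 \<le> 9 / 2 * vp m g x ^ 4 + 9 / 2 * g x ^ 4" for x
      unfolding p4[symmetric] .
    then have "(\<integral>x. (3 / 2 * ((vp m g x)\<^sup>2 + (g x)\<^sup>2))\<^sup>2 \<partial>circ) \<le> (\<integral>x. 9 / 2 * vp m g x ^ 4 + 9 / 2 * g x ^ 4 \<partial>circ)"
      using q[of m] v4(1) g4(1) by (intro integral_mono) (auto simp: sq_int_def)
    also have "\<dots> = 9 / 2 * (\<integral>x. vp m g x ^ 4 \<partial>circ) + 9 / 2 * (\<integral>x. g x ^ 4 \<partial>circ)"
      using v4(1)[of m] g4(1) by simp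
    finally show ?thesis using v4(2)[of m] g4(2) by simp
  qed
  have ad: "sq_int circ (\<lambda>x. \<bar>vp m g x - g x\<bar>)" for m
    using sq_int_diff[OF vs gs, of m] borel_measurable_abs[of "\<lambda>x. vp m g x - g x" circ] by (simp add: sq_int_def)
  have "norm (Sc (\<lambda>x. vp m g x ^ 3) a - Sc (\<lambda>x. g x ^ 3) a) \<le> sqrt (\<integral>x. (vp m g x - g x)\<^sup>2 \<partial>circ) * sqrt (9 * C)" for m
  proof -
    note ii = i3[OF vs v4(1), of m] i3[OF gs g4(1)]
    have di: "integrable circ (\<lambda>x. (vp m g x ^ 3 - g x ^ 3) * sin (a * x))"
      using ii by (intro integrable_mult_sin) auto
    have "Sc (\<lambda>x. vp m g x ^ 3) a - Sc (\<lambda>x. g x ^ 3) a = (\<integral>x. (vp m g x ^ 3 - g x ^ 3) * sin (a * x) \<partial>circ)"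
      using Sc_diff[OF ii, of a] by (simp add: Sc_def)
    also have "norm \<dots> \<le> (\<integral>x. \<bar>(vp m g x ^ 3 - g x ^ 3) * sin (a * x)\<bar> \<partial>circ)"
      using integral_abs_bound[of circ "\<lambda>x. (vp m g x ^ 3 - g x ^ 3) * sin (a * x)"] by simp
    also have "\<dots> \<le> (\<integral>x. \<bar>vp m g x - g x\<bar> * (3 / 2 * ((vp m g x)\<^sup>2 + (g x)\<^sup>2)) \<partial>circ)"
    proof (rule integral_mono)
      show "integrable circ (\<lambda>x. \<bar>(vp m g x ^ 3 - g x ^ 3) * sin (a * x)\<bar>)" using di by simp
      show "integrable circ (\<lambda>x. \<bar>vp m g x - g x\<bar> * (3 / 2 * ((vp m g x)\<^sup>2 + (g x)\<^sup>2)))"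
        by (rule sq_int_mult[OF ad q])
      fix x
      have *: "\<bar>u ^ 3 - v ^ 3\<bar> \<le> \<bar>u - v\<bar> * (3 / 2 * (u\<^sup>2 + v\<^sup>2))" for u v :: real
      proof -
        have "u ^ 3 - v ^ 3 = (u - v) * (u\<^sup>2 + u * v + v\<^sup>2)" by (simp add: power3_eq_cube power2_eq_square algebra_simps)
        moreover have b: "\<bar>u\<^sup>2 + u * v + v\<^sup>2\<bar> \<le> 3 / 2 * (u\<^sup>2 + v\<^sup>2)"
          using sum_squares_bound[of u v] sum_squares_bound[of u "- v"] zero_le_power2[of u] zero_le_power2[of v]
          unfolding power2_minus by (simp add: abs_le_iff del: zero_le_power2)
        ultimately show ?thesis using mult_left_mono[OF b abs_ge_zero[of "u - v"]] by (simp only: abs_mult)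
      qed
      have "\<bar>(vp m g x ^ 3 - g x ^ 3) * sin (a * x)\<bar> \<le> \<bar>vp m g x ^ 3 - g x ^ 3\<bar> * 1"
        unfolding abs_mult by (intro mult_left_mono) auto
      then have "\<bar>(vp m g x ^ 3 - g x ^ 3) * sin (a * x)\<bar> \<le> \<bar>vp m g x ^ 3 - g x ^ 3\<bar>" by (simp only: mult_1_right)
      from order_trans[OF this *]
      show "\<bar>(vp m g x ^ 3 - g x ^ 3) * sin (a * x)\<bar> \<le> \<bar>vp m g x - g x\<bar> * (3 / 2 * ((vp m g x)\<^sup>2 + (g x)\<^sup>2))" .
    qed
    also have "\<dots> \<le> sqrt (\<integral>x. (vp m g x - g x)\<^sup>2 \<partial>circ) * sqrt (\<integral>x. (3 / 2 * ((vp m g x)\<^sup>2 + (g x)\<^sup>2))\<^sup>2 \<partial>circ)"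
      using abs_le_D1[OF Cauchy_Schwarz_integral_abs[OF ad q]] by simp
    also have "\<dots> \<le> sqrt (\<integral>x. (vp m g x - g x)\<^sup>2 \<partial>circ) * sqrt (9 * C)"
      by (intro mult_left_mono real_sqrt_le_mono Q) auto
    finally show ?thesis .
  qed
  note le = this
  have "(\<lambda>m. sqrt (\<integral>x. (vp m g x - g x)\<^sup>2 \<partial>circ) * sqrt (9 * C)) \<longlonglongrightarrow> sqrt 0 * sqrt (9 * C)"
    by (intro tendsto_intros vp_L2 gs)
  then have "(\<lambda>m. Sc (\<lambda>x. vp m g x ^ 3) a - Sc (\<lambda>x. g x ^ 3) a) \<longlonglongrightarrow> 0"
    by (intro Lim_null_comparison[OF always_eventually[OF allI[OF le]]]) simp
  then show ?thesis by (simp add: LIM_zero_iff)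
qed

lemma Sc_summable_weighted:
  assumes H: "Hs t g" and t: "t \<ge> 0"
  shows "summable (\<lambda>n. real n powr t * (Sc g (real n))\<^sup>2)"
proof (rule summableI_nonneg_bounded)
  fix N
  have le: "(Sc g (real n))\<^sup>2 \<le> 4 * pi\<^sup>2 * (cmod (fcoeff g (int n)))\<^sup>2" for n
    by (simp add: cmod_fcoeff[OF Hs_integrable[OF H]])
  have "(\<Sum>n<N. real n powr t * (Sc g (real n))\<^sup>2) \<le> (\<Sum>n<N. 4 * pi\<^sup>2 * (\<bar>real_of_int (int n)\<bar> powr t * (cmod (fcoeff g (int n)))\<^sup>2))"
  proof (rule sum_mono)
    fix n
    have "real n powr t * (Sc g (real n))\<^sup>2 \<le> real n powr t * (4 * pi\<^sup>2 * (cmod (fcoeff g (int n)))\<^sup>2)"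
      by (intro mult_left_mono le) auto
    then show "real n powr t * (Sc g (real n))\<^sup>2 \<le> 4 * pi\<^sup>2 * (\<bar>real_of_int (int n)\<bar> powr t * (cmod (fcoeff g (int n)))\<^sup>2)"
      by (simp add: mult_ac)
  qed
  also have "\<dots> = 4 * pi\<^sup>2 * (\<Sum>k\<in>int ` {..<N}. \<bar>real_of_int k\<bar> powr t * (cmod (fcoeff g k))\<^sup>2)"
    by (subst sum.reindex) (auto simp: sum_distrib_left)
  also have "\<dots> \<le> 4 * pi\<^sup>2 * dq t g"
    by (intro mult_left_mono dq_sum_le H t) auto
  finally show "(\<Sum>n<N. real n powr t * (Sc g (real n))\<^sup>2) \<le> 4 * pi\<^sup>2 * dq t g" .
qed simp

text \<open>A bootstrap on \<open>Q ga\<close>. A singularity of order \<open>ga\<close> gives cube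
  coefficients of order n^(3 ga - 1); the Euler-Lagrange equation gains n^(-t), whence
  \<open>Q ga'\<close> for all \<open>ga' > 3 * ga - t\<close>. As long as
  \<open>ga \<le> 1/4\<close>, this lowers the exponent precisely because \<open>t > 1/2\<close>; at
  \<open>ga = 0\<close> the claimed decay is reached.\<close>

theorem coefficient_decay:
  assumes t: "t > 1/2" and c: "c > -1" and g: "g \<in> A0 t" "odd_fun g"
    and min: "\<And>u. u \<in> A0 t \<Longrightarrow> odd_fun u \<Longrightarrow> Bc t c g \<le> Bc t c u"
    and mono: "\<And>m x y. sin x \<le> sin y \<Longrightarrow> vp m g x \<le> vp m g y"
  obtains C where "\<And>n. n \<ge> 1 \<Longrightarrow> \<bar>Sc g (real n)\<bar> \<le> C * real n powr (- 1 - t)"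
proof -
  have H: "Hs t g" using g(1) by (auto simp: A0_def H0_def)
  note i = Hs_integrable[OF H]
  define Q where "Q ga \<longleftrightarrow> summable (\<lambda>n. \<bar>Sc g (real n)\<bar> * real n powr (- ga))" for ga
  have decay: "\<exists>C. \<forall>n\<ge>1. \<bar>Sc g (real n)\<bar> \<le> C * real n powr (3 * ga - 1 - t)" if Qg: "Q ga" and ga: "0 \<le> ga" "ga < 1/3" for ga
  proof -
    define K where "K = 2 / pi * (\<Sum>n. \<bar>Sc g (real n)\<bar> * real n powr (- ga))"
    have K: "K \<ge> 0" unfolding K_def using Qg by (intro mult_nonneg_nonneg suminf_nonneg) (auto simp: Q_def)
    define K' where "K' = 4 * K ^ 3 * (2 + 1 / (1 - 3 * ga))"
    have "\<bar>Sc (\<lambda>x. g x ^ 3) (real n)\<bar> \<le> K' * real n powr (3 * ga - 1)" if n: "n \<ge> 1" for n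
    proof (rule LIMSEQ_le_const2)
      show "(\<lambda>m. \<bar>Sc (\<lambda>x. vp m g x ^ 3) (real n)\<bar>) \<longlonglongrightarrow> \<bar>Sc (\<lambda>x. g x ^ 3) (real n)\<bar>"
        by (intro tendsto_intros vp_cube_limit[OF H t])
      have "\<bar>Sc (\<lambda>x. vp m g x ^ 3) (real n)\<bar> \<le> K' * real n powr (3 * ga - 1)" for m
        unfolding K'_def
      proof (rule vp_cube_coeff_bound[OF i g(2) mono ga K _ n])
        show "vp m g x \<le> K * (pi / 2 - x) powr (- ga)" if "0 \<le> x" "x < pi / 2" for x
          unfolding K_def using ga Qg by (intro vp_pointwise_bound[OF i g(2) mono _ _ _ that]) (auto simp: Q_def)
      qed
      then show "\<exists>M. \<forall>m\<ge>M. \<bar>Sc (\<lambda>x. vp m g x ^ 3) (real n)\<bar> \<le> K' * real n powr (3 * ga - 1)" by blast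
    qed
    note cube = this
    \<comment> \<open>Keeps \<open>n powr t + c\<close> comparable to \<open>n powr t\<close> also
      for negative \<open>c > -1\<close>.\<close>
    define \<kappa> where "\<kappa> = min 1 (1 + c)"
    have k: "\<kappa> > 0" using c by (simp add: \<kappa>_def)
    have "\<bar>Sc g (real n)\<bar> \<le> (2 * \<bar>Bc t c g\<bar> * K' / \<kappa>) * real n powr (3 * ga - 1 - t)" if n: "n \<ge> 1" for n
    proof -
      have nt: "real n powr t \<ge> 1" using n t by (intro ge_one_powr_ge_zero) auto
      have "\<kappa> * real n powr t \<le> real n powr t + c"
      proof (cases "c \<ge> 0")
        case False
        then have "c * real n powr t \<le> c * 1" using nt by (intro mult_left_mono_neg) auto
        then show ?thesis using False by (simp add: \<kappa>_def distrib_right)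
      qed (simp add: \<kappa>_def)
      then have "\<kappa> * real n powr t * \<bar>Sc g (real n)\<bar> \<le> (real n powr t + c) * \<bar>Sc g (real n)\<bar>" by (rule mult_right_mono) simp
      also have "\<dots> = \<bar>(real n powr t + c) * Sc g (real n)\<bar>" using nt c by (simp add: abs_mult)
      also have "\<dots> = 2 * \<bar>Bc t c g\<bar> * \<bar>Sc (\<lambda>x. g x ^ 3) (real n)\<bar>"
      proof -
        have "(real n powr t + c) * Sc g (real n) = 2 * Bc t c g * Sc (\<lambda>x. g x ^ 3) (real n)"
          by (rule Euler_Lagrange[OF t c g min n])
        then show ?thesis by (simp only: abs_mult abs_numeral)
      qed
      also have "\<dots> \<le> 2 * \<bar>Bc t c g\<bar> * (K' * real n powr (3 * ga - 1))"
        by (intro mult_left_mono cube n) auto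
      finally have "\<kappa> * real n powr t * \<bar>Sc g (real n)\<bar> \<le> 2 * \<bar>Bc t c g\<bar> * (K' * real n powr (3 * ga - 1))" .
      then have "\<bar>Sc g (real n)\<bar> \<le> 2 * \<bar>Bc t c g\<bar> * (K' * real n powr (3 * ga - 1)) / (\<kappa> * real n powr t)"
      proof -
        have "\<kappa> * real n powr t > 0" using k nt by (intro mult_pos_pos) linarith+
        then show ?thesis using \<open>\<kappa> * real n powr t * \<bar>Sc g (real n)\<bar> \<le> 2 * \<bar>Bc t c g\<bar> * (K' * real n powr (3 * ga - 1))\<close>
          by (simp only: pos_le_divide_eq mult.commute[of _ "\<kappa> * real n powr t"])
      qed
      also have "\<dots> = (2 * \<bar>Bc t c g\<bar> * K' / \<kappa>) * real n powr (3 * ga - 1 - t)"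
        by (simp add: powr_diff mult_ac)
      finally show ?thesis .
    qed
    then show ?thesis by blast
  qed
  have step: "Q ga'" if Qg: "Q ga" and ga: "0 \<le> ga" "ga < 1/3" and gt: "ga' > 3 * ga - t" for ga ga'
  proof -
    obtain C where C: "\<And>n. n \<ge> 1 \<Longrightarrow> \<bar>Sc g (real n)\<bar> \<le> C * real n powr (3 * ga - 1 - t)"
      using decay[OF Qg ga] by blast
    have "summable (\<lambda>n. C * real n powr (3 * ga - 1 - t - ga'))"
      using gt by (intro summable_mult) (simp add: summable_real_powr_iff)
    then show "Q ga'" unfolding Q_def
    proof (rule summable_comparison_test')
      fix n :: nat assume n: "n \<ge> 1"
      have "\<bar>Sc g (real n)\<bar> * real n powr (- ga') \<le> C * real n powr (3 * ga - 1 - t) * real n powr (- ga')"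
        by (intro mult_right_mono C n) auto
      also have "\<dots> = C * real n powr (3 * ga - 1 - t - ga')"
        unfolding mult.assoc powr_add[symmetric] by simp
      finally show "norm (\<bar>Sc g (real n)\<bar> * real n powr (- ga')) \<le> C * real n powr (3 * ga - 1 - t - ga')" by simp
    qed
  qed
  \<comment> \<open>The product of n^(t/2) |Sc g n| and n^(-1/4 - t/2) is bounded by the sum of
    their squares; the energy makes one series converge, \<open>t > 1/2\<close> the other.\<close>
  have start: "Q (1/4)"
    unfolding Q_def
  proof (rule summable_comparison_test'[of _ 1])
    show "summable (\<lambda>n. real n powr t * (Sc g (real n))\<^sup>2 + real n powr (- 1/2 - t))"
      using t by (intro summable_add Sc_summable_weighted H) (auto simp: summable_real_powr_iff)
    fix n :: nat assume n: "n \<ge> 1"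
    define a where "a = real n powr (t / 2) * \<bar>Sc g (real n)\<bar>"
    define b where "b = real n powr (- 1/4 - t / 2)"
    have "real n powr (t / 2) * real n powr (- 1/4 - t / 2) = real n powr (- 1/4)"
      by (simp only: powr_add[symmetric]) simp
    moreover have "a * b = real n powr (t / 2) * real n powr (- 1/4 - t / 2) * \<bar>Sc g (real n)\<bar>"
      by (simp only: a_def b_def mult_ac)
    ultimately have "a * b = real n powr (- 1/4) * \<bar>Sc g (real n)\<bar>" by (simp only:)
    moreover have "a\<^sup>2 = real n powr t * (Sc g (real n))\<^sup>2"
    proof -
      have "(real n powr (t / 2))\<^sup>2 = real n powr t" by (simp add: power2_eq_square powr_add[symmetric])
      then show ?thesis by (simp add: a_def power_mult_distrib)
    qed
    moreover have "b\<^sup>2 = real n powr (- 1/2 - t)"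
      by (simp add: b_def power2_eq_square powr_add[symmetric])
    moreover have "a * b \<le> a\<^sup>2 + b\<^sup>2" 
      using sum_squares_bound[of a b] zero_le_power2[of a] zero_le_power2[of b] by linarith
    ultimately show "norm (\<bar>Sc g (real n)\<bar> * real n powr - (1/4)) \<le> real n powr t * (Sc g (real n))\<^sup>2 + real n powr (- 1/2 - t)"
      by (simp add: mult.commute)
  qed
  \<comment> \<open>For \<open>ga \<le> 1/4\<close> one has
    \<open>3 * ga - t \<le> ga - 2 * \<delta>\<close>, so each round can lower the exponent by
    \<open>\<delta>\<close> with strict inequality to spare.\<close>
  define \<delta> where "\<delta> = (t - 1/2) / 2"
  have d: "\<delta> > 0" using t by (simp add: \<delta>_def)
  have iter: "Q (max 0 (1/4 - real k * \<delta>))" for k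
  proof (induction k)
    case (Suc k)
    let ?ga = "max 0 (1/4 - real k * \<delta>)"
    have "0 \<le> real k * \<delta>" using d by simp
    then have le: "?ga \<le> 1/4" by (intro max.boundedI) auto
    show ?case
    proof (rule step[OF Suc])
      have "3 * ?ga - t \<le> ?ga - 2 * \<delta>" using le by (simp add: \<delta>_def field_simps)
      also have "\<dots> < max 0 (1/4 - real (Suc k) * \<delta>)" using d by (simp add: distrib_right)
      finally show "3 * ?ga - t < max 0 (1/4 - real (Suc k) * \<delta>)" .
    qed (use le in auto)
  qed (use start in simp)
  obtain k :: nat where "1/4 / \<delta> < real k" using reals_Archimedean2 by blast
  then have "1/4 - real k * \<delta> < 0" using d by (simp add: field_simps)
  then have "Q 0" using iter[of k] by (simp add: max_absorb1)
  from decay[OF this] obtain C where "\<forall>n\<ge>1. \<bar>Sc g (real n)\<bar> \<le> C * real n powr (3 * 0 - 1 - t)" by auto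
  then show thesis by (intro that[of C]) auto
qed

section \<open>Strict monotonicity\<close>

text \<open>The absolutely convergent sine series is the continuous representative. The means
  \<open>vp\<close> converge to it at every point by dominated convergence for series, which turns
  their monotonicity into that of the function itself.\<close>

theorem continuous_minimizer:
  assumes t: "1/2 < t" "t \<le> 2" and c: "c > -1"
  obtains g where "g \<in> A0 t" "odd_fun g" "\<And>u. u \<in> A0 t \<Longrightarrow> odd_fun u \<Longrightarrow> Bc t c g \<le> Bc t c u"
    "continuous_on UNIV g" "\<And>x y. sin x \<le> sin y \<Longrightarrow> g x \<le> g y"
    "summable (\<lambda>n. \<bar>Sc g (real n)\<bar>)" "\<And>x. g x = (\<Sum>n. Sc g (real n) * sin (real n * x)) / pi"
proof -
  obtain g where g: "g \<in> A0 t" "odd_fun g" "\<And>u. u \<in> A0 t \<Longrightarrow> odd_fun u \<Longrightarrow> Bc t c g \<le> Bc t c u"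
    "\<And>m x y. sin x \<le> sin y \<Longrightarrow> vp m g x \<le> vp m g y"
    using odd_monotone_minimizer[OF t c] by blast
  have H: "Hs t g" using g(1) by (auto simp: A0_def H0_def)
  note i = Hs_integrable[OF H]
  define b where "b n = Sc g (real n)" for n :: nat
  have b0: "b 0 = 0" by (simp add: b_def Sc_def)
  obtain C where C: "\<And>n. n \<ge> 1 \<Longrightarrow> \<bar>b n\<bar> \<le> C * real n powr (- 1 - t)"
    unfolding b_def using coefficient_decay[OF t(1) c g(1,2) g(3) g(4)] by blast
  have "summable (\<lambda>n. C * real n powr (- 1 - t))"
    using t by (intro summable_mult) (simp add: summable_real_powr_iff)
  then have sb: "summable (\<lambda>n. \<bar>b n\<bar>)"
    by (rule summable_comparison_test'[of _ 1]) (use C in auto)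
  have nb: "\<bar>b n * sin (real n * x)\<bar> \<le> \<bar>b n\<bar>" for n x
    using mult_left_mono[OF abs_sin_le_one abs_ge_zero, of "b n" "real n * x"] by (simp add: abs_mult)
  have ss: "summable (\<lambda>n. b n * sin (real n * x))" for x
    by (rule summable_comparison_test'[OF sb, of 0]) (use nb in simp)
  define h where "h x = (\<Sum>n. b n * sin (real n * x)) / pi" for x
  have hc: "continuous_on UNIV h"
  proof -
    have "uniform_limit UNIV (\<lambda>N x. \<Sum>n<N. b n * sin (real n * x)) (\<lambda>x. \<Sum>n. b n * sin (real n * x)) sequentially"
      by (rule Weierstrass_m_test[OF _ sb]) (use nb in simp)
    then have "continuous_on UNIV (\<lambda>x. \<Sum>n. b n * sin (real n * x))"
      by (rule uniform_limit_theorem[rotated]) (auto intro!: always_eventually continuous_intros)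
    then show ?thesis unfolding h_def by (intro continuous_intros) auto
  qed
  have sums1: "(\<Sum>n\<in>{1..m}. F n * b n * sin (real n * x)) = (\<Sum>n\<le>m. F n * b n * sin (real n * x))" for F :: "nat \<Rightarrow> real" and m x
    by (rule sum.mono_neutral_left) (auto simp: b0 not_less_eq_eq)
  have AE: "AE x in circ. h x = g x"
  proof -
    note gs = Hs_sq_int[OF H]
    obtain r where r: "strict_mono r" "AE x in circ. (\<lambda>n. psum (fcoeff g) (r n) x) \<longlonglongrightarrow> g x"
      by (rule L2_limit_AE_subseq[where u = "psum (fcoeff g)", OF finite_measure_circ sq_int_psum gs psum_fcoeff_tendsto[OF gs]])
    have p: "psum (fcoeff g) N x = (\<Sum>n\<le>N. b n * sin (real n * x)) / pi" for N x
      using psum_real[OF i, of "\<lambda>_. 1" N x] sums1[of "\<lambda>_. 1" x N] integral_odd_fun[OF g(2)]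
      by (simp add: Cc_odd[OF g(2)] b_def)
    have "(\<lambda>N. psum (fcoeff g) N x) \<longlonglongrightarrow> h x" for x
      unfolding p h_def by (intro tendsto_intros summable_LIMSEQ' ss) auto
    then have L: "(\<lambda>n. psum (fcoeff g) (r n) x) \<longlonglongrightarrow> h x" for x
      using LIMSEQ_subseq_LIMSEQ[OF _ r(1)] by (auto simp: o_def)
    show ?thesis using r(2) by eventually_elim (rule LIMSEQ_unique[OF L])
  qed
  have hp: "per2pi h"
  proof -
    have "sin (real n * (x + 2 * pi)) = sin (real n * x)" for n x
      using sin.plus_of_nat[of "real n * x" n] by (simp add: distrib_left mult_ac)
    then show ?thesis by (simp add: per2pi_def h_def)
  qed
  have ho: "odd_fun h" by (simp add: odd_fun_def h_def suminf_minus[OF ss])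
  have hm: "h \<in> borel_measurable lebesgue"
    by (intro measurable_completion) (simp add: borel_measurable_continuous_onI[OF hc])
  note A = A0_cong_AE[OF g(1) hp hm AE]
  have hi: "integrable circ h" by (rule A0_integrable[OF A(1)])
  have Sch: "Sc h (real n) = b n" for n
    using A(2)[of "int n"] by (simp add: fcoeff_Cc_Sc[OF hi] fcoeff_Cc_Sc[OF i] b_def)
  have lim: "(\<lambda>m. vp m g x) \<longlonglongrightarrow> h x" for x
  proof -
    have "(\<lambda>m. \<Sum>n. bp m n * (b n * sin (real n * x))) \<longlonglongrightarrow> (\<Sum>n. 1 * (b n * sin (real n * x)))"
    proof (rule tannery[OF _ _ sb])
      show "(\<lambda>m. bp m n * (b n * sin (real n * x))) \<longlonglongrightarrow> 1 * (b n * sin (real n * x))" for n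
        using bp_limits[of n] by (intro tendsto_intros) auto
      show "\<bar>bp m n * (b n * sin (real n * x))\<bar> \<le> \<bar>b n\<bar>" for n m
        using mult_left_le_one_le[OF abs_ge_zero[of "b n * sin (real n * x)"], of "bp m n"] nb[of n x] bp_nonneg[of m n] bp_le_1[of m n]
        by (simp only: abs_mult[of "bp m n"]) simp
    qed
    moreover have "(\<Sum>n. bp m n * (b n * sin (real n * x))) = pi * vp m g x" for m
    proof -
      have "(\<Sum>n. bp m n * (b n * sin (real n * x))) = (\<Sum>n\<in>{1..m}. bp m n * (b n * sin (real n * x)))"
        by (rule suminf_finite) (auto simp: bp_eq_0 b0 not_le less_Suc_eq_le)
      then show ?thesis unfolding vp_odd[OF i g(2)] by (simp add: b_def mult.assoc)
    qed
    ultimately have "(\<lambda>m. pi * vp m g x / pi) \<longlonglongrightarrow> h x" unfolding h_def by (intro tendsto_intros) auto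
    then show ?thesis by simp
  qed
  show thesis
  proof (rule that[OF A(1) ho _ hc])
    show "Bc t c h \<le> Bc t c u" if "u \<in> A0 t" "odd_fun u" for u using g(3)[OF that] A(3) by simp
    show "h x \<le> h y" if "sin x \<le> sin y" for x y
      by (rule LIMSEQ_le[OF lim lim]) (use g(4)[OF that] in auto)
    show "summable (\<lambda>n. \<bar>Sc h (real n)\<bar>)" using sb by (simp add: Sch)
    show "h x = (\<Sum>n. Sc h (real n) * sin (real n * x)) / pi" for x unfolding Sch by (rule h_def)
  qed
qed

lemma Sc_reflection_difference:
  assumes h: "per2pi h" "integrable circ h" "odd_fun h"
  shows "Sc (\<lambda>r. h (p + r) - h (p - r)) (real n) = 2 * cos (real n * p) * Sc h (real n)"
    "integrable circ (\<lambda>r. h (p + r) - h (p - r))"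
proof -
  have i: "integrable circ (sh p h)" using integrable_sh[of h "\<lambda>x. x"] h by simp
  then have i': "integrable circ (\<lambda>r. sh p h (- r))" using integrable_circ_reflect[of "sh p h"] by simp
  have eq: "(\<lambda>r. h (p + r) - h (p - r)) = (\<lambda>r. sh p h r - sh p h (- r))"
    by (simp add: sh_def fun_eq_iff add.commute)
  show "integrable circ (\<lambda>r. h (p + r) - h (p - r))" unfolding eq using i i' by simp
  show "Sc (\<lambda>r. h (p + r) - h (p - r)) (real n) = 2 * cos (real n * p) * Sc h (real n)"
    unfolding eq Sc_diff[OF i i'] Sc_reflect Sc_sh[OF h(1,2)] Cc_odd[OF h(3)] by simp
qed

text \<open>For \<open>w r = g (p + r) - g (p - r)\<close> the Euler-Lagrange equation reads \<open>w = (M + |D|\<^sup>t)\<^sup>-\<^sup>1 F\<close> with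
  \<open>F\<close> of the sign of \<open>sin\<close>. Writing \<open>X = M + 1 + |D|\<^sup>t\<close>, the identity
  \<open>1 / (X - 1) = (\<Sum>j<J. X\<^sup>-\<^sup>j\<^sup>-\<^sup>1) + X\<^sup>-\<^sup>J / (X - 1)\<close> shows \<open>w \<ge> X\<^sup>-\<^sup>J w\<close> on \<open>(0, pi)\<close>, and after
  rescaling the right-hand side converges to the first sine mode of \<open>w\<close>, which is positive.\<close>

theorem strictly_monotone:
  assumes t: "1/2 < t" "t \<le> 2" and c: "c > -1" and g: "g \<in> A0 t" "odd_fun g"
    and min: "\<And>u. u \<in> A0 t \<Longrightarrow> odd_fun u \<Longrightarrow> Bc t c g \<le> Bc t c u"
    and mono: "\<And>x y. sin x \<le> sin y \<Longrightarrow> g x \<le> g y"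
    and sb: "summable (\<lambda>n. \<bar>Sc g (real n)\<bar>)"
    and ser: "\<And>x. g x = (\<Sum>n. Sc g (real n) * sin (real n * x)) / pi"
    and ps: "cos p > 0" "sin s > 0"
  shows "g (p - s) < g (p + s)"
proof -
  have per: "per2pi g" and H: "Hs t g" and z: "(\<integral>x. g x \<partial>circ) = 0" and one: "(\<integral>x. g x ^ 4 \<partial>circ) = 1"
    using g(1) by (auto simp: A0_def H0_def)
  note i = Hs_integrable[OF H]
  define b where "b n = Sc g (real n)" for n :: nat
  define w where "w n = 2 * cos (real n * p) * b n" for n :: nat
  have wb: "\<bar>w n\<bar> \<le> 2 * \<bar>b n\<bar>" for n
    using mult_right_mono[OF abs_cos_le_one, of "\<bar>b n\<bar>" "real n * p"] by (simp add: w_def abs_mult)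
  have s2b: "summable (\<lambda>n. 2 * \<bar>b n\<bar>)" using sb by (intro summable_mult) (simp add: b_def)
  have wsb: "\<bar>w n * sin (real n * s)\<bar> \<le> 2 * \<bar>b n\<bar>" for n
  proof -
    have "\<bar>w n * sin (real n * s)\<bar> \<le> \<bar>w n\<bar> * 1" unfolding abs_mult by (intro mult_left_mono) auto
    then show ?thesis using wb[of n] by simp
  qed
  have ss: "summable (\<lambda>n. b n * sin (real n * x))" for x
  proof (rule summable_comparison_test'[OF s2b, of 0])
    fix n
    have "\<bar>b n * sin (real n * x)\<bar> \<le> \<bar>b n\<bar> * 1" unfolding abs_mult by (intro mult_left_mono) auto
    then show "norm (b n * sin (real n * x)) \<le> 2 * \<bar>b n\<bar>" by simp
  qed
  define R where "R = (\<Sum>n. w n * sin (real n * s))"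
  have R: "R = pi * (g (p + s) - g (p - s))"
  proof -
    have "pi * (g (p + s) - g (p - s)) = (\<Sum>n. b n * sin (real n * (p + s))) - (\<Sum>n. b n * sin (real n * (p - s)))"
      using ser[of "p + s"] ser[of "p - s"] by (simp add: b_def right_diff_distrib)
    also have "\<dots> = (\<Sum>n. b n * sin (real n * (p + s)) - b n * sin (real n * (p - s)))"
      by (rule suminf_diff[OF ss ss])
    also have "\<dots> = R" unfolding R_def
      by (intro arg_cong[where f = suminf] ext) (simp add: w_def distrib_left right_diff_distrib sin_add sin_diff algebra_simps)
    finally show ?thesis ..
  qed
  have g0: "g 0 = 0" using g(2) by (simp add: odd_fun_def) (metis add.inverse_neutral neg_equal_zero)
  \<comment> \<open>By monotonicity \<open>g\<close> has the sign of \<open>sin\<close> and vanishes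
    where \<open>sin\<close> does, so a zero integral would make \<open>g\<close> vanish almost
    everywhere, against the constraint.\<close>
  have b1: "b 1 > 0"
  proof -
    have nn: "0 \<le> g x * sin x" for x
      using mono[of 0 x] mono[of x 0] g0 by (cases "sin x \<ge> 0") (auto simp: mult_nonpos_nonpos)
    have gi: "integrable circ (\<lambda>x. g x * sin x)" using integrable_mult_sin[OF i, of 1] by simp
    have "b 1 = (\<integral>x. g x * sin x \<partial>circ)" by (simp add: b_def Sc_def)
    moreover have "(\<integral>x. g x * sin x \<partial>circ) \<noteq> 0"
    proof
      assume "(\<integral>x. g x * sin x \<partial>circ) = 0"
      then have "AE x in circ. g x * sin x = 0" using gi nn by (subst (asm) integral_nonneg_eq_0_iff_AE) auto
      then have "AE x in circ. g x ^ 4 = 0"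
      proof eventually_elim
        fix x assume "g x * sin x = 0"
        then have "g x = 0" using mono[of x 0] mono[of 0 x] g0 by (cases "sin x = 0") auto
        then show "g x ^ 4 = 0" by simp
      qed
      then have "(\<integral>x. g x ^ 4 \<partial>circ) = 0" by (rule integral_eq_zero_AE)
      then show False using one by simp
    qed
    moreover have "0 \<le> (\<integral>x. g x * sin x \<partial>circ)" by (rule Bochner_Integration.integral_nonneg) (rule nn)
    ultimately show ?thesis by simp
  qed
  have w1: "w 1 > 0" using b1 ps by (simp add: w_def)
  \<comment> \<open>Large enough that \<open>M - c \<ge> 0\<close>, so that \<open>F\<close> below
    has the sign of \<open>sin\<close>, and that \<open>X n \<ge> 1\<close>.\<close>
  define M where "M = \<bar>c\<bar> + 1"
  define l where "l = 2 * Bc t c g"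
  have l0: "l \<ge> 0"
  proof -
    have "pi * min 1 (1 + c) * dq t g \<le> Bc t c g" by (rule Bc_coercive[OF H _ z c]) (use t in simp)
    moreover have "0 \<le> pi * min 1 (1 + c) * dq t g" using c by (intro mult_nonneg_nonneg dq_nonneg) auto
    ultimately show ?thesis by (simp add: l_def)
  qed
  define X where "X n = M + 1 + real n powr t" for n :: nat
  have X1: "X n \<ge> 1" for n by (simp add: X_def M_def)
  \<comment> \<open>The Euler-Lagrange equation for the reflection difference, with
    \<open>(M - c)\<close> times that difference added to both sides.\<close>
  define F where "F r = l * (g (p + r) ^ 3 - g (p - r) ^ 3) + (M - c) * (g (p + r) - g (p - r))" for r
  have i3: "integrable circ (\<lambda>x. g x ^ 3)"
    by (rule integrable_power_le_fourth[OF finite_measure_circ borel_measurable_integrable[OF i] Sobolev_L4(1)[OF H t(1)]]) simp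
  have per3: "per2pi (\<lambda>x. g x ^ 3)" and odd3: "odd_fun (\<lambda>x. g x ^ 3)"
    using per g(2) by (simp_all add: per2pi_def odd_fun_def)
  note d1 = Sc_reflection_difference[OF per i g(2), of p]
  note d3 = Sc_reflection_difference[OF per3 i3 odd3, of p]
  have Fi: "integrable circ F" unfolding F_def using d1(2) d3(2) by simp
  have Fsgn: "0 \<le> F r * sin r" for r
  proof -
    have sd: "sin (p + r) - sin (p - r) = 2 * cos p * sin r" by (simp add: sin_add sin_diff)
    have Mc: "M - c \<ge> 0" by (simp add: M_def)
    show ?thesis
    proof (cases "sin r \<ge> 0")
      case True
      then have "0 \<le> 2 * cos p * sin r" using ps by simp
      then have "g (p - r) \<le> g (p + r)" using sd by (intro mono) linarith
      moreover from this have "g (p - r) ^ 3 \<le> g (p + r) ^ 3" by (intro power_mono_odd) auto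
      ultimately have "0 \<le> F r" unfolding F_def using l0 Mc by (intro add_nonneg_nonneg mult_nonneg_nonneg) auto
      with True show ?thesis by simp
    next
      case False
      then have "2 * cos p * sin r \<le> 0" using ps by (simp add: mult_nonneg_nonpos)
      then have "g (p + r) \<le> g (p - r)" using sd by (intro mono) linarith
      moreover from this have "g (p + r) ^ 3 \<le> g (p - r) ^ 3" by (intro power_mono_odd) auto
      ultimately have "F r \<le> 0" unfolding F_def using l0 Mc by (intro add_nonpos_nonpos mult_nonneg_nonpos) auto
      with False show ?thesis by (simp add: mult_nonpos_nonpos)
    qed
  qed
  have ScF: "Sc F (real n) = (X n - 1) * w n" if n: "n \<ge> 1" for n
  proof -
    have "Sc F (real n) = l * Sc (\<lambda>r. g (p + r) ^ 3 - g (p - r) ^ 3) (real n) + (M - c) * Sc (\<lambda>r. g (p + r) - g (p - r)) (real n)"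
      unfolding F_def Sc_def using integrable_mult_sin[OF d3(2), of "real n"] integrable_mult_sin[OF d1(2), of "real n"]
      by (simp add: distrib_right mult.assoc)
    also have "\<dots> = 2 * cos (real n * p) * (l * Sc (\<lambda>x. g x ^ 3) (real n) + (M - c) * b n)"
      unfolding d1(1) d3(1) by (simp add: b_def algebra_simps)
    also have "l * Sc (\<lambda>x. g x ^ 3) (real n) = (real n powr t + c) * b n"
      unfolding l_def b_def by (rule Euler_Lagrange[OF t(1) c g min n, symmetric])
    also have "2 * cos (real n * p) * ((real n powr t + c) * b n + (M - c) * b n) = (X n - 1) * w n"
      by (simp add: X_def w_def algebra_simps)
    finally show ?thesis .
  qed
  \<comment> \<open>The factor \<open>bp k n\<close> makes the sum finite, so that
    \<open>cone_apply\<close> gives its sign; letting \<open>k\<close> tend to infinity removes the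
    factor under the majorant \<open>2 * \<bar>b n\<bar>\<close>.\<close>
  have T: "0 \<le> (\<Sum>n. (1 / X n) ^ Suc j * ((X n - 1) * (w n * sin (real n * s))))" for j
  proof -
    have M1: "M + 1 > 0" by (simp add: M_def)
    define a where "a k n = bp k n * (1 / X n) ^ Suc j * ((X n - 1) * (w n * sin (real n * s)))" for k n
    have "(\<lambda>k. \<Sum>n. a k n) \<longlonglongrightarrow> (\<Sum>n. 1 * (1 / X n) ^ Suc j * ((X n - 1) * (w n * sin (real n * s))))"
    proof (rule tannery[OF _ _ s2b])
      show "(\<lambda>k. a k n) \<longlonglongrightarrow> 1 * (1 / X n) ^ Suc j * ((X n - 1) * (w n * sin (real n * s)))" for n
        unfolding a_def using bp_limits[of n] by (intro tendsto_intros) auto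
      fix n k
      have "\<bar>a k n\<bar> = bp k n * ((1 / X n) ^ j * ((X n - 1) / X n)) * \<bar>w n * sin (real n * s)\<bar>"
        using X1[of n] bp_nonneg[of k n] by (simp add: a_def abs_mult power_abs)
      also have "\<dots> \<le> 1 * (1 * 1) * \<bar>w n * sin (real n * s)\<bar>"
        using X1[of n] bp_nonneg[of k n] bp_le_1[of k n]
        by (intro mult_right_mono mult_mono power_le_one) (auto intro!: mult_nonneg_nonneg divide_nonneg_nonneg)
      finally show "\<bar>a k n\<bar> \<le> 2 * \<bar>b n\<bar>" using wsb[of n] by simp
    qed
    moreover have "0 \<le> (\<Sum>n. a k n)" for k
    proof -
      have cn: "cone k (\<lambda>n. bp k n * (1 / X n) ^ Suc j)"
        using cone_bp_resolvent[of "t / 2" "M + 1" k j] t M1 by (simp add: X_def)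
      have "0 \<le> (\<Sum>n\<in>{1..k}. bp k n * (1 / X n) ^ Suc j * Sc F (real n) * sin (real n * s)) * sin s"
        by (rule cone_apply[OF cn Fi]) (use Fsgn in auto)
      then have "0 \<le> (\<Sum>n\<in>{1..k}. bp k n * (1 / X n) ^ Suc j * Sc F (real n) * sin (real n * s))"
        using ps by (simp add: zero_le_mult_iff)
      also have "\<dots> = (\<Sum>n\<in>{1..k}. a k n)"
        by (intro sum.cong refl) (simp add: a_def ScF)
      also have "\<dots> = (\<Sum>n. a k n)"
      proof (rule suminf_finite[symmetric])
        fix n assume "n \<notin> {1..k}"
        then have "n = 0 \<or> k < n" by auto
        then show "a k n = 0" by (auto simp: a_def bp_eq_0)
      qed simp
      finally show ?thesis .
    qed
    ultimately show ?thesis using LIMSEQ_le_const[of _ _ 0] by fastforce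
  qed
  have sw: "summable (\<lambda>n. f n * (w n * sin (real n * s)))" if "\<And>n. \<bar>f n\<bar> \<le> 1" for f
  proof (rule summable_comparison_test'[OF s2b, of 0])
    fix n
    have "\<bar>f n * (w n * sin (real n * s))\<bar> \<le> 1 * \<bar>w n * sin (real n * s)\<bar>"
      unfolding abs_mult[of "f n"] by (intro mult_right_mono that) auto
    then show "norm (f n * (w n * sin (real n * s))) \<le> 2 * \<bar>b n\<bar>" using wsb[of n] by simp
  qed
  have Xj: "\<bar>(1 / X n) ^ j\<bar> \<le> 1" for n j
    using X1[of n] by (simp add: power_abs power_le_one)
  have X11: "\<bar>(1 / X n) ^ Suc j * (X n - 1)\<bar> \<le> 1" for n j
  proof -
    have "\<bar>(1 / X n) ^ Suc j * (X n - 1)\<bar> = (1 / X n) ^ j * ((X n - 1) / X n)"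
      using X1[of n] by (simp add: abs_mult power_abs)
    also have "\<dots> \<le> 1 * 1" using X1[of n] by (intro mult_mono power_le_one) auto
    finally show ?thesis by simp
  qed
  have ineq: "(\<Sum>n. (1 / X n) ^ J * (w n * sin (real n * s))) \<le> R" for J
  proof (induction J)
    case (Suc J)
    have s1: "summable (\<lambda>n. (1 / X n) ^ J * (w n * sin (real n * s)))" by (rule sw[OF Xj])
    have s2: "summable (\<lambda>n. (1 / X n) ^ Suc J * (w n * sin (real n * s)))" by (rule sw[OF Xj])
    have "0 \<le> (\<Sum>n. (1 / X n) ^ Suc J * ((X n - 1) * (w n * sin (real n * s))))" by (rule T)
    also have "\<dots> = (\<Sum>n. (1 / X n) ^ J * (w n * sin (real n * s)) - (1 / X n) ^ Suc J * (w n * sin (real n * s)))"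
    proof (intro arg_cong[where f = suminf] ext)
      fix n
      have "X n \<noteq> 0" using X1[of n] by simp
      \<comment> \<open>The shift by one in \<open>X\<close> makes the nonnegative quantity from
        \<open>T\<close> the difference of consecutive sums.\<close>
      then have "(1 / X n) ^ Suc J * (X n - 1) = (1 / X n) ^ J - (1 / X n) ^ Suc J"
        by (simp add: field_simps)
      then show "(1 / X n) ^ Suc J * ((X n - 1) * (w n * sin (real n * s))) = (1 / X n) ^ J * (w n * sin (real n * s)) - (1 / X n) ^ Suc J * (w n * sin (real n * s))"
        by (metis mult.assoc left_diff_distrib)
    qed
    also have "\<dots> = (\<Sum>n. (1 / X n) ^ J * (w n * sin (real n * s))) - (\<Sum>n. (1 / X n) ^ Suc J * (w n * sin (real n * s)))"
      by (rule suminf_diff[OF s1 s2, symmetric])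
    finally show ?case using Suc by linarith
  qed (simp add: R_def)
  \<comment> \<open>Scaling by \<open>X 1 ^ J\<close> keeps the sign. For \<open>n \<ge> 2\<close>
    the ratio \<open>X 1 / X n\<close> is less than 1 and the mode dies out; the term
    \<open>n = 0\<close> contains \<open>sin 0\<close>.\<close>
  have "(\<lambda>J. \<Sum>n. (X 1 / X n) ^ J * (w n * sin (real n * s))) \<longlonglongrightarrow> (\<Sum>n. if n = 1 then w 1 * sin s else 0)"
  proof (rule tannery[OF _ _ s2b])
    fix n :: nat
    have le: "X 1 \<le> X n" if "n \<ge> 1"
      using that t by (simp add: X_def ge_one_powr_ge_zero)
    show "(\<lambda>J. (X 1 / X n) ^ J * (w n * sin (real n * s))) \<longlonglongrightarrow> (if n = 1 then w 1 * sin s else 0)"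
    proof -
      consider "n = 0" | "n = 1" | "n \<ge> 2" by linarith
      then show ?thesis
      proof cases
        case 2 then show ?thesis using X1[of 1] by simp
      next
        case 3
        then have "1 powr t < real n powr t" using t by (intro powr_less_mono2) auto
        then have "X 1 < X n" by (simp add: X_def)
        then have "(\<lambda>J. (X 1 / X n) ^ J) \<longlonglongrightarrow> 0" using X1[of 1] X1[of n] by (intro LIMSEQ_realpow_zero) auto
        from tendsto_mult_right[OF this, of "w n * sin (real n * s)"] show ?thesis using 3 by simp
      qed simp
    qed
    show "\<bar>(X 1 / X n) ^ J * (w n * sin (real n * s))\<bar> \<le> 2 * \<bar>b n\<bar>" for J
    proof (cases "n = 0")
      case False
      have "\<bar>(X 1 / X n) ^ J\<bar> \<le> 1" using le False X1[of 1] X1[of n] by (simp add: power_abs power_le_one)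
      then have "\<bar>(X 1 / X n) ^ J * (w n * sin (real n * s))\<bar> \<le> 1 * \<bar>w n * sin (real n * s)\<bar>"
        unfolding abs_mult[of "(X 1 / X n) ^ J"] by (intro mult_right_mono) auto
      then show ?thesis using wsb[of n] by simp
    qed simp
  qed
  moreover have "(\<Sum>n. if n = 1 then w 1 * sin s else 0) = w 1 * sin s"
    using suminf_finite[of "{1}" "\<lambda>n::nat. if n = 1 then w 1 * sin s else 0"] by simp
  moreover have "0 < w 1 * sin s" using w1 ps(2) by (rule mult_pos_pos)
  ultimately have "\<forall>\<^sub>F J in sequentially. 0 < (\<Sum>n. (X 1 / X n) ^ J * (w n * sin (real n * s)))"
    by (simp only: order_tendstoD(1))
  then have "\<exists>J. 0 < (\<Sum>n. (X 1 / X n) ^ J * (w n * sin (real n * s)))"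
    by (rule eventually_happens'[OF sequentially_bot])
  then obtain J where J: "0 < (\<Sum>n. (X 1 / X n) ^ J * (w n * sin (real n * s)))" ..
  have "(\<Sum>n. (X 1 / X n) ^ J * (w n * sin (real n * s))) = (\<Sum>n. X 1 ^ J * ((1 / X n) ^ J * (w n * sin (real n * s))))"
    by (intro arg_cong[where f = suminf] ext) (simp only: power_divide power_one times_divide_eq_left times_divide_eq_right mult_1_left)
  also have "\<dots> = X 1 ^ J * (\<Sum>n. (1 / X n) ^ J * (w n * sin (real n * s)))"
    using suminf_mult[OF sw[OF Xj[of _ J]], of "X 1 ^ J"] .
  finally have "0 < X 1 ^ J * (\<Sum>n. (1 / X n) ^ J * (w n * sin (real n * s)))" using J by (rule subst)
  then have "0 < (\<Sum>n. (1 / X n) ^ J * (w n * sin (real n * s)))"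
    by (rule zero_less_mult_pos) (use X1[of 1] in simp)
  also note ineq
  finally have "0 < R" .
  then show ?thesis using R by (simp add: zero_less_mult_iff)
qed

text \<open>A local extremum of \<open>g\<close> is one of \<open>sin\<close> at the same point, so
  the derivative test is applied to \<open>sin\<close> and not to \<open>g\<close>. This leaves pi/2
  and -pi/2 as candidates in one period.\<close>

lemma single_lobe_of_sin_strict_mono:
  assumes strict: "\<And>x y. sin x < sin y \<Longrightarrow> g x < g y" and mono: "\<And>x y. sin x \<le> sin y \<Longrightarrow> g x \<le> g y"
  shows "single_lobe g"
proof -
  have crit: "cos x = 0" if "loc_max g x \<or> loc_min g x" for x
  proof -
    have d: "(sin has_field_derivative cos x) (at x)" by (rule DERIV_sin)
    from that show ?thesis
    proof
      assume "loc_max g x"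
      then obtain e where e: "e > 0" "\<And>y. \<bar>y - x\<bar> < e \<Longrightarrow> g y \<le> g x" by (auto simp: loc_max_def)
      have "\<forall>y. \<bar>x - y\<bar> < e \<longrightarrow> sin y \<le> sin x"
      proof (intro allI impI)
        fix y assume "\<bar>x - y\<bar> < e"
        then have "g y \<le> g x" using e(2)[of y] by (simp add: abs_minus_commute)
        then show "sin y \<le> sin x" using strict[of x y] by (meson linorder_not_le)
      qed
      from DERIV_local_max[OF d e(1) this] show ?thesis .
    next
      assume "loc_min g x"
      then obtain e where e: "e > 0" "\<And>y. \<bar>y - x\<bar> < e \<Longrightarrow> g x \<le> g y" by (auto simp: loc_min_def)
      have "\<forall>y. \<bar>x - y\<bar> < e \<longrightarrow> sin x \<le> sin y"
      proof (intro allI impI)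
        fix y assume "\<bar>x - y\<bar> < e"
        then have "g x \<le> g y" using e(2)[of y] by (simp add: abs_minus_commute)
        then show "sin x \<le> sin y" using strict[of y x] by (meson linorder_not_le)
      qed
      from DERIV_local_min[OF d e(1) this] show ?thesis .
    qed
  qed
  have pm: "x = pi / 2 \<or> x = - pi / 2" if "cos x = 0" "-pi < x" "x \<le> pi" for x
  proof (cases "x \<ge> 0")
    case True
    then have "x = pi / 2" using cos_inj_pi[of x "pi / 2"] that by simp
    then show ?thesis by simp
  next
    case False
    then have "- x = pi / 2" using cos_inj_pi[of "- x" "pi / 2"] that by simp
    then show ?thesis by simp
  qed
  have lt1: "sin y < 1" if "0 < \<bar>y - pi / 2\<bar>" "\<bar>y - pi / 2\<bar> < pi" for y
  proof -
    have "sin y = cos \<bar>y - pi / 2\<bar>" by (simp add: cos_diff)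
    also have "\<dots> < cos 0" by (rule cos_monotone_0_pi) (use that in auto)
    finally show ?thesis by simp
  qed
  have gt1: "-1 < sin y" if "0 < \<bar>y - (- pi / 2)\<bar>" "\<bar>y - (- pi / 2)\<bar> < pi" for y
  proof -
    have "\<bar>- y - pi / 2\<bar> = \<bar>y - (- pi / 2)\<bar>" by (simp add: abs_if field_simps)
    then have "sin (- y) < 1" using that by (intro lt1) auto
    then show ?thesis by simp
  qed
  have max: "loc_max g (pi / 2)" unfolding loc_max_def by (intro exI[of _ 1]) (auto intro!: mono)
  have min: "loc_min g (- pi / 2)" unfolding loc_min_def by (intro exI[of _ 1]) (auto intro!: mono)
  have imax: "iso_max g (pi / 2)" unfolding iso_max_def
    by (intro exI[of _ pi]) (use lt1 in \<open>auto intro!: strict\<close>)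
  have imin: "iso_min g (- pi / 2)" unfolding iso_min_def
    by (intro exI[of _ pi]) (use gt1 in \<open>auto intro!: strict\<close>)
  have nmax: "\<not> loc_max g (- pi / 2)"
  proof
    assume "loc_max g (- pi / 2)"
    then obtain e where e: "e > 0" "\<And>y. \<bar>y - (- pi / 2)\<bar> < e \<Longrightarrow> g y \<le> g (- pi / 2)" unfolding loc_max_def by blast
    \<comment> \<open>Small enough to stay in the neighbourhood and within distance pi, where
      \<open>sin\<close> differs from its extreme value.\<close>
    define d where "d = min (e / 2) 1"
    have d: "0 < d" "d < e" "d < pi" using e(1) pi_gt3 by (auto simp: d_def)
    have "g (- pi / 2) < g (- pi / 2 + d)" using gt1[of "- pi / 2 + d"] d by (intro strict) simp
    moreover have "g (- pi / 2 + d) \<le> g (- pi / 2)" using d by (intro e(2)) simp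
    ultimately show False by simp
  qed
  have nmin: "\<not> loc_min g (pi / 2)"
  proof
    assume "loc_min g (pi / 2)"
    then obtain e where e: "e > 0" "\<And>y. \<bar>y - pi / 2\<bar> < e \<Longrightarrow> g (pi / 2) \<le> g y" unfolding loc_min_def by blast
    define d where "d = min (e / 2) 1"
    have d: "0 < d" "d < e" "d < pi" using e(1) pi_gt3 by (auto simp: d_def)
    have "g (pi / 2 + d) < g (pi / 2)" using lt1[of "pi / 2 + d"] d by (intro strict) simp
    moreover have "g (pi / 2) \<le> g (pi / 2 + d)" using d by (intro e(2)) simp
    ultimately show False by simp
  qed
  have "- (pi / 2) \<le> pi" using pi_gt_zero by linarith
  then have ina: "pi / 2 \<in> {- pi<..pi}" "- pi / 2 \<in> {- pi<..pi}" by auto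
  have "x = pi / 2" if "x \<in> {- pi<..pi}" "loc_max g x" for x
  proof -
    have "x = pi / 2 \<or> x = - pi / 2" using pm[of x] crit[of x] that by simp
    then show ?thesis using nmax that(2) by (elim disjE; simp only:)
  qed
  then have smax: "{x \<in> {- pi<..pi}. loc_max g x} = {pi / 2}"
    using max ina(1) by blast
  have "x = - pi / 2" if "x \<in> {- pi<..pi}" "loc_min g x" for x
  proof -
    have "x = pi / 2 \<or> x = - pi / 2" using pm[of x] crit[of x] that by simp
    then show ?thesis using nmin that(2) by (elim disjE; simp only:)
  qed
  then have smin: "{x \<in> {- pi<..pi}. loc_min g x} = {- pi / 2}"
    using min ina(2) by blast
  show ?thesis unfolding single_lobe_def
    by (rule exI[of _ "pi / 2"], rule exI[of _ "- pi / 2"]) (intro conjI smax smin imax imin)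
qed

section \<open>Attainment of the infimum and conclusion\<close>

lemma ground_state_q_odd:
  assumes "ground_state_odd t c g" shows "Bc t c g = q_odd t c"
  unfolding q_odd_def
  proof (rule cInf_eq_minimum[symmetric])
  show "Bc t c g \<in> Bc t c ` admissible_odd t"
    using assms by (intro imageI) (simp add: ground_state_odd_def)
  show "Bc t c g \<le> x" if "x \<in> Bc t c ` admissible_odd t" for x
    using assms that by (clarsimp simp: ground_state_odd_def)
qed

text \<open>Minimizes directly among odd functions; it covers the range \<alpha> > 2, where
  polarization is not at hand.\<close>

lemma exists_ground_state_odd:
  assumes t: "t > 1/2" and c: "c > -1"
  shows "\<exists>g. ground_state_odd t c g"
proof -
  have "\<exists>v\<in>{u \<in> A0 t. odd_fun u}. \<forall>u\<in>{u \<in> A0 t. odd_fun u}. Bc t c v \<le> Bc t c u"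
  proof (rule exists_minimizer[OF t c])
    show "{u \<in> A0 t. odd_fun u} \<noteq> {}" using normsin_A0 by blast
    fix u :: "nat \<Rightarrow> real \<Rightarrow> real"
    assume u: "\<And>k. u k \<in> {u \<in> A0 t. odd_fun u}" and p: "plim u \<in> A0 t"
    have o: "u k (- x) = - u k x" for k x using u[of k] by (simp add: odd_fun_def)
    have "plim u (- x) = - plim u x" for x
    proof (cases "convergent (\<lambda>k. u k x)")
      case True
      from tendsto_minus[OF plim_tendsto[of u x, OF True]] have "(\<lambda>k. u k (- x)) \<longlonglongrightarrow> - plim u x" by (simp add: o)
      then show ?thesis by (rule plim_eq)
    next
      \<comment> \<open>The sequence diverges at \<open>x\<close> and \<open>- x\<close>
        simultaneously, and the default value 0 of \<open>plim\<close> is its own negative.\<close>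
      case False
      then show ?thesis by (simp add: plim_def o convergent_minus_iff[symmetric])
    qed
    with p show "plim u \<in> {u \<in> A0 t. odd_fun u}" by (simp add: odd_fun_def)
  qed auto
  then show ?thesis by (auto simp: ground_state_odd_def admissible_odd_iff)
qed

theorem theorem2p1:
  fixes \<alpha> c :: real
  assumes "\<alpha> > 1/2" and "c > -1"
  shows "\<exists>g. ground_state_odd \<alpha> c g \<and> Bc \<alpha> c g = q_odd \<alpha> c \<and>
           (\<alpha> \<le> 2 \<longrightarrow> continuous_on UNIV g \<and> single_lobe g \<and>
               even_about g (pi/2) \<and> even_about g (-pi/2))"
proof (cases "\<alpha> \<le> 2")
  case False
  then show ?thesis using exists_ground_state_odd[OF assms] ground_state_q_odd by blast
next
  case True
  obtain g where g: "g \<in> A0 \<alpha>" "odd_fun g" "\<And>u. u \<in> A0 \<alpha> \<Longrightarrow> odd_fun u \<Longrightarrow> Bc \<alpha> c g \<le> Bc \<alpha> c u"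
    "continuous_on UNIV g" "\<And>x y. sin x \<le> sin y \<Longrightarrow> g x \<le> g y"
    "summable (\<lambda>n. \<bar>Sc g (real n)\<bar>)" "\<And>x. g x = (\<Sum>n. Sc g (real n) * sin (real n * x)) / pi"
    using continuous_minimizer[OF assms(1) True assms(2)] by blast
  have gs: "ground_state_odd \<alpha> c g"
    using g(1-3) by (auto simp: ground_state_odd_def admissible_odd_iff)
  note S = strictly_monotone[OF assms(1) True assms(2) g(1-3,5-7)]
  have per: "g (x + 2 * pi) = g x" for x using g(1) by (simp add: A0_def H0_def per2pi_def)
  have strict: "g x < g y" if xy: "sin x < sin y" for x y
  proof -
    define p where "p = (x + y) / 2"
    define s where "s = (y - x) / 2"
    have e: "y = p + s" "x = p - s" by (simp_all add: p_def s_def field_simps)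
    \<comment> \<open>Midpoint and half-difference again turn the comparison of sines into the sign
      of \<open>cos p * sin s\<close>.\<close>
    have "0 < 2 * (cos p * sin s)" using xy unfolding e by (simp add: sin_add sin_diff)
    then consider "cos p > 0" "sin s > 0" | "cos p < 0" "sin s < 0" by (auto simp: zero_less_mult_iff)
    then show ?thesis
    proof cases
      case 1 then show ?thesis unfolding e by (intro S)
    next
      case 2
      \<comment> \<open>Adding pi to \<open>p\<close> and subtracting it from \<open>s\<close> flips
        both signs, keeps \<open>p + s\<close>, and changes \<open>p - s\<close> by a
        period.\<close>
      then have "g ((p + pi) - (s - pi)) < g ((p + pi) + (s - pi))" by (intro S) auto
      moreover have "(p + pi) - (s - pi) = (p - s) + 2 * pi" "(p + pi) + (s - pi) = p + s" by auto
      ultimately show ?thesis using per[of "p - s"] unfolding e by simp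
    qed
  qed
  \<comment> \<open>A function of \<open>sin x\<close> alone inherits the symmetry of
    \<open>sin\<close> about pi/2 and -pi/2.\<close>
  have eq: "g x = g y" if "sin x = sin y" for x y using g(5)[of x y] g(5)[of y x] that by simp
  have "even_about g (pi/2)" unfolding even_about_def by (intro allI eq) (simp add: sin_add sin_diff)
  moreover have "even_about g (-pi/2)" unfolding even_about_def by (intro allI eq) (simp add: sin_add sin_diff)
  ultimately show ?thesis
    using gs ground_state_q_odd[OF gs] g(4) single_lobe_of_sin_strict_mono[of g, OF strict g(5)] by blast
qed

end
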